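(* Let $\mu_+,\mu_-\in\mathbb{R}$, $\beta\in(-1,1)$, $t>0$, and let $X=(X_t)_{t\ge 0}$ be the refracted skew Brownian motion with parameters $(\beta,\mu_+,\mu_-)$, skew level $a=0$ and starting point $X_0=0$. Then the probability density $p(t;y)$ of $X_t$ is given by $$p(t;y)=\begin{cases}2(1+\beta)\,e^{2\mu_+y}\displaystyle\int_0^\infty\!\int_0^t h(t-\tau;(1+\beta)b+y,\mu_+)\,h(\tau;(1-\beta)b,-\mu_-)\,\mathrm{d}\tau\,\mathrm{d}b, & y>0,\\[3mm] 2(1-\beta)\,e^{2\mu_-y}\displaystyle\int_0^\infty\!\int_0^t h(t-\tau;(1+\beta)b,\mu_+)\,h(\tau;(1-\beta)b-y,-\mu_-)\,\mathrm{d}\tau\,\mathrm{d}b, & y<0,\end{cases}$$ where $h(s;x,\mu):=\frac{|x|}{\sqrt{2\pi s^3}}\,e^{-\frac{(x+\mu s)^2}{2s}}$ for $x,\mu\in\mathbb{R}$, $s>0$.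
   Context: The refracted skew Brownian motion with parameters $\beta\in(-1,1)$, $\mu_+,\mu_-\in\mathbb{R}$ and skew level $a\in\mathbb{R}$ is the pathwise unique (strong) solution $X$ of $$X_t=X_0+B_t+\beta L^X(t,a)+\mu_+\int_0^t \mathbf{1}_{\{X_s>a\}}\,\mathrm{d}s+\mu_-\int_0^t\mathbf{1}_{\{X_s<a\}}\,\mathrm{d}s,\qquad t\ge 0,$$ where $B$ is a standard Brownian motion and $L^X(t,a)=\lim_{\epsilon\to0^+}\frac{1}{2\epsilon}\mathrm{Leb}(\{s\le t:|X_s-a|\le\epsilon\})$ is the symmetric local time of $X$ at level $a$. *)

theory Defs
  imports "HOL-Probability.Probability"
begin

definition standard_brownian_motion :: "'a measure \<Rightarrow> (real \<Rightarrow> 'a \<Rightarrow> real) \<Rightarrow> bool" where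
  "standard_brownian_motion M B \<longleftrightarrow>
     prob_space M \<and>
     (\<forall>t\<ge>0. B t \<in> borel_measurable M) \<and>
     (AE \<omega> in M. B 0 \<omega> = 0) \<and>
     (AE \<omega> in M. continuous_on {0..} (\<lambda>t. B t \<omega>)) \<and>
     (\<forall>s t. 0 \<le> s \<and> s < t \<longrightarrow>
        distributed M lborel (\<lambda>\<omega>. B t \<omega> - B s \<omega>)
          (\<lambda>x. ennreal (normal_density 0 (sqrt (t - s)) x))) \<and>
     (\<forall>(\<tau> :: nat \<Rightarrow> real) n. 0 \<le> \<tau> 0 \<and> mono \<tau> \<longrightarrow>
        prob_space.indep_vars M (\<lambda>_. borel) (\<lambda>i \<omega>. B (\<tau> (Suc i)) \<omega> - B (\<tau> i) \<omega>) {..<n})"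

definition augmented_filtration :: "'a measure \<Rightarrow> (real \<Rightarrow> 'a \<Rightarrow> real) \<Rightarrow> real \<Rightarrow> 'a measure" where
  "augmented_filtration M B t =
     sigma (space M)
       ({B s -` A \<inter> space M | s A. 0 \<le> s \<and> s \<le> t \<and> A \<in> sets borel} \<union> null_sets M)"

text \<open>The limit is stated as a relation, so that a path without a local time at \<open>a\<close>
  is not silently given an arbitrary one.\<close>

definition has_symmetric_local_time :: "(real \<Rightarrow> real) \<Rightarrow> real \<Rightarrow> real \<Rightarrow> real \<Rightarrow> bool" where
  "has_symmetric_local_time x t a l \<longleftrightarrow>
     ((\<lambda>\<epsilon>. measure lebesgue {s \<in> {0..t}. \<bar>x s - a\<bar> \<le> \<epsilon>} / (2 * \<epsilon>)) \<longlongrightarrow> l) (at_right 0)"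

text \<open>Being a strong solution is encoded by adaptedness to the augmented filtration of the
  driving Brownian motion \<open>B\<close>. The null set in the equation does not depend on \<open>t\<close>.\<close>

definition refracted_skew_brownian_motion ::
  "'a measure \<Rightarrow> (real \<Rightarrow> 'a \<Rightarrow> real) \<Rightarrow> real \<Rightarrow> real \<Rightarrow> real \<Rightarrow> real \<Rightarrow> real \<Rightarrow> (real \<Rightarrow> 'a \<Rightarrow> real) \<Rightarrow> bool"
where
  "refracted_skew_brownian_motion M B \<beta> \<mu>p \<mu>m a x0 X \<longleftrightarrow>
     standard_brownian_motion M B \<and>
     (\<forall>t\<ge>0. X t \<in> borel_measurable (augmented_filtration M B t)) \<and>
     (AE \<omega> in M. continuous_on {0..} (\<lambda>t. X t \<omega>)) \<and>
     (AE \<omega> in M. X 0 \<omega> = x0) \<and>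
     (AE \<omega> in M. \<forall>t\<ge>0. \<exists>l. has_symmetric_local_time (\<lambda>s. X s \<omega>) t a l \<and>
        X t \<omega> = X 0 \<omega> + B t \<omega> + \<beta> * l
          + \<mu>p * (LBINT s:{0..t}. indicator {a<..} (X s \<omega>))
          + \<mu>m * (LBINT s:{0..t}. indicator {..<a} (X s \<omega>)))"

definition h :: "real \<Rightarrow> real \<Rightarrow> real \<Rightarrow> real" where
  "h s x \<mu> = \<bar>x\<bar> / sqrt (2 * pi * s ^ 3) * exp (- (x + \<mu> * s)\<^sup>2 / (2 * s))"

end

theory Submission
  imports Defs "HOL-Real_Asymp.Real_Asymp"
begin

text \<open>Apply the Ito--Tanaka formula, in expectation, to functions that are exponentials on each side
  of the skew level, with a kink there. Taking Laplace transforms in time and choosing the exponents so that the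
  generator is homogeneous eliminates the expected local time, and yields the Laplace transform in
  \<open>(t, \<theta>)\<close> of the expectation of \<open>exp (- \<theta> * X t)\<close> over \<open>{X t > 0}\<close>. Since \<open>h\<close> is a first-passage density, the Laplace
  transform of the claimed density is a product of exponentials integrated over \<open>b\<close>, and it is
  the same function. Uniqueness of Laplace transforms identifies the law for almost every \<open>t\<close>, and continuity in
  \<open>t\<close> of both sides for every \<open>t\<close>. The negative half-line follows by applying this to \<open>- X\<close>.\<close>

section \<open>Uniqueness of Laplace transforms\<close>

text \<open>No stochastic integral occurs. The increment of f(X) over a short interval is cut at the
  intermediate value X u + (B v - B u): up to there only the Brownian increment acts, and its
  conditional moments give the second-order term in expectation; from there on only drift and local
  time act, and they are handled path by path. The obstacle is the local time, known merely as a
  pathwise limit of occupation ratios and, for \<beta> = 0, not controlled by the equation at all.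
  Exchanging that limit with the expectation rests on second moments of smoothed occupation times,
  bounded uniformly in the smoothing scale e. They come from an even test function, whose derivative
  at the level is 0, so that the local time drops out of its own estimate. Kinks are smoothed by
  replacing |x| with sqrt(x^2 + e^2), because half the second derivative of that function is a
  mixture of the boxes that define the symmetric local time. Finiteness of the claimed density at a
  given time is not estimated directly either: its Laplace transform is explicit, and each later
  time dominates the earlier ones up to a factor.\<close>

lemma laplace_unique_measure:
  fixes M N :: "real measure"
  assumes "finite_borel_measure M" "finite_borel_measure N"
    and posM: "AE x in M. 0 \<le> x" and posN: "AE x in N. 0 \<le> x"
    and eq: "\<And>n::nat. (\<integral>x. exp (- (real n * x)) \<partial>M) = (\<integral>x. exp (- (real n * x)) \<partial>N)"
  shows "M = N"
proof -
  interpret M: finite_borel_measure M by fact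
  interpret N: finite_borel_measure N by fact
  have [measurable_cong]: "sets M = sets borel" "sets N = sets borel"
    by (simp_all add: M.M_is_borel N.M_is_borel)
  have intM: "integrable M (\<lambda>x. exp (- (real n * x)))" for n
    by (rule M.integrable_const_bound[where B=1]) (use posM in auto)
  have intN: "integrable N (\<lambda>x. exp (- (real n * x)))" for n
    by (rule N.integrable_const_bound[where B=1]) (use posN in auto)
  \<comment> \<open>Under z = exp(-x) the half-line becomes (0, 1] and the transforms at the
    integers become the moments of z. They determine the integrals of all polynomials in z, hence by
    Weierstrass those of all continuous functions of z.\<close>
  have poly_exp: "poly p (exp (- x)) = (\<Sum>i\<le>degree p. coeff p i * exp (- (real i * x)))" for p and x :: real
    by (simp add: poly_altdef exp_of_nat_mult[symmetric])
  have polyM: "integrable M (\<lambda>x. poly p (exp (- x)))" for p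
    unfolding poly_exp by (auto intro!: Bochner_Integration.integrable_sum intM)
  have polyN: "integrable N (\<lambda>x. poly p (exp (- x)))" for p
    unfolding poly_exp by (auto intro!: Bochner_Integration.integrable_sum intN)
  have polyeq: "(\<integral>x. poly p (exp (- x)) \<partial>M) = (\<integral>x. poly p (exp (- x)) \<partial>N)" for p
    unfolding poly_exp using intM intN
    by (subst (1 2) Bochner_Integration.integral_sum) (auto simp: eq)
  have cont_eq: "(\<integral>x. g (exp (- x)) \<partial>M) = (\<integral>x. g (exp (- x)) \<partial>N)"
    if g: "continuous_on UNIV g" and b: "\<And>z. \<bar>g z\<bar> \<le> 1" for g :: "real \<Rightarrow> real"
  proof -
    have [measurable]: "g \<in> borel_measurable borel"
      using g by (rule borel_measurable_continuous_onI)
    have gM: "integrable M (\<lambda>x. g (exp (- x)))"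
      by (rule M.integrable_const_bound[where B=1]) (use b in auto)
    have gN: "integrable N (\<lambda>x. g (exp (- x)))"
      by (rule N.integrable_const_bound[where B=1]) (use b in auto)
    let ?K = "measure M (space M) + measure N (space N)"
    have *: "\<bar>(\<integral>x. g (exp (- x)) \<partial>M) - (\<integral>x. g (exp (- x)) \<partial>N)\<bar> \<le> e * ?K" if "e > 0" for e
    proof -
      obtain m where m: "\<And>x. x \<in> {0..1} \<Longrightarrow> \<bar>g x - (\<Sum>k\<le>m. g (k/m) * Bernstein m k x)\<bar> < e"
        using Bernstein_Weierstrass[of g e] continuous_on_subset[OF g] \<open>e > 0\<close> by (metis order_refl subset_UNIV)
      \<comment> \<open>The Bernstein sum as a formal polynomial, because \<open>polyeq\<close>
        speaks of \<open>poly\<close>.\<close>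
      define p where "p = (\<Sum>k\<le>m. [:g (k/m) * (m choose k):] * ([:0,1:]^k * [:1,-1:]^(m-k)))"
      have p: "poly p x = (\<Sum>k\<le>m. g (k/m) * Bernstein m k x)" for x
        by (simp add: p_def Bernstein_def poly_sum mult.assoc)
      have bd: "\<bar>g (exp (- x)) - poly p (exp (- x))\<bar> \<le> e" if "0 \<le> x" for x
        using m[of "exp (- x)"] that unfolding p by (force intro: less_imp_le)
      have "\<bar>(\<integral>x. g (exp (- x)) - poly p (exp (- x)) \<partial>M)\<bar> \<le> (\<integral>x. e \<partial>M)"
        by (intro order_trans[OF integral_abs_bound] integral_mono_AE)
           (use posM bd polyM gM in auto)
      then have 1: "\<bar>(\<integral>x. g (exp (- x)) \<partial>M) - (\<integral>x. poly p (exp (- x)) \<partial>M)\<bar> \<le> e * measure M (space M)"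
        using gM polyM by (simp add: Bochner_Integration.integral_diff mult.commute)
      have "\<bar>(\<integral>x. g (exp (- x)) - poly p (exp (- x)) \<partial>N)\<bar> \<le> (\<integral>x. e \<partial>N)"
        by (intro order_trans[OF integral_abs_bound] integral_mono_AE)
           (use posN bd polyN gN in auto)
      then have 2: "\<bar>(\<integral>x. g (exp (- x)) \<partial>N) - (\<integral>x. poly p (exp (- x)) \<partial>N)\<bar> \<le> e * measure N (space N)"
        using gN polyN by (simp add: Bochner_Integration.integral_diff mult.commute)
      show ?thesis using 1 2 polyeq[of p] by (simp add: distrib_left abs_le_iff)
    qed
    have K: "0 \<le> ?K" by simp
    have "\<bar>(\<integral>x. g (exp (- x)) \<partial>M) - (\<integral>x. g (exp (- x)) \<partial>N)\<bar> \<le> 0 + e" if "0 < e" for e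
    proof -
      \<comment> \<open>The summand 1 avoids a division by zero when both measures vanish.\<close>
      have "\<bar>(\<integral>x. g (exp (- x)) \<partial>M) - (\<integral>x. g (exp (- x)) \<partial>N)\<bar> \<le> e / (?K + 1) * ?K"
        by (rule *) (use K that in \<open>auto intro!: divide_pos_pos add_nonneg_pos\<close>)
      also have "\<dots> \<le> e / (?K + 1) * (?K + 1)"
        using K that by (intro mult_left_mono divide_nonneg_nonneg) linarith+
      also have "\<dots> = 0 + e" using K by (simp add: add_nonneg_eq_0_iff)
      finally show ?thesis .
    qed
    then have "\<bar>(\<integral>x. g (exp (- x)) \<partial>M) - (\<integral>x. g (exp (- x)) \<partial>N)\<bar> \<le> 0"
      by (rule field_le_epsilon)
    then show ?thesis by simp
  qed
  have "cdf M a = cdf N a" for a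
  proof -
    \<comment> \<open>Ramps that decrease to the indicator of z at least exp(-a), which in terms of
      x is the indicator of {..a}; on that set they equal 1 for every n.\<close>
    define g where "g n z = max 0 (min 1 (1 + real n * (z - exp (- a))))" for n and z :: real
    have gb: "\<bar>g n z\<bar> \<le> 1" for n z by (auto simp: g_def)
    have [measurable]: "g n \<in> borel_measurable borel" for n unfolding g_def by measurable
    have lim: "(\<lambda>n. g n (exp (- x))) \<longlonglongrightarrow> indicator {..a} x" for x
    proof (cases "x \<le> a")
      case True then have "g n (exp (- x)) = 1" for n by (simp add: g_def)
      then show ?thesis using True by simp
    next
      case False
      then have "exp (- x) - exp (- a) < 0" by simp
      then have "LIM n sequentially. (exp (- x) - exp (- a)) * real n :> at_bot"
        by (intro filterlim_tendsto_neg_mult_at_bot[OF tendsto_const] filterlim_real_sequentially)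
      then have "\<forall>\<^sub>F n in sequentially. (exp (- x) - exp (- a)) * real n \<le> -1"
        unfolding filterlim_at_bot by blast
      then have "\<forall>\<^sub>F n in sequentially. g n (exp (- x)) = 0"
        by eventually_elim (auto simp: g_def mult.commute)
      then show ?thesis using False by (simp add: tendsto_eventually)
    qed
    have "(\<lambda>n. \<integral>x. g n (exp (- x)) \<partial>M) \<longlonglongrightarrow> (\<integral>x. indicator {..a} x \<partial>M)"
      by (rule integral_dominated_convergence[where w="\<lambda>_. 1"]) (use lim gb in auto)
    moreover have "(\<lambda>n. \<integral>x. g n (exp (- x)) \<partial>N) \<longlonglongrightarrow> (\<integral>x. indicator {..a} x \<partial>N)"
      by (rule integral_dominated_convergence[where w="\<lambda>_. 1"]) (use lim gb in auto)
    moreover have "(\<integral>x. g n (exp (- x)) \<partial>M) = (\<integral>x. g n (exp (- x)) \<partial>N)" for n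
      by (rule cont_eq[OF _ gb]) (auto simp: g_def intro!: continuous_intros)
    ultimately have "(\<integral>x. indicator {..a} x \<partial>M :: real) = (\<integral>x. indicator {..a} x \<partial>N)"
      using LIMSEQ_unique by simp
    then show ?thesis by (simp add: cdf_def)
  qed
  then show ?thesis
    by (intro cdf_unique' assms ext)
qed

text \<open>The weight exp(-l t) turns both functions into densities of finite measures. The offset
  \<open>l\<close> is left free so that the sequence \<open>l + n\<close> can be started beyond a
  value at which the two transforms are not known to agree.\<close>

lemma laplace_unique_AE:
  fixes f g :: "real \<Rightarrow> ennreal"
  assumes [measurable]: "f \<in> borel_measurable borel" "g \<in> borel_measurable borel"
    and eq: "\<And>n::nat. (\<integral>\<^sup>+t\<in>{0<..}. ennreal (exp (- ((l + real n) * t))) * f t \<partial>lborel)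
        = (\<integral>\<^sup>+t\<in>{0<..}. ennreal (exp (- ((l + real n) * t))) * g t \<partial>lborel)"
    and fin: "(\<integral>\<^sup>+t\<in>{0<..}. ennreal (exp (- (l * t))) * f t \<partial>lborel) < \<infinity>"
  shows "AE t in lborel. 0 < t \<longrightarrow> f t = g t"
proof -
  define F where "F t = ennreal (exp (- (l * t))) * f t * indicator {0<..} t" for t
  define G where "G t = ennreal (exp (- (l * t))) * g t * indicator {0<..} t" for t
  have [measurable]: "F \<in> borel_measurable borel" "G \<in> borel_measurable borel"
    unfolding F_def G_def by measurable
  have finF: "(\<integral>\<^sup>+t. F t \<partial>lborel) < \<infinity>" using fin by (simp add: F_def)
  have finG: "(\<integral>\<^sup>+t. G t \<partial>lborel) < \<infinity>" using fin eq[of 0] by (simp add: G_def)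
  have e: "ennreal (exp (- (l * t))) * z * k * ennreal (exp (- (real n * t)))
      = ennreal (exp (- ((l + real n) * t))) * z * k" for n :: nat and t z k
  proof -
    have "ennreal (exp (- (l * t))) * ennreal (exp (- (real n * t))) = ennreal (exp (- ((l + real n) * t)))"
      by (simp add: ennreal_mult[symmetric] exp_add[symmetric] algebra_simps)
    then show ?thesis by (metis mult.assoc mult.commute)
  qed
  have dens: "density lborel F = density lborel G"
  proof (rule laplace_unique_measure)
    show "finite_borel_measure (density lborel F)" "finite_borel_measure (density lborel G)"
      using finF finG
      by (auto intro!: finite_borel_measure.intro finite_measureI simp: emeasure_density finite_borel_measure_axioms_def)
    show "AE x in density lborel F. 0 \<le> x" "AE x in density lborel G. 0 \<le> x"
      by (subst AE_density, simp, auto simp: F_def G_def indicator_def)+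
    show "(\<integral>x. exp (- (real n * x)) \<partial>density lborel F) = (\<integral>x. exp (- (real n * x)) \<partial>density lborel G)" for n
    proof (subst (1 2) integral_eq_nn_integral)
      have "(\<integral>\<^sup>+ x. ennreal (exp (- (real n * x))) \<partial>density lborel F)
          = (\<integral>\<^sup>+ x. ennreal (exp (- (real n * x))) \<partial>density lborel G)"
        using eq[of n] by (subst (1 2) nn_integral_density) (simp_all add: F_def G_def e)
      then show "enn2real (\<integral>\<^sup>+ x. ennreal (exp (- (real n * x))) \<partial>density lborel F)
          = enn2real (\<integral>\<^sup>+ x. ennreal (exp (- (real n * x))) \<partial>density lborel G)" by simp
    qed auto
  qed
  have "AE t in lborel. F t = G t"
    using dens finF by (subst (asm) finite_density_unique) auto
  then show ?thesis
  proof eventually_elim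
    case (elim t)
    show ?case
    proof
      assume "0 < t"
      with elim have "ennreal (exp (- (l * t))) * f t = ennreal (exp (- (l * t))) * g t"
        by (simp add: F_def G_def)
      then show "f t = g t" by (simp add: ennreal_mult_cancel_left)
    qed
  qed
qed

section \<open>First-passage densities\<close>

text \<open>Near \<open>z\<close> the distribution function is a constant plus the integral of a
  continuous density from the fixed base point \<open>z - 1\<close>, so the fundamental theorem of
  calculus applies.\<close>

lemma cdf_std_normal_has_derivative:
  "(cdf std_normal_distribution has_real_derivative std_normal_density z) (at z)"
proof -
  interpret real_distribution std_normal_distribution
    by (rule real_dist_normal_dist)
  have eq: "cdf std_normal_distribution w = cdf std_normal_distribution (z - 1) + integral {z-1..w} std_normal_density"
    if "w \<in> {z-1<..<z+1}" for w
  proof -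
    have "set_integrable lborel {z-1..w} std_normal_density"
      unfolding set_integrable_def by (intro integrable_mult_indicator) auto
    then have "(LBINT x:{z-1..w}. std_normal_density x) = integral {z-1..w} std_normal_density"
      by (rule set_borel_integral_eq_integral)
    moreover have "measure std_normal_distribution {z-1<..w} = (LBINT x:{z-1..w}. std_normal_density x)"
    proof -
      have "measure std_normal_distribution {z-1<..w} = (\<integral>x. indicator {z-1<..w} x \<partial>std_normal_distribution)"
        by simp
      also have "\<dots> = (\<integral>x. std_normal_density x * indicator {z-1<..w} x \<partial>lborel)"
        by (subst integral_density) auto
      also have "\<dots> = (LBINT x:{z-1..w}. std_normal_density x)"
        unfolding set_lebesgue_integral_def
        by (rule integral_cong_AE) (use AE_lborel_singleton[of "z-1"] in \<open>auto simp: indicator_def\<close>)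
      finally show ?thesis .
    qed
    ultimately show ?thesis
      using cdf_diff_eq[of "z-1" w] that by simp
  qed
  have "((\<lambda>w. integral {z-1..w} std_normal_density) has_real_derivative std_normal_density z) (at z within {z-1..z+1})"
    by (rule integral_has_real_derivative) (auto simp: std_normal_density_def intro!: continuous_intros)
  then have "((\<lambda>w. integral {z-1..w} std_normal_density) has_real_derivative std_normal_density z) (at z)"
    by (subst (asm) at_within_interior) (auto simp: interior_atLeastAtMost_real)
  then have "((\<lambda>w. cdf std_normal_distribution (z - 1)
    + integral {z-1..w} std_normal_density) has_real_derivative std_normal_density z) (at z)"
    by (auto intro!: derivative_eq_intros)
  moreover have "\<forall>\<^sub>F w in nhds z. w \<in> {z-1<..<z+1}"
    by (intro eventually_nhds_in_open) auto
  then have "\<forall>\<^sub>F w in nhds z. cdf std_normal_distribution w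
    = cdf std_normal_distribution (z - 1) + integral {z-1..w} std_normal_density"
    by eventually_elim (rule eq)
  ultimately show ?thesis
    by (simp add: DERIV_cong_ev[OF refl _ refl])
qed

text \<open>The integrand is the density of the first time at which a Brownian motion with drift
  \<open>r\<close> reaches \<open>x\<close>; since the drift points towards \<open>x\<close>, that
  time is almost surely finite.\<close>

lemma inverse_gaussian_mass:
  fixes x r :: real
  assumes x: "0 < x" and r: "0 < r"
  shows "(\<integral>\<^sup>+s\<in>{0<..}. ennreal (x / sqrt (2 * pi * s ^ 3) * exp (- (x - r * s)\<^sup>2 / (2 * s))) \<partial>lborel) = 1"
proof -
  interpret N: real_distribution std_normal_distribution
    by (rule real_dist_normal_dist)
  let ?P = "cdf std_normal_distribution"
  define f where "f s = x / sqrt (2 * pi * s ^ 3) * exp (- (x - r * s)\<^sup>2 / (2 * s))" for s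
  \<comment> \<open>The distribution function of the hitting time. The second summand is the
    reflection-principle term, weighted by exp(2 r x) because of the drift.\<close>
  define F where "F s = ?P ((r * s - x) / sqrt s) + exp (2 * r * x) * ?P (- (r * s + x) / sqrt s)" for s
  have deriv: "(F has_real_derivative f s) (at s)" if s: "0 < s" for s
  proof -
    define q where "q = sqrt s"
    have q: "0 < q" "s = q\<^sup>2" "sqrt s = q" using s by (auto simp: q_def)
    have d1: "((\<lambda>s. (r * s - x) / sqrt s) has_real_derivative (r * q - (r * s - x) / (2 * q)) / s) (at s)"
      using s q by (auto intro!: derivative_eq_intros simp: field_simps power2_eq_square)
    have d2: "((\<lambda>s. - (r * s + x) / sqrt s) has_real_derivative (- r * q + (r * s + x) / (2 * q)) / s) (at s)"
      using s q by (auto intro!: derivative_eq_intros simp: field_simps power2_eq_square)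
    have e1: "std_normal_density ((r * s - x) / sqrt s) = 1 / sqrt (2 * pi) * exp (- (x - r * s)\<^sup>2 / (2 * s))"
      unfolding std_normal_density_def q(3) using q by (simp add: field_simps power2_eq_square)
    \<comment> \<open>The weight exp(2 r x) turns the second Gaussian factor into the first one, so
      that both derivatives carry the same exponential and only rational terms remain to be
      added.\<close>
    have ee: "2 * r * x + - (r * s + x)\<^sup>2 / (2 * s) = - (x - r * s)\<^sup>2 / (2 * s)"
      using s by (simp add: field_simps power2_eq_square)
    have e2': "std_normal_density (- (r * s + x) / sqrt s) = 1 / sqrt (2 * pi) * exp (- (r * s + x)\<^sup>2 / (2 * s))"
      unfolding std_normal_density_def q(3) using q by (simp add: field_simps power2_eq_square)
    have e2: "exp (2 * r * x) * std_normal_density (- (r * s + x) / sqrt s)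
      = 1 / sqrt (2 * pi) * exp (- (x - r * s)\<^sup>2 / (2 * s))"
      unfolding e2' ee[symmetric] exp_add by simp
    have "(F has_real_derivative std_normal_density ((r * s - x) / sqrt s) * ((r * q - (r * s - x) / (2 * q)) / s)
        + exp (2 * r * x) * (std_normal_density (- (r * s + x) / sqrt s) * ((- r * q + (r * s + x) / (2 * q)) / s))) (at s)"
      unfolding F_def
      by (intro DERIV_add DERIV_cmult DERIV_chain2[OF cdf_std_normal_has_derivative d1]
           DERIV_chain2[OF cdf_std_normal_has_derivative d2])
    moreover have "std_normal_density ((r * s - x) / sqrt s) * ((r * q - (r * s - x) / (2 * q)) / s)
        + exp (2 * r * x) * (std_normal_density (- (r * s + x) / sqrt s) * ((- r * q + (r * s + x) / (2 * q)) / s)) = f s"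
    proof -
      have sq: "sqrt (2 * pi * s ^ 3) = sqrt (2 * pi) * (q * s)"
      proof -
        have "s ^ 3 = (q * s)\<^sup>2" using q by (simp add: power_mult_distrib power3_eq_cube power2_eq_square)
        moreover have "0 < q * s" using q(1) s by simp
        ultimately show ?thesis by (simp only: real_sqrt_mult real_sqrt_abs abs_of_pos)
      qed
      define E where "E = 1 / sqrt (2 * pi) * exp (- (x - r * s)\<^sup>2 / (2 * s))"
      have "(r * q - (r * s - x) / (2 * q)) / s + (- r * q + (r * s + x) / (2 * q)) / s = x / (q * s)"
        using s q(1) by (simp add: field_simps)
      then have "E * ((r * q - (r * s - x) / (2 * q)) / s) + E * ((- r * q + (r * s + x) / (2 * q)) / s)
        = E * (x / (q * s))"
        by (simp only: distrib_left[symmetric])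
      then show ?thesis
        unfolding mult.assoc[symmetric] e2 e1 f_def sq E_def by (simp add: mult_ac)
    qed
    ultimately show ?thesis by simp
  qed
  \<comment> \<open>At time 0 both arguments of the normal distribution function tend to minus
    infinity, which gives F = 0; at infinity the positive drift sends the first to plus infinity and
    the second to minus infinity, which gives F = 1.\<close>
  have l1: "filterlim (\<lambda>s. (r * s - x) / sqrt s) at_bot (at_right 0)" using x r by real_asymp
  have l2: "filterlim (\<lambda>s. - (r * s + x) / sqrt s) at_bot (at_right 0)" using x r by real_asymp
  have l3: "filterlim (\<lambda>s. (r * s - x) / sqrt s) at_top at_top" using x r by real_asymp
  have l4: "filterlim (\<lambda>s. - (r * s + x) / sqrt s) at_bot at_top" using x r by real_asymp
  have L0: "(F \<longlongrightarrow> 0 + exp (2 * r * x) * 0) (at_right 0)"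
    unfolding F_def by (intro tendsto_intros filterlim_compose[OF N.cdf_lim_at_bot] l1 l2)
  have L1: "(F \<longlongrightarrow> 1 + exp (2 * r * x) * 0) at_top"
    unfolding F_def
      by (intro tendsto_intros filterlim_compose[OF N.cdf_lim_at_top_prob] filterlim_compose[OF N.cdf_lim_at_bot] l3 l4)
  have nonneg: "0 \<le> f s" if "0 \<le> s" for s using x that by (simp add: f_def)
  have cont: "isCont f s" if "0 < s" for s
    using that unfolding f_def by (intro continuous_intros) auto
  have A: "((F \<circ> real_of_ereal) \<longlongrightarrow> 0) (at_right 0)" "((F \<circ> real_of_ereal) \<longlongrightarrow> 1) (at_left \<infinity>)"
    using L0 L1 by (simp_all add: zero_ereal_def ereal_tendsto_simps)
  have "0 < (\<infinity>::ereal)" by simp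
  note ftc = interval_integral_FTC_nonneg[OF this _ _ _ A, of f]
  have "set_integrable lborel (einterval 0 \<infinity>) f" "(LBINT s=0..\<infinity>. f s) = 1 - 0"
    by (rule ftc; use deriv cont nonneg in \<open>auto simp: zero_ereal_def\<close>)+
  then have i: "set_integrable lborel {0<..} f" "(LBINT s:{0<..}. f s) = 1"
    unfolding interval_lebesgue_integral_0_infty
    by (auto simp: zero_ereal_def einterval_def greaterThan_def)
  have "(\<integral>\<^sup>+s. ennreal (indicator {0<..} s *\<^sub>R f s) \<partial>lborel) = ennreal (LBINT s:{0<..}. f s)"
    unfolding set_lebesgue_integral_def using i(1)[unfolded set_integrable_def]
    by (rule nn_integral_eq_integral) (auto simp: indicator_def nonneg)
  moreover have "(\<integral>\<^sup>+s. ennreal (indicator {0<..} s *\<^sub>R f s) \<partial>lborel) = (\<integral>\<^sup>+s\<in>{0<..}. ennreal (f s) \<partial>lborel)"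
    by (intro nn_integral_cong) (auto simp: indicator_def)
  ultimately have "(\<integral>\<^sup>+s\<in>{0<..}. ennreal (f s) \<partial>lborel) = 1"
    unfolding i(2) by simp
  then show ?thesis unfolding f_def .
qed

lemma h_nonneg: "0 \<le> s \<Longrightarrow> 0 \<le> h s x \<mu>"
  by (simp add: h_def)

lemma h_measurable [measurable (raw)]:
  assumes [measurable]: "f \<in> borel_measurable M" "g \<in> borel_measurable M"
  shows "(\<lambda>w. h (f w) (g w) \<mu>) \<in> borel_measurable M"
  unfolding h_def by measurable

text \<open>\<open>h\<close> is the first-passage density to \<open>x\<close> under drift - \<mu>.
  Multiplying by exp(-l s) and completing the square changes the drift to \<open>r\<close> at the
  price of a constant factor, and the density with drift \<open>r\<close> has mass one.\<close>

lemma laplace_h: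
  assumes x: "0 < x" and l: "0 < l"
  shows "(\<integral>\<^sup>+s\<in>{0<..}. ennreal (exp (- (l * s)) * h s x \<mu>) \<partial>lborel)
    = ennreal (exp (- x * (\<mu> + sqrt (\<mu>\<^sup>2 + 2 * l))))"
proof -
  define r where "r = sqrt (\<mu>\<^sup>2 + 2 * l)"
  have r: "0 < r" and r2: "r\<^sup>2 = \<mu>\<^sup>2 + 2 * l" using l by (auto simp: r_def add_nonneg_pos)
  have e: "exp (- (l * s)) * h s x \<mu>
      = exp (- x * (\<mu> + r)) * (x / sqrt (2 * pi * s ^ 3) * exp (- (x - r * s)\<^sup>2 / (2 * s)))" if "0 < s" for s
  proof -
    have l2: "l = (r\<^sup>2 - \<mu>\<^sup>2) / 2" using r2 by simp
    have "- (l * s) + - (x + \<mu> * s)\<^sup>2 / (2 * s) = - x * (\<mu> + r) + - (x - r * s)\<^sup>2 / (2 * s)"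
      using that unfolding l2 by (simp add: field_simps power2_eq_square)
    then have "exp (- (l * s)) * exp (- (x + \<mu> * s)\<^sup>2 / (2 * s)) = exp (- x * (\<mu> + r)) * exp (- (x - r * s)\<^sup>2 / (2 * s))"
      by (simp only: exp_add[symmetric])
    then show ?thesis using x by (simp add: h_def field_simps)
  qed
  have "(\<integral>\<^sup>+s\<in>{0<..}. ennreal (exp (- (l * s)) * h s x \<mu>) \<partial>lborel)
     = (\<integral>\<^sup>+s. ennreal (exp (- x * (\<mu> + r))) * (ennreal (x / sqrt (2 * pi * s ^ 3) * exp (- (x - r * s)\<^sup>2 / (2 * s))) * indicator {0<..} s) \<partial>lborel)"
    using x by (intro nn_integral_cong) (auto simp: indicator_def e ennreal_mult[symmetric])
  also have "\<dots> = ennreal (exp (- x * (\<mu> + r)))"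
    using inverse_gaussian_mass[OF x r] by (subst nn_integral_cmult) auto
  finally show ?thesis unfolding r_def .
qed

text \<open>Supplies one majorant for all times in [t0, t1]: a later time has the larger Gaussian
  factor, the cross term of the exponent does not involve time, and the power -3/2 of time changes
  by at most the square root of (t1/t0)^3.\<close>

lemma h_scale_bound:
  assumes t: "0 < t0" "t0 \<le> t" "t \<le> t1" and s: "0 < s" "s \<le> 1"
  shows "h (t * s) x \<mu> \<le> sqrt (t1 ^ 3 / t0 ^ 3) * exp (\<mu>\<^sup>2 * t1 / 2) * h (t1 * s) x \<mu>"
proof -
  have t1: "0 < t1" "0 < t" using t by auto
  \<comment> \<open>The exponent splits into a term monotone in \<open>u\<close>, a term free of
    \<open>u\<close>, and a term of bounded size.\<close>
  have E: "- (x + \<mu> * (u * s))\<^sup>2 / (2 * (u * s)) = - x\<^sup>2 / (2 * s) * (1 / u) - \<mu> * x - \<mu>\<^sup>2 * u * s / 2" if "0 < u" for u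
    using that s by (simp add: field_simps power2_eq_square)
  have "- x\<^sup>2 / (2 * s) * (1 / t) \<le> - x\<^sup>2 / (2 * s) * (1 / t1)"
    using t t1 s by (intro mult_left_mono_neg) (auto simp: field_simps divide_nonneg_pos)
  moreover have "0 \<le> \<mu>\<^sup>2 * t * s / 2" using t1 s by simp
  moreover have "\<mu>\<^sup>2 * t1 * s / 2 \<le> \<mu>\<^sup>2 * t1 / 2"
    using t1 s by (simp add: mult_left_le)
  ultimately have "- (x + \<mu> * (t * s))\<^sup>2 / (2 * (t * s)) \<le> \<mu>\<^sup>2 * t1 / 2 + - (x + \<mu> * (t1 * s))\<^sup>2 / (2 * (t1 * s))"
    unfolding E[OF t1(1)] E[OF t1(2)] by linarith
  then have 1: "exp (- (x + \<mu> * (t * s))\<^sup>2 / (2 * (t * s)))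
    \<le> exp (\<mu>\<^sup>2 * t1 / 2) * exp (- (x + \<mu> * (t1 * s))\<^sup>2 / (2 * (t1 * s)))"
    by (simp only: exp_add[symmetric] exp_le_cancel_iff)
  have 2: "\<bar>x\<bar> / sqrt (2 * pi * (t * s) ^ 3) \<le> sqrt (t1 ^ 3 / t0 ^ 3) * (\<bar>x\<bar> / sqrt (2 * pi * (t1 * s) ^ 3))"
  proof -
    have "sqrt (2 * pi * (t0 * s) ^ 3) \<le> sqrt (2 * pi * (t * s) ^ 3)"
      using t s by (intro real_sqrt_le_mono mult_left_mono power_mono mult_right_mono) auto
    then have "\<bar>x\<bar> / sqrt (2 * pi * (t * s) ^ 3) \<le> \<bar>x\<bar> / sqrt (2 * pi * (t0 * s) ^ 3)"
      using t s by (intro divide_left_mono mult_pos_pos) auto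
    also have "\<dots> = sqrt (t1 ^ 3 / t0 ^ 3) * (\<bar>x\<bar> / sqrt (2 * pi * (t1 * s) ^ 3))"
      using t t1 s by (simp add: real_sqrt_mult real_sqrt_divide power_mult_distrib)
    finally show ?thesis .
  qed
  have "h (t * s) x \<mu>
    \<le> (sqrt (t1 ^ 3 / t0 ^ 3) * (\<bar>x\<bar> / sqrt (2 * pi * (t1 * s) ^ 3))) * (exp (\<mu>\<^sup>2 * t1 / 2) * exp (- (x + \<mu> * (t1 * s))\<^sup>2 / (2 * (t1 * s))))"
    unfolding h_def using 1 2 t t1 s by (intro mult_mono) auto
  then show ?thesis by (simp add: h_def mult_ac)
qed

lemma h_scale_tendsto:
  assumes "u \<longlonglongrightarrow> t" "0 < t" "0 < s"
  shows "(\<lambda>n. h (u n * s) x \<mu>) \<longlonglongrightarrow> h (t * s) x \<mu>"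
  unfolding h_def using assms by (intro tendsto_intros) auto

text \<open>With the triangle 0 < s < t written as a condition inside the integrand, both variables
  range over the whole line, where Tonelli and the translation of t by s apply.\<close>

lemma nn_integral_convolution:
  fixes f g :: "real \<Rightarrow> ennreal"
  assumes [measurable]: "f \<in> borel_measurable borel" "g \<in> borel_measurable borel"
  shows "(\<integral>\<^sup>+t\<in>{0<..}. (\<integral>\<^sup>+s\<in>{0<..<t}. f (t - s) * g s \<partial>lborel) \<partial>lborel)
    = (\<integral>\<^sup>+s\<in>{0<..}. f s \<partial>lborel) * (\<integral>\<^sup>+s\<in>{0<..}. g s \<partial>lborel)"
proof -
  have "(\<integral>\<^sup>+t\<in>{0<..}. (\<integral>\<^sup>+s\<in>{0<..<t}. f (t - s) * g s \<partial>lborel) \<partial>lborel)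
     = (\<integral>\<^sup>+t. (\<integral>\<^sup>+s. (if 0 < s \<and> s < t then f (t - s) * g s else 0) \<partial>lborel) \<partial>lborel)"
  proof (intro nn_integral_cong)
    fix t :: real
    show "(\<integral>\<^sup>+s\<in>{0<..<t}. f (t - s) * g s \<partial>lborel) * indicator {0<..} t
      = (\<integral>\<^sup>+s. (if 0 < s \<and> s < t then f (t - s) * g s else 0) \<partial>lborel)"
    proof (cases "0 < t")
      case False
      then have "(if 0 < s \<and> s < t then f (t - s) * g s else 0) = 0" for s by auto
      then show ?thesis using False by simp
    qed (auto intro!: nn_integral_cong simp: indicator_def)
  qed
  also have "\<dots> = (\<integral>\<^sup>+s. (\<integral>\<^sup>+t. (if 0 < s \<and> s < t then f (t - s) * g s else 0) \<partial>lborel) \<partial>lborel)"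
    by (intro lborel_pair.Fubini') measurable
  also have "\<dots> = (\<integral>\<^sup>+s. (\<integral>\<^sup>+t\<in>{0<..}. f t \<partial>lborel) * (g s * indicator {0<..} s) \<partial>lborel)"
  proof (intro nn_integral_cong)
    fix s :: real
    have "(\<integral>\<^sup>+t. (if 0 < s \<and> s < t then f (t - s) * g s else 0) \<partial>lborel)
       = (\<integral>\<^sup>+t. (if 0 < s \<and> s < s + t then f (s + t - s) * g s else 0) \<partial>lborel)"
      using nn_integral_real_affine[of "\<lambda>t. if 0 < s \<and> s < t then f (t - s) * g s else 0" 1 s] by (simp cong: if_cong)
    also have "\<dots> = (\<integral>\<^sup>+t. (f t * indicator {0<..} t) * (g s * indicator {0<..} s) \<partial>lborel)"
      by (intro nn_integral_cong) (auto simp: indicator_def)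
    also have "\<dots> = (\<integral>\<^sup>+t\<in>{0<..}. f t \<partial>lborel) * (g s * indicator {0<..} s)"
      by (subst nn_integral_multc) auto
    finally show "(\<integral>\<^sup>+t. (if 0 < s \<and> s < t then f (t - s) * g s else 0) \<partial>lborel)
       = (\<integral>\<^sup>+t\<in>{0<..}. f t \<partial>lborel) * (g s * indicator {0<..} s)" .
  qed
  also have "\<dots> = (\<integral>\<^sup>+s\<in>{0<..}. f s \<partial>lborel) * (\<integral>\<^sup>+s\<in>{0<..}. g s \<partial>lborel)"
    by (subst nn_integral_cmult) auto
  finally show ?thesis .
qed

lemma nn_integral_exp_Ioi:
  fixes w :: real
  assumes w: "0 < w"
  shows "(\<integral>\<^sup>+b\<in>{0<..}. ennreal (exp (- (w * b))) \<partial>lborel) = ennreal (1 / w)"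
proof -
  have "(\<integral>\<^sup>+b\<in>{0<..}. ennreal (exp (- (w * b))) \<partial>lborel) = (\<integral>\<^sup>+b\<in>{0..}. ennreal (exp (- (w * b))) \<partial>lborel)"
    by (rule nn_integral_cong_AE) (use AE_lborel_singleton[of 0] in \<open>auto simp: indicator_def\<close>)
  also have "\<dots> = ennreal (0 - (- exp (- (w * 0)) / w))"
  proof (rule nn_integral_FTC_atLeast)
    show "((\<lambda>b. - exp (- (w * b)) / w) \<longlongrightarrow> 0) at_top" using w by real_asymp
    show "((\<lambda>b. - exp (- (w * b)) / w) has_real_derivative exp (- (w * b))) (at b)" for b
      using w by (auto intro!: derivative_eq_intros)
  qed auto
  finally show ?thesis using w by simp
qed

section \<open>The density on the positive half-line\<close>

text \<open>The branch y > 0 of the claimed density. It is a nonnegative extended integral so that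
  Tonelli can be used before finiteness is known. The branch y < 0 is the same function at -y with
  parameters - \<beta>, - \<mu>m, - \<mu>p.\<close>

definition half_density :: "real \<Rightarrow> real \<Rightarrow> real \<Rightarrow> real \<Rightarrow> real \<Rightarrow> ennreal" where
  "half_density \<beta> \<mu>p \<mu>m t y = ennreal (2 * (1 + \<beta>) * exp (2 * \<mu>p * y)) *
     (\<integral>\<^sup>+b\<in>{0<..}. (\<integral>\<^sup>+\<tau>\<in>{0<..<t}. ennreal (h (t - \<tau>) ((1 + \<beta>) * b + y) \<mu>p * h \<tau> ((1 - \<beta>) * b) (- \<mu>m)) \<partial>lborel) \<partial>lborel)"

lemma half_density_measurable [measurable]:
  "(\<lambda>(t, y). half_density \<beta> \<mu>p \<mu>m t y) \<in> borel_measurable (borel \<Otimes>\<^sub>M borel)"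
proof -
  \<comment> \<open>The inner range depends on \<open>t\<close>; as a condition in the integrand it
    becomes jointly measurable.\<close>
  have "(\<lambda>(t, y). half_density \<beta> \<mu>p \<mu>m t y) = (\<lambda>(t, y). ennreal (2 * (1 + \<beta>) * exp (2 * \<mu>p * y)) *
     (\<integral>\<^sup>+b. (\<integral>\<^sup>+\<tau>. (if 0 < \<tau> \<and> \<tau> < t then ennreal (h (t - \<tau>) ((1 + \<beta>) * b + y) \<mu>p * h \<tau> ((1 - \<beta>) * b) (- \<mu>m)) else 0) \<partial>lborel) * indicator {0<..} b \<partial>lborel))"
    by (auto simp: half_density_def indicator_def fun_eq_iff intro!: arg_cong2[where f="(*)"] nn_integral_cong)
  also have "\<dots> \<in> borel_measurable (borel \<Otimes>\<^sub>M borel)" by measurable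
  finally show ?thesis .
qed

lemma half_density_measurable' [measurable (raw)]:
  assumes [measurable]: "f \<in> borel_measurable M" "g \<in> borel_measurable M"
  shows "(\<lambda>w. half_density \<beta> \<mu>p \<mu>m (f w) (g w)) \<in> borel_measurable M"
  using measurable_compose[OF _ half_density_measurable, of "\<lambda>w. (f w, g w)" M] by simp

lemma laplace_half_density:
  fixes \<beta> \<mu>p \<mu>m \<theta> l :: real
  assumes \<beta>: "-1 < \<beta>" "\<beta> < 1" and l: "0 < l"
  defines "rp \<equiv> sqrt (\<mu>p\<^sup>2 + 2 * l)" and "rm \<equiv> sqrt (\<mu>m\<^sup>2 + 2 * l)"
  assumes \<theta>: "0 < \<theta> + rp - \<mu>p"
  shows "(\<integral>\<^sup>+t\<in>{0<..}. ennreal (exp (- (l * t)))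
    * (\<integral>\<^sup>+y\<in>{0<..}. ennreal (exp (- (\<theta> * y))) * half_density \<beta> \<mu>p \<mu>m t y \<partial>lborel) \<partial>lborel)
    = ennreal (2 * (1 + \<beta>) / ((1 + \<beta>) * (\<mu>p + rp) + (1 - \<beta>) * (rm - \<mu>m)) / (\<theta> + rp - \<mu>p))"
proof -
  define w where "w = (1 + \<beta>) * (\<mu>p + rp) + (1 - \<beta>) * (rm - \<mu>m)"
  have "\<bar>\<mu>p\<bar> < rp" "\<bar>\<mu>m\<bar> < rm"
    unfolding rp_def rm_def using l by (auto intro!: real_less_rsqrt)
  then have r: "0 < \<mu>p + rp" "0 < rm - \<mu>m" by auto
  then have w: "0 < w" unfolding w_def using \<beta> by (intro add_pos_pos[OF mult_pos_pos mult_pos_pos]) auto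
  define H where "H t y b \<tau> = ennreal (exp (- (l * t)) * exp (- (\<theta> * y)) * (2 * (1 + \<beta>) * exp (2 * \<mu>p * y))
      * (h (t - \<tau>) ((1 + \<beta>) * b + y) \<mu>p * h \<tau> ((1 - \<beta>) * b) (- \<mu>m)))" for t y b \<tau>
  \<comment> \<open>All ranges of integration are collected in one condition, so that every exchange
    of integrals takes place over the whole line.\<close>
  define I where "I t y b \<tau> = (if 0 < t \<and> 0 < y \<and> 0 < b \<and> 0 < \<tau> \<and> \<tau> < t then H t y b \<tau> else 0)" for t y b \<tau>
  have [measurable]: "(\<lambda>w. H (f w) (g w) (k w) (m w)) \<in> borel_measurable M"
    if [measurable]: "f \<in> borel_measurable M" "g \<in> borel_measurable M" "k \<in> borel_measurable M" "m \<in> borel_measurable M"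
    for f g k m and M :: "'x measure"
    unfolding H_def by measurable
  have [measurable]: "(\<lambda>w. I (f w) (g w) (k w) (m w)) \<in> borel_measurable M"
    if [measurable]: "f \<in> borel_measurable M" "g \<in> borel_measurable M" "k \<in> borel_measurable M" "m \<in> borel_measurable M"
    for f g k m and M :: "'x measure"
    unfolding I_def by measurable
  have "(\<integral>\<^sup>+t\<in>{0<..}. ennreal (exp (- (l * t)))
    * (\<integral>\<^sup>+y\<in>{0<..}. ennreal (exp (- (\<theta> * y))) * half_density \<beta> \<mu>p \<mu>m t y \<partial>lborel) \<partial>lborel)
    = (\<integral>\<^sup>+t. \<integral>\<^sup>+y. \<integral>\<^sup>+b. \<integral>\<^sup>+\<tau>. I t y b \<tau> \<partial>lborel \<partial>lborel \<partial>lborel \<partial>lborel)"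
  proof (intro nn_integral_cong)
    fix t :: real
    have "ennreal (exp (- (l * t))) * (ennreal (exp (- (\<theta> * y))) * half_density \<beta> \<mu>p \<mu>m t y * indicator {0<..} y)
      * indicator {0<..} t
       = (\<integral>\<^sup>+b. \<integral>\<^sup>+\<tau>. I t y b \<tau> \<partial>lborel \<partial>lborel)" for y
    proof (cases "0 < t \<and> 0 < y")
      case True
      let ?c = "exp (- (l * t)) * exp (- (\<theta> * y)) * (2 * (1 + \<beta>) * exp (2 * \<mu>p * y))"
      have "(\<integral>\<^sup>+b. \<integral>\<^sup>+\<tau>. I t y b \<tau> \<partial>lborel \<partial>lborel)
         = (\<integral>\<^sup>+b. (ennreal ?c * (\<integral>\<^sup>+\<tau>\<in>{0<..<t}. ennreal (h (t - \<tau>) ((1 + \<beta>) * b + y) \<mu>p * h \<tau> ((1 - \<beta>) * b) (- \<mu>m)) \<partial>lborel) * indicator {0<..} b) \<partial>lborel)"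
      proof (intro nn_integral_cong)
        fix b :: real
        have "ennreal ?c * (\<integral>\<^sup>+\<tau>\<in>{0<..<t}. ennreal (h (t - \<tau>) ((1 + \<beta>) * b + y) \<mu>p * h \<tau> ((1 - \<beta>) * b) (- \<mu>m)) \<partial>lborel)
           = (\<integral>\<^sup>+\<tau>. ennreal ?c * (ennreal (h (t - \<tau>) ((1 + \<beta>) * b + y) \<mu>p * h \<tau> ((1 - \<beta>) * b) (- \<mu>m)) * indicator {0<..<t} \<tau>) \<partial>lborel)"
          by (subst nn_integral_cmult) auto
        also have "\<dots> = (\<integral>\<^sup>+\<tau>. (if 0 < \<tau> \<and> \<tau> < t then H t y b \<tau> else 0) \<partial>lborel)"
          using \<beta> by (intro nn_integral_cong) (auto simp: H_def ennreal_mult[symmetric] h_nonneg indicator_def)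
        finally show "(\<integral>\<^sup>+\<tau>. I t y b \<tau> \<partial>lborel)
          = ennreal ?c * (\<integral>\<^sup>+\<tau>\<in>{0<..<t}. ennreal (h (t - \<tau>) ((1 + \<beta>) * b + y) \<mu>p * h \<tau> ((1 - \<beta>) * b) (- \<mu>m)) \<partial>lborel) * indicator {0<..} b"
          using True by (auto simp: I_def indicator_def)
      qed
      also have "\<dots>
        = ennreal ?c * (\<integral>\<^sup>+b\<in>{0<..}. (\<integral>\<^sup>+\<tau>\<in>{0<..<t}. ennreal (h (t - \<tau>) ((1 + \<beta>) * b + y) \<mu>p * h \<tau> ((1 - \<beta>) * b) (- \<mu>m)) \<partial>lborel) \<partial>lborel)"
        by (subst nn_integral_cmult[symmetric]) (auto simp: mult_ac)
      also have "\<dots> = ennreal (exp (- (l * t))) * (ennreal (exp (- (\<theta> * y))) * half_density \<beta> \<mu>p \<mu>m t y)"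
        using \<beta> by (simp add: half_density_def ennreal_mult mult_ac)
      finally show ?thesis using True by simp
    qed (auto simp: I_def)
    then show "ennreal (exp (- (l * t))) * (\<integral>\<^sup>+y\<in>{0<..}. ennreal (exp (- (\<theta> * y))) * half_density \<beta> \<mu>p \<mu>m t y \<partial>lborel)
      * indicator {0<..} t
      = (\<integral>\<^sup>+y. \<integral>\<^sup>+b. \<integral>\<^sup>+\<tau>. I t y b \<tau> \<partial>lborel \<partial>lborel \<partial>lborel)"
      by (subst nn_integral_cmult[symmetric], simp, subst nn_integral_multc[symmetric], simp) (intro nn_integral_cong, simp)
  qed
  also have "\<dots> = (\<integral>\<^sup>+y. \<integral>\<^sup>+t. \<integral>\<^sup>+b. \<integral>\<^sup>+\<tau>. I t y b \<tau> \<partial>lborel \<partial>lborel \<partial>lborel \<partial>lborel)"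
    by (intro lborel_pair.Fubini') measurable
  also have "\<dots> = (\<integral>\<^sup>+y. \<integral>\<^sup>+b. \<integral>\<^sup>+t. \<integral>\<^sup>+\<tau>. I t y b \<tau> \<partial>lborel \<partial>lborel \<partial>lborel \<partial>lborel)"
    by (intro nn_integral_cong lborel_pair.Fubini') measurable
  also have "\<dots>
    = (\<integral>\<^sup>+y. \<integral>\<^sup>+b. ennreal (2 * (1 + \<beta>) * exp (- ((\<theta> + rp - \<mu>p) * y))) * indicator {0<..} y * (ennreal (exp (- (w * b))) * indicator {0<..} b) \<partial>lborel \<partial>lborel)"
  proof (intro nn_integral_cong)
    fix y b :: real
    show "(\<integral>\<^sup>+t. \<integral>\<^sup>+\<tau>. I t y b \<tau> \<partial>lborel \<partial>lborel)
      = ennreal (2 * (1 + \<beta>) * exp (- ((\<theta> + rp - \<mu>p) * y))) * indicator {0<..} y * (ennreal (exp (- (w * b))) * indicator {0<..} b)"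
    proof (cases "0 < y \<and> 0 < b")
      case True
      then have pos: "0 < (1 + \<beta>) * b + y" "0 < (1 - \<beta>) * b" using \<beta> by (auto intro: add_pos_pos)
      let ?c = "exp (- (\<theta> * y)) * (2 * (1 + \<beta>) * exp (2 * \<mu>p * y))"
      define f where "f s = ennreal (exp (- (l * s)) * h s ((1 + \<beta>) * b + y) \<mu>p)" for s
      define g where "g s = ennreal (exp (- (l * s)) * h s ((1 - \<beta>) * b) (- \<mu>m))" for s
      have [measurable]: "f \<in> borel_measurable borel" "g \<in> borel_measurable borel" unfolding f_def g_def by measurable
      have HH: "H t y b \<tau> = ennreal ?c * (f (t - \<tau>) * g \<tau>)" if "0 < \<tau>" "\<tau> < t" for t \<tau>
      proof -
        have "exp (- (l * t)) = exp (- (l * (t - \<tau>))) * exp (- (l * \<tau>))"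
          by (simp add: exp_add[symmetric] algebra_simps)
        then show ?thesis
          using that \<beta> by (simp add: H_def f_def g_def ennreal_mult[symmetric] h_nonneg mult_ac)
      qed
      have "(\<integral>\<^sup>+t. \<integral>\<^sup>+\<tau>. I t y b \<tau> \<partial>lborel \<partial>lborel)
        = (\<integral>\<^sup>+t. ennreal ?c * ((\<integral>\<^sup>+\<tau>\<in>{0<..<t}. f (t - \<tau>) * g \<tau> \<partial>lborel) * indicator {0<..} t) \<partial>lborel)"
      proof (intro nn_integral_cong)
        fix t :: real
        have "(\<integral>\<^sup>+\<tau>. I t y b \<tau> \<partial>lborel) = (\<integral>\<^sup>+\<tau>. ennreal ?c * (f (t - \<tau>) * g \<tau> * indicator {0<..<t} \<tau>) \<partial>lborel)"
          using True by (intro nn_integral_cong) (auto simp: I_def HH indicator_def)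
        also have "\<dots> = ennreal ?c * (\<integral>\<^sup>+\<tau>\<in>{0<..<t}. f (t - \<tau>) * g \<tau> \<partial>lborel)"
          by (subst nn_integral_cmult) auto
        finally show "(\<integral>\<^sup>+\<tau>. I t y b \<tau> \<partial>lborel)
          = ennreal ?c * ((\<integral>\<^sup>+\<tau>\<in>{0<..<t}. f (t - \<tau>) * g \<tau> \<partial>lborel) * indicator {0<..} t)"
          by (cases "0 < t") (auto simp: I_def)
      qed
      also have "\<dots> = ennreal ?c * (\<integral>\<^sup>+t\<in>{0<..}. (\<integral>\<^sup>+\<tau>\<in>{0<..<t}. f (t - \<tau>) * g \<tau> \<partial>lborel) \<partial>lborel)"
      proof (subst nn_integral_cmult)
        have "(\<lambda>t. (\<integral>\<^sup>+\<tau>. (if 0 < \<tau> \<and> \<tau> < t then f (t - \<tau>) * g \<tau> else 0) \<partial>lborel)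
          * indicator {0<..} t) \<in> borel_measurable lborel"
          by measurable
        also have "(\<lambda>t. (\<integral>\<^sup>+\<tau>. (if 0 < \<tau> \<and> \<tau> < t then f (t - \<tau>) * g \<tau> else 0) \<partial>lborel) * indicator {0<..} t)
            = (\<lambda>t. (\<integral>\<^sup>+\<tau>\<in>{0<..<t}. f (t - \<tau>) * g \<tau> \<partial>lborel) * indicator {0<..} t)"
          by (intro ext arg_cong2[where f="(*)"] nn_integral_cong) (auto simp: indicator_def)
        finally show "(\<lambda>t. (\<integral>\<^sup>+\<tau>\<in>{0<..<t}. f (t - \<tau>) * g \<tau> \<partial>lborel) * indicator {0<..} t) \<in> borel_measurable lborel" .
      qed auto
      also have "\<dots>
        = ennreal ?c * (ennreal (exp (- ((1 + \<beta>) * b + y) * (\<mu>p + rp))) * ennreal (exp (- ((1 - \<beta>) * b) * (- \<mu>m + rm))))"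
        unfolding nn_integral_convolution[OF \<open>f \<in> _\<close> \<open>g \<in> _\<close>]
        unfolding f_def g_def laplace_h[OF pos(1) l] laplace_h[OF pos(2) l] rp_def rm_def by simp
      also have "\<dots>
        = ennreal (2 * (1 + \<beta>) * (exp (- (\<theta> * y)) * exp (2 * \<mu>p * y) * exp (- ((1 + \<beta>) * b + y) * (\<mu>p + rp)) * exp (- ((1 - \<beta>) * b) * (- \<mu>m + rm))))"
        using \<beta> by (simp add: ennreal_mult[symmetric] mult_ac)
      \<comment> \<open>Collecting exponents: exp(2 \<mu>p y) turns the rate \<mu>p + rp of the
        passage time in y into rp - \<mu>p, and the two rates in b add up to
        \<open>w\<close>.\<close>
      also have "exp (- (\<theta> * y)) * exp (2 * \<mu>p * y) * exp (- ((1 + \<beta>) * b + y) * (\<mu>p + rp))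
        * exp (- ((1 - \<beta>) * b) * (- \<mu>m + rm))
          = exp (- ((\<theta> + rp - \<mu>p) * y)) * exp (- (w * b))"
        unfolding exp_add[symmetric] w_def by (simp add: algebra_simps)
      also have "ennreal (2 * (1 + \<beta>) * (exp (- ((\<theta> + rp - \<mu>p) * y)) * exp (- (w * b))))
        = ennreal (2 * (1 + \<beta>) * exp (- ((\<theta> + rp - \<mu>p) * y))) * indicator {0<..} y * (ennreal (exp (- (w * b))) * indicator {0<..} b)"
        using True \<beta> by (simp add: ennreal_mult[symmetric] mult_ac)
      finally show ?thesis .
    qed (auto simp: I_def)
  qed
  also have "\<dots>
    = (\<integral>\<^sup>+y. ennreal (2 * (1 + \<beta>)) * ennreal (1 / w) * (ennreal (exp (- ((\<theta> + rp - \<mu>p) * y))) * indicator {0<..} y) \<partial>lborel)"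
    using \<beta> by (subst nn_integral_cmult, simp, unfold nn_integral_exp_Ioi[OF w])
      (auto intro!: nn_integral_cong simp: indicator_def ennreal_mult mult_ac)
  also have "\<dots> = ennreal (2 * (1 + \<beta>)) * ennreal (1 / w) * ennreal (1 / (\<theta> + rp - \<mu>p))"
    by (subst nn_integral_cmult) (auto simp: nn_integral_exp_Ioi[OF \<theta>])
  also have "\<dots> = ennreal (2 * (1 + \<beta>) / w / (\<theta> + rp - \<mu>p))"
    using \<beta> w \<theta> by (simp add: ennreal_mult[symmetric])
  finally show ?thesis unfolding w_def .
qed

text \<open>With the substitution of \<open>t * \<sigma>\<close> for \<open>\<tau>\<close> the domain of integration no longer depends on \<open>t\<close>,
  and the integrand at time \<open>t\<close> is dominated by a multiple of the one at any later time.\<close>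

definition kernel3 :: "real \<Rightarrow> real \<Rightarrow> real \<Rightarrow> real \<Rightarrow> real \<times> real \<times> real \<Rightarrow> ennreal" where
  "kernel3 \<beta> \<mu>p \<mu>m t = (\<lambda>(y, b, \<sigma>). if 0 < y \<and> 0 < b \<and> 0 < \<sigma> \<and> \<sigma> < 1
     then ennreal (t * (2 * (1 + \<beta>) * exp (2 * \<mu>p * y)) * (h (t * (1 - \<sigma>)) ((1 + \<beta>) * b + y) \<mu>p * h (t * \<sigma>) ((1 - \<beta>) * b) (- \<mu>m)))
     else 0)"

lemma kernel3_measurable [measurable]:
  "kernel3 \<beta> \<mu>p \<mu>m t \<in> borel_measurable (lborel \<Otimes>\<^sub>M (lborel \<Otimes>\<^sub>M lborel))"
  unfolding kernel3_def by measurable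

lemma nn_integral_half_density:
  assumes \<beta>: "-1 < \<beta>" "\<beta> < 1" and t: "0 < t"
    and [measurable]: "g \<in> borel_measurable borel"
  shows "(\<integral>\<^sup>+y\<in>{0<..}. g y * half_density \<beta> \<mu>p \<mu>m t y \<partial>lborel)
    = (\<integral>\<^sup>+z. g (fst z) * kernel3 \<beta> \<mu>p \<mu>m t z \<partial>(lborel \<Otimes>\<^sub>M (lborel \<Otimes>\<^sub>M lborel)))"
proof -
  have eq: "g y * half_density \<beta> \<mu>p \<mu>m t y * indicator {0<..} y
     = (\<integral>\<^sup>+b. \<integral>\<^sup>+\<sigma>. g y * kernel3 \<beta> \<mu>p \<mu>m t (y, b, \<sigma>) \<partial>lborel \<partial>lborel)" for y
  proof (cases "0 < y")
    case True
    let ?c = "ennreal (2 * (1 + \<beta>) * exp (2 * \<mu>p * y))"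
    \<comment> \<open>Substitution of t * \<sigma> for \<tau>; the factor \<open>t\<close> in
      \<open>kernel3\<close> is its Jacobian.\<close>
    have inner: "(\<integral>\<^sup>+\<tau>\<in>{0<..<t}. ennreal (h (t - \<tau>) ((1 + \<beta>) * b + y) \<mu>p * h \<tau> ((1 - \<beta>) * b) (- \<mu>m)) \<partial>lborel)
      = (\<integral>\<^sup>+\<sigma>. ennreal t * (ennreal (h (t * (1 - \<sigma>)) ((1 + \<beta>) * b + y) \<mu>p * h (t * \<sigma>) ((1 - \<beta>) * b) (- \<mu>m)) * indicator {0<..<1} \<sigma>) \<partial>lborel)" for b
    proof -
      have "(\<integral>\<^sup>+\<tau>\<in>{0<..<t}. ennreal (h (t - \<tau>) ((1 + \<beta>) * b + y) \<mu>p * h \<tau> ((1 - \<beta>) * b) (- \<mu>m)) \<partial>lborel)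
        = ennreal \<bar>t\<bar> * (\<integral>\<^sup>+\<sigma>. ennreal (h (t - (0 + t * \<sigma>)) ((1 + \<beta>) * b + y) \<mu>p * h (0 + t * \<sigma>) ((1 - \<beta>) * b) (- \<mu>m)) * indicator {0<..<t} (0 + t * \<sigma>) \<partial>lborel)"
        using t by (intro nn_integral_real_affine) auto
      also have "\<dots>
        = (\<integral>\<^sup>+\<sigma>. ennreal t * (ennreal (h (t - (0 + t * \<sigma>)) ((1 + \<beta>) * b + y) \<mu>p * h (0 + t * \<sigma>) ((1 - \<beta>) * b) (- \<mu>m)) * indicator {0<..<t} (0 + t * \<sigma>)) \<partial>lborel)"
        using t by (subst nn_integral_cmult) auto
      also have "\<dots>
        = (\<integral>\<^sup>+\<sigma>. ennreal t * (ennreal (h (t * (1 - \<sigma>)) ((1 + \<beta>) * b + y) \<mu>p * h (t * \<sigma>) ((1 - \<beta>) * b) (- \<mu>m)) * indicator {0<..<1} \<sigma>) \<partial>lborel)"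
        using t by (intro nn_integral_cong) (auto simp: indicator_def zero_less_mult_iff right_diff_distrib)
      finally show ?thesis .
    qed
    have k: "(\<integral>\<^sup>+\<sigma>. g y * kernel3 \<beta> \<mu>p \<mu>m t (y, b, \<sigma>) \<partial>lborel)
      = g y * ?c * ((\<integral>\<^sup>+\<tau>\<in>{0<..<t}. ennreal (h (t - \<tau>) ((1 + \<beta>) * b + y) \<mu>p * h \<tau> ((1 - \<beta>) * b) (- \<mu>m)) \<partial>lborel) * indicator {0<..} b)" for b
    proof (cases "0 < b")
      case b: True
      have "(\<integral>\<^sup>+\<sigma>. g y * kernel3 \<beta> \<mu>p \<mu>m t (y, b, \<sigma>) \<partial>lborel)
         = (\<integral>\<^sup>+\<sigma>. g y * ?c * (ennreal t * (ennreal (h (t * (1 - \<sigma>)) ((1 + \<beta>) * b + y) \<mu>p * h (t * \<sigma>) ((1 - \<beta>) * b) (- \<mu>m)) * indicator {0<..<1} \<sigma>)) \<partial>lborel)"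
        using True b t \<beta>
          by (intro nn_integral_cong) (auto simp: kernel3_def indicator_def ennreal_mult h_nonneg mult_ac)
      also have "\<dots>
        = g y * ?c * (\<integral>\<^sup>+\<sigma>. ennreal t * (ennreal (h (t * (1 - \<sigma>)) ((1 + \<beta>) * b + y) \<mu>p * h (t * \<sigma>) ((1 - \<beta>) * b) (- \<mu>m)) * indicator {0<..<1} \<sigma>) \<partial>lborel)"
        by (subst nn_integral_cmult) auto
      finally show ?thesis using b unfolding inner by simp
    qed (simp add: kernel3_def)
    show ?thesis
      unfolding k half_density_def using True
      by (subst nn_integral_cmult) (auto simp: mult.assoc)
  qed (simp add: kernel3_def)
  have "(\<integral>\<^sup>+z. g (fst z) * kernel3 \<beta> \<mu>p \<mu>m t z \<partial>(lborel \<Otimes>\<^sub>M (lborel \<Otimes>\<^sub>M lborel)))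
    = (\<integral>\<^sup>+y. \<integral>\<^sup>+z. g y * kernel3 \<beta> \<mu>p \<mu>m t (y, z) \<partial>(lborel \<Otimes>\<^sub>M lborel) \<partial>lborel)"
    by (subst sigma_finite_measure.nn_integral_fst[symmetric, OF sigma_finite_pair_measure[OF sigma_finite_lborel sigma_finite_lborel]]) auto
  also have "\<dots> = (\<integral>\<^sup>+y. \<integral>\<^sup>+b. \<integral>\<^sup>+\<sigma>. g y * kernel3 \<beta> \<mu>p \<mu>m t (y, b, \<sigma>) \<partial>lborel \<partial>lborel \<partial>lborel)"
    by (intro nn_integral_cong, subst lborel.nn_integral_fst[symmetric]) auto
  finally show ?thesis by (simp add: eq)
qed

text \<open>\<open>h_scale_bound\<close> is applied to both passage densities. Their two square
  roots multiply to t1^3 / t0^3, and the Jacobian \<open>t\<close> is at most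
  \<open>t1\<close>.\<close>

lemma kernel3_bound:
  assumes \<beta>: "-1 < \<beta>" "\<beta> < 1" and t: "0 < t0" "t0 \<le> t" "t \<le> t1"
  shows "kernel3 \<beta> \<mu>p \<mu>m t z
    \<le> ennreal ((t1 ^ 3 / t0 ^ 3) * exp (\<mu>p\<^sup>2 * t1 / 2) * exp (\<mu>m\<^sup>2 * t1 / 2)) * kernel3 \<beta> \<mu>p \<mu>m t1 z"
proof -
  obtain y b \<sigma> where z: "z = (y, b, \<sigma>)" by (cases z) auto
  show ?thesis
  proof (cases "0 < y \<and> 0 < b \<and> 0 < \<sigma> \<and> \<sigma> < 1")
    case True
    define r where "r = sqrt (t1 ^ 3 / t0 ^ 3)"
    have rr: "r * r = t1 ^ 3 / t0 ^ 3" using t by (simp add: r_def)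
    have 1: "h (t * (1 - \<sigma>)) ((1 + \<beta>) * b + y) \<mu>p \<le> r * exp (\<mu>p\<^sup>2 * t1 / 2) * h (t1 * (1 - \<sigma>)) ((1 + \<beta>) * b + y) \<mu>p"
      unfolding r_def by (rule h_scale_bound) (use t True in auto)
    have 2: "h (t * \<sigma>) ((1 - \<beta>) * b) (- \<mu>m) \<le> r * exp ((- \<mu>m)\<^sup>2 * t1 / 2) * h (t1 * \<sigma>) ((1 - \<beta>) * b) (- \<mu>m)"
      unfolding r_def by (rule h_scale_bound) (use t True in auto)
    have "t * (2 * (1 + \<beta>) * exp (2 * \<mu>p * y)) * (h (t * (1 - \<sigma>)) ((1 + \<beta>) * b + y) \<mu>p * h (t * \<sigma>) ((1 - \<beta>) * b) (- \<mu>m))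
       \<le> t1 * (2 * (1 + \<beta>) * exp (2 * \<mu>p * y)) * ((r * exp (\<mu>p\<^sup>2 * t1 / 2) * h (t1 * (1 - \<sigma>)) ((1 + \<beta>) * b + y) \<mu>p) * (r * exp ((- \<mu>m)\<^sup>2 * t1 / 2) * h (t1 * \<sigma>) ((1 - \<beta>) * b) (- \<mu>m)))"
      using \<beta> t True by (intro mult_mono 1 2) (auto intro!: mult_nonneg_nonneg h_nonneg simp: r_def)
    also have "\<dots>
      = (r * r) * exp (\<mu>p\<^sup>2 * t1 / 2) * exp (\<mu>m\<^sup>2 * t1 / 2) * (t1 * (2 * (1 + \<beta>) * exp (2 * \<mu>p * y)) * (h (t1 * (1 - \<sigma>)) ((1 + \<beta>) * b + y) \<mu>p * h (t1 * \<sigma>) ((1 - \<beta>) * b) (- \<mu>m)))"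
      by (simp add: mult_ac)
    finally show ?thesis
      using True t \<beta> unfolding rr by (simp add: kernel3_def z ennreal_mult'[symmetric] ennreal_leI)
  qed (auto simp: kernel3_def z)
qed

lemma kernel3_tendsto:
  assumes "u \<longlonglongrightarrow> t" "0 < t"
  shows "(\<lambda>n. kernel3 \<beta> \<mu>p \<mu>m (u n) z) \<longlonglongrightarrow> kernel3 \<beta> \<mu>p \<mu>m t z"
  unfolding kernel3_def using assms
  by (cases z) (auto intro!: tendsto_ennrealI tendsto_mult h_scale_tendsto)

text \<open>The triple integral is not estimated. Its Laplace transform in time at l = 1 and
  \<theta> = 0 is finite by the explicit formula, so the integral is finite at almost every
  time.\<close>

lemma half_density_finite_at_later_time:
  assumes \<beta>: "-1 < \<beta>" "\<beta> < 1"
  obtains t1 where "t < t1" "0 < t1" "(\<integral>\<^sup>+z. kernel3 \<beta> \<mu>p \<mu>m t1 z \<partial>(lborel \<Otimes>\<^sub>M (lborel \<Otimes>\<^sub>M lborel))) < \<infinity>"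
proof -
  define T where "T s = (\<integral>\<^sup>+y\<in>{0<..}. ennreal (exp (- (0 * y))) * half_density \<beta> \<mu>p \<mu>m s y \<partial>lborel)" for s
  have [measurable]: "T \<in> borel_measurable borel" unfolding T_def by measurable
  have "\<mu>p < sqrt (\<mu>p\<^sup>2 + 2 * 1)" by (rule real_less_rsqrt) simp
  then have "(\<integral>\<^sup>+s\<in>{0<..}. ennreal (exp (- (1 * s))) * T s \<partial>lborel) < \<infinity>"
    unfolding T_def using \<beta> by (subst laplace_half_density) auto
  then have "AE s in lborel. ennreal (exp (- (1 * s))) * T s * indicator {0<..} s \<noteq> \<infinity>"
    by (intro nn_integral_PInf_AE) auto
  then have "AE s in lborel. 0 < s \<longrightarrow> T s < \<infinity>"
    by eventually_elim (auto simp: indicator_def less_top ennreal_mult_eq_top_iff)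
  then obtain s where "max 0 t < s" "T s < \<infinity>"
  proof (rule AE_E3)
    fix N assume N: "\<And>x. x \<in> space lborel - N \<Longrightarrow> 0 < x \<longrightarrow> T x < \<infinity>" "N \<in> null_sets lborel"
      and th: "\<And>s. max 0 t < s \<Longrightarrow> T s < \<infinity> \<Longrightarrow> thesis"
    \<comment> \<open>An interval of positive length is not contained in a null set, hence contains
      a good time.\<close>
    have "\<not> {max 0 t <..< max 0 t + 1} \<subseteq> N"
      using null_sets_subset[OF N(2), of "{max 0 t <..< max 0 t + 1}"] by (auto simp: null_sets_def)
    then obtain s where "s \<in> {max 0 t <..< max 0 t + 1}" "s \<notin> N" by blast
    then show thesis using N(1)[of s] th[of s] by auto
  qed
  then show thesis
    using that[of s] nn_integral_half_density[OF \<beta>, of s "\<lambda>_. 1" \<mu>p \<mu>m] by (simp add: T_def)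
qed

text \<open>Domination runs from later to earlier times, so a single finite value beyond
  \<open>t\<close> suffices.\<close>

lemma kernel3_finite:
  assumes \<beta>: "-1 < \<beta>" "\<beta> < 1" and t: "0 < t"
  shows "(\<integral>\<^sup>+z. kernel3 \<beta> \<mu>p \<mu>m t z \<partial>(lborel \<Otimes>\<^sub>M (lborel \<Otimes>\<^sub>M lborel))) < \<infinity>"
proof -
  obtain t1 where t1: "t < t1" "0 < t1" "(\<integral>\<^sup>+z. kernel3 \<beta> \<mu>p \<mu>m t1 z \<partial>(lborel \<Otimes>\<^sub>M (lborel \<Otimes>\<^sub>M lborel))) < \<infinity>"
    by (rule half_density_finite_at_later_time[OF \<beta>])
  let ?C = "ennreal ((t1 ^ 3 / t ^ 3) * exp (\<mu>p\<^sup>2 * t1 / 2) * exp (\<mu>m\<^sup>2 * t1 / 2))"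
  have "(\<integral>\<^sup>+z. kernel3 \<beta> \<mu>p \<mu>m t z \<partial>(lborel \<Otimes>\<^sub>M (lborel \<Otimes>\<^sub>M lborel)))
     \<le> (\<integral>\<^sup>+z. ?C * kernel3 \<beta> \<mu>p \<mu>m t1 z \<partial>(lborel \<Otimes>\<^sub>M (lborel \<Otimes>\<^sub>M lborel)))"
    using t t1 by (intro nn_integral_mono kernel3_bound[OF \<beta>]) auto
  also have "\<dots> < \<infinity>" using t1 by (subst nn_integral_cmult) (auto simp: ennreal_mult_less_top)
  finally show ?thesis .
qed

lemma half_density_finite:
  assumes \<beta>: "-1 < \<beta>" "\<beta> < 1" and t: "0 < t"
  shows "(\<integral>\<^sup>+y\<in>{0<..}. half_density \<beta> \<mu>p \<mu>m t y \<partial>lborel) < \<infinity>"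
  using nn_integral_half_density[OF assms, of "\<lambda>_. 1" \<mu>p \<mu>m] kernel3_finite[OF assms, of \<mu>p \<mu>m] by simp

text \<open>Continuity from the right, which is what an approach to t through almost every time
  needs. With t as the smallest time involved and a bound of the sequence as the largest,
  \<open>kernel3_bound\<close> gives one integrable majorant.\<close>

lemma half_density_tendsto:
  assumes \<beta>: "-1 < \<beta>" "\<beta> < 1" and t: "0 < t" and u: "u \<longlonglongrightarrow> t" "\<And>n. t \<le> u n"
    and [measurable]: "g \<in> borel_measurable borel" and g: "\<And>y. g y \<le> 1"
  shows "(\<lambda>n. \<integral>\<^sup>+y\<in>{0<..}. g y * half_density \<beta> \<mu>p \<mu>m (u n) y \<partial>lborel)
    \<longlonglongrightarrow> (\<integral>\<^sup>+y\<in>{0<..}. g y * half_density \<beta> \<mu>p \<mu>m t y \<partial>lborel)"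
proof -
  have "Bseq u" using u(1) by (intro convergent_imp_Bseq) (auto simp: convergent_def)
  from this[unfolded Bseq_def] obtain K where "\<forall>n. norm (u n) \<le> K" by blast
  then have K: "\<And>n. u n \<le> K" by (simp add: abs_le_iff)
  let ?t1 = "max K t"
  let ?C = "ennreal ((?t1 ^ 3 / t ^ 3) * exp (\<mu>p\<^sup>2 * ?t1 / 2) * exp (\<mu>m\<^sup>2 * ?t1 / 2))"
  have upos: "0 < u n" for n using t u(2)[of n] by simp
  have "(\<lambda>n. \<integral>\<^sup>+z. g (fst z) * kernel3 \<beta> \<mu>p \<mu>m (u n) z \<partial>(lborel \<Otimes>\<^sub>M (lborel \<Otimes>\<^sub>M lborel)))
    \<longlonglongrightarrow> (\<integral>\<^sup>+z. g (fst z) * kernel3 \<beta> \<mu>p \<mu>m t z \<partial>(lborel \<Otimes>\<^sub>M (lborel \<Otimes>\<^sub>M lborel)))"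
  proof (rule nn_integral_dominated_convergence[where w="\<lambda>z. ?C * kernel3 \<beta> \<mu>p \<mu>m ?t1 z"])
    show "AE z in lborel \<Otimes>\<^sub>M (lborel \<Otimes>\<^sub>M lborel). g (fst z) * kernel3 \<beta> \<mu>p \<mu>m (u n) z \<le> ?C * kernel3 \<beta> \<mu>p \<mu>m ?t1 z" for n
      using mult_mono[OF g kernel3_bound[OF \<beta> t u(2)]] K by (intro AE_I2) (auto simp: le_max_iff_disj)
    show "(\<integral>\<^sup>+z. ?C * kernel3 \<beta> \<mu>p \<mu>m ?t1 z \<partial>(lborel \<Otimes>\<^sub>M (lborel \<Otimes>\<^sub>M lborel))) < \<infinity>"
      using kernel3_finite[OF \<beta>, of ?t1 \<mu>p \<mu>m] t
      by (subst nn_integral_cmult) (auto simp: ennreal_mult_less_top)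
    show "AE z in lborel \<Otimes>\<^sub>M (lborel \<Otimes>\<^sub>M lborel). (\<lambda>n. g (fst z) * kernel3 \<beta> \<mu>p \<mu>m (u n) z)
      \<longlonglongrightarrow> g (fst z) * kernel3 \<beta> \<mu>p \<mu>m t z"
    proof (intro AE_I2 ennreal_tendsto_cmult kernel3_tendsto u t)
      show "g (fst z) < top" for z :: "real \<times> real \<times> real" using g[of "fst z"] by (rule le_less_trans) simp
    qed
  qed auto
  then show ?thesis
    using t by (subst (1 2) nn_integral_half_density[OF \<beta>]) (auto simp: upos)
qed

text \<open>Where the inner nonnegative integral is infinite, the Bochner integral takes the default
  value 0. Finiteness of the outer integral confines such b to a null set, so the two iterated
  integrals agree.\<close>

lemma half_density_eq_lebesgue_integral:
  assumes \<beta>: "-1 < \<beta>" "\<beta> < 1" and fin: "half_density \<beta> \<mu>p \<mu>m t y < \<infinity>"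
  shows "ennreal (2 * (1 + \<beta>) * exp (2 * \<mu>p * y) *
         (LBINT b:{0<..}. LBINT \<tau>:{0<..<t}. h (t - \<tau>) ((1 + \<beta>) * b + y) \<mu>p * h \<tau> ((1 - \<beta>) * b) (- \<mu>m)))
    = half_density \<beta> \<mu>p \<mu>m t y"
proof -
  define k where "k b \<tau> = h (t - \<tau>) ((1 + \<beta>) * b + y) \<mu>p * h \<tau> ((1 - \<beta>) * b) (- \<mu>m)" for b \<tau>
  have [measurable]: "(\<lambda>w. k (f w) (g w)) \<in> borel_measurable M"
    if [measurable]: "f \<in> borel_measurable M" "g \<in> borel_measurable M" for f g and M :: "'x measure"
    unfolding k_def by measurable
  define I where "I b = (\<integral>\<^sup>+\<tau>\<in>{0<..<t}. ennreal (k b \<tau>) \<partial>lborel)" for b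
  have [measurable]: "I \<in> borel_measurable borel" unfolding I_def by measurable
  have hd: "half_density \<beta> \<mu>p \<mu>m t y = ennreal (2 * (1 + \<beta>) * exp (2 * \<mu>p * y)) * (\<integral>\<^sup>+b\<in>{0<..}. I b \<partial>lborel)"
    by (simp add: half_density_def I_def k_def)
  have c: "0 < 2 * (1 + \<beta>) * exp (2 * \<mu>p * y)" using \<beta> by simp
  then have finI: "(\<integral>\<^sup>+b\<in>{0<..}. I b \<partial>lborel) < \<infinity>"
    using fin unfolding hd by (auto simp: ennreal_mult_less_top ennreal_eq_0_iff)
  have inner: "(LBINT \<tau>:{0<..<t}. k b \<tau>) = enn2real (I b)" for b
    unfolding set_lebesgue_integral_def I_def
  proof (subst integral_eq_nn_integral)
    show "AE \<tau> in lborel. 0 \<le> indicator {0<..<t} \<tau> *\<^sub>R k b \<tau>"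
      by (intro AE_I2) (auto simp: indicator_def k_def h_nonneg)
    show "enn2real (\<integral>\<^sup>+ \<tau>. ennreal (indicator {0<..<t} \<tau> *\<^sub>R k b \<tau>) \<partial>lborel)
      = enn2real (\<integral>\<^sup>+ \<tau>. ennreal (k b \<tau>) * indicator {0<..<t} \<tau> \<partial>lborel)"
      by (intro arg_cong[where f=enn2real] nn_integral_cong) (auto simp: indicator_def)
  qed auto
  have "AE b in lborel. I b * indicator {0<..} b \<noteq> \<infinity>"
    using finI by (intro nn_integral_PInf_AE) auto
  then have AE: "AE b in lborel. ennreal (indicator {0<..} b *\<^sub>R enn2real (I b)) = I b * indicator {0<..} b"
    by eventually_elim (auto simp: indicator_def less_top)
  have "(LBINT b:{0<..}. enn2real (I b)) = enn2real (\<integral>\<^sup>+b\<in>{0<..}. I b \<partial>lborel)"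
    unfolding set_lebesgue_integral_def
    using nn_integral_cong_AE[OF AE] by (subst integral_eq_nn_integral) auto
  then show ?thesis
    unfolding hd k_def[symmetric] inner using c finI by (simp add: ennreal_mult)
qed

text \<open>The substitution t - \<tau> exchanges the two passage densities; it identifies the
  negative branch with the positive branch for the reflected process.\<close>

lemma half_density_reflect:
  "(LBINT b:{0<..}. LBINT \<tau>:{0<..<t}. h (t - \<tau>) ((1 + \<beta>) * b) \<mu>p * h \<tau> ((1 - \<beta>) * b - y) (- \<mu>m))
   = (LBINT b:{0<..}. LBINT \<tau>:{0<..<t}. h (t - \<tau>) ((1 + - \<beta>) * b + - y) (- \<mu>m) * h \<tau> ((1 - - \<beta>) * b) (- (- \<mu>p)))"
proof -
  have "(LBINT \<tau>:{0<..<t}. h (t - \<tau>) ((1 + \<beta>) * b) \<mu>p * h \<tau> ((1 - \<beta>) * b - y) (- \<mu>m))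
   = (LBINT \<tau>:{0<..<t}. h (t - \<tau>) ((1 - \<beta>) * b - y) (- \<mu>m) * h \<tau> ((1 + \<beta>) * b) \<mu>p)" for b
    unfolding set_lebesgue_integral_def
    by (subst lborel_integral_real_affine[of "-1" _ t])
       (auto intro!: Bochner_Integration.integral_cong simp: indicator_def)
  then show ?thesis by simp
qed

section \<open>Increments independent of the augmented filtration\<close>

lemma cylinder_sets:
  fixes B :: "real \<Rightarrow> 'a \<Rightarrow> real"
  assumes "\<And>r. r \<in> R \<Longrightarrow> B r \<in> borel_measurable M" "finite R" "\<And>r. r \<in> R \<Longrightarrow> A r \<in> sets borel"
  shows "{\<omega> \<in> space M. \<forall>r\<in>R. B r \<omega> \<in> A r} \<in> sets M"
proof (rule sets.sets_Collect_finite_All)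
  show "{\<omega> \<in> space M. B r \<omega> \<in> A r} \<in> sets M" if "r \<in> R" for r
    using measurable_sets[OF assms(1,3), OF that that] by (simp add: vimage_def Int_def conj_commute)
qed fact

text \<open>Independence is available for the increments along a monotone sequence of times. The
  values at the times in \<open>R\<close> are sums of consecutive increments of the partition
  generated by \<open>R\<close>, 0 and \<open>s\<close>, and B t - B s is the increment that comes
  next.\<close>

lemma cylinder_indep_increment:
  assumes bm: "standard_brownian_motion M B" and st: "0 \<le> s" "s < t"
    and R: "finite R" "R \<subseteq> {0..s}" and A: "\<And>r. r \<in> R \<Longrightarrow> A r \<in> sets borel" and E: "E \<in> sets borel"
  shows "measure M ({\<omega> \<in> space M. \<forall>r\<in>R. B r \<omega> \<in> A r} \<inter> ((\<lambda>\<omega>. B t \<omega> - B s \<omega>) -` E \<inter> space M))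
    = measure M {\<omega> \<in> space M. \<forall>r\<in>R. B r \<omega> \<in> A r} * measure M ((\<lambda>\<omega>. B t \<omega> - B s \<omega>) -` E \<inter> space M)"
proof -
  interpret prob_space M using bm by (simp add: standard_brownian_motion_def)
  have Bm: "B r \<in> borel_measurable M" if "0 \<le> r" for r
    using bm that by (simp add: standard_brownian_motion_def)
  define l where "l = sorted_list_of_set (R \<union> {0, s})"
  define n where "n = length l - 1"
  have l: "sorted l" "distinct l" "set l = R \<union> {0, s}" unfolding l_def using R set_sorted_list_of_set[of "R \<union> {0, s}"]
    by (simp_all only: sorted_sorted_list_of_set distinct_sorted_list_of_set finite_Un finite_insert finite.emptyI)
  then have len: "length l = Suc n" by (cases l) (auto simp: n_def)
  have l_le: "l ! i \<le> l ! j" if "i \<le> j" "j < Suc n" for i j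
    using sorted_nth_mono[OF l(1)] that len by auto
  have l_in: "l ! i \<in> R \<union> {0, s}" if "i < Suc n" for i using that len l(3) by (metis nth_mem)
  have l_ex: "\<exists>i<Suc n. l ! i = r" if "r \<in> R \<union> {0, s}" for r
    using that unfolding l(3)[symmetric] len[symmetric] in_set_conv_nth by auto
  have l_bd: "0 \<le> l ! i" "l ! i \<le> s" if "i < Suc n" for i using l_in[OF that] R st by auto
  have l0: "l ! 0 = 0"
  proof -
    obtain i where "i < Suc n" "l ! i = 0" using l_ex[of 0] by auto
    then show ?thesis using l_le[of 0 i] l_bd(1)[of 0] by simp
  qed
  have ln: "l ! n = s"
  proof -
    obtain i where "i < Suc n" "l ! i = s" using l_ex[of s] by auto
    then show ?thesis using l_le[of i n] l_bd(2)[of n] by simp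
  qed
  \<comment> \<open>Constant beyond index \<open>n\<close>: the sequence stays monotone, and its
    increment with index \<open>n\<close> is B t - B s.\<close>
  define \<tau> where "\<tau> i = (if i \<le> n then l ! i else t)" for i
  have "mono \<tau>"
    using l_le l_bd(2) st by (force simp: mono_def \<tau>_def less_Suc_eq_le)
  moreover have "0 \<le> \<tau> 0" by (simp add: \<tau>_def l0)
  ultimately have ind: "indep_vars (\<lambda>_. borel) (\<lambda>i \<omega>. B (\<tau> (Suc i)) \<omega> - B (\<tau> i) \<omega>) {..<Suc n}"
    using bm unfolding standard_brownian_motion_def by blast
  define D where "D i \<omega> = B (\<tau> (Suc i)) \<omega> - B (\<tau> i) \<omega>" for i \<omega>
  define S where "S = {v \<in> space (PiM {..<n} (\<lambda>_. borel)). \<forall>j\<in>{..n}. l ! j \<in> R \<longrightarrow> (\<Sum>i<j. v i) \<in> A (l ! j)}"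
  have "(\<lambda>v. \<Sum>i<j. v i) \<in> borel_measurable (PiM {..<n} (\<lambda>_. borel :: real measure))" if "j \<le> n" for j
    using that by (intro borel_measurable_sum measurable_component_singleton) auto
  note sm = this
  have S: "S \<in> sets (PiM {..<n} (\<lambda>_. borel))"
    unfolding S_def
  proof (rule sets.sets_Collect_finite_All)
    fix j assume j: "j \<in> {..n}"
    show "{v \<in> space (PiM {..<n} (\<lambda>_. borel)). l ! j \<in> R \<longrightarrow> (\<Sum>i<j. v i) \<in> A (l ! j)} \<in> sets (PiM {..<n} (\<lambda>_. borel))"
    proof (cases "l ! j \<in> R")
      case True
      then show ?thesis using measurable_sets[OF sm A[OF True], of j] j by (simp add: vimage_def Int_def conj_commute)
    qed simp
  qed simp
  have iv: "indep_var (PiM {..<n} (\<lambda>_. borel)) (\<lambda>\<omega>. restrict (\<lambda>i. D i \<omega>) {..<n}) (PiM {n} (\<lambda>_. borel)) (\<lambda>\<omega>. restrict (\<lambda>i. D i \<omega>) {n})"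
    using ind unfolding D_def by (rule indep_var_restrict) auto
  have E': "{v \<in> space (PiM {n} (\<lambda>_. borel)). v n \<in> E} \<in> sets (PiM {n} (\<lambda>_. borel))"
    using measurable_sets[OF measurable_component_singleton[of n "{n}" "\<lambda>_. borel"] E]
      by (simp add: vimage_def Int_def conj_commute)
  \<comment> \<open>B 0 vanishes only almost surely. The event in terms of B r - B 0 is an exact
    function of the increments and differs from the intended cylinder by a null set, which is
    removed at the end.\<close>
  define H' where "H' = {\<omega> \<in> space M. \<forall>r\<in>R. B r \<omega> - B 0 \<omega> \<in> A r}"
  have tel: "(\<Sum>i<j. D i \<omega>) = B (l ! j) \<omega> - B 0 \<omega>" if "j \<le> n" for j \<omega>
    using sum_lessThan_telescope[of "\<lambda>i. B (\<tau> i) \<omega>" j] that by (simp add: D_def \<tau>_def l0)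
  have H': "H' = (\<lambda>\<omega>. restrict (\<lambda>i. D i \<omega>) {..<n}) -` S \<inter> space M"
  proof -
    have "restrict (\<lambda>i. D i \<omega>) {..<n} \<in> S \<longleftrightarrow> (\<forall>j\<in>{..n}. l ! j \<in> R \<longrightarrow> B (l ! j) \<omega> - B 0 \<omega> \<in> A (l ! j))" for \<omega>
      by (auto simp: S_def space_PiM tel)
    moreover have "(\<forall>j\<in>{..n}. l ! j \<in> R \<longrightarrow> B (l ! j) \<omega> - B 0 \<omega> \<in> A (l ! j)) \<longleftrightarrow> (\<forall>r\<in>R. B r \<omega> - B 0 \<omega> \<in> A r)" for \<omega>
      using l_ex by (metis UnI1 atMost_iff less_Suc_eq_le)
    ultimately show ?thesis by (auto simp: H'_def)
  qed
  have Dn: "(\<lambda>\<omega>. B t \<omega> - B s \<omega>) -` E \<inter> space M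
    = (\<lambda>\<omega>. restrict (\<lambda>i. D i \<omega>) {n}) -` {v \<in> space (PiM {n} (\<lambda>_. borel)). v n \<in> E} \<inter> space M"
    by (auto simp: D_def \<tau>_def ln space_PiM)
  have main: "measure M (H' \<inter> ((\<lambda>\<omega>. B t \<omega> - B s \<omega>) -` E \<inter> space M))
    = measure M H' * measure M ((\<lambda>\<omega>. B t \<omega> - B s \<omega>) -` E \<inter> space M)"
    using indep_varD[OF iv S E'] unfolding H' Dn
    by (auto simp: vimage_def Int_def conj_ac intro!: arg_cong[where f="measure M"] elim!: back_subst[where P="\<lambda>x. x = _"])
  have B0: "AE \<omega> in M. B 0 \<omega> = 0" using bm by (simp add: standard_brownian_motion_def)
  have Rm: "{\<omega> \<in> space M. \<forall>r\<in>R. B r \<omega> \<in> A r} \<in> sets M"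
    using R A by (intro cylinder_sets Bm) auto
  have H'm: "H' \<in> sets M"
    unfolding H'_def using R A by (intro cylinder_sets[where B="\<lambda>r \<omega>. B r \<omega> - B 0 \<omega>"] borel_measurable_diff Bm) auto
  have Em: "(\<lambda>\<omega>. B t \<omega> - B s \<omega>) -` E \<inter> space M \<in> sets M"
    using E st by (intro measurable_sets[where A=borel] borel_measurable_diff Bm) auto
  have "measure M H' = measure M {\<omega> \<in> space M. \<forall>r\<in>R. B r \<omega> \<in> A r}"
    using B0 by (intro measure_eq_AE Rm H'm) (auto elim!: eventually_mono simp: H'_def)
  moreover have "measure M (H' \<inter> ((\<lambda>\<omega>. B t \<omega> - B s \<omega>) -` E \<inter> space M))
    = measure M ({\<omega> \<in> space M. \<forall>r\<in>R. B r \<omega> \<in> A r} \<inter> ((\<lambda>\<omega>. B t \<omega> - B s \<omega>) -` E \<inter> space M))"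
    using B0 by (intro measure_eq_AE sets.Int Rm H'm Em) (auto elim!: eventually_mono simp: H'_def)
  ultimately show ?thesis using main by simp
qed

lemma augmented_filtration_generator_subset:
  assumes bm: "standard_brownian_motion M B"
  shows "{B s -` A \<inter> space M | s A. 0 \<le> s \<and> s \<le> t \<and> A \<in> sets borel} \<union> null_sets M \<subseteq> sets M"
proof safe
  fix s :: real and A assume "0 \<le> s" "A \<in> sets (borel :: real measure)"
  moreover have "B s \<in> borel_measurable M" using bm \<open>0 \<le> s\<close> by (simp add: standard_brownian_motion_def)
  ultimately show "B s -` A \<inter> space M \<in> sets M" by (metis measurable_sets)
qed auto

lemma sets_augmented_filtration:
  assumes bm: "standard_brownian_motion M B"
  shows "sets (augmented_filtration M B t) = sigma_sets (space M)
       ({B s -` A \<inter> space M | s A. 0 \<le> s \<and> s \<le> t \<and> A \<in> sets borel} \<union> null_sets M)"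
    and "space (augmented_filtration M B t) = space M"
proof -
  have "{B s -` A \<inter> space M | s A. 0 \<le> s \<and> s \<le> t \<and> A \<in> sets borel} \<union> null_sets M \<subseteq> Pow (space M)"
    using augmented_filtration_generator_subset[OF bm, of t] sets.space_closed by blast
  then show "sets (augmented_filtration M B t) = sigma_sets (space M)
       ({B s -` A \<inter> space M | s A. 0 \<le> s \<and> s \<le> t \<and> A \<in> sets borel} \<union> null_sets M)"
    and "space (augmented_filtration M B t) = space M"
    unfolding augmented_filtration_def by (simp_all add: sets_measure_of space_measure_of_conv)
qed

lemma subalgebra_augmented_filtration:
  assumes bm: "standard_brownian_motion M B"
  shows "subalgebra M (augmented_filtration M B t)"
  unfolding subalgebra_def sets_augmented_filtration[OF bm]
  by (intro conjI refl sets.sigma_sets_subset augmented_filtration_generator_subset bm)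

lemma augmented_filtration_mono:
  assumes bm: "standard_brownian_motion M B" and "s \<le> t"
  shows "sets (augmented_filtration M B s) \<subseteq> sets (augmented_filtration M B t)"
  unfolding sets_augmented_filtration[OF bm] 
proof (rule sigma_sets_mono')
  show "{B r -` A \<inter> space M | r A. 0 \<le> r \<and> r \<le> s \<and> A \<in> sets borel} \<union> null_sets M
    \<subseteq> {B r -` A \<inter> space M | r A. 0 \<le> r \<and> r \<le> t \<and> A \<in> sets borel} \<union> null_sets M"
    using assms(2) order_trans by blast
qed

text \<open>Finite-dimensional cylinders together with the null sets are stable under intersection
  and generate the augmented filtration. Cylinders are independent of the increment by the previous
  lemmas, and a null set is independent of everything.\<close>

lemma augmented_filtration_indep_set:
  assumes bm: "standard_brownian_motion M B" and st: "0 \<le> s" "s < t"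
  shows "prob_space.indep_set M (sets (augmented_filtration M B s))
     (sigma_sets (space M) {(\<lambda>\<omega>. B t \<omega> - B s \<omega>) -` E \<inter> space M | E. E \<in> sets borel})"
proof -
  interpret prob_space M using bm by (simp add: standard_brownian_motion_def)
  have Bm: "B r \<in> borel_measurable M" if "0 \<le> r" for r
    using bm that by (simp add: standard_brownian_motion_def)
  define cyl where "cyl a \<longleftrightarrow> (\<exists>R A. a
    = {\<omega> \<in> space M. \<forall>r\<in>R. B r \<omega> \<in> A r} \<and> finite R \<and> R \<subseteq> {0..s} \<and> (\<forall>r\<in>R. A r \<in> sets borel))" for a
  have cylE: thesis if "cyl a"
    "\<And>R A. \<lbrakk>a = {\<omega> \<in> space M. \<forall>r\<in>R. B r \<omega> \<in> A r}; finite R; R \<subseteq> {0..s}; \<forall>r\<in>R. A r \<in> sets borel\<rbrakk> \<Longrightarrow> thesis" for a thesis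
    using that(1)[unfolded cyl_def] by (elim exE conjE) (rule that(2))
  have cylI: "cyl {\<omega> \<in> space M. \<forall>r\<in>R. B r \<omega> \<in> A r}" if "finite R" "R \<subseteq> {0..s}" "\<forall>r\<in>R. A r \<in> sets borel" for R A
    unfolding cyl_def using that by (intro exI[of _ R] exI[of _ A]) simp
  define C where "C = {a. cyl a} \<union> null_sets M"
  have CM: "C \<subseteq> sets M"
  proof
    fix a assume "a \<in> C"
    then consider "a \<in> null_sets M" | "cyl a" unfolding C_def by blast
    then show "a \<in> sets M"
    proof cases
      case 2
      then show ?thesis by (elim cylE) (simp add: cylinder_sets Bm subset_iff)
    qed auto
  qed
  have stable: "Int_stable C"
  proof (rule Int_stableI)
    fix a b assume ab: "a \<in> C" "b \<in> C"
    show "a \<inter> b \<in> C"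
    proof (cases "a \<in> null_sets M \<or> b \<in> null_sets M")
      case True
      then have "a \<inter> b \<in> null_sets M"
      proof
        assume "a \<in> null_sets M"
        moreover have "b \<in> sets M" using CM ab(2) ..
        ultimately show ?thesis by (rule null_set_Int2)
      next
        assume "b \<in> null_sets M"
        moreover have "a \<in> sets M" using CM ab(1) ..
        ultimately show ?thesis by (rule null_set_Int1)
      qed
      then show ?thesis by (simp add: C_def)
    next
      case False
      obtain R1 A1 where
        1: "a = {\<omega> \<in> space M. \<forall>r\<in>R1. B r \<omega> \<in> A1 r}" "finite R1" "R1 \<subseteq> {0..s}" "\<forall>r\<in>R1. A1 r \<in> sets borel"
      proof (rule cylE)
        show "cyl a" using False ab(1) by (simp add: C_def)
      qed
      obtain R2 A2 where
        2: "b = {\<omega> \<in> space M. \<forall>r\<in>R2. B r \<omega> \<in> A2 r}" "finite R2" "R2 \<subseteq> {0..s}" "\<forall>r\<in>R2. A2 r \<in> sets borel"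
      proof (rule cylE)
        show "cyl b" using False ab(2) by (simp add: C_def)
      qed
      let ?A = "\<lambda>r. (if r \<in> R1 then A1 r else UNIV) \<inter> (if r \<in> R2 then A2 r else UNIV)"
      have "a \<inter> b = {\<omega> \<in> space M. \<forall>r\<in>R1 \<union> R2. B r \<omega> \<in> ?A r}"
        unfolding 1(1) 2(1) by auto
      moreover have "cyl {\<omega> \<in> space M. \<forall>r\<in>R1 \<union> R2. B r \<omega> \<in> ?A r}"
        by (rule cylI) (use 1(2-4) 2(2-4) in auto)
      ultimately show ?thesis by (simp add: C_def)
    qed
  qed
  let ?E = "{(\<lambda>\<omega>. B t \<omega> - B s \<omega>) -` E \<inter> space M | E. E \<in> sets borel}"
  have EM: "?E \<subseteq> sets M"
  proof safe
    fix E assume E: "E \<in> sets (borel :: real measure)"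
    show "(\<lambda>\<omega>. B t \<omega> - B s \<omega>) -` E \<inter> space M \<in> sets M"
      using E st by (intro measurable_sets[where A=borel] borel_measurable_diff Bm) auto
  qed
  have "indep_set C ?E"
  proof (rule indep_setI[OF CM EM])
    fix a b assume a: "a \<in> C" and "b \<in> ?E"
    then obtain E where b: "b = (\<lambda>\<omega>. B t \<omega> - B s \<omega>) -` E \<inter> space M" "E \<in> sets borel" by auto
    show "prob (a \<inter> b) = prob a * prob b"
    proof (cases "a \<in> null_sets M")
      case True
      then have "a \<inter> b \<in> null_sets M" using EM \<open>b \<in> ?E\<close> by (intro null_set_Int2) auto
      then show ?thesis using True by (simp add: measure_eq_0_null_sets)
    next
      case False
      with a have "cyl a" by (simp add: C_def)
      then obtain R A where "a = {\<omega> \<in> space M. \<forall>r\<in>R. B r \<omega> \<in> A r}" "finite R" "R \<subseteq> {0..s}" "\<forall>r\<in>R. A r \<in> sets borel"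
        by (rule cylE)
      then show ?thesis using cylinder_indep_increment[OF bm st, of R A E] b by simp
    qed
  qed
  moreover have "Int_stable ?E"
  proof (rule Int_stableI)
    fix a b assume "a \<in> ?E" "b \<in> ?E"
    then obtain E1 E2 where "a = (\<lambda>\<omega>. B t \<omega> - B s \<omega>) -` E1 \<inter> space M" "b
      = (\<lambda>\<omega>. B t \<omega> - B s \<omega>) -` E2 \<inter> space M" "E1 \<in> sets borel" "E2 \<in> sets borel"
      by auto
    then have "a \<inter> b = (\<lambda>\<omega>. B t \<omega> - B s \<omega>) -` (E1 \<inter> E2) \<inter> space M" "E1 \<inter> E2 \<in> sets borel" by auto
    then show "a \<inter> b \<in> ?E" by blast
  qed
  ultimately have ind: "indep_set (sigma_sets (space M) C) (sigma_sets (space M) ?E)"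
    using stable by (intro indep_set_sigma_sets)
  have "sets (augmented_filtration M B s) \<subseteq> sigma_sets (space M) C"
    unfolding sets_augmented_filtration[OF bm]
  proof (rule sigma_sets_mono')
    show "{B r -` A \<inter> space M |r A. 0 \<le> r \<and> r \<le> s \<and> A \<in> sets borel} \<union> null_sets M \<subseteq> C"
    proof safe
      fix r A assume "0 \<le> r" "r \<le> s" "A \<in> sets (borel :: real measure)"
      then have "cyl {\<omega> \<in> space M. \<forall>u\<in>{r}. B u \<omega> \<in> A}" by (intro cylI) auto
      then show "B r -` A \<inter> space M \<in> C" by (simp add: C_def vimage_def Int_def conj_commute)
    qed (simp add: C_def)
  qed
  then show ?thesis using ind unfolding indep_sets2_eq by blast
qed

lemma augmented_filtration_indep_var:
  fixes Z :: "'a \<Rightarrow> real"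
  assumes bm: "standard_brownian_motion M B" and st: "0 \<le> s" "s < t"
    and Z: "Z \<in> borel_measurable (augmented_filtration M B s)"
  shows "prob_space.indep_var M borel Z borel (\<lambda>\<omega>. B t \<omega> - B s \<omega>)"
proof -
  interpret prob_space M using bm by (simp add: standard_brownian_motion_def)
  have "{Z -` A \<inter> space M | A. A \<in> sets borel} \<subseteq> sets (augmented_filtration M B s)"
    using measurable_sets[OF Z] by (auto simp: sets_augmented_filtration(2)[OF bm])
  then have "sigma_sets (space M) {Z -` A \<inter> space M | A. A \<in> sets borel} \<subseteq> sets (augmented_filtration M B s)"
    using sets.sigma_sets_subset[of _ "augmented_filtration M B s"] by (simp add: sets_augmented_filtration(2)[OF bm])
  moreover have "Z \<in> borel_measurable M"
    using Z subalgebra_augmented_filtration[OF bm] by (rule measurable_from_subalg[rotated])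
  moreover have "(\<lambda>\<omega>. B t \<omega> - B s \<omega>) \<in> borel_measurable M"
    using bm st unfolding standard_brownian_motion_def by (intro borel_measurable_diff) auto
  ultimately show ?thesis
    using augmented_filtration_indep_set[OF bm st] unfolding indep_var_eq indep_sets2_eq by blast
qed

text \<open>What the later argument needs of the law of the increments: conditional mean and
  variance, tested against bounded adapted weights, and the fourth moment.\<close>

lemma brownian_increment_moments:
  fixes Z :: "'a \<Rightarrow> real"
  assumes bm: "standard_brownian_motion M B" and st: "0 \<le> s" "s < t"
    and Z: "Z \<in> borel_measurable (augmented_filtration M B s)" and bd: "\<And>\<omega>. \<bar>Z \<omega>\<bar> \<le> K"
  shows "integrable M (\<lambda>\<omega>. (B t \<omega> - B s \<omega>) ^ k)"
    and "(\<integral>\<omega>. Z \<omega> * (B t \<omega> - B s \<omega>) \<partial>M) = 0"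
    and "(\<integral>\<omega>. Z \<omega> * (B t \<omega> - B s \<omega>)\<^sup>2 \<partial>M) = (t - s) * (\<integral>\<omega>. Z \<omega> \<partial>M)"
    and "(\<integral>\<omega>. (B t \<omega> - B s \<omega>) ^ 4 \<partial>M) = 3 * (t - s)\<^sup>2"
proof -
  interpret prob_space M using bm by (simp add: standard_brownian_motion_def)
  let ?D = "\<lambda>\<omega>. B t \<omega> - B s \<omega>"
  have Zm: "Z \<in> borel_measurable M"
    using Z subalgebra_augmented_filtration[OF bm] by (rule measurable_from_subalg[rotated])
  have Zi: "integrable M Z" by (rule integrable_const_bound[where B=K]) (use Zm bd in auto)
  have Dd: "distributed M lborel ?D (\<lambda>x. ennreal (normal_density 0 (sqrt (t - s)) x))"
    using bm st by (simp add: standard_brownian_motion_def)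
  have sg: "0 < sqrt (t - s)" using st by simp
  have int: "integrable lborel (\<lambda>x. normal_density 0 (sqrt (t - s)) x * x ^ k)" for k
    using integrable_normal_moment[OF sg, of 0 k] by simp
  show pow: "integrable M (\<lambda>\<omega>. ?D \<omega> ^ k)" for k
    using distributed_integrable[OF Dd, of "\<lambda>x. x ^ k"] int by simp
  have E: "(\<integral>\<omega>. ?D \<omega> ^ k \<partial>M) = (\<integral>x. normal_density 0 (sqrt (t - s)) x * x ^ k \<partial>lborel)" for k
    using distributed_integral[OF Dd, of "\<lambda>x. x ^ k"] by simp
  have iv: "indep_var borel Z borel ?D" by (rule augmented_filtration_indep_var[OF bm st Z])
  have ivk: "indep_var borel Z borel (\<lambda>\<omega>. ?D \<omega> ^ k)" for k
    using indep_var_compose[OF iv, of "\<lambda>x. x" borel "\<lambda>x. x ^ k" borel] by (simp add: comp_def)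
  have prod: "(\<integral>\<omega>. Z \<omega> * ?D \<omega> ^ k \<partial>M) = (\<integral>\<omega>. Z \<omega> \<partial>M) * (\<integral>\<omega>. ?D \<omega> ^ k \<partial>M)" for k
    by (rule indep_var_lebesgue_integral[OF ivk Zi pow])
  have "(\<integral>\<omega>. ?D \<omega> ^ 1 \<partial>M) = 0"
    unfolding E using integral_normal_moment_odd[OF sg, of 0 0] by simp
  then show "(\<integral>\<omega>. Z \<omega> * ?D \<omega> \<partial>M) = 0" using prod[of 1] by simp
  have "(\<integral>\<omega>. ?D \<omega> ^ 2 \<partial>M) = t - s"
    unfolding E using integral_normal_moment_even[OF sg, of 0 1] st by (simp add: fact_numeral)
  then show "(\<integral>\<omega>. Z \<omega> * ?D \<omega> ^ 2 \<partial>M) = (t - s) * (\<integral>\<omega>. Z \<omega> \<partial>M)" using prod[of 2] by simp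
  show "(\<integral>\<omega>. ?D \<omega> ^ 4 \<partial>M) = 3 * (t - s)\<^sup>2"
    unfolding E using integral_normal_moment_even[OF sg, of 0 2] st
    by (simp add: fact_numeral field_simps power4_eq_xxxx power2_eq_square)
qed

lemma set_integrable_bounded:
  fixes g :: "real \<Rightarrow> real"
  assumes "g \<in> borel_measurable borel" "\<And>r. \<bar>g r\<bar> \<le> C"
  shows "set_integrable lborel {u..v} g"
  unfolding set_integrable_def
  by (rule integrableI_bounded_set_indicator[where B=C]) (use assms in \<open>auto simp: emeasure_lborel_Icc_eq\<close>)

section \<open>Symmetric local time of a path\<close>

lemma local_time_level_set:
  fixes x :: "real \<Rightarrow> real"
  assumes "continuous_on UNIV x"
  shows "compact {s \<in> {0..t}. \<bar>x s - 0\<bar> \<le> e}"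
proof -
  have "closed {s. \<bar>x s - 0\<bar> \<le> e}"
    using assms by (intro closed_Collect_le continuous_intros)
  then have "compact ({0..t} \<inter> {s. \<bar>x s - 0\<bar> \<le> e})" by (intro compact_Int_closed) auto
  then show ?thesis by (simp add: Int_def)
qed

lemma local_time_lmeasurable:
  fixes x :: "real \<Rightarrow> real"
  assumes "continuous_on UNIV x"
  shows "{s \<in> {0..t}. \<bar>x s - 0\<bar> \<le> e} \<in> lmeasurable"
  using local_time_level_set[OF assms] by (rule lmeasurable_compact)

lemma local_time_unique:
  assumes "has_symmetric_local_time x t a l" "has_symmetric_local_time x t a l'"
  shows "l = l'"
  using tendsto_unique[OF trivial_limit_at_right_real assms[unfolded has_symmetric_local_time_def]] .

lemma local_time_nonneg:
  assumes "has_symmetric_local_time x t 0 l"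
  shows "0 \<le> l"
  using assms unfolding has_symmetric_local_time_def
  by (rule tendsto_lowerbound) (auto simp: eventually_at_right_less intro!: eventually_mono[OF eventually_at_right_less])

lemma local_time_mono:
  assumes x: "continuous_on UNIV x" and "s \<le> t"
    and l: "has_symmetric_local_time x s 0 l" "has_symmetric_local_time x t 0 l'"
  shows "l \<le> l'"
  using l(2,1) unfolding has_symmetric_local_time_def
proof (rule tendsto_le[OF trivial_limit_at_right_real])
  show "\<forall>\<^sub>F e in at_right 0. measure lebesgue {r \<in> {0..s}. \<bar>x r - 0\<bar> \<le> e} / (2 * e)
    \<le> measure lebesgue {r \<in> {0..t}. \<bar>x r - 0\<bar> \<le> e} / (2 * e)"
  proof (rule eventually_mono[OF eventually_at_right_less])
    fix e :: real assume "0 < e"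
    moreover have "measure lebesgue {r \<in> {0..s}. \<bar>x r - 0\<bar> \<le> e} \<le> measure lebesgue {r \<in> {0..t}. \<bar>x r - 0\<bar> \<le> e}"
      using \<open>s \<le> t\<close> by (intro measure_mono_fmeasurable local_time_lmeasurable x fmeasurableD) auto
    ultimately show "measure lebesgue {r \<in> {0..s}. \<bar>x r - 0\<bar> \<le> e} / (2 * e) \<le> measure lebesgue {r \<in> {0..t}. \<bar>x r - 0\<bar>
      \<le> e} / (2 * e)"
      by (simp add: divide_right_mono)
  qed
qed

text \<open>On the compact interval |x| has a positive minimum, and below that size the occupation
  sets up to \<open>s\<close> and up to \<open>t\<close> coincide.\<close>

lemma local_time_flat:
  assumes x: "continuous_on UNIV x" and st: "0 \<le> s" "s \<le> t"
    and nz: "\<And>r. s \<le> r \<Longrightarrow> r \<le> t \<Longrightarrow> x r \<noteq> 0"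
    and l: "has_symmetric_local_time x s 0 l" "has_symmetric_local_time x t 0 l'"
  shows "l = l'"
proof -
  have "compact ((\<lambda>r. \<bar>x r\<bar>) ` {s..t})"
    by (intro compact_continuous_image continuous_intros continuous_on_subset[OF x]) auto
  moreover have "(\<lambda>r. \<bar>x r\<bar>) ` {s..t} \<noteq> {}" using st by auto
  ultimately obtain d where d: "d \<in> (\<lambda>r. \<bar>x r\<bar>) ` {s..t}" "\<And>y. y \<in> (\<lambda>r. \<bar>x r\<bar>) ` {s..t} \<Longrightarrow> d \<le> y"
    using compact_attains_inf by metis
  have d0: "0 < d" using d(1) nz by auto
  have "\<forall>\<^sub>F e in at_right 0. e < d" using d0 by (auto simp: eventually_at_right_field)
  then have "\<forall>\<^sub>F e in at_right 0. measure lebesgue {r \<in> {0..s}. \<bar>x r - 0\<bar> \<le> e} / (2 * e)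
    = measure lebesgue {r \<in> {0..t}. \<bar>x r - 0\<bar> \<le> e} / (2 * e)"
  proof eventually_elim
    case (elim e)
    have "{r \<in> {0..s}. \<bar>x r - 0\<bar> \<le> e} = {r \<in> {0..t}. \<bar>x r - 0\<bar> \<le> e}"
    proof safe
      fix r assume r: "\<bar>x r - 0\<bar> \<le> e" "r \<in> {0..t}"
      show "r \<in> {0..s}"
      proof (rule ccontr)
        assume "r \<notin> {0..s}"
        then have "d \<le> \<bar>x r\<bar>" using r by (intro d(2)) auto
        then show False using elim r by simp
      qed
    qed (use st in auto)
    then show ?case by simp
  qed
  then have "has_symmetric_local_time x t 0 l"
    using l(1) unfolding has_symmetric_local_time_def by (rule tendsto_cong[THEN iffD1])
  then show ?thesis using l(2) local_time_unique by blast
qed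

text \<open>If occupation divided by 2e has a finite limit, the occupation itself tends to 0, and it
  contains the zero set for every e.\<close>

lemma local_time_zero_set:
  assumes x: "continuous_on UNIV x" and l: "has_symmetric_local_time x t 0 l"
  shows "measure lebesgue {s \<in> {0..t}. x s = 0} = 0"
proof -
  have "((\<lambda>e. measure lebesgue {s \<in> {0..t}. \<bar>x s - 0\<bar> \<le> e} / (2 * e) * (2 * e)) \<longlongrightarrow> l * (2 * 0)) (at_right 0)"
    using l unfolding has_symmetric_local_time_def by (intro tendsto_intros) auto
  moreover have "\<forall>\<^sub>F e in at_right 0. measure lebesgue {s \<in> {0..t}. x s = 0} \<le> measure lebesgue {s \<in> {0..t}. \<bar>x s - 0\<bar>
    \<le> e} / (2 * e) * (2 * e)"
  proof (rule eventually_mono[OF eventually_at_right_less])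
    fix e :: real assume e: "0 < e"
    have "{s \<in> {0..t}. x s = 0} \<in> lmeasurable" using local_time_lmeasurable[OF x, of t 0] by simp
    then have "measure lebesgue {s \<in> {0..t}. x s = 0} \<le> measure lebesgue {s \<in> {0..t}. \<bar>x s - 0\<bar> \<le> e}"
      using e by (intro measure_mono_fmeasurable local_time_lmeasurable x fmeasurableD) auto
    then show "measure lebesgue {s \<in> {0..t}. x s = 0} \<le> measure lebesgue {s \<in> {0..t}. \<bar>x s - 0\<bar>
      \<le> e} / (2 * e) * (2 * e)"
      using e by simp
  qed
  ultimately have "measure lebesgue {s \<in> {0..t}. x s = 0} \<le> l * (2 * 0)"
    by (rule tendsto_lowerbound) simp
  then show ?thesis by (simp add: measure_le_0_iff)
qed

text \<open>The limit bounds the ratio for small e; for the others the occupation is at most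
  \<open>t\<close> and the denominator is bounded below.\<close>

lemma local_time_ratio_bounded:
  assumes x: "continuous_on UNIV x" and t: "0 \<le> t" and l: "has_symmetric_local_time x t 0 l"
  obtains K where "0 \<le> K" "\<And>e. 0 < e \<Longrightarrow> measure lebesgue {s \<in> {0..t}. \<bar>x s - 0\<bar> \<le> e} / (2 * e) \<le> K"
proof -
  have "\<forall>\<^sub>F e in at_right 0. measure lebesgue {s \<in> {0..t}. \<bar>x s - 0\<bar> \<le> e} / (2 * e) < l + 1"
    using l unfolding has_symmetric_local_time_def by (rule order_tendstoD) simp
  then obtain d where d: "0 < d" "\<And>e. 0 < e \<Longrightarrow> e < d \<Longrightarrow> measure lebesgue {s \<in> {0..t}. \<bar>x s - 0\<bar> \<le> e} / (2 * e) < l + 1"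
    by (auto simp: eventually_at_right_field)
  show thesis
  proof (rule that[of "max (l + 1) (t / (2 * d))"])
    fix e :: real assume e: "0 < e"
    show "measure lebesgue {s \<in> {0..t}. \<bar>x s - 0\<bar> \<le> e} / (2 * e) \<le> max (l + 1) (t / (2 * d))"
    proof (cases "e < d")
      case False
      have "measure lebesgue {s \<in> {0..t}. \<bar>x s - 0\<bar> \<le> e} \<le> measure lebesgue {0..t}"
        by (intro measure_mono_fmeasurable local_time_lmeasurable x fmeasurableD) auto
      also have "\<dots> = t" using t by simp
      finally have m: "measure lebesgue {s \<in> {0..t}. \<bar>x s - 0\<bar> \<le> e} \<le> t" .
      have "measure lebesgue {s \<in> {0..t}. \<bar>x s - 0\<bar> \<le> e} / (2 * e) \<le> t / (2 * d)"
        by (rule frac_le[OF t m]) (use False d(1) in linarith)+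
      then show ?thesis by (rule max.coboundedI2)
    next
      case True
      then show ?thesis using d(2)[OF e] by (intro max.coboundedI1) simp
    qed
  next
    show "0 \<le> max (l + 1) (t / (2 * d))" using local_time_nonneg[OF l] by (intro max.coboundedI1) simp
  qed
qed

text \<open>Half the second derivative in \<open>x\<close> of sqrt(x^2 + e^2). It is an approximate
  identity of mass one as e tends to 0, and it is the form in which the local time appears in the
  Ito formula for smoothed kinks.\<close>

definition poisson_kernel :: "real \<Rightarrow> real \<Rightarrow> real" where
  "poisson_kernel e x = e\<^sup>2 / (2 * sqrt (x\<^sup>2 + e\<^sup>2) ^ 3)"

lemma poisson_kernel_measurable [measurable]: "poisson_kernel e \<in> borel_measurable borel"
  unfolding poisson_kernel_def[abs_def] by measurable

lemma poisson_kernel_nonneg: "0 \<le> poisson_kernel e x" by (simp add: poisson_kernel_def)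

lemma poisson_kernel_bound:
  assumes "0 < e" shows "poisson_kernel e x \<le> 1 / (2 * e)"
proof -
  have "e ^ 3 \<le> sqrt (x\<^sup>2 + e\<^sup>2) ^ 3" using assms by (intro power_mono real_le_rsqrt) auto
  then have "e\<^sup>2 / (2 * sqrt (x\<^sup>2 + e\<^sup>2) ^ 3) \<le> e\<^sup>2 / (2 * e ^ 3)"
    using assms by (intro divide_left_mono) (auto intro!: mult_pos_pos zero_less_power add_nonneg_pos)
  then show ?thesis using assms by (simp add: poisson_kernel_def power2_eq_square power3_eq_cube)
qed

text \<open>Layer-cake representation. The profile decreases in w, so it is a superposition of
  indicators of w \<le> z; the second identity says that, after normalising the box of half-width z
  by 2z, the weights have total mass one. The antiderivatives are -1/(1+z^2)^(3/2) and
  z^3/(1+z^2)^(3/2).\<close>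

lemma poisson_kernel_layers:
  fixes w :: real
  assumes "0 \<le> w"
  shows "(\<integral>\<^sup>+z. ennreal (3 * z / sqrt (1 + z\<^sup>2) ^ 5) * indicator {w..} z \<partial>lborel) = ennreal (1 / sqrt (1 + w\<^sup>2) ^ 3)"
    and "(\<integral>\<^sup>+z. ennreal (z * (3 * z / sqrt (1 + z\<^sup>2) ^ 5)) * indicator {0..} z \<partial>lborel) = 1"
proof -
  have sq: "0 < 1 + z\<^sup>2" for z :: real by (simp add: add_pos_nonneg)
  have dq: "((\<lambda>z. sqrt (1 + z\<^sup>2)) has_real_derivative z / sqrt (1 + z\<^sup>2)) (at z)" for z
    using sq[of z] by (auto intro!: derivative_eq_intros simp: field_simps)
  have sqrt_pos: "0 < sqrt (1 + z\<^sup>2)" for z :: real using sq[of z] by simp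
  have aux: "3 * (z / q * q ^ 2) = 3 * q * z" if "0 < q" for q z :: real
    using that by (simp add: power2_eq_square)
  have d3: "((\<lambda>z. sqrt (1 + z\<^sup>2) ^ 3) has_real_derivative 3 * sqrt (1 + z\<^sup>2) * z) (at z)" for z
  proof -
    have "3 * (z / sqrt (1 + z\<^sup>2) * sqrt (1 + z\<^sup>2) ^ 2) = 3 * sqrt (1 + z\<^sup>2) * z"
      using aux[OF sqrt_pos[of z]] .
    then show ?thesis using DERIV_power[OF dq[of z], of 3] by simp
  qed
  have q6: "q ^ 3 * q ^ 3 = q * q ^ 5" for q :: real by (simp add: eval_nat_numeral)
  have "(\<integral>\<^sup>+z. ennreal (3 * z / sqrt (1 + z\<^sup>2) ^ 5) * indicator {w..} z \<partial>lborel)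
    = ennreal (0 - (- 1 / sqrt (1 + w\<^sup>2) ^ 3))"
  proof (rule nn_integral_FTC_atLeast)
    show "((\<lambda>z. - 1 / sqrt (1 + z\<^sup>2) ^ 3) \<longlongrightarrow> 0) at_top" by real_asymp
    fix z :: real assume "w \<le> z"
    have e: "(0 * q ^ 3 - (- 1) * (3 * q * z)) / (q ^ 3 * q ^ 3) = 3 * z / q ^ 5" if "0 < q" for q :: real
      unfolding q6 using that by simp
    show "((\<lambda>z. - 1 / sqrt (1 + z\<^sup>2) ^ 3) has_real_derivative 3 * z / sqrt (1 + z\<^sup>2) ^ 5) (at z)"
      by (rule DERIV_cong[OF DERIV_divide[OF DERIV_const d3] e[OF sqrt_pos]]) (use sqrt_pos[of z] in simp)
    show "0 \<le> 3 * z / sqrt (1 + z\<^sup>2) ^ 5" using \<open>w \<le> z\<close> assms by simp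
  qed measurable
  then show "(\<integral>\<^sup>+z. ennreal (3 * z / sqrt (1 + z\<^sup>2) ^ 5) * indicator {w..} z \<partial>lborel) = ennreal (1 / sqrt (1 + w\<^sup>2) ^ 3)"
    by simp
  have "(\<integral>\<^sup>+z. ennreal (z * (3 * z / sqrt (1 + z\<^sup>2) ^ 5)) * indicator {0..} z \<partial>lborel)
    = ennreal (1 - 0 ^ 3 / sqrt (1 + 0\<^sup>2) ^ 3)"
  proof (rule nn_integral_FTC_atLeast)
    show "((\<lambda>z::real. z ^ 3 / sqrt (1 + z\<^sup>2) ^ 3) \<longlongrightarrow> 1) at_top" by real_asymp
    fix z :: real
    define q where "q = sqrt (1 + z\<^sup>2)"
    have q: "0 < q" "q\<^sup>2 = 1 + z\<^sup>2" using sq[of z] by (auto simp: q_def)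
    have "3 * z\<^sup>2 * q ^ 3 - z ^ 3 * (3 * q * z) = 3 * z\<^sup>2 * q * (q\<^sup>2 - z\<^sup>2)"
      by (simp add: algebra_simps eval_nat_numeral)
    also have "\<dots> = q * (z * (3 * z))" unfolding q(2) by (simp add: power2_eq_square)
    finally have "(3 * z\<^sup>2 * q ^ 3 - z ^ 3 * (3 * q * z)) / (q ^ 3 * q ^ 3) = z * (3 * z / q ^ 5)"
      unfolding q6 using q(1) by simp
    note e = this[unfolded q_def]
    have cube: "((\<lambda>z. z ^ 3) has_real_derivative 3 * z\<^sup>2) (at z)"
      by (auto intro!: derivative_eq_intros)
    show "((\<lambda>z. z ^ 3 / sqrt (1 + z\<^sup>2) ^ 3) has_real_derivative z * (3 * z / sqrt (1 + z\<^sup>2) ^ 5)) (at z)"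
      by (rule DERIV_cong[OF DERIV_divide[OF cube d3] e]) (use sqrt_pos[of z] in simp)
    show "0 \<le> z * (3 * z / sqrt (1 + z\<^sup>2) ^ 5)" by simp
  qed measurable
  then show "(\<integral>\<^sup>+z. ennreal (z * (3 * z / sqrt (1 + z\<^sup>2) ^ 5)) * indicator {0..} z \<partial>lborel) = 1"
    by simp
qed

text \<open>The Poisson-type kernel is a mixture of the box kernels in the definition of the local time.\<close>

lemma poisson_kernel_local_time:
  assumes x: "continuous_on UNIV x" and t: "0 \<le> t" and l: "has_symmetric_local_time x t 0 l"
    and e: "e \<longlonglongrightarrow> 0" "\<And>n. 0 < e n"
  shows "(\<lambda>n. LBINT s:{0..t}. poisson_kernel (e n) (x s)) \<longlonglongrightarrow> l"
proof -
  have [measurable]: "x \<in> borel_measurable borel" using x by (rule borel_measurable_continuous_onI)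
  define occ where "occ r = measure lebesgue {s \<in> {0..t}. \<bar>x s - 0\<bar> \<le> r}" for r
  define p where "p z = 3 * z / sqrt (1 + z\<^sup>2) ^ 5" for z :: real
  have [measurable]: "p \<in> borel_measurable borel" unfolding p_def by measurable
  have occ: "(\<integral>\<^sup>+s. (if 0 \<le> s \<and> s \<le> t \<and> \<bar>x s\<bar> \<le> r then 1 else 0) \<partial>lborel) = ennreal (occ r)" for r
  proof -
    have "(\<integral>\<^sup>+s. (if 0 \<le> s \<and> s \<le> t \<and> \<bar>x s\<bar> \<le> r then 1 else 0) \<partial>lborel)
      = (\<integral>\<^sup>+s. indicator {s \<in> {0..t}. \<bar>x s - 0\<bar> \<le> r} s \<partial>lborel)"
      by (intro nn_integral_cong) (auto simp: indicator_def)
    also have "\<dots> = emeasure lborel {s \<in> {0..t}. \<bar>x s - 0\<bar> \<le> r}"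
      using borel_compact[OF local_time_level_set[OF x]] by (intro nn_integral_indicator) auto
    also have "\<dots> = emeasure lebesgue {s \<in> {0..t}. \<bar>x s - 0\<bar> \<le> r}"
      using borel_compact[OF local_time_level_set[OF x]] by simp
    also have "\<dots> = ennreal (occ r)"
      unfolding occ_def using fmeasurableD2[OF local_time_lmeasurable[OF x]] by (intro emeasure_eq_ennreal_measure) auto
    finally show ?thesis .
  qed
  \<comment> \<open>Tonelli over layers and time: the box of half-width e * z contributes the
    occupation ratio at scale e * z, with weight z * p z.\<close>
  have key: "(\<integral>\<^sup>+s. ennreal (poisson_kernel e (x s)) * indicator {0..t} s \<partial>lborel)
      = (\<integral>\<^sup>+z. ennreal (z * p z) * indicator {0..} z * ennreal (occ (e * z) / (2 * (e * z))) \<partial>lborel)" if e: "0 < e" for e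
  proof -
    have k: "poisson_kernel e y = 1 / (2 * e) * (1 / sqrt (1 + (\<bar>y\<bar> / e)\<^sup>2) ^ 3)" for y
    proof -
      have "sqrt (y\<^sup>2 + e\<^sup>2) = e * sqrt (1 + (\<bar>y\<bar> / e)\<^sup>2)"
        using e by (intro real_sqrt_unique) (auto simp: power_mult_distrib power_divide field_simps)
      then show ?thesis using e by (simp add: poisson_kernel_def power_mult_distrib power2_eq_square power3_eq_cube)
    qed
    have "(\<integral>\<^sup>+s. ennreal (poisson_kernel e (x s)) * indicator {0..t} s \<partial>lborel)
      = (\<integral>\<^sup>+s. (\<integral>\<^sup>+z. ennreal (1 / (2 * e)) * (if 0 \<le> z then ennreal (p z) else 0) * (if 0 \<le> s \<and> s \<le> t \<and> \<bar>x s\<bar> \<le> e * z then 1 else 0) \<partial>lborel) \<partial>lborel)"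
    proof (intro nn_integral_cong)
      fix s :: real
      have "(\<integral>\<^sup>+z. ennreal (1 / (2 * e)) * (if 0 \<le> z then ennreal (p z) else 0) * (if 0 \<le> s \<and> s \<le> t \<and> \<bar>x s\<bar>
        \<le> e * z then 1 else 0) \<partial>lborel)
         = (\<integral>\<^sup>+z. (ennreal (1 / (2 * e)) * indicator {0..t} s) * (ennreal (p z) * indicator {\<bar>x s\<bar> / e..} z) \<partial>lborel)"
      proof (intro nn_integral_cong)
        fix z :: real
        have "\<bar>x s\<bar> / e \<le> z \<longleftrightarrow> 0 \<le> z \<and> \<bar>x s\<bar> \<le> e * z"
          using e zero_le_mult_iff[of e z] by (auto simp: field_simps)
        then show "ennreal (1 / (2 * e)) * (if 0 \<le> z then ennreal (p z) else 0) * (if 0 \<le> s \<and> s \<le> t \<and> \<bar>x s\<bar>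
          \<le> e * z then 1 else 0)
          = ennreal (1 / (2 * e)) * indicator {0..t} s * (ennreal (p z) * indicator {\<bar>x s\<bar> / e..} z)"
          by (auto simp: indicator_def)
      qed
      also have "\<dots> = (ennreal (1 / (2 * e)) * indicator {0..t} s) * ennreal (1 / sqrt (1 + (\<bar>x s\<bar> / e)\<^sup>2) ^ 3)"
        using e poisson_kernel_layers(1)[of "\<bar>x s\<bar> / e"] by (subst nn_integral_cmult) (auto simp: p_def)
      also have "\<dots> = ennreal (poisson_kernel e (x s)) * indicator {0..t} s"
        unfolding k using e by (auto simp: indicator_def ennreal_mult[symmetric])
      finally show "ennreal (poisson_kernel e (x s)) * indicator {0..t} s
        = (\<integral>\<^sup>+z. ennreal (1 / (2 * e)) * (if 0 \<le> z then ennreal (p z) else 0) * (if 0 \<le> s \<and> s \<le> t \<and> \<bar>x s\<bar> \<le> e * z then 1 else 0) \<partial>lborel)" by simp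
    qed
    also have "\<dots>
      = (\<integral>\<^sup>+z. (\<integral>\<^sup>+s. ennreal (1 / (2 * e)) * (if 0 \<le> z then ennreal (p z) else 0) * (if 0 \<le> s \<and> s \<le> t \<and> \<bar>x s\<bar> \<le> e * z then 1 else 0) \<partial>lborel) \<partial>lborel)"
      by (intro lborel_pair.Fubini') measurable
    also have "\<dots> = (\<integral>\<^sup>+z. ennreal (1 / (2 * e)) * (if 0 \<le> z then ennreal (p z) else 0) * ennreal (occ (e * z)) \<partial>lborel)"
      by (intro nn_integral_cong, subst nn_integral_cmult) (auto simp: occ)
    also have "\<dots> = (\<integral>\<^sup>+z. ennreal (z * p z) * indicator {0..} z * ennreal (occ (e * z) / (2 * (e * z))) \<partial>lborel)"
    proof (rule nn_integral_cong_AE, rule eventually_mono[OF AE_lborel_singleton[of 0]])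
      fix z :: real assume "z \<noteq> 0"
      have "0 \<le> occ r" for r by (simp add: occ_def)
      then show "ennreal (1 / (2 * e)) * (if 0 \<le> z then ennreal (p z) else 0) * ennreal (occ (e * z))
        = ennreal (z * p z) * indicator {0..} z * ennreal (occ (e * z) / (2 * (e * z)))"
        using e \<open>z \<noteq> 0\<close> by (auto simp: indicator_def ennreal_mult[symmetric] p_def field_simps)
    qed
    finally show ?thesis .
  qed
  \<comment> \<open>The layer z runs over the whole half-line, so the ratio has to be dominated at
    all scales and not just near 0.\<close>
  obtain K where K: "0 \<le> K" "\<And>e. 0 < e \<Longrightarrow> occ e / (2 * e) \<le> K"
    unfolding occ_def by (rule local_time_ratio_bounded[OF x t l]) auto
  have [measurable]: "(\<lambda>z. ennreal (occ (e * z))) \<in> borel_measurable borel" for e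
    unfolding occ[symmetric] by measurable
  have occm: "(\<lambda>z. occ (e * z)) \<in> borel_measurable borel" for e
    by (subst measurable_cong[where g="\<lambda>z. enn2real (ennreal (occ (e * z)))"]) (auto simp: occ_def)
  note [measurable] = occm
  have lim: "(\<lambda>n. occ (e n * z) / (2 * (e n * z))) \<longlonglongrightarrow> l" if "0 < z" for z
  proof -
    have "(\<lambda>n. e n * z) \<longlonglongrightarrow> 0" using tendsto_mult_right[OF e(1), of z] by simp
    then have "filterlim (\<lambda>n. e n * z) (at_right 0) sequentially"
      using e(2) less_imp_neq[OF e(2)] that by (auto simp: filterlim_at intro!: always_eventually)
    with l show ?thesis unfolding has_symmetric_local_time_def occ_def by (rule filterlim_compose)
  qed
  have "(\<lambda>n. \<integral>\<^sup>+z. ennreal (z * p z) * indicator {0..} z * ennreal (occ (e n * z) / (2 * (e n * z))) \<partial>lborel)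
    \<longlonglongrightarrow> (\<integral>\<^sup>+z. ennreal (z * p z) * indicator {0..} z * ennreal l \<partial>lborel)"
  proof (rule nn_integral_dominated_convergence[where w="\<lambda>z. ennreal (z * p z) * indicator {0..} z * ennreal K"])
    show "(\<integral>\<^sup>+z. ennreal (z * p z) * indicator {0..} z * ennreal K \<partial>lborel) < \<infinity>"
      using poisson_kernel_layers(2)[OF order_refl] by (subst nn_integral_multc) (auto simp: p_def)
    show "AE z in lborel. ennreal (z * p z) * indicator {0..} z * ennreal (occ (e n * z) / (2 * (e n * z)))
      \<le> ennreal (z * p z) * indicator {0..} z * ennreal K" for n
    proof (rule AE_I2)
      fix z show "ennreal (z * p z) * indicator {0..} z * ennreal (occ (e n * z) / (2 * (e n * z)))
        \<le> ennreal (z * p z) * indicator {0..} z * ennreal K"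
        by (cases "0 < z") (use K e(2)[of n] in \<open>auto simp: indicator_def intro!: mult_left_mono ennreal_leI\<close>)
    qed
    show "AE z in lborel. (\<lambda>n. ennreal (z * p z) * indicator {0..} z * ennreal (occ (e n * z) / (2 * (e n * z))))
      \<longlonglongrightarrow> ennreal (z * p z) * indicator {0..} z * ennreal l"
    proof (rule AE_I2)
      fix z show "(\<lambda>n. ennreal (z * p z) * indicator {0..} z * ennreal (occ (e n * z) / (2 * (e n * z))))
        \<longlonglongrightarrow> ennreal (z * p z) * indicator {0..} z * ennreal l"
        by (cases "0 < z") (auto simp: indicator_def intro!: ennreal_tendsto_cmult tendsto_ennrealI lim)
    qed
  qed auto
  moreover have "(\<integral>\<^sup>+z. ennreal (z * p z) * indicator {0..} z * ennreal l \<partial>lborel) = ennreal l"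
    using poisson_kernel_layers(2)[OF order_refl] by (subst nn_integral_multc) (auto simp: p_def)
  ultimately have nn: "(\<lambda>n. \<integral>\<^sup>+s. ennreal (poisson_kernel (e n) (x s)) * indicator {0..t} s \<partial>lborel) \<longlonglongrightarrow> ennreal l"
    using key[OF e(2)] by simp
  have "(\<integral>\<^sup>+s. ennreal (poisson_kernel (e n) (x s)) * indicator {0..t} s \<partial>lborel)
    = ennreal (LBINT s:{0..t}. poisson_kernel (e n) (x s))" for n
  proof -
    have "(\<integral>\<^sup>+s. ennreal (indicator {0..t} s *\<^sub>R poisson_kernel (e n) (x s)) \<partial>lborel)
      = ennreal (LBINT s:{0..t}. poisson_kernel (e n) (x s))"
      unfolding set_lebesgue_integral_def
      by (rule nn_integral_eq_integral[OF set_integrable_bounded[where C="1 / (2 * e n)", unfolded set_integrable_def]])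
         (auto simp: poisson_kernel_nonneg poisson_kernel_bound[OF e(2)])
    moreover have "(\<integral>\<^sup>+s. ennreal (indicator {0..t} s *\<^sub>R poisson_kernel (e n) (x s)) \<partial>lborel)
      = (\<integral>\<^sup>+s. ennreal (poisson_kernel (e n) (x s)) * indicator {0..t} s \<partial>lborel)"
      by (intro nn_integral_cong) (auto simp: indicator_def)
    ultimately show ?thesis by simp
  qed
  then have "(\<lambda>n. ennreal (LBINT s:{0..t}. poisson_kernel (e n) (x s))) \<longlonglongrightarrow> ennreal l"
    using nn by simp
  moreover have "0 \<le> (LBINT s:{0..t}. poisson_kernel (e n) (x s))" for n
    unfolding set_lebesgue_integral_def by (rule integral_nonneg_AE) (simp add: poisson_kernel_nonneg)
  ultimately show ?thesis using local_time_nonneg[OF l] by (simp add: tendsto_ennreal_iff)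
qed

lemma set_integral_increment:
  fixes g :: "real \<Rightarrow> real"
  assumes [measurable]: "g \<in> borel_measurable borel" and b: "\<And>r. \<bar>g r\<bar> \<le> C" and "0 \<le> u" "u \<le> v"
  shows "(LBINT r:{0..v}. g r) - (LBINT r:{0..u}. g r) = (LBINT r:{u..v}. g r)"
proof -
  have i: "set_integrable lborel {a..c} g" for a c by (rule set_integrable_bounded) (use b in auto)
  have "set_integrable lborel {u<..v} g" by (rule set_integrable_subset[OF i[of u v]]) auto
  then have "(LBINT r:{0..u} \<union> {u<..v}. g r) = (LBINT r:{0..u}. g r) + (LBINT r:{u<..v}. g r)"
    by (intro set_integral_Un i) auto
  moreover have "{0..u} \<union> {u<..v} = {0..v}" using assms by auto
  moreover have "(LBINT r:{u<..v}. g r) = (LBINT r:{u..v}. g r)"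
    unfolding set_lebesgue_integral_def
    by (rule integral_cong_AE) (use AE_lborel_singleton[of u] in \<open>auto simp: indicator_def\<close>)
  ultimately show ?thesis by simp
qed

lemma set_integral_abs_le:
  fixes g :: "real \<Rightarrow> real"
  assumes [measurable]: "g \<in> borel_measurable borel" and b: "\<And>r. u \<le> r \<Longrightarrow> r \<le> v \<Longrightarrow> \<bar>g r\<bar> \<le> C" and "u \<le> v"
  shows "\<bar>LBINT r:{u..v}. g r\<bar> \<le> C * (v - u)"
proof -
  have "norm (LBINT r:{u..v}. g r) \<le> (\<integral>r. C * indicator {u..v} r \<partial>lborel)"
    unfolding set_lebesgue_integral_def
  proof (rule Bochner_Integration.integral_norm_bound_integral)
    show "integrable lborel (\<lambda>r. indicator {u..v} r *\<^sub>R g r)"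
      by (rule integrableI_bounded_set_indicator[where B=C]) (use b in \<open>auto simp: emeasure_lborel_Icc_eq\<close>)
    show "norm (indicator {u..v} r *\<^sub>R g r) \<le> C * indicator {u..v} r" for r
      using b[of r] by (auto simp: indicator_def)
  qed (auto simp: emeasure_lborel_Icc_eq)
  then show ?thesis using \<open>u \<le> v\<close> by simp
qed

section \<open>Pathwise estimates\<close>

text \<open>Both strict indicators of the equation vanish at the level, whence the value 0
  there.\<close>

definition drift :: "real \<Rightarrow> real \<Rightarrow> real \<Rightarrow> real" where
  "drift \<mu>p \<mu>m z = (if 0 < z then \<mu>p else if z < 0 then \<mu>m else 0)"

lemma drift_measurable [measurable]: "drift \<mu>p \<mu>m \<in> borel_measurable borel"
  unfolding drift_def[abs_def] by measurable

lemma drift_bound: "\<bar>drift \<mu>p \<mu>m z\<bar> \<le> \<bar>\<mu>p\<bar> + \<bar>\<mu>m\<bar>" by (simp add: drift_def)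

definition grid :: "real \<Rightarrow> real \<Rightarrow> nat \<Rightarrow> nat \<Rightarrow> real" where
  "grid s t n i = s + real i * ((t - s) / real n)"

lemma grid_bounds:
  assumes "s \<le> t" "i \<le> n" "0 < n"
  shows "s \<le> grid s t n i" "grid s t n i \<le> t" 
proof -
  have "real i * ((t - s) / real n) \<le> real n * ((t - s) / real n)"
    using assms by (intro mult_right_mono) auto
  then show "grid s t n i \<le> t" using assms by (simp add: grid_def)
qed (use assms in \<open>simp add: grid_def\<close>)

lemma grid_step: "grid s t n (Suc i) - grid s t n i = (t - s) / real n"
  by (simp add: grid_def algebra_simps add_divide_distrib[symmetric])

lemma grid_0 [simp]: "grid s t n 0 = s" by (simp add: grid_def)
lemma grid_n [simp]: "0 < n \<Longrightarrow> grid s t n n = t" by (simp add: grid_def)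

text \<open>The deterministic content of the equation for a single outcome. Paths are continuous on
  the whole line so that measurability in time needs no restriction to the half-line.\<close>

locale skew_path =
  fixes x b l :: "real \<Rightarrow> real" and \<beta> \<mu>p \<mu>m :: real
  assumes x_cont: "continuous_on UNIV x" and b_cont: "continuous_on UNIV b"
    and x0: "x 0 = 0" and b0: "b 0 = 0"
    and lt: "\<And>t. 0 \<le> t \<Longrightarrow> has_symmetric_local_time x t 0 (l t)"
    and eq: "\<And>t. 0 \<le> t \<Longrightarrow> x t = b t + \<beta> * l t + (LBINT s:{0..t}. drift \<mu>p \<mu>m (x s))"
begin

abbreviation "c \<equiv> \<bar>\<mu>p\<bar> + \<bar>\<mu>m\<bar>"

lemma x_meas [measurable]: "x \<in> borel_measurable borel"
  using x_cont by (rule borel_measurable_continuous_onI)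

lemma drift_increment:
  assumes "0 \<le> u" "u \<le> v"
  shows "x v - x u = b v - b u + \<beta> * (l v - l u) + (LBINT s:{u..v}. drift \<mu>p \<mu>m (x s))"
proof -
  have "(LBINT s:{0..v}. drift \<mu>p \<mu>m (x s)) - (LBINT s:{0..u}. drift \<mu>p \<mu>m (x s)) = (LBINT s:{u..v}. drift \<mu>p \<mu>m (x s))"
    by (rule set_integral_increment[OF _ drift_bound assms]) measurable
  then show ?thesis using assms eq[of u] eq[of v] by (simp add: algebra_simps)
qed

lemma l_mono: "0 \<le> u \<Longrightarrow> u \<le> v \<Longrightarrow> l u \<le> l v"
  using local_time_mono[OF x_cont _ lt lt] by simp

lemma l_nonneg: "0 \<le> u \<Longrightarrow> 0 \<le> l u"
  using local_time_nonneg lt by blast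

lemma l_flat: "0 \<le> u \<Longrightarrow> u \<le> v \<Longrightarrow> (\<And>r. u \<le> r \<Longrightarrow> r \<le> v \<Longrightarrow> x r \<noteq> 0) \<Longrightarrow> l v = l u"
  using local_time_flat[OF x_cont _ _ _ lt lt, of u v] by simp

text \<open>Let g be the last zero up to t. After g the local time is flat, so x t is a Brownian
  increment plus drift. Solving the equation for \<beta> * l t then leaves |b t| twice, |b g| once
  and two drift terms, whence the constants 3 and 2.\<close>

lemma local_time_bound:
  assumes t: "0 \<le> t" and S: "\<And>r. 0 \<le> r \<Longrightarrow> r \<le> t \<Longrightarrow> \<bar>b r\<bar> \<le> S"
  shows "\<bar>\<beta>\<bar> * l t \<le> 3 * S + 2 * c * t"
proof -
  let ?D = "\<lambda>u v. LBINT s:{u..v}. drift \<mu>p \<mu>m (x s)"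
  have D: "\<bar>?D u v\<bar> \<le> c * (v - u)" if "u \<le> v" for u v
    by (rule set_integral_abs_le) (use that drift_bound in auto)
  define Z where "Z = {r \<in> {0..t}. x r = 0}"
  have "closed {s. x s = 0}" using x_cont by (intro closed_Collect_eq continuous_intros)
  then have "compact ({0..t} \<inter> {s. x s = 0})" by (intro compact_Int_closed) auto
  then have "compact Z" by (simp add: Z_def Int_def)
  moreover have "0 \<in> Z" using t x0 by (simp add: Z_def)
  ultimately obtain g where g: "g \<in> Z" "\<And>r. r \<in> Z \<Longrightarrow> r \<le> g"
    using compact_attains_sup[of Z] by blast
  have g': "0 \<le> g" "g \<le> t" "x g = 0" using g(1) by (auto simp: Z_def)
  have nz: "x r \<noteq> 0" if "g < r" "r \<le> t" for r using g(2)[of r] that g' by (force simp: Z_def)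
  \<comment> \<open>\<open>l_flat\<close> requires a nonzero path at the left end, so g is reached
    only as a limit from the right. Continuity there holds for \<beta> * l, because all other terms
    of the equation are continuous; the equation says nothing about l itself when \<beta> =
    0.\<close>
  have "\<beta> * l t = \<beta> * l g"
  proof (cases "g = t")
    case False
    then have gt: "g < t" using g' by simp
    have fl: "l t = l r" if "g < r" "r \<le> t" for r using that g' nz by (intro l_flat) auto
    have "\<bar>\<beta> * l t - \<beta> * l g\<bar> \<le> 0 + e" if "0 < e" for e
    proof -
      have "isCont x g" "isCont b g" using x_cont b_cont by (auto simp: continuous_on_eq_continuous_at)
      then have "((\<lambda>r. \<bar>x r - x g\<bar> + \<bar>b r - b g\<bar> + c * (r - g)) \<longlongrightarrow> \<bar>x g - x g\<bar> + \<bar>b g - b g\<bar> + c * (g - g)) (at g)"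
        by (intro tendsto_intros) (auto simp: isCont_def)
      then have "((\<lambda>r. \<bar>x r - x g\<bar> + \<bar>b r - b g\<bar> + c * (r - g)) \<longlongrightarrow> 0) (at_right g)"
        by (auto intro: filterlim_at_split[THEN iffD1, THEN conjunct2])
      then have "\<forall>\<^sub>F r in at_right g. \<bar>x r - x g\<bar> + \<bar>b r - b g\<bar> + c * (r - g) < e"
        by (rule order_tendstoD) fact
      moreover have "\<forall>\<^sub>F r in at_right g. g < r \<and> r < t"
        using gt by (auto simp: eventually_at_right_field)
      ultimately have "\<forall>\<^sub>F r in at_right g. \<bar>x r - x g\<bar> + \<bar>b r - b g\<bar> + c * (r - g) < e \<and> g < r \<and> r < t"
        by eventually_elim auto
      then obtain r where r: "\<bar>x r - x g\<bar> + \<bar>b r - b g\<bar> + c * (r - g) < e" "g < r" "r < t"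
        using eventually_happens[of _ "at_right g"] trivial_limit_at_right_real by blast
      have "\<beta> * l r - \<beta> * l g = (x r - x g) - (b r - b g) - ?D g r"
        using drift_increment[of g r] r g' by (simp add: algebra_simps)
      then have "\<bar>\<beta> * l r - \<beta> * l g\<bar> \<le> e" using r D[of g r] by linarith
      then show ?thesis using fl[of r] r by simp
    qed
    then have "\<bar>\<beta> * l t - \<beta> * l g\<bar> \<le> 0" by (rule field_le_epsilon)
    then show ?thesis by simp
  qed simp
  then have "\<beta> * (l t - l g) = 0" by (simp add: right_diff_distrib)
  then have "x t = (b t - b g) + ?D g t" using drift_increment[of g t] g' by linarith
  moreover have "\<beta> * l t = x t - b t - ?D 0 t" using eq[OF t] by simp
  moreover have "\<bar>b t\<bar> \<le> S" "\<bar>b g\<bar> \<le> S" using S t g' by auto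
  moreover have "c * (t - g) \<le> c * t" "c * (t - 0) \<le> c * t" using g' by (auto intro!: mult_left_mono)
  ultimately have "\<bar>\<beta> * l t\<bar> \<le> 3 * S + 2 * c * t" using D[of g t] D[of 0 t] g' t by linarith
  then show ?thesis using l_nonneg[OF t] by (simp add: abs_mult)
qed

text \<open>From the intermediate point x u + (b v - b u) to x v only local time and drift
  contribute, and the mean value theorem makes f' at a nearby point their common factor. If l grows
  on [u, v] then x vanishes somewhere in it, so f' 0 is the right factor for the local time.\<close>

lemma ito_step:
  fixes f f' :: "real \<Rightarrow> real"
  assumes f: "\<And>z. (f has_real_derivative f' z) (at z)" and lip: "\<And>z w. \<bar>f' z - f' w\<bar> \<le> K * \<bar>z - w\<bar>"
    and uv: "0 \<le> u" "u \<le> v" and xo: "\<And>r q. u \<le> r \<Longrightarrow> r \<le> v \<Longrightarrow> u \<le> q \<Longrightarrow> q \<le> v \<Longrightarrow> \<bar>x r - x q\<bar> \<le> \<eta>"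
    and bo: "\<bar>b v - b u\<bar> \<le> \<eta>"
    and [measurable]: "f' \<in> borel_measurable borel"
  shows "\<bar>f (x v) - f (x u + (b v - b u)) - (LBINT r:{u..v}. f' (x r) * drift \<mu>p \<mu>m (x r)) - f' 0 * (\<beta> * (l v - l u))\<bar>
    \<le> 2 * \<eta> * K * (c * (v - u) + \<bar>\<beta>\<bar> * (l v - l u))"
proof -
  have K: "0 \<le> K" using lip[of 1 0] by simp
  have \<eta>: "0 \<le> \<eta>" using bo by simp
  \<comment> \<open>Both end points lie within \<eta> of x u, hence so does the mean value point;
    for equal end points x u itself serves.\<close>
  obtain \<xi> where \<xi>: "f (x v) - f (x u + (b v - b u)) = f' \<xi> * (x v - (x u + (b v - b u)))" "\<bar>\<xi> - x u\<bar> \<le> \<eta>"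
  proof -
    have xv: "\<bar>x v - x u\<bar> \<le> \<eta>" using xo uv by simp
    consider "x v = x u + (b v - b u)" | "x v < x u + (b v - b u)" | "x u + (b v - b u) < x v" by linarith
    then show thesis
    proof cases
      case 1 then show thesis using that[of "x u"] \<eta> by simp
    next
      case 2
      then obtain z where "x v < z" "z < x u + (b v - b u)" "f (x u + (b v - b u)) - f (x v)
        = (x u + (b v - b u) - x v) * f' z"
        using MVT2[OF 2, of f f'] f by blast
      then show thesis using that[of z] xv bo by (auto simp: algebra_simps)
    next
      case 3
      then obtain z where "x u + (b v - b u) < z" "z < x v" "f (x v) - f (x u + (b v - b u))
        = (x v - (x u + (b v - b u))) * f' z"
        using MVT2[OF 3, of f f'] f by blast
      then show thesis using that[of z] xv bo by (auto simp: algebra_simps)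
    qed
  qed
  let ?d = "\<lambda>r. drift \<mu>p \<mu>m (x r)"
  have near: "\<bar>f' \<xi> - f' (x r)\<bar> \<le> 2 * \<eta> * K" if "u \<le> r" "r \<le> v" for r
  proof -
    have "\<bar>\<xi> - x r\<bar> \<le> 2 * \<eta>" using \<xi>(2) xo[of u r] that uv by simp
    then have "K * \<bar>\<xi> - x r\<bar> \<le> K * (2 * \<eta>)" using K by (rule mult_left_mono)
    then show ?thesis using lip[of \<xi> "x r"] by (simp add: mult_ac)
  qed
  have f'b: "\<bar>f' (x r)\<bar> \<le> \<bar>f' \<xi>\<bar> + 2 * \<eta> * K" if "u \<le> r" "r \<le> v" for r using near[OF that] by linarith
  have "\<bar>f' \<xi> * (\<beta> * (l v - l u)) - f' 0 * (\<beta> * (l v - l u))\<bar> \<le> 2 * \<eta> * K * (\<bar>\<beta>\<bar> * (l v - l u))"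
  proof (cases "l v = l u")
    case False
    then obtain r where r: "u \<le> r" "r \<le> v" "x r = 0" using l_flat[OF uv] by blast
    have "\<bar>f' \<xi> * (\<beta> * (l v - l u)) - f' 0 * (\<beta> * (l v - l u))\<bar> = \<bar>f' \<xi> - f' 0\<bar> * (\<bar>\<beta>\<bar> * (l v - l u))"
      using l_mono[OF uv] by (simp add: left_diff_distrib[symmetric] abs_mult)
    also have "\<dots> \<le> 2 * \<eta> * K * (\<bar>\<beta>\<bar> * (l v - l u))"
      using near[OF r(1,2)] r(3) l_mono[OF uv] by (intro mult_right_mono) auto
    finally show ?thesis .
  qed simp
  moreover have "\<bar>f' \<xi> * (LBINT r:{u..v}. ?d r) - (LBINT r:{u..v}. f' (x r) * ?d r)\<bar> \<le> 2 * \<eta> * K * (c * (v - u))"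
  proof -
    have i1: "set_integrable lborel {u..v} (\<lambda>r. f' \<xi> * ?d r)"
      unfolding set_integrable_def
      by (rule integrableI_bounded_set_indicator[where B="\<bar>f' \<xi>\<bar> * c"])
         (auto simp: emeasure_lborel_Icc_eq abs_mult intro!: mult_left_mono drift_bound)
    have i2: "set_integrable lborel {u..v} (\<lambda>r. f' (x r) * ?d r)"
      unfolding set_integrable_def
      by (rule integrableI_bounded_set_indicator[where B="(\<bar>f' \<xi>\<bar> + 2 * \<eta> * K) * c"])
         (use f'b \<eta> K in \<open>auto simp: emeasure_lborel_Icc_eq abs_mult intro!: AE_I2 mult_mono drift_bound\<close>)
    have "f' \<xi> * (LBINT r:{u..v}. ?d r) - (LBINT r:{u..v}. f' (x r) * ?d r)
      = (LBINT r:{u..v}. f' \<xi> * ?d r - f' (x r) * ?d r)"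
      using set_integral_diff(2)[OF i1 i2] by simp
    also have "\<bar>\<dots>\<bar> \<le> (2 * \<eta> * K * c) * (v - u)"
    proof (rule set_integral_abs_le)
      fix r assume r: "u \<le> r" "r \<le> v"
      have "\<bar>f' \<xi> * ?d r - f' (x r) * ?d r\<bar> = \<bar>f' \<xi> - f' (x r)\<bar> * \<bar>?d r\<bar>"
        by (simp add: left_diff_distrib[symmetric] abs_mult)
      also have "\<dots> \<le> 2 * \<eta> * K * c" using near[OF r] drift_bound K \<eta> by (intro mult_mono) auto
      finally show "\<bar>f' \<xi> * ?d r - f' (x r) * ?d r\<bar> \<le> 2 * \<eta> * K * c" .
    qed (use uv in auto)
    finally show ?thesis by (simp add: mult_ac)
  qed
  moreover have "f (x v) - f (x u + (b v - b u)) = f' \<xi> * (\<beta> * (l v - l u)) + f' \<xi> * (LBINT r:{u..v}. ?d r)"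
  proof -
    have "x v - (x u + (b v - b u)) = \<beta> * (l v - l u) + (LBINT r:{u..v}. ?d r)"
      using drift_increment[OF uv] by linarith
    then show ?thesis unfolding \<xi>(1) by (simp only: distrib_left)
  qed
  ultimately have "\<bar>f (x v) - f (x u + (b v - b u)) - (LBINT r:{u..v}. f' (x r) * ?d r) - f' 0 * (\<beta> * (l v - l u))\<bar>
    \<le> 2 * \<eta> * K * (c * (v - u)) + 2 * \<eta> * K * (\<bar>\<beta>\<bar> * (l v - l u))" by linarith
  then show ?thesis by (simp add: distrib_left)
qed

definition drift_sum :: "(real \<Rightarrow> real) \<Rightarrow> real \<Rightarrow> real \<Rightarrow> nat \<Rightarrow> real" where
  "drift_sum f s t n
    = (\<Sum>i<n. f (x (grid s t n (Suc i))) - f (x (grid s t n i) + (b (grid s t n (Suc i)) - b (grid s t n i))))"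

text \<open>A bound by the total variation of the non-Brownian part, uniform in the grid; it is the
  majorant for dominated convergence in \<open>ito_expectation\<close>.\<close>

lemma drift_sum_bound:
  fixes f f' :: "real \<Rightarrow> real"
  assumes lip: "\<And>z w. \<bar>f z - f w\<bar> \<le> K * \<bar>z - w\<bar>" and st: "0 \<le> s" "s \<le> t" and n: "0 < n"
  shows "\<bar>drift_sum f s t n\<bar> \<le> K * (c * (t - s) + \<bar>\<beta>\<bar> * (l t - l s))"
proof -
  let ?g = "grid s t n"
  have K: "0 \<le> K" using lip[of 1 0] by simp
  have "\<bar>drift_sum f s t n\<bar> \<le> (\<Sum>i<n. \<bar>f (x (?g (Suc i))) - f (x (?g i) + (b (?g (Suc i)) - b (?g i)))\<bar>)"
    unfolding drift_sum_def by (rule sum_abs)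
  also have "\<dots> \<le> (\<Sum>i<n. K * (c * (?g (Suc i) - ?g i) + \<bar>\<beta>\<bar> * (l (?g (Suc i)) - l (?g i))))"
  proof (rule sum_mono)
    fix i assume "i \<in> {..<n}"
    then have g: "0 \<le> ?g i" "?g i \<le> ?g (Suc i)"
      using grid_bounds[OF st(2), of i n] n st grid_step[of s t n i]
        by (auto, smt (verit) divide_nonneg_nonneg of_nat_0_le_iff)
    have "\<bar>LBINT r:{?g i..?g (Suc i)}. drift \<mu>p \<mu>m (x r)\<bar> \<le> c * (?g (Suc i) - ?g i)"
      by (rule set_integral_abs_le) (use g drift_bound in auto)
    moreover have "\<bar>\<beta> * (l (?g (Suc i)) - l (?g i))\<bar> = \<bar>\<beta>\<bar> * (l (?g (Suc i)) - l (?g i))"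
      using l_mono[OF g] by (simp add: abs_mult)
    ultimately have "\<bar>x (?g (Suc i)) - (x (?g i) + (b (?g (Suc i)) - b (?g i)))\<bar>
      \<le> c * (?g (Suc i) - ?g i) + \<bar>\<beta>\<bar> * (l (?g (Suc i)) - l (?g i))"
      using drift_increment[OF g] by linarith
    then have "K * \<bar>x (?g (Suc i)) - (x (?g i) + (b (?g (Suc i)) - b (?g i)))\<bar>
      \<le> K * (c * (?g (Suc i) - ?g i) + \<bar>\<beta>\<bar> * (l (?g (Suc i)) - l (?g i)))"
      using K by (rule mult_left_mono)
    then show "\<bar>f (x (?g (Suc i))) - f (x (?g i) + (b (?g (Suc i)) - b (?g i)))\<bar>
      \<le> K * (c * (?g (Suc i) - ?g i) + \<bar>\<beta>\<bar> * (l (?g (Suc i)) - l (?g i)))"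
      using lip order_trans by blast
  qed
  also have "\<dots> = K * (c * (\<Sum>i<n. ?g (Suc i) - ?g i) + \<bar>\<beta>\<bar> * (\<Sum>i<n. l (?g (Suc i)) - l (?g i)))"
    by (simp only: sum_distrib_left[symmetric] sum.distrib)
  also have "\<dots> = K * (c * (t - s) + \<bar>\<beta>\<bar> * (l t - l s))"
    using sum_lessThan_telescope[of ?g n] sum_lessThan_telescope[of "\<lambda>i. l (?g i)" n] n by simp
  finally show ?thesis .
qed

text \<open>The errors of \<open>ito_step\<close> add up to 2 * \<eta> * K times a total variation
  that does not depend on the grid, while uniform continuity makes the oscillation \<eta> small with
  the mesh.\<close>

lemma drift_sum_tendsto:
  fixes f f' :: "real \<Rightarrow> real"
  assumes f: "\<And>z. (f has_real_derivative f' z) (at z)" and lip: "\<And>z w. \<bar>f' z - f' w\<bar> \<le> K * \<bar>z - w\<bar>"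
    and f'b: "\<And>z. \<bar>f' z\<bar> \<le> K'" and [measurable]: "f' \<in> borel_measurable borel" and st: "0 \<le> s" "s \<le> t"
  shows "(\<lambda>n. drift_sum f s t (Suc n)) \<longlonglongrightarrow> (LBINT r:{s..t}. f' (x r) * drift \<mu>p \<mu>m (x r)) + f' 0 * (\<beta> * (l t - l s))"
proof (rule LIMSEQ_I)
  fix e :: real assume e: "0 < e"
  have K: "0 \<le> K" using lip[of 1 0] by simp
  have K': "0 \<le> K'" using f'b[of 0] by linarith
  let ?V = "c * (t - s) + \<bar>\<beta>\<bar> * (l t - l s)"
  have V: "0 \<le> ?V" using st l_mono[OF st] by (intro add_nonneg_nonneg mult_nonneg_nonneg) auto
  \<comment> \<open>Chosen so that the summed error is at most e/2; the summand 1 keeps the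
    denominator positive when K or the variation is 0.\<close>
  define \<eta> where "\<eta> = e / (2 * (2 * K * ?V + 1))"
  have d: "0 < 2 * K * ?V + 1" using K V by (intro add_nonneg_pos mult_nonneg_nonneg) auto
  have \<eta>: "0 < \<eta>" using e d by (simp add: \<eta>_def)
  have small: "2 * \<eta> * K * ?V < e"
  proof -
    have "2 * \<eta> * K * ?V = \<eta> * (2 * K * ?V)" by simp
    also have "\<dots> \<le> \<eta> * (2 * K * ?V + 1)" using \<eta> by (intro mult_left_mono) auto
    also have "\<dots> = e / 2" using d by (simp add: \<eta>_def field_simps)
    also have "\<dots> < e" using e by simp
    finally show ?thesis .
  qed
  have "uniformly_continuous_on {s..t} x" "uniformly_continuous_on {s..t} b"
    by (intro compact_uniformly_continuous continuous_on_subset[OF x_cont] continuous_on_subset[OF b_cont]; simp)+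
  note uc = this[unfolded uniformly_continuous_on_def, rule_format, OF \<eta>]
  obtain d1 where d1: "0 < d1" "\<And>r q. r \<in> {s..t} \<Longrightarrow> q \<in> {s..t} \<Longrightarrow> dist q r < d1 \<Longrightarrow> dist (x q) (x r) < \<eta>"
    using uc(1) by blast
  obtain d2 where d2: "0 < d2" "\<And>r q. r \<in> {s..t} \<Longrightarrow> q \<in> {s..t} \<Longrightarrow> dist q r < d2 \<Longrightarrow> dist (b q) (b r) < \<eta>"
    using uc(2) by blast
  obtain N where N: "(t - s) / real (Suc N) < min d1 d2"
  proof -
    obtain N where "(t - s) / min d1 d2 < real N" using reals_Archimedean2 by blast
    then have N: "(t - s) / min d1 d2 < real (Suc N)" by simp
    have m: "0 < min d1 d2" using d1(1) d2(1) by simp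
    have "t - s < min d1 d2 * real (Suc N)" using N m by (simp only: pos_divide_less_eq mult.commute)
    then have "(t - s) / real (Suc N) < min d1 d2" by (simp only: pos_divide_less_eq of_nat_0_less_iff zero_less_Suc)
    then show thesis by (rule that)
  qed
  have "norm (drift_sum f s t (Suc n)
    - ((LBINT r:{s..t}. f' (x r) * drift \<mu>p \<mu>m (x r)) + f' 0 * (\<beta> * (l t - l s)))) < e" if "N \<le> n" for n
  proof -
    let ?g = "grid s t (Suc n)"
    let ?J = "\<lambda>v. LBINT r:{0..v}. f' (x r) * drift \<mu>p \<mu>m (x r)"
    have J: "?J v - ?J u = (LBINT r:{u..v}. f' (x r) * drift \<mu>p \<mu>m (x r))" if "0 \<le> u" "u \<le> v" for u v
      by (rule set_integral_increment[where C="K'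
        * c"]) (use that f'b drift_bound K' in \<open>auto simp: abs_mult intro!: mult_mono\<close>)
    have mesh: "(t - s) / real (Suc n) < min d1 d2"
    proof -
      have "(t - s) / real (Suc n) \<le> (t - s) / real (Suc N)" using that st by (intro divide_left_mono) auto
      then show ?thesis using N by linarith
    qed
    have step: "\<bar>f (x (?g (Suc i))) - f (x (?g i) + (b (?g (Suc i)) - b (?g i)))
      - (?J (?g (Suc i)) - ?J (?g i)) - f' 0 * (\<beta> * (l (?g (Suc i)) - l (?g i)))\<bar>
      \<le> 2 * \<eta> * K * (c * (?g (Suc i) - ?g i) + \<bar>\<beta>\<bar> * (l (?g (Suc i)) - l (?g i)))" if i: "i < Suc n" for i
    proof -
      have st': "0 \<le> (t - s) / real (Suc n)" using st by simp
      have g: "s \<le> ?g i" "?g (Suc i) \<le> t" "?g i \<le> ?g (Suc i)"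
        using grid_bounds[OF st(2), of i "Suc n"] grid_bounds[OF st(2), of "Suc i" "Suc n"] i grid_step[of s t "Suc n" i] st' by linarith+
      have g0: "0 \<le> ?g i" using g st by simp
      have wd: "?g (Suc i) - ?g i < d1" "?g (Suc i) - ?g i < d2" using mesh unfolding grid_step by simp_all
      have "\<bar>x r - x q\<bar> \<le> \<eta>" if "?g i \<le> r" "r \<le> ?g (Suc i)" "?g i \<le> q" "q \<le> ?g (Suc i)" for r q
      proof -
        have "\<bar>r - q\<bar> < d1" using that wd(1) by linarith
        then have "dist (x r) (x q) < \<eta>" using that g by (intro d1(2)) (auto simp: dist_real_def)
        then show ?thesis by (simp add: dist_real_def)
      qed
      moreover have "\<bar>b (?g (Suc i)) - b (?g i)\<bar> \<le> \<eta>"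
      proof -
        have "\<bar>?g (Suc i) - ?g i\<bar> < d2" using wd(2) g by linarith
        then have "dist (b (?g (Suc i))) (b (?g i)) < \<eta>" using g by (intro d2(2)) (auto simp: dist_real_def)
        then show ?thesis by (simp add: dist_real_def)
      qed
      ultimately show ?thesis
        unfolding J[OF g0 g(3)] by (intro ito_step[OF f lip g0 g(3)]) auto
    qed
    have split_sum: "(\<Sum>i<m. a i - j i - p * (q * k i)) = (\<Sum>i<m. a i) - (\<Sum>i<m. j i) - p * (q * (\<Sum>i<m. k i))"
      for a j k :: "nat \<Rightarrow> real" and p q m
      by (simp add: sum_subtractf sum_distrib_left)
    have factor_sum: "(\<Sum>i<m. p * (q * a i + r * k i)) = p * (q * (\<Sum>i<m. a i) + r * (\<Sum>i<m. k i))"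
      for a k :: "nat \<Rightarrow> real" and p q r m
      by (simp add: sum.distrib sum_distrib_left distrib_left)
    define E where "E i
      = f (x (?g (Suc i))) - f (x (?g i) + (b (?g (Suc i)) - b (?g i))) - (?J (?g (Suc i)) - ?J (?g i)) - f' 0 * (\<beta> * (l (?g (Suc i)) - l (?g i)))" for i
    have "drift_sum f s t (Suc n) - ((LBINT r:{s..t}. f' (x r) * drift \<mu>p \<mu>m (x r)) + f' 0 * (\<beta> * (l t - l s)))
      = drift_sum f s t (Suc n) - (\<Sum>i<Suc n. ?J (?g (Suc i)) - ?J (?g i)) - f' 0 * (\<beta> * (\<Sum>i<Suc n. l (?g (Suc i)) - l (?g i)))"
      using J[OF st]
        unfolding sum_lessThan_telescope[of "\<lambda>i. ?J (?g i)"] sum_lessThan_telescope[of "\<lambda>i. l (?g i)"] grid_0 grid_n[OF zero_less_Suc] by linarith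
    then have 1: "drift_sum f s t (Suc n) - ((LBINT r:{s..t}. f' (x r) * drift \<mu>p \<mu>m (x r)) + f' 0 * (\<beta> * (l t - l s)))
      = (\<Sum>i<Suc n. E i)"
      unfolding drift_sum_def E_def split_sum .
    have "\<bar>\<Sum>i<Suc n. E i\<bar> \<le> (\<Sum>i<Suc n. \<bar>E i\<bar>)" by (rule sum_abs)
    also have "\<dots> \<le> (\<Sum>i<Suc n. 2 * \<eta> * K * (c * (?g (Suc i) - ?g i) + \<bar>\<beta>\<bar> * (l (?g (Suc i)) - l (?g i))))"
      unfolding E_def by (rule sum_mono, rule step) simp
    also have "\<dots> = 2 * \<eta> * K * (c * (\<Sum>i<Suc n. ?g (Suc i) - ?g i) + \<bar>\<beta>\<bar> * (\<Sum>i<Suc n. l (?g (Suc i)) - l (?g i)))"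
      by (rule factor_sum)
    also have "\<dots> = 2 * \<eta> * K * ?V"
      unfolding sum_lessThan_telescope[of ?g] sum_lessThan_telescope[of "\<lambda>i. l (?g i)"] grid_0 grid_n[OF zero_less_Suc] ..
    also have "\<dots> < e" by (rule small)
    finally show ?thesis unfolding 1 real_norm_def .
  qed
  then show "\<exists>N. \<forall>n\<ge>N. norm (drift_sum f s t (Suc n)
    - ((LBINT r:{s..t}. f' (x r) * drift \<mu>p \<mu>m (x r)) + f' 0 * (\<beta> * (l t - l s)))) < e"
    by blast
qed

end

section \<open>Smooth test functions and smoothed exponentials with a kink\<close>

definition C3_bounded :: "(real \<Rightarrow> real) \<Rightarrow> (real \<Rightarrow> real) \<Rightarrow> (real \<Rightarrow> real) \<Rightarrow> real \<Rightarrow> bool" where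
  "C3_bounded f f1 f2 K \<longleftrightarrow> (\<exists>f3. \<forall>z. (f has_real_derivative f1 z) (at z) \<and> (f1 has_real_derivative f2 z) (at z) \<and>
     (f2 has_real_derivative f3 z) (at z) \<and> \<bar>f z\<bar> \<le> K \<and> \<bar>f1 z\<bar> \<le> K \<and> \<bar>f2 z\<bar> \<le> K \<and> \<bar>f3 z\<bar> \<le> K)"

lemma C3_boundedD:
  assumes "C3_bounded f f1 f2 K"
  shows "(f has_real_derivative f1 z) (at z)" "(f1 has_real_derivative f2 z) (at z)"
    "\<bar>f z\<bar> \<le> K" "\<bar>f1 z\<bar> \<le> K" "\<bar>f2 z\<bar> \<le> K" "continuous_on UNIV f" "continuous_on UNIV f1" "continuous_on UNIV f2"
    "0 \<le> K"
proof -
  obtain f3 where f: "\<And>z. (f has_real_derivative f1 z) (at z)" "\<And>z. (f1 has_real_derivative f2 z) (at z)"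
     "\<And>z. (f2 has_real_derivative f3 z) (at z)" "\<And>z. \<bar>f z\<bar> \<le> K" "\<And>z. \<bar>f1 z\<bar> \<le> K" "\<And>z. \<bar>f2 z\<bar> \<le> K"
    using assms unfolding C3_bounded_def by blast
  show "(f has_real_derivative f1 z) (at z)" "(f1 has_real_derivative f2 z) (at z)"
    "\<bar>f z\<bar> \<le> K" "\<bar>f1 z\<bar> \<le> K" "\<bar>f2 z\<bar> \<le> K" by (rule f)+
  show "continuous_on UNIV f" "continuous_on UNIV f1" "continuous_on UNIV f2"
    using f(1-3) by (auto intro!: continuous_at_imp_continuous_on DERIV_isCont)
  show "0 \<le> K" using f(4)[of 0] by linarith
qed

lemma bounded_derivative_lipschitz:
  fixes f f' :: "real \<Rightarrow> real"
  assumes "\<And>z. (f has_real_derivative f' z) (at z)" "\<And>z. \<bar>f' z\<bar> \<le> K"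
  shows "\<bar>f z - f w\<bar> \<le> K * \<bar>z - w\<bar>"
  using field_differentiable_bound[of UNIV f f' K z w] assms by (auto simp: has_field_derivative_at_within)

lemma C3_bounded_taylor:
  assumes "C3_bounded f f1 f2 K"
  shows "\<bar>f (x + d) - f x - f1 x * d - f2 x / 2 * d\<^sup>2\<bar> \<le> K * \<bar>d\<bar> ^ 3"
proof -
  obtain f3 where f: "\<And>z. (f has_real_derivative f1 z) (at z)" "\<And>z. (f1 has_real_derivative f2 z) (at z)"
     "\<And>z. (f2 has_real_derivative f3 z) (at z)" "\<And>z. \<bar>f3 z\<bar> \<le> K"
    using assms unfolding C3_bounded_def by blast
  define D where "D m z
    = (if m = 0 then f (x + z) else if m = 1 then f1 (x + z) else if m = 2 then f2 (x + z) else f3 (x + z))" for m :: nat and z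
  have sh: "((\<lambda>z. g (x + z)) has_real_derivative g' (x
    + z)) (at z)" if "\<And>z. (g has_real_derivative g' z) (at z)" for g g' :: "real \<Rightarrow> real" and z
    using DERIV_chain2[OF that, of "\<lambda>z. x + z" 1 z UNIV]
      by (simp add: DERIV_add[OF DERIV_const DERIV_ident, simplified])
  have D: "(D m has_real_derivative D (Suc m) z) (at z)" if "m < 3" for m z
  proof -
    have "m = 0 \<or> m = 1 \<or> m = 2" using that by arith
    then show ?thesis
      using sh[OF f(1)] sh[OF f(2)] sh[OF f(3)] by (auto simp: D_def[abs_def])
  qed
  have "\<exists>t. \<bar>t\<bar> \<le> \<bar>d\<bar> \<and> D 0 d = (\<Sum>m<3. D m 0 / fact m * d ^ m) + D 3 t / fact 3 * d ^ 3"
    by (rule Maclaurin_bi_le) (use D in auto)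
  then obtain t where "f (x + d) = f x + f1 x * d + f2 x / 2 * d\<^sup>2 + f3 (x + t) / 6 * d ^ 3"
    by (auto simp: D_def eval_nat_numeral fact_numeral)
  then have "\<bar>f (x + d) - f x - f1 x * d - f2 x / 2 * d\<^sup>2\<bar> = \<bar>f3 (x + t)\<bar> / 6 * \<bar>d\<bar> ^ 3"
    by (simp add: abs_mult power_abs)
  also have "\<dots> \<le> K * \<bar>d\<bar> ^ 3" using f(4)[of "x + t"] by (intro mult_right_mono) auto
  finally show ?thesis .
qed

text \<open>A smooth approximation, as e tends to 0, of the function with logarithmic slope \<alpha>
  - \<gamma> to the right of the level and \<alpha> + \<gamma> to the left. The condition |\<alpha>|
  \<le> \<gamma> used below makes it decay or stay constant on both sides.\<close>

definition exp_hyp :: "real \<Rightarrow> real \<Rightarrow> real \<Rightarrow> real \<Rightarrow> real" where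
  "exp_hyp \<alpha> \<gamma> e x = exp (\<alpha> * x - \<gamma> * sqrt (x\<^sup>2 + e\<^sup>2))"

text \<open>The logarithmic derivative of \<open>exp_hyp\<close>. Its own derivative is -2 \<gamma>
  times \<open>poisson_kernel\<close>, so the second derivative of \<open>exp_hyp\<close> contains
  the approximate local time.\<close>

definition hyp_slope :: "real \<Rightarrow> real \<Rightarrow> real \<Rightarrow> real \<Rightarrow> real" where
  "hyp_slope \<alpha> \<gamma> e x = \<alpha> - \<gamma> * (x / sqrt (x\<^sup>2 + e\<^sup>2))"

lemma hyp_pos: "0 < e \<Longrightarrow> 0 < sqrt (x\<^sup>2 + e\<^sup>2)" for e x :: real
  by (simp add: add_nonneg_pos)

lemma hyp_ge: "0 < e \<Longrightarrow> e \<le> sqrt (x\<^sup>2 + e\<^sup>2)" for e x :: real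
  by (rule real_le_rsqrt) simp

lemma hyp_ratio: "\<bar>x / sqrt (x\<^sup>2 + e\<^sup>2)\<bar> \<le> 1" for e x :: real
proof (cases "sqrt (x\<^sup>2 + e\<^sup>2) = 0")
  case False
  then have "0 < sqrt (x\<^sup>2 + e\<^sup>2)" by (metis real_sqrt_ge_zero sum_power2_ge_zero less_eq_real_def)
  then show ?thesis using real_sqrt_ge_abs1[of x e] unfolding abs_divide
    by (simp only: abs_of_pos pos_divide_le_eq mult_1)
qed simp

lemma hyp_slope_bound:
  assumes "\<bar>\<alpha>\<bar> \<le> \<gamma>" shows "\<bar>hyp_slope \<alpha> \<gamma> e x\<bar> \<le> 2 * \<gamma>"
proof -
  have "\<bar>\<gamma> * (x / sqrt (x\<^sup>2 + e\<^sup>2))\<bar> \<le> \<gamma> * 1"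
    unfolding abs_mult using assms hyp_ratio[of x e] by (intro mult_mono) auto
  then show ?thesis using assms unfolding hyp_slope_def by linarith
qed

lemma exp_hyp_le_1:
  assumes "\<bar>\<alpha>\<bar> \<le> \<gamma>" shows "exp_hyp \<alpha> \<gamma> e x \<le> 1"
proof -
  have "\<alpha> * x \<le> \<bar>\<alpha>\<bar> * \<bar>x\<bar>" by (metis abs_ge_self abs_mult)
  also have "\<dots> \<le> \<gamma> * sqrt (x\<^sup>2 + e\<^sup>2)" using assms by (intro mult_mono real_sqrt_ge_abs1) auto
  finally show ?thesis by (simp add: exp_hyp_def)
qed

lemma exp_hyp_derivatives:
  assumes e: "0 < e"
  shows "((exp_hyp \<alpha> \<gamma> e) has_real_derivative hyp_slope \<alpha> \<gamma> e x * exp_hyp \<alpha> \<gamma> e x) (at x)"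
    and "((\<lambda>x. hyp_slope \<alpha> \<gamma> e x * exp_hyp \<alpha> \<gamma> e x) has_real_derivative
       ((hyp_slope \<alpha> \<gamma> e x)\<^sup>2 - 2 * \<gamma> * poisson_kernel e x) * exp_hyp \<alpha> \<gamma> e x) (at x)"
    and "((\<lambda>x. ((hyp_slope \<alpha> \<gamma> e x)\<^sup>2 - 2 * \<gamma> * poisson_kernel e x) * exp_hyp \<alpha> \<gamma> e x) has_real_derivative
       ((hyp_slope \<alpha> \<gamma> e x) ^ 3 - 3 * hyp_slope \<alpha> \<gamma> e x * (2 * \<gamma> * poisson_kernel e x) + 3 * \<gamma> * (e\<^sup>2 * x / sqrt (x\<^sup>2 + e\<^sup>2) ^ 5)) * exp_hyp \<alpha> \<gamma> e x) (at x)"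
proof -
  define q where "q = sqrt (x\<^sup>2 + e\<^sup>2)"
  have q: "0 < q" "q\<^sup>2 = x\<^sup>2 + e\<^sup>2" using hyp_pos[OF e, of x] by (auto simp: q_def)
  have "0 < x\<^sup>2 + e\<^sup>2" using e by (simp add: add_nonneg_pos)
  then have dq: "((\<lambda>x. sqrt (x\<^sup>2 + e\<^sup>2)) has_real_derivative x / q) (at x)"
    unfolding q_def by (auto intro!: derivative_eq_intros simp: field_simps)
  show d1: "((exp_hyp \<alpha> \<gamma> e) has_real_derivative hyp_slope \<alpha> \<gamma> e x * exp_hyp \<alpha> \<gamma> e x) (at x)"
  proof -
    have "((\<lambda>x. \<alpha> * x - \<gamma> * sqrt (x\<^sup>2 + e\<^sup>2)) has_real_derivative \<alpha> * 1 - \<gamma> * (x / q)) (at x)"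
      by (intro DERIV_diff DERIV_cmult DERIV_ident dq)
    from DERIV_chain2[OF DERIV_exp this] show ?thesis
      by (simp add: exp_hyp_def[abs_def] hyp_slope_def q_def mult.commute)
  qed
  have nz: "sqrt (x\<^sup>2 + e\<^sup>2) \<noteq> 0" using q(1) unfolding q_def by linarith
  have "((\<lambda>x. x / sqrt (x\<^sup>2 + e\<^sup>2)) has_real_derivative (1 * q - x * (x / q)) / (q * q)) (at x)"
    using DERIV_divide[OF DERIV_ident dq nz] unfolding q_def .
  moreover have "(1 * q - x * (x / q)) / (q * q) = e\<^sup>2 / q ^ 3"
  proof -
    have "1 * q - x * (x / q) = e\<^sup>2 / q"
      using q by (simp add: field_simps power2_eq_square)
    then show ?thesis by (simp add: power3_eq_cube)
  qed
  ultimately have "((\<lambda>x. x / sqrt (x\<^sup>2 + e\<^sup>2)) has_real_derivative e\<^sup>2 / q ^ 3) (at x)" by simp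
  then have "((\<lambda>x. \<alpha> - \<gamma> * (x / sqrt (x\<^sup>2 + e\<^sup>2))) has_real_derivative 0 - \<gamma> * (e\<^sup>2 / q ^ 3)) (at x)"
    by (intro DERIV_diff DERIV_const DERIV_cmult)
  then have ds: "(hyp_slope \<alpha> \<gamma> e has_real_derivative - (2 * \<gamma> * poisson_kernel e x)) (at x)"
    by (simp add: hyp_slope_def[abs_def] poisson_kernel_def q_def)
  show "((\<lambda>x. hyp_slope \<alpha> \<gamma> e x * exp_hyp \<alpha> \<gamma> e x) has_real_derivative
       ((hyp_slope \<alpha> \<gamma> e x)\<^sup>2 - 2 * \<gamma> * poisson_kernel e x) * exp_hyp \<alpha> \<gamma> e x) (at x)"
    by (rule DERIV_cong[OF DERIV_mult[OF ds d1]]) (simp add: algebra_simps power2_eq_square)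
  have q3: "((\<lambda>x. sqrt (x\<^sup>2 + e\<^sup>2) ^ 3) has_real_derivative 3 * q * x) (at x)"
    by (rule DERIV_cong[OF DERIV_power[OF dq]]) (unfold q_def[symmetric], use q(1) in \<open>simp add: power2_eq_square\<close>)
  have dp: "(poisson_kernel e has_real_derivative - (3 / 2 * (e\<^sup>2 * x / q ^ 5))) (at x)"
    unfolding poisson_kernel_def[abs_def]
  proof (rule DERIV_cong[OF DERIV_divide[OF DERIV_const DERIV_cmult[OF q3]]])
    show "2 * sqrt (x\<^sup>2 + e\<^sup>2) ^ 3 \<noteq> 0" using q(1) unfolding q_def[symmetric] by simp
    have "q ^ 3 * q ^ 3 = q * q ^ 5" by (simp add: eval_nat_numeral)
    then show "(0 * (2 * sqrt (x\<^sup>2 + e\<^sup>2) ^ 3) - e\<^sup>2 * (2 * (3 * q * x))) / (2 * sqrt (x\<^sup>2 + e\<^sup>2) ^ 3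
      * (2 * sqrt (x\<^sup>2 + e\<^sup>2) ^ 3)) = - (3 / 2 * (e\<^sup>2 * x / q ^ 5))"
      unfolding q_def[symmetric] using q(1) by (simp add: field_simps)
  qed
  have dd: "((\<lambda>x. (hyp_slope \<alpha> \<gamma> e x)\<^sup>2 - 2 * \<gamma> * poisson_kernel e x) has_real_derivative
      2 * (hyp_slope \<alpha> \<gamma> e x) * (- (2 * \<gamma> * poisson_kernel e x)) - 2 * \<gamma> * (- (3 / 2 * (e\<^sup>2 * x / q ^ 5)))) (at x)"
  proof (rule DERIV_diff)
    show "((\<lambda>x. (hyp_slope \<alpha> \<gamma> e x)\<^sup>2) has_real_derivative 2 * (hyp_slope \<alpha> \<gamma> e x)
      * (- (2 * \<gamma> * poisson_kernel e x))) (at x)"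
      by (rule DERIV_cong[OF DERIV_power[OF ds]]) simp
    show "((\<lambda>x. 2 * \<gamma> * poisson_kernel e x) has_real_derivative 2 * \<gamma> * (- (3 / 2 * (e\<^sup>2 * x / q ^ 5)))) (at x)"
      by (rule DERIV_cmult[OF dp])
  qed
  show "((\<lambda>x. ((hyp_slope \<alpha> \<gamma> e x)\<^sup>2 - 2 * \<gamma> * poisson_kernel e x) * exp_hyp \<alpha> \<gamma> e x) has_real_derivative
       ((hyp_slope \<alpha> \<gamma> e x) ^ 3 - 3 * hyp_slope \<alpha> \<gamma> e x * (2 * \<gamma> * poisson_kernel e x) + 3 * \<gamma> * (e\<^sup>2 * x / sqrt (x\<^sup>2 + e\<^sup>2) ^ 5)) * exp_hyp \<alpha> \<gamma> e x) (at x)"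
    by (rule DERIV_cong[OF DERIV_mult[OF dd d1]]) (unfold q_def[symmetric], simp add: algebra_simps power2_eq_square power3_eq_cube)
qed

text \<open>Every derivative is \<open>exp_hyp\<close> times a polynomial in bounded quantities. The
  bound may grow without limit as e tends to 0, but the Ito formula is applied at fixed e and its
  limit form does not contain K.\<close>

lemma C3_bounded_exp_hyp:
  assumes e: "0 < e" and \<alpha>: "\<bar>\<alpha>\<bar> \<le> \<gamma>"
  shows "\<exists>K. C3_bounded (exp_hyp \<alpha> \<gamma> e) (\<lambda>x. hyp_slope \<alpha> \<gamma> e x * exp_hyp \<alpha> \<gamma> e x)
     (\<lambda>x. ((hyp_slope \<alpha> \<gamma> e x)\<^sup>2 - 2 * \<gamma> * poisson_kernel e x) * exp_hyp \<alpha> \<gamma> e x) K"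
proof -
  define s where "s = hyp_slope \<alpha> \<gamma> e"
  define p where "p = poisson_kernel e"
  define u where "u = exp_hyp \<alpha> \<gamma> e"
  define w where "w x = e\<^sup>2 * x / sqrt (x\<^sup>2 + e\<^sup>2) ^ 5" for x
  have \<gamma>: "0 \<le> \<gamma>" using \<alpha> by linarith
  define G where "G = 2 * \<gamma>"
  define P where "P = 1 / (2 * e)"
  define W where "W = 1 / e\<^sup>2"
  have s: "\<bar>s x\<bar> \<le> G" for x unfolding s_def G_def by (rule hyp_slope_bound[OF \<alpha>])
  have p: "\<bar>p x\<bar> \<le> P" for x unfolding p_def P_def using poisson_kernel_bound[OF e] poisson_kernel_nonneg
    by (simp add: abs_le_iff)
  have u: "\<bar>u x\<bar> \<le> 1" for x using exp_hyp_le_1[OF \<alpha>] by (simp add: u_def exp_hyp_def)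
  have w: "\<bar>w x\<bar> \<le> W" for x
  proof -
    define q where "q = sqrt (x\<^sup>2 + e\<^sup>2)"
    have q: "0 < q" "e \<le> q" using hyp_pos[OF e] hyp_ge[OF e] by (auto simp: q_def)
    have "w x = e\<^sup>2 * x / q ^ 5" by (simp only: w_def q_def)
    also have "\<dots> = (e / q)\<^sup>2 * (x / q) * (1 / q\<^sup>2)"
      using q by (simp add: eval_nat_numeral)
    finally have "\<bar>w x\<bar> = (e / q)\<^sup>2 * \<bar>x / q\<bar> * (1 / q\<^sup>2)" by (simp add: abs_mult)
    also have "\<dots> \<le> 1 * 1 * (1 / e\<^sup>2)"
      using q e hyp_ratio[of x e]
        by (intro mult_mono power_le_one) (auto simp: q_def[symmetric] divide_le_eq_1 intro!: divide_left_mono power_mono)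
    finally show ?thesis by (simp add: W_def)
  qed
  have pos: "0 \<le> G" "0 \<le> P" "0 \<le> W" using \<gamma> e by (auto simp: G_def P_def W_def)
  define K where "K = max (max 1 G) (max (G\<^sup>2 + 2 * \<gamma> * P) (G ^ 3 + 3 * G * (2 * \<gamma> * P) + 3 * \<gamma> * W))"
  have m: "\<bar>a * u x\<bar> \<le> C" if "\<bar>a\<bar> \<le> C" for a C x
    using mult_mono[OF that u[of x]] that by (simp add: abs_mult)
  have b2: "\<bar>(s x)\<^sup>2 - 2 * \<gamma> * p x\<bar> \<le> G\<^sup>2 + 2 * \<gamma> * P" for x
  proof -
    have "\<bar>(s x)\<^sup>2\<bar> \<le> G\<^sup>2" using power_mono[OF s[of x], of 2] by (simp add: power_abs)
    moreover have "\<bar>2 * \<gamma> * p x\<bar> \<le> 2 * \<gamma> * P" unfolding abs_mult using p[of x] \<gamma> by (intro mult_mono) auto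
    ultimately show ?thesis by linarith
  qed
  have b3: "\<bar>(s x) ^ 3 - 3 * s x * (2 * \<gamma> * p x) + 3 * \<gamma> * w x\<bar> \<le> G ^ 3 + 3 * G * (2 * \<gamma> * P) + 3 * \<gamma> * W" for x
  proof -
    have "\<bar>(s x) ^ 3\<bar> \<le> G ^ 3" using power_mono[OF s[of x], of 3] by (simp add: power_abs)
    moreover have "\<bar>3 * s x * (2 * \<gamma> * p x)\<bar> \<le> 3 * G * (2 * \<gamma> * P)"
      unfolding abs_mult using p[of x] s[of x] \<gamma> pos by (intro mult_mono) auto
    moreover have "\<bar>3 * \<gamma> * w x\<bar> \<le> 3 * \<gamma> * W" unfolding abs_mult using w[of x] \<gamma> by (intro mult_mono) auto
    ultimately show ?thesis by linarith
  qed
  have "C3_bounded u (\<lambda>x. s x * u x) (\<lambda>x. ((s x)\<^sup>2 - 2 * \<gamma> * p x) * u x) K"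
    unfolding C3_bounded_def
  proof (intro exI[of _ "\<lambda>x. ((s x) ^ 3 - 3 * s x * (2 * \<gamma> * p x) + 3 * \<gamma> * w x) * u x"] allI conjI)
    fix z
    show "(u has_real_derivative s z * u z) (at z)" 
      "((\<lambda>x. s x * u x) has_real_derivative ((s z)\<^sup>2 - 2 * \<gamma> * p z) * u z) (at z)"
      "((\<lambda>x. ((s x)\<^sup>2 - 2 * \<gamma> * p x) * u x) has_real_derivative ((s z) ^ 3 - 3 * s z * (2 * \<gamma> * p z) + 3 * \<gamma> * w z)
        * u z) (at z)"
      unfolding s_def u_def p_def w_def by (rule exp_hyp_derivatives[OF e])+
    show "\<bar>u z\<bar> \<le> K" "\<bar>s z * u z\<bar> \<le> K" "\<bar>((s z)\<^sup>2 - 2 * \<gamma> * p z) * u z\<bar> \<le> K"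
      "\<bar>((s z) ^ 3 - 3 * s z * (2 * \<gamma> * p z) + 3 * \<gamma> * w z) * u z\<bar> \<le> K"
      using u[of z] m[OF s[of z]] m[OF b2[of z]] m[OF b3[of z]] unfolding K_def by (simp_all add: le_max_iff_disj)
  qed
  then show ?thesis unfolding s_def u_def p_def by blast
qed

section \<open>The Ito formula in expectation\<close>

text \<open>Rounding time down to a grid leaves countably many measurable sections, and continuity
  of the paths recovers the process in the limit.\<close>

lemma joint_measurable_continuous_process:
  fixes X :: "real \<Rightarrow> 'a \<Rightarrow> real"
  assumes c: "\<And>\<omega>. continuous_on UNIV (\<lambda>s. X s \<omega>)" and m: "\<And>s. X s \<in> borel_measurable M"
  shows "(\<lambda>(s, \<omega>). X s \<omega>) \<in> borel_measurable (borel \<Otimes>\<^sub>M M)"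
proof (rule borel_measurable_LIMSEQ_real)
  define r where "r n s = real_of_int \<lfloor>real (Suc n) * s\<rfloor> / real (Suc n)" for n s
  show "(\<lambda>n. case z of (s, \<omega>) \<Rightarrow> X (r n s) \<omega>) \<longlonglongrightarrow> (case z of (s, \<omega>) \<Rightarrow> X s \<omega>)" for z
  proof (cases z)
    case (Pair s \<omega>)
    have "(\<lambda>n. r n s) \<longlonglongrightarrow> s"
    proof (rule tendsto_sandwich[where f="\<lambda>n. s - 1 / real (Suc n)" and h="\<lambda>n. s"])
      show "\<forall>\<^sub>F n in sequentially. s - 1 / real (Suc n) \<le> r n s"
      proof (intro always_eventually allI)
        fix n
        have "real (Suc n) * s - 1 \<le> real_of_int \<lfloor>real (Suc n) * s\<rfloor>" by linarith
        then have "(real (Suc n) * s - 1) / real (Suc n) \<le> r n s" unfolding r_def by (rule divide_right_mono) simp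
        then show "s - 1 / real (Suc n) \<le> r n s" by (simp add: diff_divide_distrib del: of_nat_Suc)
      qed
      show "\<forall>\<^sub>F n in sequentially. r n s \<le> s"
      proof (intro always_eventually allI)
        fix n
        have "real_of_int \<lfloor>real (Suc n) * s\<rfloor> / real (Suc n) \<le> (real (Suc n) * s) / real (Suc n)"
          by (rule divide_right_mono) auto
        then show "r n s \<le> s" by (simp add: r_def del: of_nat_Suc)
      qed
      have "(\<lambda>n. s - inverse (real (Suc n))) \<longlonglongrightarrow> s - 0" by (intro tendsto_intros LIMSEQ_inverse_real_of_nat)
      then show "(\<lambda>n. s - 1 / real (Suc n)) \<longlonglongrightarrow> s" by (simp add: inverse_eq_divide)
    qed simp
    moreover have "isCont (\<lambda>s. X s \<omega>) s" using c[of \<omega>] by (simp add: continuous_on_eq_continuous_at)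
    ultimately show ?thesis using Pair isCont_tendsto_compose by fastforce
  qed
  show "(\<lambda>z. case z of (s, \<omega>) \<Rightarrow> X (r n s) \<omega>) \<in> borel_measurable (borel \<Otimes>\<^sub>M M)" for n
  proof -
    have "(\<lambda>z. (\<lambda>i z. X (real_of_int i / real (Suc n)) (snd z)) \<lfloor>real (Suc n)
      * fst z\<rfloor> z) \<in> borel_measurable (borel \<Otimes>\<^sub>M M)"
      by (rule measurable_compose_countable) (use m in measurable)
    then show ?thesis by (simp add: r_def case_prod_beta)
  qed
qed

text \<open>Bounded second moments imply uniform integrability: the part of |W - L| above a level N
  is at most (W - L)^2 / N, the rest is truncated and passes by dominated convergence. Fatou carries
  the moment bound over to L.\<close>

lemma (in prob_space) expectation_tendsto_of_second_moments:
  fixes W :: "nat \<Rightarrow> 'a \<Rightarrow> real" and L :: "'a \<Rightarrow> real"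
  assumes Wm [measurable]: "\<And>n. W n \<in> borel_measurable M" and Wb: "\<And>n. integrable M (\<lambda>\<omega>. (W n \<omega>)\<^sup>2)"
    and lim: "\<And>\<omega>. \<omega> \<in> space M \<Longrightarrow> (\<lambda>n. W n \<omega>) \<longlonglongrightarrow> L \<omega>"
    and C: "\<And>n. (\<integral>\<omega>. (W n \<omega>)\<^sup>2 \<partial>M) \<le> C"
  shows "integrable M L" and "(\<lambda>n. \<integral>\<omega>. W n \<omega> \<partial>M) \<longlonglongrightarrow> (\<integral>\<omega>. L \<omega> \<partial>M)"
proof -
  have [measurable]: "L \<in> borel_measurable M"
    by (rule borel_measurable_LIMSEQ_real[OF lim Wm])
  have C0: "0 \<le> C" 
    by (rule order_trans[OF integral_nonneg_AE C[of 0]]) simp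
  have nnW: "(\<integral>\<^sup>+\<omega>. ennreal ((W n \<omega>)\<^sup>2) \<partial>M) \<le> ennreal C" for n
    using C[of n] by (subst nn_integral_eq_integral[OF Wb]) (auto intro: ennreal_leI)
  have "(\<integral>\<^sup>+\<omega>. ennreal ((L \<omega>)\<^sup>2) \<partial>M) = (\<integral>\<^sup>+\<omega>. liminf (\<lambda>n. ennreal ((W n \<omega>)\<^sup>2)) \<partial>M)"
    by (intro nn_integral_cong lim_imp_Liminf[symmetric] tendsto_ennrealI tendsto_power lim) auto
  also have "\<dots> \<le> liminf (\<lambda>n. \<integral>\<^sup>+\<omega>. ennreal ((W n \<omega>)\<^sup>2) \<partial>M)" by (rule nn_integral_liminf) auto
  also have "\<dots> \<le> ennreal C" using nnW by (intro Liminf_le) (auto intro!: always_eventually)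
  finally have L2: "(\<integral>\<^sup>+\<omega>. ennreal ((L \<omega>)\<^sup>2) \<partial>M) \<le> ennreal C" .
  then have L2i: "integrable M (\<lambda>\<omega>. (L \<omega>)\<^sup>2)"
    by (intro integrableI_bounded) (auto simp: le_less_trans[OF _ ennreal_less_top])
  have L2C: "(\<integral>\<omega>. (L \<omega>)\<^sup>2 \<partial>M) \<le> C"
    using L2 C0 by (subst (asm) nn_integral_eq_integral[OF L2i]) (auto simp: ennreal_le_iff)
  have sq: "\<bar>x\<bar> \<le> 1 + x\<^sup>2" for x :: real
  proof -
    have "2 * \<bar>x\<bar> * 1 \<le> \<bar>x\<bar>\<^sup>2 + 1\<^sup>2" by (rule sum_squares_bound)
    then have "2 * \<bar>x\<bar> \<le> x\<^sup>2 + 1" by simp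
    then show ?thesis using abs_ge_zero[of x] by linarith
  qed
  show Li: "integrable M L"
    by (rule Bochner_Integration.integrable_bound[where f="\<lambda>\<omega>. 1 + (L \<omega>)\<^sup>2"]) (use L2i sq in auto)
  have Wi: "integrable M (W n)" for n
    by (rule Bochner_Integration.integrable_bound[where f="\<lambda>\<omega>. 1 + (W n \<omega>)\<^sup>2"]) (use Wb sq in auto)
  show "(\<lambda>n. \<integral>\<omega>. W n \<omega> \<partial>M) \<longlonglongrightarrow> (\<integral>\<omega>. L \<omega> \<partial>M)"
  proof (rule LIMSEQ_I)
    fix r :: real assume r: "0 < r"
    \<comment> \<open>Makes the tail term 4 * C / N at most r/2; C + 1 instead of C keeps the level
      positive.\<close>
    define N where "N = 8 * (C + 1) / r"
    have N: "0 < N" using r C0 by (simp add: N_def)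
    have "(\<lambda>n. \<integral>\<omega>. min \<bar>W n \<omega> - L \<omega>\<bar> N \<partial>M) \<longlonglongrightarrow> (\<integral>\<omega>. 0 \<partial>M)"
    proof (rule integral_dominated_convergence[where w="\<lambda>_. N"])
      show "AE \<omega> in M. (\<lambda>n. min \<bar>W n \<omega> - L \<omega>\<bar> N) \<longlonglongrightarrow> 0"
      proof (rule AE_I2)
        fix \<omega> assume "\<omega> \<in> space M"
        then have "(\<lambda>n. min \<bar>W n \<omega> - L \<omega>\<bar> N) \<longlonglongrightarrow> min \<bar>L \<omega> - L \<omega>\<bar> N" by (intro tendsto_intros lim)
        then show "(\<lambda>n. min \<bar>W n \<omega> - L \<omega>\<bar> N) \<longlonglongrightarrow> 0" using N by simp
      qed
    qed (use N in \<open>auto intro!: AE_I2\<close>)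
    then have ev: "\<forall>\<^sub>F n in sequentially. (\<integral>\<omega>. min \<bar>W n \<omega> - L \<omega>\<bar> N \<partial>M) < r / 2"
      using r by (intro order_tendstoD) auto
    have bd: "norm ((\<integral>\<omega>. W n \<omega> \<partial>M) - (\<integral>\<omega>. L \<omega> \<partial>M)) \<le> (\<integral>\<omega>. min \<bar>W n \<omega> - L \<omega>\<bar> N \<partial>M) + 4 * C / N" for n
    proof -
      have pt: "\<bar>a - b\<bar> \<le> min \<bar>a - b\<bar> N + (2 * a\<^sup>2 + 2 * b\<^sup>2) / N" for a b :: real
      proof (cases "\<bar>a - b\<bar> \<le> N")
        case False
        have "\<bar>a - b\<bar> * N \<le> \<bar>a - b\<bar> * \<bar>a - b\<bar>" using False by (intro mult_left_mono) auto
        also have "\<dots> = (a - b)\<^sup>2" by (simp add: power2_eq_square)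
        also have "\<dots> \<le> 2 * a\<^sup>2 + 2 * b\<^sup>2" using zero_le_power2[of "a + b"] by (simp add: power2_sum power2_diff)
        finally have "\<bar>a - b\<bar> \<le> (2 * a\<^sup>2 + 2 * b\<^sup>2) / N" using N by (simp add: pos_le_divide_eq)
        then show ?thesis using N by linarith
      qed (use N in simp)
      have mi: "integrable M (\<lambda>\<omega>. min \<bar>W n \<omega> - L \<omega>\<bar> N)"
        by (rule integrable_const_bound[where B=N]) (use N in auto)
      have "norm ((\<integral>\<omega>. W n \<omega> \<partial>M) - (\<integral>\<omega>. L \<omega> \<partial>M)) = norm (\<integral>\<omega>. W n \<omega> - L \<omega> \<partial>M)"
        using Wi Li by simp
      also have "\<dots> \<le> (\<integral>\<omega>. min \<bar>W n \<omega> - L \<omega>\<bar> N + (2 * (W n \<omega>)\<^sup>2 + 2 * (L \<omega>)\<^sup>2) / N \<partial>M)"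
      proof (rule order_trans[OF integral_norm_bound integral_mono])
        show "integrable M (\<lambda>\<omega>. norm (W n \<omega> - L \<omega>))" using Wi Li
          by (intro integrable_norm Bochner_Integration.integrable_diff)
        show "integrable M (\<lambda>\<omega>. min \<bar>W n \<omega> - L \<omega>\<bar> N + (2 * (W n \<omega>)\<^sup>2 + 2 * (L \<omega>)\<^sup>2) / N)"
          using Wb L2i mi by (intro Bochner_Integration.integrable_add integrable_divide integrable_mult_right)
        show "norm (W n \<omega> - L \<omega>) \<le> min \<bar>W n \<omega> - L \<omega>\<bar> N + (2 * (W n \<omega>)\<^sup>2 + 2 * (L \<omega>)\<^sup>2) / N" for \<omega>
          using pt[of "W n \<omega>" "L \<omega>"] by simp
      qed
      also have "\<dots> = (\<integral>\<omega>. min \<bar>W n \<omega> - L \<omega>\<bar> N \<partial>M) + (2 * (\<integral>\<omega>. (W n \<omega>)\<^sup>2 \<partial>M) + 2 * (\<integral>\<omega>. (L \<omega>)\<^sup>2 \<partial>M)) / N"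
        using Wb L2i mi by simp
      also have "\<dots> \<le> (\<integral>\<omega>. min \<bar>W n \<omega> - L \<omega>\<bar> N \<partial>M) + 4 * C / N"
        using C[of n] L2C N by (intro add_left_mono divide_right_mono) auto
      finally show ?thesis .
    qed
    have small: "4 * C / N \<le> r / 2"
    proof -
      have "r / 2 * N = 4 * (C + 1)" using r by (simp add: N_def)
      then show ?thesis using N by (simp only: pos_divide_le_eq) simp
    qed
    from ev have "\<forall>\<^sub>F n in sequentially. norm ((\<integral>\<omega>. W n \<omega> \<partial>M) - (\<integral>\<omega>. L \<omega> \<partial>M)) < r"
    proof eventually_elim
      case (elim n)
      show ?case using bd[of n] small elim by linarith
    qed
    then show "\<exists>no. \<forall>n\<ge>no. norm ((\<integral>\<omega>. W n \<omega> \<partial>M) - (\<integral>\<omega>. L \<omega> \<partial>M)) < r"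
      by (simp add: eventually_sequentially)
  qed
qed

lemma riemann_sum_tendsto:
  fixes g :: "real \<Rightarrow> real"
  assumes g: "continuous_on UNIV g" and b: "\<And>r. \<bar>g r\<bar> \<le> K" and st: "0 \<le> s" "s \<le> t"
  shows "(\<lambda>n. \<Sum>i<Suc n. g (grid s t (Suc n) i) * ((t - s) / real (Suc n))) \<longlonglongrightarrow> (LBINT r:{s..t}. g r)"
proof (rule LIMSEQ_I)
  fix e :: real assume e: "0 < e"
  have [measurable]: "g \<in> borel_measurable borel" using g by (rule borel_measurable_continuous_onI)
  define \<eta> where "\<eta> = e / (2 * (t - s + 1))"
  have \<eta>: "0 < \<eta>" using e st by (simp add: \<eta>_def)
  have small: "\<eta> * (t - s) < e"
  proof -
    have "\<eta> * (t - s) \<le> \<eta> * (t - s + 1)" using \<eta> by (intro mult_left_mono) auto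
    also have "\<dots> = e / 2" using st by (simp add: \<eta>_def field_simps)
    also have "\<dots> < e" using e by simp
    finally show ?thesis .
  qed
  have "uniformly_continuous_on {s..t} g"
    by (intro compact_uniformly_continuous continuous_on_subset[OF g]) auto
  note uc = this[unfolded uniformly_continuous_on_def, rule_format, OF \<eta>]
  obtain d where d: "0 < d" "\<And>r q. r \<in> {s..t} \<Longrightarrow> q \<in> {s..t} \<Longrightarrow> dist q r < d \<Longrightarrow> dist (g q) (g r) < \<eta>"
    using uc by blast
  obtain N where N: "(t - s) / real (Suc N) < d"
  proof -
    obtain N where "(t - s) / d < real N" using reals_Archimedean2 by blast
    then have N: "(t - s) / d < real (Suc N)" by simp
    have "t - s < d * real (Suc N)" using N d(1) by (simp only: pos_divide_less_eq mult.commute)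
    then have "(t - s) / real (Suc N) < d" by (simp only: pos_divide_less_eq of_nat_0_less_iff zero_less_Suc)
    then show thesis by (rule that)
  qed
  have "norm ((\<Sum>i<Suc n. g (grid s t (Suc n) i) * ((t - s) / real (Suc n)))
    - (LBINT r:{s..t}. g r)) < e" if "N \<le> n" for n
  proof -
    let ?g = "grid s t (Suc n)"
    let ?J = "\<lambda>v. LBINT r:{0..v}. g r"
    have J: "?J v - ?J u = (LBINT r:{u..v}. g r)" if "0 \<le> u" "u \<le> v" for u v
      by (rule set_integral_increment[where C=K]) (use that b in auto)
    have mesh: "(t - s) / real (Suc n) < d"
    proof -
      have "(t - s) / real (Suc n) \<le> (t - s) / real (Suc N)" using that st by (intro divide_left_mono) auto
      then show ?thesis using N by linarith
    qed
    define E where "E i = g (?g i) * ((t - s) / real (Suc n)) - (?J (?g (Suc i)) - ?J (?g i))" for i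
    have step: "\<bar>E i\<bar> \<le> \<eta> * ((t - s) / real (Suc n))" if i: "i < Suc n" for i
    proof -
      have st': "0 \<le> (t - s) / real (Suc n)" using st by simp
      have gg: "s \<le> ?g i" "?g (Suc i) \<le> t" "?g i \<le> ?g (Suc i)"
        using grid_bounds[OF st(2), of i "Suc n"] grid_bounds[OF st(2), of "Suc i" "Suc n"] i grid_step[of s t "Suc n" i] st' by linarith+
      have g0: "0 \<le> ?g i" using gg st by simp
      have wd: "?g (Suc i) - ?g i < d" using mesh unfolding grid_step .
      have "g (?g i) * ((t - s) / real (Suc n)) = (LBINT r:{?g i..?g (Suc i)}. g (?g i))"
        using gg(3) unfolding set_lebesgue_integral_def grid_step[of s t "Suc n" i, symmetric] by simp
      then have "E i = (LBINT r:{?g i..?g (Suc i)}. g (?g i) - g r)"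
        unfolding E_def J[OF g0 gg(3)]
        by (subst set_integral_diff(2)) (auto intro!: set_integrable_bounded[where C=K] b)
      also have "\<bar>\<dots>\<bar> \<le> \<eta> * (?g (Suc i) - ?g i)"
      proof (rule set_integral_abs_le)
        fix r assume r: "?g i \<le> r" "r \<le> ?g (Suc i)"
        have "\<bar>?g i - r\<bar> < d" using r wd by linarith
        then have "dist (g (?g i)) (g r) < \<eta>" using r gg by (intro d(2)) (auto simp: dist_real_def)
        then show "\<bar>g (?g i) - g r\<bar> \<le> \<eta>" by (simp add: dist_real_def)
      qed (use gg in auto)
      finally show ?thesis unfolding grid_step .
    qed
    have "(\<Sum>i<Suc n. E i) = (\<Sum>i<Suc n. g (?g i) * ((t - s) / real (Suc n))) - (\<Sum>i<Suc n. ?J (?g (Suc i)) - ?J (?g i))"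
      unfolding E_def by (rule sum_subtractf)
    then have 1: "(\<Sum>i<Suc n. g (?g i) * ((t - s) / real (Suc n))) - (LBINT r:{s..t}. g r) = (\<Sum>i<Suc n. E i)"
      using J[OF st] unfolding sum_lessThan_telescope[of "\<lambda>i. ?J (?g i)"] grid_0 grid_n[OF zero_less_Suc] by linarith
    have "\<bar>\<Sum>i<Suc n. E i\<bar> \<le> (\<Sum>i<Suc n. \<bar>E i\<bar>)" by (rule sum_abs)
    also have "\<dots> \<le> (\<Sum>i<Suc n. \<eta> * ((t - s) / real (Suc n)))" by (rule sum_mono, rule step) simp
    also have "\<dots> = \<eta> * (t - s)" by (simp del: sum.lessThan_Suc of_nat_Suc)
    also have "\<dots> < e" by (rule small)
    finally show ?thesis unfolding 1 real_norm_def .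
  qed
  then show "\<exists>N. \<forall>n\<ge>N. norm ((\<Sum>i<Suc n. g (grid s t (Suc n) i) * ((t - s) / real (Suc n))) - (LBINT r:{s..t}. g r)) < e"
    by blast
qed

text \<open>The right-hand integrand comes from differentiating minus the squared tail integral. In
  expectation the inner integral can be conditioned on time s, which reduces a second moment to
  first moments.\<close>

lemma square_of_tail_integral:
  fixes g :: "real \<Rightarrow> real"
  assumes g: "continuous_on UNIV g" and T: "0 \<le> T"
  shows "(LBINT r:{0..T}. g r)\<^sup>2 = 2 * (LBINT s:{0..T}. g s * (LBINT r:{s..T}. g r))"
proof -
  have si: "set_integrable lborel {a..c} g" for a c
    by (rule borel_integrable_atLeastAtMost') (use continuous_on_subset[OF g] in auto)
  have eqI: "(LBINT r:{a..c}. g r) = integral {a..c} g" for a c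
    by (rule set_borel_integral_eq_integral[OF si])
  have split: "integral {s..T} g = integral {0..T} g - integral {0..s} g" if "s \<in> {0..T}" for s
    using that Henstock_Kurzweil_Integration.integral_combine[of 0 s T g] set_borel_integral_eq_integral(1)[OF si, of 0 T] by simp
  have d: "((\<lambda>s.
    - (integral {0..T} g - integral {0..s} g)\<^sup>2) has_vector_derivative (2 * (g s * integral {s..T} g))) (at s within {0..T})"
    if "s \<in> {0..T}" for s
  proof -
    have "((\<lambda>s. integral {0..s} g) has_real_derivative g s) (at s within {0..T})"
      by (rule integral_has_real_derivative) (use continuous_on_subset[OF g] that in auto)
    then have "((\<lambda>s.
      - (integral {0..T} g - integral {0..s} g)\<^sup>2) has_real_derivative (2 * (g s * integral {s..T} g))) (at s within {0..T})"
      unfolding split[OF that] by (auto intro!: derivative_eq_intros)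
    then show ?thesis by (simp add: has_real_derivative_iff_has_vector_derivative)
  qed
  have c: "continuous_on {0..T} (\<lambda>s. 2 * (g s * integral {s..T} g))"
  proof -
    have "continuous_on {0..T} (\<lambda>s. 2 * (g s * (integral {0..T} g - integral {0..s} g)))"
      by (intro continuous_intros continuous_on_subset[OF g] indefinite_integral_continuous_1 integrable_continuous_interval) auto
    moreover have "2 * (g s * (integral {0..T} g - integral {0..s} g))
      = 2 * (g s * integral {s..T} g)" if "s \<in> {0..T}" for s
      unfolding split[OF that] ..
    ultimately show ?thesis by (rule continuous_on_eq)
  qed
  have "(LBINT s:{0..T}. 2 * (g s * integral {s..T} g))
    = - (integral {0..T} g - integral {0..T} g)\<^sup>2 - - (integral {0..T} g - integral {0..0} g)\<^sup>2"
    unfolding set_lebesgue_integral_def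
    by (rule integral_FTC_Icc[where F="\<lambda>s. - (integral {0..T} g - integral {0..s} g)\<^sup>2", OF T _ c]) (rule d, simp)
  then show ?thesis unfolding eqI by (simp add: set_integral_mult_right)
qed

text \<open>A pointwise Markov inequality: summing the last term over a grid bounds all increments
  of that grid simultaneously.\<close>

lemma markov_fourth:
  fixes x a :: real
  assumes "0 < a" shows "\<bar>x\<bar> \<le> a + x ^ 4 / a ^ 3"
proof (cases "\<bar>x\<bar> \<le> a")
  case False
  have "\<bar>x\<bar> * a ^ 3 \<le> \<bar>x\<bar> * \<bar>x\<bar> ^ 3" using False assms by (intro mult_left_mono power_mono) auto
  also have "\<dots> = x ^ 4" by (simp add: power_abs[symmetric] eval_nat_numeral)
  finally show ?thesis using assms by (simp add: pos_le_divide_eq add_increasing)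
qed (use assms in \<open>simp add: add_increasing2\<close>)

text \<open>Trades the third absolute moment for the second and fourth. With a = sqrt(v - u) both
  terms have order (v - u)^(3/2) for a Brownian increment.\<close>

lemma cube_le:
  fixes d a :: real
  assumes "0 < a" shows "\<bar>d\<bar> ^ 3 \<le> a * d\<^sup>2 + d ^ 4 / a"
proof -
  have "2 * \<bar>d\<bar> * a \<le> d\<^sup>2 + a\<^sup>2" using sum_squares_bound[of "\<bar>d\<bar>" a] by simp
  then have "\<bar>d\<bar> * a \<le> d\<^sup>2 + a\<^sup>2" using assms mult_nonneg_nonneg[of "\<bar>d\<bar>" a] by linarith
  then have "d\<^sup>2 * (\<bar>d\<bar> * a) \<le> d\<^sup>2 * (d\<^sup>2 + a\<^sup>2)" by (rule mult_left_mono) simp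
  moreover have "d\<^sup>2 * (\<bar>d\<bar> * a) = \<bar>d\<bar> ^ 3 * a" by (simp add: power2_eq_square power3_eq_cube)
  moreover have "d\<^sup>2 * (d\<^sup>2 + a\<^sup>2) = (a * d\<^sup>2 + d ^ 4 / a) * a"
    using assms by (simp add: field_simps eval_nat_numeral)
  ultimately have "\<bar>d\<bar> ^ 3 * a \<le> (a * d\<^sup>2 + d ^ 4 / a) * a" by simp
  then show ?thesis using assms by (simp only: mult_le_cancel_right_pos)
qed

text \<open>The equation is required for every outcome, and Brownian motion enters only through
  moments of increments against adapted weights. In this form the assumptions survive both
  reflection and a modification on a null set. Fixing X at negative times makes it jointly
  measurable in all real times.\<close>

locale refracted = prob_space M for M :: "'a measure" +
  fixes F :: "real \<Rightarrow> 'a measure" and X B L :: "real \<Rightarrow> 'a \<Rightarrow> real" and \<beta> \<mu>p \<mu>m :: real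
  assumes \<beta>: "-1 < \<beta>" "\<beta> < 1"
    and path: "\<And>\<omega>. skew_path (\<lambda>t. X t \<omega>) (\<lambda>t. B t \<omega>) (\<lambda>t. L t \<omega>) \<beta> \<mu>p \<mu>m"
    and subalg: "\<And>t. subalgebra M (F t)"
    and F_mono: "\<And>s t. s \<le> t \<Longrightarrow> sets (F s) \<subseteq> sets (F t)"
    and X_adapted: "\<And>t. 0 \<le> t \<Longrightarrow> X t \<in> borel_measurable (F t)"
    and X_neg: "\<And>t \<omega>. t < 0 \<Longrightarrow> X t \<omega> = 0"
    and B_meas: "\<And>t. 0 \<le> t \<Longrightarrow> B t \<in> borel_measurable M"
    and incr_integrable: "\<And>s t k. 0 \<le> s \<Longrightarrow> s < t \<Longrightarrow> integrable M (\<lambda>\<omega>. (B t \<omega> - B s \<omega>) ^ k)"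
    and incr_1: "\<And>s t Z K. 0 \<le> s \<Longrightarrow> s < t \<Longrightarrow> Z \<in> borel_measurable (F s) \<Longrightarrow> (\<And>\<omega>. \<bar>Z \<omega>\<bar> \<le> K) \<Longrightarrow>
       (\<integral>\<omega>. Z \<omega> * (B t \<omega> - B s \<omega>) \<partial>M) = 0"
    and incr_2: "\<And>s t Z K. 0 \<le> s \<Longrightarrow> s < t \<Longrightarrow> Z \<in> borel_measurable (F s) \<Longrightarrow> (\<And>\<omega>. \<bar>Z \<omega>\<bar> \<le> K) \<Longrightarrow>
       (\<integral>\<omega>. Z \<omega> * (B t \<omega> - B s \<omega>)\<^sup>2 \<partial>M) = (t - s) * (\<integral>\<omega>. Z \<omega> \<partial>M)"
    and incr_4: "\<And>s t. 0 \<le> s \<Longrightarrow> s < t \<Longrightarrow> (\<integral>\<omega>. (B t \<omega> - B s \<omega>) ^ 4 \<partial>M) = 3 * (t - s)\<^sup>2"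
begin

sublocale pth: skew_path "\<lambda>t. X t \<omega>" "\<lambda>t. B t \<omega>" "\<lambda>t. L t \<omega>" \<beta> \<mu>p \<mu>m for \<omega>
  by (rule path)

lemma adapted_mono: "s \<le> t \<Longrightarrow> Z \<in> borel_measurable (F s) \<Longrightarrow> Z \<in> borel_measurable (F t)"
  using F_mono[of s t] subalg[of s] subalg[of t]
  by (auto simp: measurable_def subalgebra_def)

lemma adapted_measurable: "Z \<in> borel_measurable (F s) \<Longrightarrow> Z \<in> borel_measurable M"
  by (rule measurable_from_subalg[OF subalg])

lemma X_measurable: "X t \<in> borel_measurable M"
proof (cases "0 \<le> t")
  case False
  then have "X t = (\<lambda>_. 0)" by (auto simp: X_neg)
  then show ?thesis by simp
qed (rule adapted_measurable[OF X_adapted])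

lemma X_joint: "(\<lambda>(s, \<omega>). X s \<omega>) \<in> borel_measurable (borel \<Otimes>\<^sub>M M)"
  by (rule joint_measurable_continuous_process[OF pth.x_cont X_measurable])

lemma X_measurable_comp [measurable (raw)]:
  assumes [measurable]: "f \<in> borel_measurable N" "g \<in> measurable N M"
  shows "(\<lambda>w. X (f w) (g w)) \<in> borel_measurable N"
  using measurable_compose[OF _ X_joint, of "\<lambda>w. (f w, g w)" N] by simp

lemma tail_integral_measurable:
  fixes g :: "real \<Rightarrow> real"
  assumes [measurable]: "g \<in> borel_measurable borel"
  shows "(\<lambda>\<omega>. LBINT r:{s..t}. g (X r \<omega>)) \<in> borel_measurable M"
proof -
  have "(\<lambda>(\<omega>, r). indicator {s..t} r *\<^sub>R g (X r \<omega>)) \<in> borel_measurable (M \<Otimes>\<^sub>M lborel)"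
  proof -
    have [measurable]: "(\<lambda>w. X (snd w) (fst w)) \<in> borel_measurable (M \<Otimes>\<^sub>M lborel)"
      by (rule X_measurable_comp) measurable
    show ?thesis unfolding case_prod_beta by measurable
  qed
  from lborel.borel_measurable_lebesgue_integral[where f="\<lambda>\<omega> r. indicator {s..t} r *\<^sub>R g (X r \<omega>)", OF this] show ?thesis
    unfolding set_lebesgue_integral_def .
qed

text \<open>L is given only outcome by outcome as a limit; measurability is inherited from the
  smoothed occupation integrals at scales 1/(n+1).\<close>

lemma L_measurable [measurable]:
  assumes t: "0 \<le> t" shows "L t \<in> borel_measurable M"
proof (rule borel_measurable_LIMSEQ_real)
  show "(\<lambda>n. LBINT r:{0..t}. poisson_kernel (1 / real (Suc n)) (X r \<omega>)) \<longlonglongrightarrow> L t \<omega>" for \<omega>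
    by (rule poisson_kernel_local_time[OF pth.x_cont t pth.lt[OF t]])
       (use LIMSEQ_inverse_real_of_nat in \<open>auto simp: inverse_eq_divide\<close>)
  show "(\<lambda>\<omega>. LBINT r:{0..t}. poisson_kernel (1 / real (Suc n)) (X r \<omega>)) \<in> borel_measurable M" for n
    by (rule tail_integral_measurable) measurable
qed

text \<open>Chaining over the dyadic points of \<open>{0..T}\<close> with fourth moments replaces a maximal inequality.\<close>

lemma running_maximum:
  assumes T: "0 < T"
  obtains S where "integrable M S" "AE \<omega> in M. \<forall>r. 0 \<le> r \<longrightarrow> r \<le> T \<longrightarrow> \<bar>B r \<omega>\<bar> \<le> S \<omega>"
proof -
  define g where "g m i = real i * (T / 2 ^ m)" for m i :: nat
  have g_step: "0 \<le> g m i" "g m i < g m (Suc i)" "g m (Suc i) - g m i = T / 2 ^ m" for m i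
    using T by (auto simp: g_def field_simps)
  \<comment> \<open>The ratio has to be below 1 with cube above 1/2: then both a m and the expected
    sum of fourth powers over (a m)^3, which is geometric with ratio 1/(2 * (9/10)^3) = 500/729, are
    summable.\<close>
  define a where "a m = (9 / 10 :: real) ^ m" for m
  have a: "0 < a m" for m by (simp add: a_def)
  \<comment> \<open>By \<open>markov_fourth\<close> this bounds every increment of dyadic level m at
    once.\<close>
  define V where "V m \<omega> = a m + (\<Sum>i<2 ^ m. (B (g m (Suc i)) \<omega> - B (g m i) \<omega>) ^ 4 / a m ^ 3)" for m \<omega>
  have V0: "0 \<le> V m \<omega>" for m \<omega>
    unfolding V_def using a[of m] by (intro add_nonneg_nonneg sum_nonneg divide_nonneg_nonneg) auto
  have Vi: "integrable M (V m)" for m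
    unfolding V_def[abs_def]
    by (intro Bochner_Integration.integrable_add Bochner_Integration.integrable_sum integrable_divide incr_integrable g_step integrable_const)
  have EV: "(\<integral>\<omega>. V m \<omega> \<partial>M) = (9 / 10) ^ m + 3 * T\<^sup>2 * (500 / 729) ^ m" for m
  proof -
    have "(\<integral>\<omega>. V m \<omega> \<partial>M) = a m + (\<Sum>i<2 ^ m. (\<integral>\<omega>. (B (g m (Suc i)) \<omega> - B (g m i) \<omega>) ^ 4 \<partial>M) / a m ^ 3)"
    proof -
      have i: "integrable M (\<lambda>\<omega>. (B (g m (Suc i)) \<omega> - B (g m i) \<omega>) ^ 4 / a m ^ 3)" for i
        by (intro integrable_divide incr_integrable g_step)
      show ?thesis
        unfolding V_def using i by (simp add: Bochner_Integration.integral_sum prob_space)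
    qed
    also have "\<dots> = a m + 2 ^ m * (3 * (T / 2 ^ m)\<^sup>2 / a m ^ 3)"
      by (simp add: incr_4[OF g_step(1,2)] g_step(3))
    also have "2 ^ m * (3 * (T / 2 ^ m)\<^sup>2 / a m ^ 3) = 3 * T\<^sup>2 * (1 / (2 ^ m * a m ^ 3))"
      by (simp add: power_divide power2_eq_square)
    also have "1 / (2 ^ m * a m ^ 3) = (500 / 729) ^ m"
    proof -
      have "2 ^ m * a m ^ 3 = (2 * (9 / 10) ^ 3) ^ m"
        by (simp only: a_def power_mult_distrib power_mult[symmetric] mult.commute[of m])
      then show ?thesis by (simp add: power_one_over[symmetric] eval_nat_numeral)
    qed
    finally show ?thesis by (simp add: a_def)
  qed
  have sEV: "summable (\<lambda>m. \<integral>\<omega>. norm (V m \<omega>) \<partial>M)"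
    using V0 by (auto simp: EV intro!: summable_add summable_mult summable_geometric)
  have nn: "(\<integral>\<^sup>+\<omega>. (\<Sum>m. ennreal (V m \<omega>)) \<partial>M) < \<infinity>"
  proof -
    have "(\<integral>\<^sup>+\<omega>. (\<Sum>m. ennreal (V m \<omega>)) \<partial>M) = (\<Sum>m. \<integral>\<^sup>+\<omega>. ennreal (V m \<omega>) \<partial>M)"
      using Vi by (intro nn_integral_suminf) auto
    also have "\<dots> = (\<Sum>m. ennreal (\<integral>\<omega>. V m \<omega> \<partial>M))"
      using Vi V0 by (intro suminf_cong nn_integral_eq_integral) auto
    also have "\<dots> = ennreal (\<Sum>m. \<integral>\<omega>. V m \<omega> \<partial>M)"
      using sEV V0 by (intro suminf_ennreal2) (auto intro!: integral_nonneg_AE)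
    finally show ?thesis by simp
  qed
  have sV: "AE \<omega> in M. summable (\<lambda>m. V m \<omega>)"
  proof -
    have "AE \<omega> in M. (\<Sum>m. ennreal (V m \<omega>)) \<noteq> \<infinity>"
      using nn Vi by (intro nn_integral_PInf_AE borel_measurable_suminf) auto
    then show ?thesis by eventually_elim (use V0 in \<open>auto intro!: summable_suminf_not_top\<close>)
  qed
  define S where "S \<omega> = (\<Sum>m. V m \<omega>)" for \<omega>
  have "integrable M S"
    unfolding S_def[abs_def] using sV V0 by (intro integrable_suminf Vi sEV) auto
  moreover have "AE \<omega> in M. \<forall>r. 0 \<le> r \<longrightarrow> r \<le> T \<longrightarrow> \<bar>B r \<omega>\<bar> \<le> S \<omega>"
    using sV
  proof eventually_elim
    case (elim \<omega>)
    have inc: "\<bar>B (g m (Suc i)) \<omega> - B (g m i) \<omega>\<bar> \<le> V m \<omega>" if "i < 2 ^ m" for m i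
    proof -
      have "(B (g m (Suc i)) \<omega> - B (g m i) \<omega>) ^ 4 / a m ^ 3
        \<le> (\<Sum>i<2 ^ m. (B (g m (Suc i)) \<omega> - B (g m i) \<omega>) ^ 4 / a m ^ 3)"
        using that a[of m] by (intro member_le_sum) auto
      then show ?thesis using markov_fourth[OF a[of m], of "B (g m (Suc i)) \<omega> - B (g m i) \<omega>"]
        unfolding V_def by linarith
    qed
    \<comment> \<open>A dyadic point of level n + 1 either has level n or is the right neighbour of
      such a point, at the cost of one increment of level n + 1.\<close>
    have dy: "\<bar>B (g n k) \<omega>\<bar> \<le> (\<Sum>m\<le>n. V m \<omega>)" if "k \<le> 2 ^ n" for n k
      using that
    proof (induction n arbitrary: k)
      case 0
      then have "k = 0 \<or> k = 1" by auto
      then show ?case using inc[of 0 0] V0[of 0 \<omega>] pth.b0[of \<omega>] by (auto simp: g_def)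
    next
      case (Suc n)
      have half: "g (Suc n) (2 * j) = g n j" for j by (simp add: g_def)
      show ?case
      proof (cases "even k")
        case True
        then obtain j where "k = 2 * j" by blast
        then show ?thesis using Suc.IH[of j] Suc.prems V0[of "Suc n" \<omega>] half[of j] by simp
      next
        case False
        then obtain j where k: "k = Suc (2 * j)" by (metis oddE Suc_eq_plus1)
        have "\<bar>B (g (Suc n) (Suc (2 * j))) \<omega> - B (g (Suc n) (2 * j)) \<omega>\<bar> \<le> V (Suc n) \<omega>"
          using Suc.prems k by (intro inc) auto
        moreover have "\<bar>B (g (Suc n) (2 * j)) \<omega>\<bar> \<le> (\<Sum>m\<le>n. V m \<omega>)"
          unfolding half using Suc.prems k by (intro Suc.IH) auto
        ultimately show ?thesis unfolding k sum.atMost_Suc by linarith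
      qed
    qed
    have dyS: "\<bar>B (g n k) \<omega>\<bar> \<le> S \<omega>" if "k \<le> 2 ^ n" for n k
      using dy[OF that] sum_le_suminf[OF elim, of "{..n}"] V0 unfolding S_def by force
    show ?case
    proof (intro allI impI)
      fix r assume r: "0 \<le> r" "r \<le> T"
      define k where "k n = nat \<lfloor>r / T * 2 ^ n\<rfloor>" for n
      have rT: "0 \<le> r / T" "r / T \<le> 1" using r T by (auto simp: divide_le_eq_1)
      have k: "real (k n) \<le> r / T * 2 ^ n" "r / T * 2 ^ n - 1 \<le> real (k n)" for n
      proof -
        have "0 \<le> r / T * 2 ^ n" using rT(1) by (intro mult_nonneg_nonneg) auto
        then have "real (k n) = real_of_int \<lfloor>r / T * 2 ^ n\<rfloor>" by (simp add: k_def)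
        then show "real (k n) \<le> r / T * 2 ^ n" "r / T * 2 ^ n - 1 \<le> real (k n)" by linarith+
      qed
      have k2: "k n \<le> 2 ^ n" for n
      proof -
        have "r / T * 2 ^ n \<le> 1 * 2 ^ n" using rT by (intro mult_right_mono) auto
        with k(1)[of n] have "real (k n) \<le> 1 * 2 ^ n" by (rule order_trans)
        then have "real (k n) \<le> real (2 ^ n)" by (simp only: of_nat_power of_nat_numeral mult_1)
        then show ?thesis by (simp only: of_nat_le_iff)
      qed
      have lim: "(\<lambda>n. g n (k n)) \<longlonglongrightarrow> r"
      proof (rule tendsto_sandwich[where f="\<lambda>n. r - T * (1 / 2) ^ n" and h="\<lambda>n. r"])
        show "\<forall>\<^sub>F n in sequentially. r - T * (1 / 2) ^ n \<le> g n (k n)"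
        proof (intro always_eventually allI)
          fix n
          have "(r / T * 2 ^ n - 1) * (T / 2 ^ n) \<le> g n (k n)"
            unfolding g_def using k(2)[of n] T by (intro mult_right_mono) auto
          moreover have "(r / T * 2 ^ n - 1) * (T / 2 ^ n) = r - T * (1 / 2) ^ n"
            using T by (simp add: field_simps power_one_over)
          ultimately show "r - T * (1 / 2) ^ n \<le> g n (k n)" by simp
        qed
        show "\<forall>\<^sub>F n in sequentially. g n (k n) \<le> r"
        proof (intro always_eventually allI)
          fix n
          have "g n (k n) \<le> (r / T * 2 ^ n) * (T / 2 ^ n)"
            unfolding g_def using k(1)[of n] T by (intro mult_right_mono) auto
          then show "g n (k n) \<le> r" using T by simp
        qed
        have "(\<lambda>n. r - T * (1 / 2) ^ n) \<longlonglongrightarrow> r - T * 0" by (intro tendsto_intros LIMSEQ_power_zero) auto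
        then show "(\<lambda>n. r - T * (1 / 2) ^ n) \<longlonglongrightarrow> r" by simp
      qed simp
      have "isCont (\<lambda>s. B s \<omega>) r" using pth.b_cont[of \<omega>] by (simp add: continuous_on_eq_continuous_at)
      then have "(\<lambda>n. B (g n (k n)) \<omega>) \<longlonglongrightarrow> B r \<omega>" using lim by (rule isCont_tendsto_compose)
      then have "(\<lambda>n. \<bar>B (g n (k n)) \<omega>\<bar>) \<longlonglongrightarrow> \<bar>B r \<omega>\<bar>" by (rule tendsto_rabs)
      then show "\<bar>B r \<omega>\<bar> \<le> S \<omega>" by (rule LIMSEQ_le_const2) (use dyS[OF k2] in auto)
    qed
  qed
  ultimately show thesis by (rule that)
qed

text \<open>Follows from the pathwise bound by the running maximum, taken up to t + 1 to have a
  positive horizon. Integrability of L itself is obtained later from the Ito formula, whose proof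
  relies on the present weaker fact.\<close>

lemma beta_L_integrable:
  assumes t: "0 \<le> t"
  shows "integrable M (\<lambda>\<omega>. \<beta> * L t \<omega>)"
proof -
  obtain S where S: "integrable M S" "AE \<omega> in M. \<forall>r. 0 \<le> r \<longrightarrow> r \<le> t + 1 \<longrightarrow> \<bar>B r \<omega>\<bar> \<le> S \<omega>"
    using running_maximum[of "t + 1"] t by auto
  show ?thesis
  proof (rule Bochner_Integration.integrable_bound)
    show "integrable M (\<lambda>\<omega>. 3 * S \<omega> + 2 * (\<bar>\<mu>p\<bar> + \<bar>\<mu>m\<bar>) * t)" using S(1) by simp
    show "(\<lambda>\<omega>. \<beta> * L t \<omega>) \<in> borel_measurable M" using L_measurable[OF t] by measurable
    show "AE \<omega> in M. norm (\<beta> * L t \<omega>) \<le> norm (3 * S \<omega> + 2 * (\<bar>\<mu>p\<bar> + \<bar>\<mu>m\<bar>) * t)"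
      using S(2)
    proof eventually_elim
      case (elim \<omega>)
      have "\<bar>\<beta>\<bar> * L t \<omega> \<le> 3 * S \<omega> + 2 * (\<bar>\<mu>p\<bar> + \<bar>\<mu>m\<bar>) * t"
        by (rule pth.local_time_bound[OF t]) (use elim in auto)
      moreover have "norm (\<beta> * L t \<omega>) = \<bar>\<beta>\<bar> * L t \<omega>" using pth.l_nonneg[OF t] by (simp add: abs_mult)
      ultimately show ?case by simp
    qed
  qed
qed

abbreviation "mu \<equiv> drift \<mu>p \<mu>m"

lemma tail_integral_bound:
  fixes g :: "real \<Rightarrow> real"
  assumes [measurable]: "g \<in> borel_measurable borel" and "\<And>z. \<bar>g z\<bar> \<le> C" "s \<le> t"
  shows "\<bar>LBINT r:{s..t}. g (X r \<omega>)\<bar> \<le> C * (t - s)"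
  by (rule set_integral_abs_le) (use assms pth.x_meas in auto)

lemma tail_integral_integrable:
  fixes g :: "real \<Rightarrow> real"
  assumes g: "g \<in> borel_measurable borel" and b: "\<And>z. \<bar>g z\<bar> \<le> C" and "s \<le> t"
  shows "integrable M (\<lambda>\<omega>. LBINT r:{s..t}. g (X r \<omega>))"
  by (rule integrable_const_bound[where B="C * (t - s)"])
     (use tail_integral_bound[OF g b] tail_integral_measurable[OF g] assms in auto)

lemma bounded_times_integrable:
  assumes "Z \<in> borel_measurable M" "\<And>\<omega>. \<bar>Z \<omega>\<bar> \<le> C" "integrable M W"
  shows "integrable M (\<lambda>\<omega>. Z \<omega> * W \<omega> :: real)"
proof (rule Bochner_Integration.integrable_bound[where f="\<lambda>\<omega>. C * W \<omega>"])
  show "AE \<omega> in M. norm (Z \<omega> * W \<omega>) \<le> norm (C * W \<omega>)"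
    by (auto intro!: AE_I2 mult_right_mono order_trans[OF assms(2) abs_ge_self] simp: abs_mult)
qed (use assms in auto)

text \<open>In the third-order expansion the linear term has conditional mean 0 and the quadratic
  one conditional mean v - u times its coefficient. The remainder is split by
  \<open>cube_le\<close>; the factor 4 is 1 from the second moment plus 3 from the fourth.\<close>

lemma taylor_step:
  assumes f: "C3_bounded f f1 f2 K" and uv: "0 \<le> u" "u < v"
    and Z: "Z \<in> borel_measurable (F u)" "\<And>\<omega>. \<bar>Z \<omega>\<bar> \<le> C"
  shows "\<bar>(\<integral>\<omega>. Z \<omega> * (f (X u \<omega> + (B v \<omega> - B u \<omega>)) - f (X u \<omega>)) \<partial>M) - (\<integral>\<omega>. Z \<omega> * (f2 (X u \<omega>) / 2 * (v - u)) \<partial>M)\<bar>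
    \<le> 4 * C * K * (v - u) * sqrt (v - u)"
proof -
  let ?D = "\<lambda>\<omega>. B v \<omega> - B u \<omega>"
  note fb = C3_boundedD[OF f]
  have [measurable]: "f \<in> borel_measurable borel" "f1 \<in> borel_measurable borel" "f2 \<in> borel_measurable borel"
    using fb by (auto intro: borel_measurable_continuous_onI)
  have C: "0 \<le> C" using Z(2)[of undefined] by linarith
  have Zm [measurable]: "Z \<in> borel_measurable M" using Z(1) by (rule adapted_measurable)
  have [measurable]: "B u \<in> borel_measurable M" "B v \<in> borel_measurable M" using B_meas uv by auto
  have [measurable]: "X u \<in> borel_measurable M" by (rule X_measurable)
  have XF: "X u \<in> borel_measurable (F u)" using X_adapted uv by simp
  note [measurable] = Z(1) XF
  have D1: "integrable M ?D" using incr_integrable[OF uv, of 1] by simp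
  have D2: "integrable M (\<lambda>\<omega>. (?D \<omega>)\<^sup>2)" by (rule incr_integrable[OF uv])
  have D4: "integrable M (\<lambda>\<omega>. ?D \<omega> ^ 4)" by (rule incr_integrable[OF uv])
  have bnd: "\<bar>Z \<omega> * k (X u \<omega>)\<bar> \<le> C * K" if "\<And>z. \<bar>k z\<bar> \<le> K" for k and \<omega>
    unfolding abs_mult using Z(2) that C by (intro mult_mono) auto
  have f1Z: "(\<lambda>\<omega>. Z \<omega> * f1 (X u \<omega>)) \<in> borel_measurable (F u)" "(\<lambda>\<omega>. Z \<omega> * (f2 (X u \<omega>) / 2)) \<in> borel_measurable (F u)"
    by measurable
  have half: "\<bar>f2 z / 2\<bar> \<le> K" for z using fb(5)[of z] by simp
  have e1: "(\<integral>\<omega>. (Z \<omega> * f1 (X u \<omega>)) * ?D \<omega> \<partial>M) = 0"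
    by (rule incr_1[OF uv f1Z(1), of "C * K"]) (rule bnd, rule fb)
  have e2: "(\<integral>\<omega>. (Z \<omega> * (f2 (X u \<omega>) / 2)) * (?D \<omega>)\<^sup>2 \<partial>M) = (v - u) * (\<integral>\<omega>. Z \<omega> * (f2 (X u \<omega>) / 2) \<partial>M)"
    by (rule incr_2[OF uv f1Z(2), of "C * K"]) (rule bnd[OF half])
  have i1: "integrable M (\<lambda>\<omega>. (Z \<omega> * f1 (X u \<omega>)) * ?D \<omega>)"
    by (rule bounded_times_integrable[where C="C * K"]) (use D1 bnd[OF fb(4)] in auto)
  have i2: "integrable M (\<lambda>\<omega>. (Z \<omega> * (f2 (X u \<omega>) / 2)) * (?D \<omega>)\<^sup>2)"
    by (rule bounded_times_integrable[where C="C * K"]) (use D2 bnd[OF half] in auto)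
  have i0: "integrable M (\<lambda>\<omega>. Z \<omega> * (f (X u \<omega> + ?D \<omega>) - f (X u \<omega>)))"
  proof (rule integrable_const_bound[where B="C * (2 * K)"])
    show "AE \<omega> in M. norm (Z \<omega> * (f (X u \<omega> + ?D \<omega>) - f (X u \<omega>))) \<le> C * (2 * K)"
    proof (rule AE_I2)
      fix \<omega>
      have "\<bar>f (X u \<omega> + ?D \<omega>) - f (X u \<omega>)\<bar> \<le> 2 * K"
        using fb(3)[of "X u \<omega> + ?D \<omega>"] fb(3)[of "X u \<omega>"] by linarith
      then show "norm (Z \<omega> * (f (X u \<omega> + ?D \<omega>) - f (X u \<omega>))) \<le> C * (2 * K)"
        unfolding real_norm_def abs_mult using Z(2)[of \<omega>] C by (intro mult_mono) auto
    qed
  qed measurable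
  let ?R = "\<lambda>\<omega>. Z \<omega> * (f (X u \<omega> + ?D \<omega>) - f (X u \<omega>)) - (Z \<omega> * f1 (X u \<omega>)) * ?D \<omega> - (Z \<omega> * (f2 (X u \<omega>) / 2)) * (?D \<omega>)\<^sup>2"
  have eq: "(\<integral>\<omega>. Z \<omega> * (f (X u \<omega> + ?D \<omega>) - f (X u \<omega>)) \<partial>M) - (\<integral>\<omega>. Z \<omega> * (f2 (X u \<omega>) / 2 * (v - u)) \<partial>M)
     = (\<integral>\<omega>. ?R \<omega> \<partial>M)"
  proof -
    have "(\<integral>\<omega>. Z \<omega> * (f2 (X u \<omega>) / 2 * (v - u)) \<partial>M) = (v - u) * (\<integral>\<omega>. Z \<omega> * (f2 (X u \<omega>) / 2) \<partial>M)"
      unfolding integral_mult_right_zero[symmetric] by (rule Bochner_Integration.integral_cong) (simp_all add: mult_ac)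
    moreover have "(\<integral>\<omega>. ?R \<omega> \<partial>M) = (\<integral>\<omega>. Z \<omega> * (f (X u \<omega> + ?D \<omega>) - f (X u \<omega>)) \<partial>M) - (\<integral>\<omega>. (Z \<omega> * f1 (X u \<omega>)) * ?D \<omega> \<partial>M)
        - (\<integral>\<omega>. (Z \<omega> * (f2 (X u \<omega>) / 2)) * (?D \<omega>)\<^sup>2 \<partial>M)"
      by (simp only: Bochner_Integration.integral_diff[OF Bochner_Integration.integrable_diff[OF i0 i1] i2] Bochner_Integration.integral_diff[OF i0 i1])
    ultimately show ?thesis unfolding e1 e2 by linarith
  qed
  have "\<bar>\<integral>\<omega>. ?R \<omega> \<partial>M\<bar> \<le> (\<integral>\<omega>. \<bar>?R \<omega>\<bar> \<partial>M)" by (rule integral_abs_bound)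
  also have "\<dots> \<le> (\<integral>\<omega>. C * (K * (sqrt (v - u) * (?D \<omega>)\<^sup>2 + ?D \<omega> ^ 4 / sqrt (v - u))) \<partial>M)"
  proof (rule integral_mono)
    show "integrable M (\<lambda>\<omega>. \<bar>?R \<omega>\<bar>)" using i0 i1 i2 by (intro integrable_abs Bochner_Integration.integrable_diff)
    show "integrable M (\<lambda>\<omega>. C * (K * (sqrt (v - u) * (?D \<omega>)\<^sup>2 + ?D \<omega> ^ 4 / sqrt (v - u))))"
      using D2 D4 by (intro integrable_mult_right Bochner_Integration.integrable_add integrable_divide)
    fix \<omega>
    have "?R \<omega> = Z \<omega> * (f (X u \<omega> + ?D \<omega>) - f (X u \<omega>) - f1 (X u \<omega>) * ?D \<omega> - f2 (X u \<omega>) / 2 * (?D \<omega>)\<^sup>2)"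
      by (simp add: algebra_simps)
    then have "\<bar>?R \<omega>\<bar> = \<bar>Z \<omega>\<bar> * \<bar>f (X u \<omega> + ?D \<omega>) - f (X u \<omega>) - f1 (X u \<omega>) * ?D \<omega> - f2 (X u \<omega>) / 2 * (?D \<omega>)\<^sup>2\<bar>"
      by (simp only: abs_mult)
    also have "\<dots> \<le> C * (K * \<bar>?D \<omega>\<bar> ^ 3)"
      using Z(2) C C3_bounded_taylor[OF f] by (intro mult_mono) auto
    also have "\<dots> \<le> C * (K * (sqrt (v - u) * (?D \<omega>)\<^sup>2 + ?D \<omega> ^ 4 / sqrt (v - u)))"
      using C fb(9) uv by (intro mult_left_mono cube_le) auto
    finally show "\<bar>?R \<omega>\<bar> \<le> C * (K * (sqrt (v - u) * (?D \<omega>)\<^sup>2 + ?D \<omega> ^ 4 / sqrt (v - u)))" .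
  qed
  also have "\<dots> = C * (K * (sqrt (v - u) * (v - u) + 3 * (v - u)\<^sup>2 / sqrt (v - u)))"
  proof -
    have "(\<integral>\<omega>. (?D \<omega>)\<^sup>2 \<partial>M) = v - u"
      using incr_2[OF uv, of "\<lambda>_. 1" 1] by (simp add: prob_space)
    then show ?thesis using D2 D4 incr_4[OF uv] by simp
  qed
  also have "\<dots> = 4 * C * K * (v - u) * sqrt (v - u)"
  proof -
    have "(v - u)\<^sup>2 / sqrt (v - u) = (v - u) * ((v - u) / sqrt (v - u))" by (simp add: power2_eq_square)
    also have "(v - u) / sqrt (v - u) = sqrt (v - u)" using uv by (simp add: real_div_sqrt)
    finally have e: "3 * (v - u)\<^sup>2 / sqrt (v - u) = 3 * ((v - u) * sqrt (v - u))" by simp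
    show ?thesis unfolding e by (simp add: algebra_simps)
  qed
  finally show ?thesis unfolding eq .
qed

text \<open>The telescoping sum over a uniform grid is Q + R. The Brownian parts Q agree in
  expectation with a Riemann sum up to an error of order sqrt(mesh); the remaining parts R converge
  on each path. The weight Z makes the identity conditional on F s, which the second-moment estimate
  requires.\<close>

lemma ito_expectation:
  assumes f: "C3_bounded f f1 f2 K" and st: "0 \<le> s" "s \<le> t"
    and Z: "Z \<in> borel_measurable (F s)" "\<And>\<omega>. \<bar>Z \<omega>\<bar> \<le> C"
  shows "(\<integral>\<omega>. Z \<omega> * (f (X t \<omega>) - f (X s \<omega>)) \<partial>M)
    = (\<integral>\<omega>. Z \<omega> * (LBINT r:{s..t}. f2 (X r \<omega>) / 2 + f1 (X r \<omega>) * mu (X r \<omega>)) \<partial>M) + f1 0 * (\<integral>\<omega>. Z \<omega> * (\<beta> * (L t \<omega> - L s \<omega>)) \<partial>M)"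
proof -
  note fb = C3_boundedD[OF f]
  have [measurable]: "f \<in> borel_measurable borel" "f1 \<in> borel_measurable borel" "f2 \<in> borel_measurable borel"
    using fb by (auto intro: borel_measurable_continuous_onI)
  have C: "0 \<le> C" using Z(2)[of undefined] by linarith
  have K: "0 \<le> K" by (rule fb)
  have Zm [measurable]: "Z \<in> borel_measurable M" using Z(1) by (rule adapted_measurable)
  let ?c = "\<bar>\<mu>p\<bar> + \<bar>\<mu>m\<bar>"
  have [measurable]: "X u \<in> borel_measurable M" for u by (rule X_measurable)
  have bL: "integrable M (\<lambda>\<omega>. \<beta> * (L t \<omega> - L s \<omega>))"
    using beta_L_integrable[of t] beta_L_integrable[of s] st by (simp add: right_diff_distrib)
  define g where "g n = grid s t (Suc n)" for n
  define d where "d n = (t - s) / real (Suc n)" for n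
  have gb: "s \<le> g n i" if "i \<le> Suc n" for n i using grid_bounds[OF st(2) that] by (simp add: g_def)
  have gs: "g n (Suc i) - g n i = d n" for n i by (simp add: g_def d_def grid_step)
  have d0: "0 \<le> d n" for n using st by (simp add: d_def)
  define q where "q n i \<omega> = f (X (g n i) \<omega> + (B (g n (Suc i)) \<omega> - B (g n i) \<omega>)) - f (X (g n i) \<omega>)" for n i \<omega>
  define Q where "Q n \<omega> = (\<Sum>i<Suc n. q n i \<omega>)" for n \<omega>
  define R where "R n \<omega> = pth.drift_sum \<omega> f s t (Suc n)" for n \<omega>
  define S where "S n \<omega> = (\<Sum>i<Suc n. f2 (X (g n i) \<omega>) / 2 * d n)" for n \<omega>
  have QR: "f (X t \<omega>) - f (X s \<omega>) = Q n \<omega> + R n \<omega>" for n \<omega>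
  proof -
    have "Q n \<omega> + R n \<omega> = (\<Sum>i<Suc n. f (X (g n (Suc i)) \<omega>) - f (X (g n i) \<omega>))"
      unfolding Q_def R_def q_def pth.drift_sum_def g_def sum.distrib[symmetric] by (rule sum.cong) auto
    also have "\<dots> = f (X (g n (Suc n)) \<omega>) - f (X (g n 0) \<omega>)" by (rule sum_lessThan_telescope)
    finally show ?thesis by (simp add: g_def)
  qed
  have Bm: "B (g n i) \<in> borel_measurable M" if "i \<le> Suc n" for n i using gb[OF that] st by (intro B_meas) auto
  have qm: "q n i \<in> borel_measurable M" if "i < Suc n" for n i
  proof -
    have [measurable]: "B (g n i) \<in> borel_measurable M" "B (g n (Suc i)) \<in> borel_measurable M" using that
      by (auto intro: Bm)
    show ?thesis unfolding q_def[abs_def] by measurable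
  qed
  have qb: "\<bar>q n i \<omega>\<bar> \<le> 2 * K" for n i \<omega>
    unfolding q_def
      using fb(3)[of "X (g n i) \<omega> + (B (g n (Suc i)) \<omega> - B (g n i) \<omega>)"] fb(3)[of "X (g n i) \<omega>"] by linarith
  have qi: "integrable M (q n i)" if "i < Suc n" for n i
    by (rule integrable_const_bound[where B="2 * K"]) (use qb qm[OF that] in auto)
  have Zqi: "integrable M (\<lambda>\<omega>. Z \<omega> * q n i \<omega>)" if "i < Suc n" for n i
    by (rule bounded_times_integrable[OF Zm Z(2) qi[OF that]])
  have Zfi: "integrable M (\<lambda>\<omega>. Z \<omega> * (f2 (X (g n i) \<omega>) / 2 * d n))" for n i
  proof (rule bounded_times_integrable[OF Zm Z(2)])
    show "integrable M (\<lambda>\<omega>. f2 (X (g n i) \<omega>) / 2 * d n)"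
      by (intro integrable_mult_left integrable_divide integrable_const_bound[where B=K]) (use fb(5) in auto)
  qed
  have fi: "integrable M (\<lambda>\<omega>. Z \<omega> * (f (X t \<omega>) - f (X s \<omega>)))"
    by (intro bounded_times_integrable[OF Zm Z(2)] Bochner_Integration.integrable_diff integrable_const_bound[where B=K]) (use fb(3) in auto)
  have ZQ: "(\<integral>\<omega>. Z \<omega> * Q n \<omega> \<partial>M) = (\<Sum>i<Suc n. \<integral>\<omega>. Z \<omega> * q n i \<omega> \<partial>M)" for n
    unfolding Q_def sum_distrib_left by (rule Bochner_Integration.integral_sum) (rule Zqi, simp)
  have ZS: "(\<integral>\<omega>. Z \<omega> * S n \<omega> \<partial>M) = (\<Sum>i<Suc n. \<integral>\<omega>. Z \<omega> * (f2 (X (g n i) \<omega>) / 2 * d n) \<partial>M)" for n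
    unfolding S_def sum_distrib_left by (rule Bochner_Integration.integral_sum) (rule Zfi)
  have ZQi: "integrable M (\<lambda>\<omega>. Z \<omega> * Q n \<omega>)" for n
    unfolding Q_def sum_distrib_left by (rule Bochner_Integration.integrable_sum) (rule Zqi, simp)
  have ZR: "(\<integral>\<omega>. Z \<omega> * R n \<omega> \<partial>M) = (\<integral>\<omega>. Z \<omega> * (f (X t \<omega>) - f (X s \<omega>)) \<partial>M) - (\<integral>\<omega>. Z \<omega> * Q n \<omega> \<partial>M)" for n
  proof -
    have "(\<integral>\<omega>. Z \<omega> * R n \<omega> \<partial>M) = (\<integral>\<omega>. Z \<omega> * (f (X t \<omega>) - f (X s \<omega>)) - Z \<omega> * Q n \<omega> \<partial>M)"
      by (rule Bochner_Integration.integral_cong) (auto simp: QR[of _ n] algebra_simps)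
    then show ?thesis using fi ZQi by simp
  qed
  have err: "\<bar>(\<integral>\<omega>. Z \<omega> * Q n \<omega> \<partial>M) - (\<integral>\<omega>. Z \<omega> * S n \<omega> \<partial>M)\<bar> \<le> 4 * C * K * (t - s) * sqrt (d n)" for n
  proof -
    have "\<bar>(\<Sum>i<Suc n. (\<integral>\<omega>. Z \<omega> * q n i \<omega> \<partial>M) - (\<integral>\<omega>. Z \<omega> * (f2 (X (g n i) \<omega>) / 2 * d n) \<partial>M))\<bar>
      \<le> (\<Sum>i<Suc n. 4 * C * K * d n * sqrt (d n))"
    proof (rule order_trans[OF sum_abs sum_mono])
      fix i assume "i \<in> {..<Suc n}"
      then have i: "i < Suc n" by simp
      show "\<bar>(\<integral>\<omega>. Z \<omega> * q n i \<omega> \<partial>M) - (\<integral>\<omega>. Z \<omega> * (f2 (X (g n i) \<omega>) / 2 * d n) \<partial>M)\<bar> \<le> 4 * C * K * d n * sqrt (d n)"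
      \<comment> \<open>For s = t the grid degenerates and \<open>taylor_step\<close>, which asks
        for u < v, does not apply; then all terms are 0.\<close>
      proof (cases "d n = 0")
        case True
        then have "q n i \<omega> = 0" for \<omega> using gs[of n i] by (simp add: q_def)
        then show ?thesis using True by simp
      next
        case False
        then have lt: "g n i < g n (Suc i)" using gs[of n i] d0[of n] by linarith
        have g0: "0 \<le> g n i" "s \<le> g n i" using gb[of i n] i st by auto
        have "Z \<in> borel_measurable (F (g n i))" by (rule adapted_mono[OF g0(2) Z(1)])
        from taylor_step[OF f g0(1) lt this Z(2)] show ?thesis unfolding gs q_def .
      qed
    qed
    also have "\<dots> = 4 * C * K * (real (Suc n) * d n) * sqrt (d n)" by (simp del: of_nat_Suc)
    also have "real (Suc n) * d n = t - s" by (simp add: d_def del: of_nat_Suc)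
    finally show ?thesis unfolding ZQ ZS by (simp only: sum_subtractf)
  qed
  have dlim: "d \<longlonglongrightarrow> 0"
    unfolding d_def using tendsto_mult[OF tendsto_const LIMSEQ_inverse_real_of_nat, of "t - s"]
      by (simp add: divide_inverse)
  have errlim: "(\<lambda>n. (\<integral>\<omega>. Z \<omega> * Q n \<omega> \<partial>M) - (\<integral>\<omega>. Z \<omega> * S n \<omega> \<partial>M)) \<longlonglongrightarrow> 0"
  proof (rule Lim_null_comparison)
    show "\<forall>\<^sub>F n in sequentially. norm ((\<integral>\<omega>. Z \<omega> * Q n \<omega> \<partial>M) - (\<integral>\<omega>. Z \<omega> * S n \<omega> \<partial>M)) \<le> 4 * C * K * (t - s) * sqrt (d n)"
      using err by (auto intro: always_eventually)
    have "(\<lambda>n. 4 * C * K * (t - s) * sqrt (d n)) \<longlonglongrightarrow> 4 * C * K * (t - s) * sqrt 0" by (intro tendsto_intros dlim)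
    then show "(\<lambda>n. 4 * C * K * (t - s) * sqrt (d n)) \<longlonglongrightarrow> 0" by simp
  qed
  define I2 where "I2 \<omega> = (LBINT r:{s..t}. f2 (X r \<omega>) / 2)" for \<omega>
  define I1 where "I1 \<omega> = (LBINT r:{s..t}. f1 (X r \<omega>) * mu (X r \<omega>))" for \<omega>
  have half: "\<bar>f2 z / 2\<bar> \<le> K" for z using fb(5)[of z] by simp
  have f1mu: "\<bar>f1 z * mu z\<bar> \<le> K * ?c" for z unfolding abs_mult using fb(4) drift_bound K by (intro mult_mono) auto
  have I2m [measurable]: "I2 \<in> borel_measurable M" unfolding I2_def[abs_def]
    by (rule tail_integral_measurable[of "\<lambda>z. f2 z / 2"]) measurable
  have I1m [measurable]: "I1 \<in> borel_measurable M" unfolding I1_def[abs_def]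
    by (rule tail_integral_measurable[of "\<lambda>z. f1 z * mu z"]) measurable
  have I2i: "integrable M I2" unfolding I2_def[abs_def]
    by (rule tail_integral_integrable[of "\<lambda>z. f2 z / 2", OF _ half st(2)]) measurable
  have I1i: "integrable M I1" unfolding I1_def[abs_def]
    by (rule tail_integral_integrable[of "\<lambda>z. f1 z * mu z", OF _ f1mu st(2)]) measurable
  have Slim: "(\<lambda>n. \<integral>\<omega>. Z \<omega> * S n \<omega> \<partial>M) \<longlonglongrightarrow> (\<integral>\<omega>. Z \<omega> * I2 \<omega> \<partial>M)"
  proof (rule integral_dominated_convergence[where w="\<lambda>_. C * (K * (t - s))"])
    have [measurable]: "S n \<in> borel_measurable M" for n unfolding S_def[abs_def] by measurable
    show "(\<lambda>\<omega>. Z \<omega> * I2 \<omega>) \<in> borel_measurable M" "(\<lambda>\<omega>. Z \<omega> * S n \<omega>) \<in> borel_measurable M" for n by measurable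
    show "AE \<omega> in M. (\<lambda>n. Z \<omega> * S n \<omega>) \<longlonglongrightarrow> Z \<omega> * I2 \<omega>"
    proof (intro AE_I2 tendsto_mult tendsto_const)
      fix \<omega>
      have c: "continuous_on UNIV (\<lambda>r. f2 (X r \<omega>) / 2)"
        by (intro continuous_intros continuous_on_compose2[OF fb(8) pth.x_cont]) auto
      show "(\<lambda>n. S n \<omega>) \<longlonglongrightarrow> I2 \<omega>"
        using riemann_sum_tendsto[OF c half st] unfolding S_def I2_def g_def d_def .
    qed
    show "AE \<omega> in M. norm (Z \<omega> * S n \<omega>) \<le> C * (K * (t - s))" for n
    proof (rule AE_I2)
      fix \<omega>
      have "\<bar>S n \<omega>\<bar> \<le> (\<Sum>i<Suc n. K * d n)"
        unfolding S_def
      proof (rule order_trans[OF sum_abs sum_mono])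
        show "\<bar>f2 (X (g n i) \<omega>) / 2 * d n\<bar> \<le> K * d n" for i
          unfolding abs_mult abs_of_nonneg[OF d0] by (rule mult_right_mono[OF half d0])
      qed
      also have "\<dots> = K * (t - s)" by (simp add: d_def del: of_nat_Suc)
      finally show "norm (Z \<omega> * S n \<omega>) \<le> C * (K * (t - s))"
        unfolding real_norm_def abs_mult using Z(2) C by (intro mult_mono) auto
    qed
  qed simp
  have Rlim: "(\<lambda>n. \<integral>\<omega>. Z \<omega> * R n \<omega> \<partial>M) \<longlonglongrightarrow> (\<integral>\<omega>. Z \<omega> * (I1 \<omega> + f1 0 * (\<beta> * (L t \<omega> - L s \<omega>))) \<partial>M)"
  \<comment> \<open>The majorant from \<open>drift_sum_bound\<close> contains the local time only in
    the product with \<beta>, whose integrability is known.\<close>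
  proof (rule integral_dominated_convergence[where w="\<lambda>\<omega>. C * (K * (?c * (t - s) + \<bar>\<beta> * (L t \<omega> - L s \<omega>)\<bar>))"])
    have [measurable]: "L t \<in> borel_measurable M" "L s \<in> borel_measurable M" using st by auto
    show "(\<lambda>\<omega>. Z \<omega> * (I1 \<omega> + f1 0 * (\<beta> * (L t \<omega> - L s \<omega>)))) \<in> borel_measurable M" by measurable
    show "(\<lambda>\<omega>. Z \<omega> * R n \<omega>) \<in> borel_measurable M" for n
    proof -
      have "(\<lambda>\<omega>. Z \<omega> * R n \<omega>) = (\<lambda>\<omega>. Z \<omega> * (f (X t \<omega>) - f (X s \<omega>)) - Z \<omega> * Q n \<omega>)"
        by (auto simp: QR[of _ n] algebra_simps)
      then show ?thesis using borel_measurable_integrable[OF fi] borel_measurable_integrable[OF ZQi] by simp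
    qed
    show "integrable M (\<lambda>\<omega>. C * (K * (?c * (t - s) + \<bar>\<beta> * (L t \<omega> - L s \<omega>)\<bar>)))"
      by (rule integrable_mult_right, rule integrable_mult_right, rule Bochner_Integration.integrable_add,
          rule integrable_const, rule integrable_abs, rule bL)
    show "AE \<omega> in M. (\<lambda>n. Z \<omega> * R n \<omega>) \<longlonglongrightarrow> Z \<omega> * (I1 \<omega> + f1 0 * (\<beta> * (L t \<omega> - L s \<omega>)))"
    proof (intro AE_I2 tendsto_mult tendsto_const)
      fix \<omega>
      show "(\<lambda>n. R n \<omega>) \<longlonglongrightarrow> I1 \<omega> + f1 0 * (\<beta> * (L t \<omega> - L s \<omega>))"
        unfolding R_def I1_def
        by (rule pth.drift_sum_tendsto[OF fb(1) bounded_derivative_lipschitz[OF fb(2) fb(5)] fb(4) _ st]) measurable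
    qed
    show "AE \<omega> in M. norm (Z \<omega> * R n \<omega>) \<le> C * (K * (?c * (t - s) + \<bar>\<beta> * (L t \<omega> - L s \<omega>)\<bar>))" for n
    proof (rule AE_I2)
      fix \<omega>
      have "\<bar>R n \<omega>\<bar> \<le> K * (?c * (t - s) + \<bar>\<beta>\<bar> * (L t \<omega> - L s \<omega>))"
        unfolding R_def by (rule pth.drift_sum_bound[OF bounded_derivative_lipschitz[OF fb(1) fb(4)] st]) simp
      also have "\<bar>\<beta>\<bar> * (L t \<omega> - L s \<omega>) = \<bar>\<beta> * (L t \<omega> - L s \<omega>)\<bar>"
        using pth.l_mono[OF st, of \<omega>] by (simp add: abs_mult)
      finally show "norm (Z \<omega> * R n \<omega>) \<le> C * (K * (?c * (t - s) + \<bar>\<beta> * (L t \<omega> - L s \<omega>)\<bar>))"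
        unfolding real_norm_def abs_mult[of "Z \<omega>"] using Z(2) C by (intro mult_mono) auto
    qed
  qed
  have "(\<lambda>n. ((\<integral>\<omega>. Z \<omega> * Q n \<omega> \<partial>M) - (\<integral>\<omega>. Z \<omega> * S n \<omega> \<partial>M)) + (\<integral>\<omega>. Z \<omega> * S n \<omega> \<partial>M) + (\<integral>\<omega>. Z \<omega> * R n \<omega> \<partial>M))
    \<longlonglongrightarrow> 0 + (\<integral>\<omega>. Z \<omega> * I2 \<omega> \<partial>M) + (\<integral>\<omega>. Z \<omega> * (I1 \<omega> + f1 0 * (\<beta> * (L t \<omega> - L s \<omega>))) \<partial>M)"
    by (intro tendsto_add errlim Slim Rlim)
  then have "(\<lambda>n. \<integral>\<omega>. Z \<omega> * (f (X t \<omega>) - f (X s \<omega>)) \<partial>M)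
    \<longlonglongrightarrow> (\<integral>\<omega>. Z \<omega> * I2 \<omega> \<partial>M) + (\<integral>\<omega>. Z \<omega> * (I1 \<omega> + f1 0 * (\<beta> * (L t \<omega> - L s \<omega>))) \<partial>M)"
    unfolding ZR by simp
  then have main: "(\<integral>\<omega>. Z \<omega> * (f (X t \<omega>) - f (X s \<omega>)) \<partial>M)
    = (\<integral>\<omega>. Z \<omega> * I2 \<omega> \<partial>M) + (\<integral>\<omega>. Z \<omega> * (I1 \<omega> + f1 0 * (\<beta> * (L t \<omega> - L s \<omega>))) \<partial>M)"
    using LIMSEQ_unique[OF tendsto_const] by blast
  have I12: "(LBINT r:{s..t}. f2 (X r \<omega>) / 2 + f1 (X r \<omega>) * mu (X r \<omega>)) = I2 \<omega> + I1 \<omega>" for \<omega>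
    unfolding I1_def I2_def
    by (rule set_integral_add(2); rule set_integrable_bounded; (rule half f1mu)?) (use pth.x_meas[of \<omega>] in measurable)
  define W where "W \<omega> = \<beta> * (L t \<omega> - L s \<omega>)" for \<omega>
  have WI: "integrable M (\<lambda>\<omega>. Z \<omega> * I1 \<omega>)" "integrable M (\<lambda>\<omega>. Z \<omega> * I2 \<omega>)" "integrable M (\<lambda>\<omega>. Z \<omega> * W \<omega>)"
    using bounded_times_integrable[OF Zm Z(2)] I1i I2i bL unfolding W_def by blast+
  have "(\<integral>\<omega>. Z \<omega> * (I1 \<omega> + f1 0 * W \<omega>) \<partial>M) = (\<integral>\<omega>. Z \<omega> * I1 \<omega> + f1 0 * (Z \<omega> * W \<omega>) \<partial>M)"
    by (simp add: algebra_simps)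
  also have "\<dots> = (\<integral>\<omega>. Z \<omega> * I1 \<omega> \<partial>M) + f1 0 * (\<integral>\<omega>. Z \<omega> * W \<omega> \<partial>M)"
    using WI by simp
  finally have 1: "(\<integral>\<omega>. Z \<omega> * (I1 \<omega> + f1 0 * W \<omega>) \<partial>M) = (\<integral>\<omega>. Z \<omega> * I1 \<omega> \<partial>M) + f1 0 * (\<integral>\<omega>. Z \<omega> * W \<omega> \<partial>M)" .
  have 2: "(\<integral>\<omega>. Z \<omega> * (I2 \<omega> + I1 \<omega>) \<partial>M) = (\<integral>\<omega>. Z \<omega> * I2 \<omega> \<partial>M) + (\<integral>\<omega>. Z \<omega> * I1 \<omega> \<partial>M)"
    using WI by (simp add: distrib_left)
  show ?thesis
    using main 1 2 unfolding W_def I12 by simp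
qed

end

section \<open>The forward equation\<close>

text \<open>A Lyapunov estimate uniform in e. For u = exp(-sqrt(x^2 + e^2)) the generator contains
  -p u, with p the kernel. Where the root is at most 1, u is at least 1/3 and three times this term
  absorbs p; elsewhere p is at most 1/2. The constant 2 is 3/2 from the squared slope plus this
  1/2.\<close>

lemma poisson_kernel_dominated:
  assumes e: "0 < e" "e \<le> 1"
  shows "poisson_kernel e x + 3 * (((hyp_slope 0 1 e x)\<^sup>2 - 2 * 1 * poisson_kernel e x) * exp_hyp 0 1 e x / 2
     + hyp_slope 0 1 e x * exp_hyp 0 1 e x * drift \<mu>p \<mu>m x) \<le> 3 * (\<bar>\<mu>p\<bar> + \<bar>\<mu>m\<bar>) + 2"
proof -
  define q where "q = sqrt (x\<^sup>2 + e\<^sup>2)"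
  define s where "s = hyp_slope 0 1 e x"
  define u where "u = exp_hyp 0 1 e x"
  define p where "p = poisson_kernel e x"
  define d where "d = drift \<mu>p \<mu>m x"
  have q: "0 < q" using hyp_pos[OF e(1)] by (simp add: q_def)
  have s: "\<bar>s\<bar> \<le> 1" using hyp_ratio[of x e] by (simp add: s_def hyp_slope_def)
  have u: "0 \<le> u" "u \<le> 1" using exp_hyp_le_1[of 0 1 e x] by (auto simp: u_def exp_hyp_def)
  have d: "\<bar>d\<bar> \<le> \<bar>\<mu>p\<bar> + \<bar>\<mu>m\<bar>" unfolding d_def by (rule drift_bound)
  have p0: "0 \<le> p" by (simp add: p_def poisson_kernel_nonneg)
  have "p \<le> 3 * (p * u) + 1 / 2"
  proof (cases "q \<le> 1")
    case True
    have "exp (1::real) \<le> 3" by (rule exp_le)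
    then have "1 / 3 \<le> exp (- 1 :: real)" by (simp add: exp_minus field_simps)
    also have "\<dots> \<le> u" using True by (simp add: u_def exp_hyp_def q_def)
    finally have "p * (1 / 3) \<le> p * u" using p0 by (rule mult_left_mono)
    then show ?thesis by simp
  next
    case False
    have "e\<^sup>2 \<le> 1" using e by (simp add: power_le_one)
    also have "1 \<le> q ^ 3" using False by simp
    finally have "e\<^sup>2 / (2 * q ^ 3) \<le> 1 / 2" using q by (simp add: field_simps)
    then have "p \<le> 1 / 2" by (simp add: p_def poisson_kernel_def q_def)
    moreover have "0 \<le> p * u" using p0 u by simp
    ultimately show ?thesis by linarith
  qed
  moreover have "s\<^sup>2 * u \<le> 1" using s u by (intro mult_le_one) (auto simp: abs_square_le_1)
  moreover have "\<bar>s * u * d\<bar> \<le> \<bar>\<mu>p\<bar> + \<bar>\<mu>m\<bar>"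
  proof -
    have "\<bar>s * u * d\<bar> \<le> 1 * 1 * (\<bar>\<mu>p\<bar> + \<bar>\<mu>m\<bar>)"
      unfolding abs_mult using s u d by (intro mult_mono) auto
    then show ?thesis by simp
  qed
  moreover have "p + 3 * ((a - 2 * b) / 2 + c) \<le> 3 * m + 2"
    if "p \<le> 3 * b + 1 / 2" "a \<le> 1" "\<bar>c\<bar> \<le> m" for a b c m using that by argo
  ultimately have "p + 3 * ((s\<^sup>2 * u - 2 * (p * u)) / 2 + s * u * d) \<le> 3 * (\<bar>\<mu>p\<bar> + \<bar>\<mu>m\<bar>) + 2" by blast
  then show ?thesis unfolding p_def s_def u_def d_def by (simp add: algebra_simps)
qed

context refracted
begin

lemma expectation_time_integral:
  fixes g :: "real \<Rightarrow> 'a \<Rightarrow> real"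
  assumes g: "(\<lambda>(r, \<omega>). g r \<omega>) \<in> borel_measurable (lborel \<Otimes>\<^sub>M M)" and b: "\<And>r \<omega>. \<bar>g r \<omega>\<bar> \<le> C"
  shows "(\<integral>\<omega>. (LBINT r:{s..t}. g r \<omega>) \<partial>M) = (LBINT r:{s..t}. (\<integral>\<omega>. g r \<omega> \<partial>M))"
    and "(\<lambda>r. \<integral>\<omega>. g r \<omega> \<partial>M) \<in> borel_measurable borel"
    and "\<bar>\<integral>\<omega>. g r \<omega> \<partial>M\<bar> \<le> C"
    and "(\<lambda>\<omega>. LBINT r:{s..t}. g r \<omega>) \<in> borel_measurable M"
proof -
  interpret P: pair_sigma_finite lborel M ..
  have gm: "g r \<in> borel_measurable M" for r
    using measurable_compose[OF measurable_Pair1'[of r lborel M] g] by simp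
  show "(\<lambda>r. \<integral>\<omega>. g r \<omega> \<partial>M) \<in> borel_measurable borel"
    using borel_measurable_lebesgue_integral[OF g] by simp
  show "\<bar>\<integral>\<omega>. g r \<omega> \<partial>M\<bar> \<le> C"
  proof -
    have "\<bar>\<integral>\<omega>. g r \<omega> \<partial>M\<bar> \<le> (\<integral>\<omega>. \<bar>g r \<omega>\<bar> \<partial>M)" by (rule integral_abs_bound)
    also have "\<dots> \<le> (\<integral>\<omega>. C \<partial>M)"
      by (intro integral_mono integrable_const integrable_const_bound[where B=C]) (use b gm in auto)
    finally show ?thesis by (simp add: prob_space)
  qed
  have gi: "(\<lambda>(r, \<omega>). indicator {s..t} r *\<^sub>R g r \<omega>) \<in> borel_measurable (lborel \<Otimes>\<^sub>M M)"
    using g unfolding case_prod_beta by measurable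
  have gi': "(\<lambda>(\<omega>, r). indicator {s..t} r *\<^sub>R g r \<omega>) \<in> borel_measurable (M \<Otimes>\<^sub>M lborel)"
    using measurable_compose[OF measurable_pair_swap' gi] by (simp add: case_prod_beta)
  show "(\<lambda>\<omega>. LBINT r:{s..t}. g r \<omega>) \<in> borel_measurable M"
    using lborel.borel_measurable_lebesgue_integral[where f="\<lambda>\<omega> r. indicator {s..t} r *\<^sub>R g r \<omega>", OF gi']
    unfolding set_lebesgue_integral_def .
  have int: "integrable (lborel \<Otimes>\<^sub>M M) (\<lambda>(r, \<omega>). indicator {s..t} r *\<^sub>R g r \<omega>)"
  proof -
    have "integrable (lborel \<Otimes>\<^sub>M M) (\<lambda>z. indicator ({s..t} \<times> space M) z *\<^sub>R (case z of (r, \<omega>) \<Rightarrow> g r \<omega>))"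
      by (rule integrableI_bounded_set_indicator[where B=C])
         (use g b in \<open>auto simp: emeasure_pair_measure_Times emeasure_space_1 emeasure_lborel_Icc_eq\<close>)
    then show ?thesis
      by (rule Bochner_Integration.integrable_cong[THEN iffD1, OF refl, rotated]) (auto simp: space_pair_measure indicator_def)
  qed
  have "(\<integral>\<omega>. (\<integral>r. indicator {s..t} r *\<^sub>R g r \<omega> \<partial>lborel) \<partial>M) = (\<integral>r. (\<integral>\<omega>. indicator {s..t} r *\<^sub>R g r \<omega> \<partial>M) \<partial>lborel)"
    by (rule P.Fubini_integral[OF int])
  then show "(\<integral>\<omega>. (LBINT r:{s..t}. g r \<omega>) \<partial>M) = (LBINT r:{s..t}. (\<integral>\<omega>. g r \<omega> \<partial>M))"
    unfolding set_lebesgue_integral_def by simp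
qed

lemma X_joint_comp:
  fixes g :: "real \<Rightarrow> real"
  assumes [measurable]: "g \<in> borel_measurable borel"
  shows "(\<lambda>(r, \<omega>). g (X r \<omega>)) \<in> borel_measurable (lborel \<Otimes>\<^sub>M M)"
  using measurable_compose[OF X_joint, of g borel] assms by (simp add: case_prod_beta)

text \<open>The test function is even, so its derivative at the level is 0 and the unknown local
  time drops out of the Ito formula. Since the function takes values in [0, 1], the occupation is
  bounded independently of e, although the kernel itself is of size 1/(2e). Testing against all
  weights Z is the conditional form of the bound.\<close>

lemma occupation_conditional_bound:
  assumes e: "0 < e" "e \<le> 1" and st: "0 \<le> s" "s \<le> t" "t \<le> T"
    and Z: "Z \<in> borel_measurable (F s)" "\<And>\<omega>. 0 \<le> Z \<omega>" "\<And>\<omega>. Z \<omega> \<le> C"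
  shows "(\<integral>\<omega>. Z \<omega> * (LBINT r:{s..t}. poisson_kernel e (X r \<omega>)) \<partial>M) \<le> (3 + (3 * (\<bar>\<mu>p\<bar> + \<bar>\<mu>m\<bar>) + 2) * T) * (\<integral>\<omega>. Z \<omega> \<partial>M)"
proof -
  let ?c = "3 * (\<bar>\<mu>p\<bar> + \<bar>\<mu>m\<bar>) + 2"
  define f where "f = exp_hyp 0 1 e"
  define f1 where "f1 x = hyp_slope 0 1 e x * exp_hyp 0 1 e x" for x
  define f2 where "f2 x = ((hyp_slope 0 1 e x)\<^sup>2 - 2 * 1 * poisson_kernel e x) * exp_hyp 0 1 e x" for x
  obtain K where f: "C3_bounded f f1 f2 K"
    using C3_bounded_exp_hyp[OF e(1), of 0 1] unfolding f_def f1_def[abs_def] f2_def[abs_def] by auto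
  note fb = C3_boundedD[OF f]
  have [measurable]: "f \<in> borel_measurable borel" "f1 \<in> borel_measurable borel" "f2 \<in> borel_measurable borel"
    using fb by (auto intro: borel_measurable_continuous_onI)
  have Zb: "\<bar>Z \<omega>\<bar> \<le> C" for \<omega> using Z(2,3)[of \<omega>] by simp
  have Zm [measurable]: "Z \<in> borel_measurable M" using Z(1) by (rule adapted_measurable)
  have Zi: "integrable M Z" by (rule integrable_const_bound[where B=C]) (use Zb in auto)
  define G where "G x = f2 x / 2 + f1 x * mu x" for x
  have [measurable]: "G \<in> borel_measurable borel" unfolding G_def[abs_def] by measurable
  have Gb: "\<bar>G x\<bar> \<le> K + K * (\<bar>\<mu>p\<bar> + \<bar>\<mu>m\<bar>)" for x
  proof -
    have "\<bar>f1 x * mu x\<bar> \<le> K * (\<bar>\<mu>p\<bar> + \<bar>\<mu>m\<bar>)" unfolding abs_mult using fb(4,9) drift_bound by (intro mult_mono) auto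
    then show ?thesis using fb(5)[of x] unfolding G_def by linarith
  qed
  have kG: "poisson_kernel e x \<le> ?c - 3 * G x" for x
    using poisson_kernel_dominated[OF e, of x \<mu>p \<mu>m] unfolding G_def f1_def f2_def by linarith
  have kb: "\<bar>poisson_kernel e x\<bar> \<le> 1 / (2 * e)" for x
    using poisson_kernel_bound[OF e(1), of x] poisson_kernel_nonneg[of e x] by simp
  have pt: "(LBINT r:{s..t}. poisson_kernel e (X r \<omega>)) \<le> ?c * (t - s) - 3 * (LBINT r:{s..t}. G (X r \<omega>))" for \<omega>
  proof -
    have i1: "set_integrable lborel {s..t} (\<lambda>r. poisson_kernel e (X r \<omega>))"
      by (rule set_integrable_bounded[OF _ kb]) (use pth.x_meas in measurable)
    have i2: "set_integrable lborel {s..t} (\<lambda>r. G (X r \<omega>))"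
      by (rule set_integrable_bounded[OF _ Gb]) (use pth.x_meas in measurable)
    have i3: "set_integrable lborel {s..t} (\<lambda>r. ?c)"
      by (rule set_integrable_bounded) auto
    have i4: "set_integrable lborel {s..t} (\<lambda>r. 3 * G (X r \<omega>))" using i2 by simp
    have "(LBINT r:{s..t}. poisson_kernel e (X r \<omega>)) \<le> (LBINT r:{s..t}. ?c - 3 * G (X r \<omega>))"
      by (rule set_integral_mono[OF i1 set_integral_diff(1)[OF i3 i4]]) (rule kG)
    also have "\<dots> = (LBINT r:{s..t}. ?c) - (LBINT r:{s..t}. 3 * G (X r \<omega>))"
      by (rule set_integral_diff(2)[OF i3 i4])
    also have "(LBINT r:{s..t}. ?c) = ?c * (t - s)"
      using st unfolding set_lebesgue_integral_def by simp
    finally show ?thesis by simp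
  qed
  have Wi: "integrable M (\<lambda>\<omega>. LBINT r:{s..t}. poisson_kernel e (X r \<omega>))"
    by (rule tail_integral_integrable[OF _ kb st(2)]) measurable
  have Gi: "integrable M (\<lambda>\<omega>. LBINT r:{s..t}. G (X r \<omega>))"
    by (rule tail_integral_integrable[OF _ Gb st(2)]) measurable
  have "f1 0 = 0" by (simp add: f1_def hyp_slope_def)
  with ito_expectation[OF f st(1,2) Z(1) Zb]
  have ito: "(\<integral>\<omega>. Z \<omega> * (LBINT r:{s..t}. G (X r \<omega>)) \<partial>M) = (\<integral>\<omega>. Z \<omega> * (f (X t \<omega>) - f (X s \<omega>)) \<partial>M)"
    by (simp add: G_def)
  have "(\<integral>\<omega>. Z \<omega> * (LBINT r:{s..t}. poisson_kernel e (X r \<omega>)) \<partial>M)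
     \<le> (\<integral>\<omega>. (?c * (t - s)) * Z \<omega> - 3 * (Z \<omega> * (LBINT r:{s..t}. G (X r \<omega>))) \<partial>M)"
  proof (rule integral_mono)
    show "integrable M (\<lambda>\<omega>. Z \<omega> * (LBINT r:{s..t}. poisson_kernel e (X r \<omega>)))"
      by (rule bounded_times_integrable[OF Zm Zb Wi])
    show "integrable M (\<lambda>\<omega>. (?c * (t - s)) * Z \<omega> - 3 * (Z \<omega> * (LBINT r:{s..t}. G (X r \<omega>))))"
      by (intro Bochner_Integration.integrable_diff integrable_mult_right Zi bounded_times_integrable[OF Zm Zb Gi])
    fix \<omega>
    have "Z \<omega> * (LBINT r:{s..t}. poisson_kernel e (X r \<omega>)) \<le> Z \<omega> * (?c * (t - s) - 3 * (LBINT r:{s..t}. G (X r \<omega>)))"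
      using pt Z(2) by (rule mult_left_mono)
    then show "Z \<omega> * (LBINT r:{s..t}. poisson_kernel e (X r \<omega>))
      \<le> (?c * (t - s)) * Z \<omega> - 3 * (Z \<omega> * (LBINT r:{s..t}. G (X r \<omega>)))"
      by (simp add: algebra_simps)
  qed
  also have "\<dots> = (?c * (t - s)) * (\<integral>\<omega>. Z \<omega> \<partial>M) - 3 * (\<integral>\<omega>. Z \<omega> * (LBINT r:{s..t}. G (X r \<omega>)) \<partial>M)"
    using Zi bounded_times_integrable[OF Zm Zb Gi]
    by (simp only: Bochner_Integration.integral_diff integrable_mult_right integral_mult_right_zero)
  also have "\<dots> \<le> (?c * T) * (\<integral>\<omega>. Z \<omega> \<partial>M) + 3 * (\<integral>\<omega>. Z \<omega> \<partial>M)"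
  proof -
    have EZ: "0 \<le> (\<integral>\<omega>. Z \<omega> \<partial>M)" using Z(2) by (intro integral_nonneg_AE) auto
    have "(?c * (t - s)) * (\<integral>\<omega>. Z \<omega> \<partial>M) \<le> (?c * T) * (\<integral>\<omega>. Z \<omega> \<partial>M)"
      using EZ st by (intro mult_right_mono mult_left_mono) auto
    moreover have "- (\<integral>\<omega>. Z \<omega> \<partial>M) \<le> (\<integral>\<omega>. Z \<omega> * (f (X t \<omega>) - f (X s \<omega>)) \<partial>M)"
      unfolding integral_minus[symmetric]
    proof (rule integral_mono)
      have [measurable]: "X u \<in> borel_measurable M" for u by (rule X_measurable)
      show "integrable M (\<lambda>\<omega>. Z \<omega> * (f (X t \<omega>) - f (X s \<omega>)))"
        by (intro bounded_times_integrable[OF Zm Zb] Bochner_Integration.integrable_diff integrable_const_bound[where B=K]) (use fb(3) in auto)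
      fix \<omega>
      have "0 \<le> f (X t \<omega>)" "f (X s \<omega>) \<le> 1" unfolding f_def using exp_hyp_le_1[of 0 1] by (auto simp: exp_hyp_def)
      then have "Z \<omega> * (- 1) \<le> Z \<omega> * (f (X t \<omega>) - f (X s \<omega>))" using Z(2) by (intro mult_left_mono) auto
      then show "- Z \<omega> \<le> Z \<omega> * (f (X t \<omega>) - f (X s \<omega>))" by simp
    qed (use Zi in simp)
    ultimately show ?thesis unfolding ito by linarith
  qed
  finally show ?thesis by (simp add: algebra_simps)
qed

text \<open>The square is twice an ordered double time integral. The occupation after s is bounded
  by A given F s, with the kernel at X s as weight; integrating over s gives A times a first moment,
  which is again at most A.\<close>

lemma occupation_second_moment:
  assumes e: "0 < e" "e \<le> 1" and T: "0 \<le> T"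
  shows "(\<integral>\<omega>. (LBINT r:{0..T}. poisson_kernel e (X r \<omega>))\<^sup>2 \<partial>M) \<le> 2 * (3 + (3 * (\<bar>\<mu>p\<bar> + \<bar>\<mu>m\<bar>) + 2) * T)\<^sup>2"
proof -
  define A where "A = 3 + (3 * (\<bar>\<mu>p\<bar> + \<bar>\<mu>m\<bar>) + 2) * T"
  have A0: "0 \<le> A" using T by (simp add: A_def)
  let ?P = "poisson_kernel e"
  have kb: "\<bar>?P x\<bar> \<le> 1 / (2 * e)" for x
    using poisson_kernel_bound[OF e(1), of x] poisson_kernel_nonneg[of e x] by simp
  define W where "W s \<omega> = (LBINT r:{s..T}. ?P (X r \<omega>))" for s \<omega>
  have EW: "(\<integral>\<omega>. W 0 \<omega> \<partial>M) \<le> A"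
    using occupation_conditional_bound[OF e order_refl T order_refl, of "\<lambda>_. 1" 1] by (simp add: W_def A_def prob_space)
  have Wb: "\<bar>W s \<omega>\<bar> \<le> 1 / (2 * e) * T" if "0 \<le> s" for s \<omega>
  proof (cases "s \<le> T")
    case True
    have "\<bar>W s \<omega>\<bar> \<le> 1 / (2 * e) * (T - s)" unfolding W_def by (rule tail_integral_bound[OF _ kb True]) measurable
    also have "\<dots> \<le> 1 / (2 * e) * T" using that e by (intro mult_left_mono) auto
    finally show ?thesis .
  qed (use T e in \<open>simp add: W_def set_lebesgue_integral_def\<close>)
  have Wj: "(\<lambda>(s, \<omega>). W s \<omega>) \<in> borel_measurable (lborel \<Otimes>\<^sub>M M)"
  proof -
    have "(\<lambda>w. X (snd w) (snd (fst w))) \<in> borel_measurable ((lborel \<Otimes>\<^sub>M M) \<Otimes>\<^sub>M lborel)"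
      by (rule X_measurable_comp) measurable
    then have "(\<lambda>(w, r). (if fst w \<le> r \<and> r
      \<le> T then ?P (X r (snd w)) else 0)) \<in> borel_measurable ((lborel \<Otimes>\<^sub>M M) \<Otimes>\<^sub>M lborel)"
      unfolding case_prod_beta by measurable
    from lborel.borel_measurable_lebesgue_integral[where f="\<lambda>w r. (if fst w \<le> r \<and> r
      \<le> T then ?P (X r (snd w)) else 0)", OF this]
    show ?thesis
      unfolding W_def set_lebesgue_integral_def case_prod_beta
      by (rule measurable_cong[THEN iffD1, rotated]) (auto intro!: Bochner_Integration.integral_cong simp: indicator_def)
  qed
  \<comment> \<open>The cut-off at negative times gives a global bound, as the exchange of
    expectation and time integral demands one; W is bounded only for nonnegative starting
    times.\<close>
  define g where "g s \<omega> = (if 0 \<le> s then ?P (X s \<omega>) * W s \<omega> else 0)" for s \<omega>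
  have gj: "(\<lambda>(s, \<omega>). g s \<omega>) \<in> borel_measurable (lborel \<Otimes>\<^sub>M M)"
    using Wj X_joint_comp[of ?P] unfolding g_def case_prod_beta by measurable
  have gb: "\<bar>g s \<omega>\<bar> \<le> 1 / (2 * e) * (1 / (2 * e) * T)" for s \<omega>
  proof (cases "0 \<le> s")
    case True
    have "\<bar>?P (X s \<omega>) * W s \<omega>\<bar> \<le> 1 / (2 * e) * (1 / (2 * e) * T)"
      unfolding abs_mult using kb Wb[OF True] e by (intro mult_mono) auto
    then show ?thesis using True by (simp add: g_def)
  qed (use T e in \<open>simp add: g_def\<close>)
  have sq: "(W 0 \<omega>)\<^sup>2 = 2 * (LBINT s:{0..T}. g s \<omega>)" for \<omega>
  proof -
    have c: "continuous_on UNIV (\<lambda>r. ?P (X r \<omega>))"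
    proof -
      have "x\<^sup>2 + e\<^sup>2 \<noteq> 0" for x using e by (metis less_irrefl zero_less_power2 add_nonneg_pos zero_le_power2)
      then show ?thesis unfolding poisson_kernel_def using e by (intro continuous_intros pth.x_cont) auto
    qed
    have "(LBINT s:{0..T}. ?P (X s \<omega>) * (LBINT r:{s..T}. ?P (X r \<omega>))) = (LBINT s:{0..T}. g s \<omega>)"
      unfolding set_lebesgue_integral_def
        by (rule Bochner_Integration.integral_cong) (auto simp: g_def W_def set_lebesgue_integral_def indicator_def)
    then show ?thesis using square_of_tail_integral[OF c T] unfolding W_def by simp
  qed
  have kj: "(\<lambda>(r, \<omega>). ?P (X r \<omega>)) \<in> borel_measurable (lborel \<Otimes>\<^sub>M M)" by (rule X_joint_comp) measurable
  have km: "(\<lambda>r. \<integral>\<omega>. ?P (X r \<omega>) \<partial>M) \<in> borel_measurable borel"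
    by (rule expectation_time_integral(2)[where g="\<lambda>r \<omega>. ?P (X r \<omega>)", OF kj kb])
  have kb2: "\<bar>\<integral>\<omega>. ?P (X r \<omega>) \<partial>M\<bar> \<le> 1 / (2 * e)" for r
    by (rule expectation_time_integral(3)[where g="\<lambda>r \<omega>. ?P (X r \<omega>)", OF kj kb])
  have ksi: "set_integrable lborel {0..T} (\<lambda>s. \<integral>\<omega>. ?P (X s \<omega>) \<partial>M)"
    by (rule set_integrable_bounded[OF km kb2])
  have 1: "(\<integral>\<omega>. (W 0 \<omega>)\<^sup>2 \<partial>M) = 2 * (LBINT s:{0..T}. (\<integral>\<omega>. g s \<omega> \<partial>M))"
    unfolding sq expectation_time_integral(1)[OF gj gb, symmetric] by simp
  have 2: "(LBINT s:{0..T}. (\<integral>\<omega>. g s \<omega> \<partial>M)) \<le> (LBINT s:{0..T}. A * (\<integral>\<omega>. ?P (X s \<omega>) \<partial>M))"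
  proof (rule set_integral_mono)
    show "set_integrable lborel {0..T} (\<lambda>s. \<integral>\<omega>. g s \<omega> \<partial>M)"
      by (rule set_integrable_bounded[OF expectation_time_integral(2,3)[OF gj gb]])
    show "set_integrable lborel {0..T} (\<lambda>s. A * (\<integral>\<omega>. ?P (X s \<omega>) \<partial>M))"
      by (rule set_integrable_mult_right, rule ksi)
    fix s assume s: "s \<in> {0..T}"
    have m: "(\<lambda>\<omega>. ?P (X s \<omega>)) \<in> borel_measurable (F s)"
      by (rule measurable_compose[OF X_adapted poisson_kernel_measurable]) (use s in simp)
    have "(\<integral>\<omega>. ?P (X s \<omega>) * (LBINT r:{s..T}. ?P (X r \<omega>)) \<partial>M) \<le> A * (\<integral>\<omega>. ?P (X s \<omega>) \<partial>M)"
      unfolding A_def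
      by (rule occupation_conditional_bound[OF e _ _ order_refl m poisson_kernel_nonneg poisson_kernel_bound[OF e(1)]]) (use s in auto)
    then show "(\<integral>\<omega>. g s \<omega> \<partial>M) \<le> A * (\<integral>\<omega>. ?P (X s \<omega>) \<partial>M)"
      using s by (simp add: g_def W_def)
  qed
  have 3: "(LBINT s:{0..T}. A * (\<integral>\<omega>. ?P (X s \<omega>) \<partial>M)) = A * (\<integral>\<omega>. W 0 \<omega> \<partial>M)"
    unfolding W_def expectation_time_integral(1)[where g="\<lambda>r \<omega>. ?P (X r \<omega>)", OF kj kb] by (rule set_integral_mult_right)
  have 4: "A * (\<integral>\<omega>. W 0 \<omega> \<partial>M) \<le> A * A" using EW A0 by (rule mult_left_mono)
  have "(\<integral>\<omega>. (W 0 \<omega>)\<^sup>2 \<partial>M) \<le> 2 * A\<^sup>2"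
    unfolding 1 power2_eq_square[of A] using 2 3 4 by linarith
  then show ?thesis unfolding W_def A_def .
qed

text \<open>Pathwise convergence of the smoothed occupation is upgraded by the uniform second
  moments. The argument covers \<beta> = 0, where \<open>beta_L_integrable\<close> carries no
  information.\<close>

lemma local_time_expectation:
  assumes T: "0 \<le> T"
  shows "integrable M (L T)"
    and "(\<lambda>n. \<integral>\<omega>. (LBINT r:{0..T}. poisson_kernel (1 / real (Suc n)) (X r \<omega>)) \<partial>M) \<longlonglongrightarrow> (\<integral>\<omega>. L T \<omega> \<partial>M)"
proof -
  define W where "W n \<omega> = (LBINT r:{0..T}. poisson_kernel (1 / real (Suc n)) (X r \<omega>))" for n \<omega>
  have e: "0 < 1 / real (Suc n)" "1 / real (Suc n) \<le> 1" for n by auto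
  have kb: "\<bar>poisson_kernel (1 / real (Suc n)) x\<bar> \<le> 1 / (2 * (1 / real (Suc n)))" for n x
    using poisson_kernel_bound[OF e(1), of n x] poisson_kernel_nonneg[of "1 / real (Suc n)" x] by simp
  have Wm: "W n \<in> borel_measurable M" for n unfolding W_def[abs_def] by (rule tail_integral_measurable) measurable
  have Wb: "\<bar>W n \<omega>\<bar> \<le> 1 / (2 * (1 / real (Suc n))) * (T - 0)" for n \<omega>
    unfolding W_def by (rule tail_integral_bound[OF _ kb T]) measurable
  have W2: "integrable M (\<lambda>\<omega>. (W n \<omega>)\<^sup>2)" for n
  proof (rule integrable_const_bound[where B="(1 / (2 * (1 / real (Suc n))) * (T - 0))\<^sup>2"])
    show "AE \<omega> in M. norm ((W n \<omega>)\<^sup>2) \<le> (1 / (2 * (1 / real (Suc n))) * (T - 0))\<^sup>2"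
    proof (rule AE_I2)
      show "norm ((W n \<omega>)\<^sup>2) \<le> (1 / (2 * (1 / real (Suc n))) * (T - 0))\<^sup>2" for \<omega>
        unfolding real_norm_def power_abs by (rule power_mono[OF Wb abs_ge_zero])
    qed
  qed (use Wm in measurable)
  have lim: "(\<lambda>n. W n \<omega>) \<longlonglongrightarrow> L T \<omega>" for \<omega>
    unfolding W_def by (rule poisson_kernel_local_time[OF pth.x_cont T pth.lt[OF T]])
       (use LIMSEQ_inverse_real_of_nat in \<open>auto simp: inverse_eq_divide\<close>)
  have C: "(\<integral>\<omega>. (W n \<omega>)\<^sup>2 \<partial>M) \<le> 2 * (3 + (3 * (\<bar>\<mu>p\<bar> + \<bar>\<mu>m\<bar>) + 2) * T)\<^sup>2" for n
    unfolding W_def by (rule occupation_second_moment[OF e T])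
  show "integrable M (L T)"
    and "(\<lambda>n. \<integral>\<omega>. (LBINT r:{0..T}. poisson_kernel (1 / real (Suc n)) (X r \<omega>)) \<partial>M) \<longlonglongrightarrow> (\<integral>\<omega>. L T \<omega> \<partial>M)"
    using expectation_tendsto_of_second_moments[OF Wm W2 lim C] by (simp_all add: W_def)
qed

end

text \<open>Integration by parts for Laplace transforms: since l exp(-l t) integrates over t > r to
  exp(-l r), Fubini on the triangle 0 < r < t turns the transform of l (A - c) into that of
  N.\<close>

lemma laplace_of_primitive:
  fixes N A :: "real \<Rightarrow> real"
  assumes [measurable]: "N \<in> borel_measurable borel" and Nb: "\<And>r. \<bar>N r\<bar> \<le> K" and l: "0 < l"
    and Am [measurable]: "A \<in> borel_measurable borel" and Ab: "\<And>r. \<bar>A r\<bar> \<le> K'"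
    and A: "\<And>t. 0 < t \<Longrightarrow> A t = c + (LBINT r:{0..t}. N r)"
  shows "(LBINT t:{0<..}. exp (- (l * t)) * (l * A t - N t)) = c"
proof -
  have expi: "integrable lborel (\<lambda>t. indicator {0<..} t * exp (- (l * t)))"
    and expv: "(\<integral>t. indicator {0<..} t * exp (- (l * t)) \<partial>lborel) = 1 / l"
  proof -
    have "(\<integral>\<^sup>+t. ennreal (indicator {0<..} t * exp (- (l * t))) \<partial>lborel)
      = (\<integral>\<^sup>+b\<in>{0<..}. ennreal (exp (- (l * b))) \<partial>lborel)"
      by (intro nn_integral_cong) (auto simp: indicator_def)
    also have "\<dots> = ennreal (1 / l)" by (rule nn_integral_exp_Ioi[OF l])
    finally have "has_bochner_integral lborel (\<lambda>t. indicator {0<..} t * exp (- (l * t))) (1 / l)"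
      using l by (intro has_bochner_integral_nn_integral) auto
    then show "integrable lborel (\<lambda>t. indicator {0<..} t * exp (- (l * t)))"
      "(\<integral>t. indicator {0<..} t * exp (- (l * t)) \<partial>lborel) = 1 / l"
      by (auto simp: has_bochner_integral_iff)
  qed
  have bi: "integrable lborel (\<lambda>t. indicator {0<..} t * exp (- (l * t)) * G t)"
    if [measurable]: "G \<in> borel_measurable borel" and "\<And>t. \<bar>G t\<bar> \<le> C" for G C
  proof (rule Bochner_Integration.integrable_bound[where f="\<lambda>t. C * (indicator {0<..} t * exp (- (l * t)))"])
    show "AE t in lborel. norm (indicator {0<..} t * exp (- (l * t)) * G t)
      \<le> norm (C * (indicator {0<..} t * exp (- (l * t))))"
    proof (rule AE_I2)
      fix t
      have "0 \<le> C" using that(2)[of 0] by linarith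
      then show "norm (indicator {0<..} t * exp (- (l * t)) * G t) \<le> norm (C * (indicator {0<..} t * exp (- (l * t))))"
        using that(2)[of t] by (auto simp: abs_mult indicator_def mult_ac intro: mult_left_mono)
    qed
  qed (use expi in auto)
  define f where "f r t = (if 0 < r \<and> r < t then l * exp (- (l * t)) * N r else 0)" for r t
  have fm: "(\<lambda>(r, t). f r t) \<in> borel_measurable (lborel \<Otimes>\<^sub>M lborel)" unfolding f_def by measurable
  have tail: "(\<integral>t. (if 0 < r \<and> r < t then l * exp (- (l * t)) else 0) \<partial>lborel) = indicator {0<..} r * exp (- (l * r))"
    and taili: "integrable lborel (\<lambda>t. if 0 < r \<and> r < t then l * exp (- (l * t)) else 0)" for r
  proof -
    have "(\<integral>\<^sup>+t. ennreal (if 0 < r \<and> r < t then l * exp (- (l * t)) else 0) \<partial>lborel)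
      = ennreal (indicator {0<..} r * exp (- (l * r)))"
    proof (cases "0 < r")
      case True
      have "(\<integral>\<^sup>+t. ennreal (if 0 < r \<and> r < t then l * exp (- (l * t)) else 0) \<partial>lborel)
        = (\<integral>\<^sup>+t. ennreal (l * exp (- (l * t))) * indicator {r..} t \<partial>lborel)"
        by (rule nn_integral_cong_AE) (use AE_lborel_singleton[of r] True in \<open>auto simp: indicator_def\<close>)
      also have "\<dots> = ennreal (0 - (- exp (- (l * r))))"
      proof (rule nn_integral_FTC_atLeast)
        show "((\<lambda>t. - exp (- (l * t))) \<longlongrightarrow> 0) at_top" using l by real_asymp
        show "((\<lambda>t. - exp (- (l * t))) has_real_derivative l * exp (- (l * t))) (at t)" for t
          by (auto intro!: derivative_eq_intros)
      qed (use l in auto)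
      finally show ?thesis using True by simp
    qed simp
    then have "has_bochner_integral lborel (\<lambda>t. if 0 < r \<and> r < t then l * exp (- (l * t)) else 0) (indicator {0<..} r
      * exp (- (l * r)))"
      using l by (intro has_bochner_integral_nn_integral) auto
    then show "(\<integral>t. (if 0 < r \<and> r < t then l * exp (- (l * t)) else 0) \<partial>lborel) = indicator {0<..} r * exp (- (l * r))"
      "integrable lborel (\<lambda>t. if 0 < r \<and> r < t then l * exp (- (l * t)) else 0)"
      by (auto simp: has_bochner_integral_iff)
  qed
  have ftail: "(\<integral>t. f r t \<partial>lborel) = indicator {0<..} r * exp (- (l * r)) * N r" for r
  proof -
    have "f r t = (if 0 < r \<and> r < t then l * exp (- (l * t)) else 0) * N r" for t by (simp add: f_def)
    then show ?thesis using tail[of r] by simp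
  qed
  have fi: "integrable (lborel \<Otimes>\<^sub>M lborel) (\<lambda>(r, t). f r t)"
  proof (rule lborel_pair.Fubini_integrable[OF fm])
    have "(\<integral>t. norm (case (r, t) of (r, t) \<Rightarrow> f r t) \<partial>lborel) = indicator {0<..} r * exp (- (l * r)) * \<bar>N r\<bar>" for r
    proof -
      have "norm (f r t) = (if 0 < r \<and> r < t then l * exp (- (l * t)) else 0) * \<bar>N r\<bar>" for t
        using l by (simp add: f_def abs_mult)
      then show ?thesis using tail[of r] by simp
    qed
    then show "integrable lborel (\<lambda>r. \<integral>t. norm (case (r, t) of (r, t) \<Rightarrow> f r t) \<partial>lborel)"
      using bi[of "\<lambda>r. \<bar>N r\<bar>" K] Nb by simp
    show "AE r in lborel. integrable lborel (\<lambda>t. case (r, t) of (r, t) \<Rightarrow> f r t)"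
    proof (rule AE_I2)
      fix r
      have "f r t = (if 0 < r \<and> r < t then l * exp (- (l * t)) else 0) * N r" for t by (simp add: f_def)
      then show "integrable lborel (\<lambda>t. case (r, t) of (r, t) \<Rightarrow> f r t)" using taili[of r] by simp
    qed
  qed
  have fub: "(\<integral>t. (\<integral>r. f r t \<partial>lborel) \<partial>lborel) = (\<integral>r. (\<integral>t. f r t \<partial>lborel) \<partial>lborel)"
    by (rule lborel_pair.Fubini_integral[OF fi])
  have inner: "(\<integral>r. f r t \<partial>lborel) = indicator {0<..} t * exp (- (l * t)) * (l * (A t - c))" for t
  proof (cases "0 < t")
    case True
    have "(\<integral>r. f r t \<partial>lborel) = (\<integral>r. (l * exp (- (l * t))) * (indicator {0..t} r *\<^sub>R N r) \<partial>lborel)"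
    proof (rule integral_cong_AE)
      have "AE r in lborel. r \<noteq> 0 \<and> r \<noteq> t" using AE_lborel_singleton[of 0] AE_lborel_singleton[of t]
        by eventually_elim simp
      then show "AE r in lborel. f r t = (l * exp (- (l * t))) * (indicator {0..t} r *\<^sub>R N r)"
        by eventually_elim (use True in \<open>auto simp: f_def indicator_def\<close>)
    qed (auto simp: f_def)
    also have "\<dots> = l * exp (- (l * t)) * (A t - c)"
      unfolding integral_mult_right_zero A[OF True] set_lebesgue_integral_def by simp
    finally show ?thesis using True by simp
  next
    case False
    then have "f r t = 0" for r by (auto simp: f_def)
    then show ?thesis using False by simp
  qed
  have eq: "(\<integral>t. indicator {0<..} t * exp (- (l * t)) * (l * (A t - c)) \<partial>lborel)
    = (\<integral>t. indicator {0<..} t * exp (- (l * t)) * N t \<partial>lborel)"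
    using fub unfolding inner ftail .
  have b1: "integrable lborel (\<lambda>t. indicator {0<..} t * exp (- (l * t)) * (l * (A t - c)))"
  proof (rule bi)
    show "\<bar>l * (A t - c)\<bar> \<le> l * (K' + \<bar>c\<bar>)" for t
      unfolding abs_mult using l Ab[of t] by (auto intro!: mult_left_mono)
  qed measurable
  have b2: "integrable lborel (\<lambda>t. indicator {0<..} t * exp (- (l * t)) * N t)" by (rule bi[OF _ Nb]) measurable
  have "(LBINT t:{0<..}. exp (- (l * t)) * (l * A t - N t))
    = (\<integral>t. indicator {0<..} t * exp (- (l * t)) * (l * (A t - c)) + (l * c) * (indicator {0<..} t * exp (- (l * t))) - indicator {0<..} t * exp (- (l * t)) * N t \<partial>lborel)"
    unfolding set_lebesgue_integral_def by (rule Bochner_Integration.integral_cong) (auto simp: algebra_simps)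
  also have "\<dots> = (\<integral>t. indicator {0<..} t * exp (- (l * t)) * (l * (A t - c)) \<partial>lborel) + (l * c) * (1 / l)
      - (\<integral>t. indicator {0<..} t * exp (- (l * t)) * N t \<partial>lborel)"
    using b1 b2 expi
      by (simp only: Bochner_Integration.integral_add Bochner_Integration.integral_diff Bochner_Integration.integrable_add integrable_mult_right integral_mult_right_zero expv)
  also have "\<dots> = c" unfolding eq using l by simp
  finally show ?thesis .
qed

lemma local_time_zero_AE:
  fixes x :: "real \<Rightarrow> real"
  assumes x: "continuous_on UNIV x" and l: "has_symmetric_local_time x t 0 l"
  shows "AE s in lborel. s \<in> {0..t} \<longrightarrow> x s \<noteq> 0"
proof (rule AE_I')
  have "compact {s \<in> {0..t}. x s = 0}" using local_time_level_set[OF x, of t 0] by simp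
  then have "{s \<in> {0..t}. x s = 0} \<in> sets borel" by (rule borel_compact)
  moreover have "{s \<in> {0..t}. x s = 0} \<in> lmeasurable" using local_time_lmeasurable[OF x, of t 0] by simp
  then have "emeasure lebesgue {s \<in> {0..t}. x s = 0} = 0"
    using local_time_zero_set[OF x l] by (simp add: emeasure_eq_measure2 fmeasurableD2 emeasure_eq_ennreal_measure)
  ultimately show "{s \<in> {0..t}. x s = 0} \<in> null_sets lborel" by (simp add: null_sets_def)
qed auto

text \<open>The pointwise limit of \<open>exp_hyp\<close> as e tends to 0. The two parameters allow
  the decay rates on the two sides to be prescribed independently.\<close>

definition exp_tent :: "real \<Rightarrow> real \<Rightarrow> real \<Rightarrow> real" where
  "exp_tent \<alpha> \<gamma> x = exp (\<alpha> * x - \<gamma> * \<bar>x\<bar>)"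

lemma exp_tent_bound:
  assumes "\<bar>\<alpha>\<bar> \<le> \<gamma>" shows "0 \<le> exp_tent \<alpha> \<gamma> x" "exp_tent \<alpha> \<gamma> x \<le> 1"
proof -
  have "\<alpha> * x \<le> \<bar>\<alpha>\<bar> * \<bar>x\<bar>" by (metis abs_ge_self abs_mult)
  also have "\<dots> \<le> \<gamma> * \<bar>x\<bar>" using assms by (intro mult_right_mono) auto
  finally show "0 \<le> exp_tent \<alpha> \<gamma> x" "exp_tent \<alpha> \<gamma> x \<le> 1" by (simp_all add: exp_tent_def)
qed

lemma exp_hyp_limits:
  assumes e: "e \<longlonglongrightarrow> 0" "\<And>n. 0 < e n"
  shows "(\<lambda>n. exp_hyp \<alpha> \<gamma> (e n) x) \<longlonglongrightarrow> exp_tent \<alpha> \<gamma> x"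
    and "x \<noteq> 0 \<Longrightarrow> (\<lambda>n. hyp_slope \<alpha> \<gamma> (e n) x) \<longlonglongrightarrow> \<alpha> - \<gamma> * sgn x"
    and "x \<noteq> 0 \<Longrightarrow> (\<lambda>n. poisson_kernel (e n) x) \<longlonglongrightarrow> 0"
proof -
  have "(\<lambda>n. sqrt (x\<^sup>2 + (e n)\<^sup>2)) \<longlonglongrightarrow> sqrt (x\<^sup>2 + 0\<^sup>2)" by (intro tendsto_intros e)
  then have s: "(\<lambda>n. sqrt (x\<^sup>2 + (e n)\<^sup>2)) \<longlonglongrightarrow> \<bar>x\<bar>" by simp
  show "(\<lambda>n. exp_hyp \<alpha> \<gamma> (e n) x) \<longlonglongrightarrow> exp_tent \<alpha> \<gamma> x"
    unfolding exp_hyp_def exp_tent_def by (intro tendsto_intros s)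
  show "(\<lambda>n. hyp_slope \<alpha> \<gamma> (e n) x) \<longlonglongrightarrow> \<alpha> - \<gamma> * sgn x" if "x \<noteq> 0"
  proof -
    have "(\<lambda>n. hyp_slope \<alpha> \<gamma> (e n) x) \<longlonglongrightarrow> \<alpha> - \<gamma> * (x / \<bar>x\<bar>)"
      unfolding hyp_slope_def using that by (intro tendsto_intros s) auto
    moreover have "x / \<bar>x\<bar> = sgn x" by (simp add: sgn_real_def abs_real_def)
    ultimately show ?thesis by simp
  qed
  show "(\<lambda>n. poisson_kernel (e n) x) \<longlonglongrightarrow> 0" if "x \<noteq> 0"
  proof -
    have "(\<lambda>n. poisson_kernel (e n) x) \<longlonglongrightarrow> 0\<^sup>2 / (2 * \<bar>x\<bar> ^ 3)"
      unfolding poisson_kernel_def using that by (intro tendsto_intros s e) auto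
    then show ?thesis by simp
  qed
qed

text \<open>With q = sqrt(x^2 + e^2), \<open>exp_hyp\<close> differs from 1 by at most 2 \<gamma> q,
  while the kernel is e^2 / (2 q^3). So replacing kernel times \<open>exp_hyp\<close> by the kernel
  alone costs a term bounded uniformly in e, and this term vanishes in the limit off the
  level.\<close>

lemma poisson_kernel_deficit:
  assumes e: "0 < e" and \<alpha>: "\<bar>\<alpha>\<bar> \<le> \<gamma>"
  shows "\<bar>poisson_kernel e x * (exp_hyp \<alpha> \<gamma> e x - 1)\<bar> \<le> \<gamma>"
proof -
  define q where "q = sqrt (x\<^sup>2 + e\<^sup>2)"
  have q: "0 < q" "e \<le> q" using hyp_pos[OF e] hyp_ge[OF e] by (auto simp: q_def)
  have "\<bar>\<alpha> * x\<bar> \<le> \<gamma> * q" unfolding abs_mult q_def using \<alpha> by (intro mult_mono real_sqrt_ge_abs1) auto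
  then have "- (2 * \<gamma> * q) \<le> \<alpha> * x - \<gamma> * q" by (simp add: abs_le_iff)
  moreover have "1 + (\<alpha> * x - \<gamma> * q) \<le> exp_hyp \<alpha> \<gamma> e x" unfolding exp_hyp_def q_def[symmetric]
    by (rule exp_ge_add_one_self)
  ultimately have "\<bar>exp_hyp \<alpha> \<gamma> e x - 1\<bar> \<le> 2 * \<gamma> * q" using exp_hyp_le_1[OF \<alpha>, of e x] by linarith
  then have "\<bar>poisson_kernel e x * (exp_hyp \<alpha> \<gamma> e x - 1)\<bar> \<le> poisson_kernel e x * (2 * \<gamma> * q)"
    unfolding abs_mult using poisson_kernel_nonneg[of e x] by (simp add: mult_left_mono)
  also have "\<dots> = \<gamma> * (e / q)\<^sup>2"
  proof -
    have k: "poisson_kernel e x = e\<^sup>2 / (2 * q ^ 3)" unfolding poisson_kernel_def q_def ..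
    show ?thesis unfolding k using q(1) by (simp add: power_divide power3_eq_cube power2_eq_square)
  qed
  also have "\<dots> \<le> \<gamma> * 1" using q e \<alpha> by (intro mult_left_mono power_le_one) auto
  finally show ?thesis by simp
qed

context refracted
begin

text \<open>Convergence away from 0 suffices, because a path with a local time spends no Lebesgue
  time at the level.\<close>

lemma time_expectation_tendsto:
  fixes g :: "nat \<Rightarrow> real \<Rightarrow> real"
  assumes g: "\<And>n. g n \<in> borel_measurable borel" and G: "G \<in> borel_measurable borel"
    and b: "\<And>n z. \<bar>g n z\<bar> \<le> C" and Gb: "\<And>z. \<bar>G z\<bar> \<le> C"
    and lim: "\<And>z. z \<noteq> 0 \<Longrightarrow> (\<lambda>n. g n z) \<longlonglongrightarrow> G z" and t: "0 \<le> t"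
  shows "(\<lambda>n. \<integral>\<omega>. (LBINT r:{0..t}. g n (X r \<omega>)) \<partial>M) \<longlonglongrightarrow> (\<integral>\<omega>. (LBINT r:{0..t}. G (X r \<omega>)) \<partial>M)"
proof (rule integral_dominated_convergence[where w="\<lambda>_. C * (t - 0)"])
  note [measurable] = g G
  show "(\<lambda>\<omega>. LBINT r:{0..t}. G (X r \<omega>)) \<in> borel_measurable M" by (rule tail_integral_measurable[OF G])
  show "(\<lambda>\<omega>. LBINT r:{0..t}. g n (X r \<omega>)) \<in> borel_measurable M" for n by (rule tail_integral_measurable[OF g])
  show "AE \<omega> in M. norm (LBINT r:{0..t}. g n (X r \<omega>)) \<le> C * (t - 0)" for n
    unfolding real_norm_def by (rule AE_I2, rule tail_integral_bound[OF g b t])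
  show "AE \<omega> in M. (\<lambda>n. LBINT r:{0..t}. g n (X r \<omega>)) \<longlonglongrightarrow> (LBINT r:{0..t}. G (X r \<omega>))"
  proof (rule AE_I2)
    fix \<omega>
    note [measurable] = pth.x_meas[of \<omega>]
    show "(\<lambda>n. LBINT r:{0..t}. g n (X r \<omega>)) \<longlonglongrightarrow> (LBINT r:{0..t}. G (X r \<omega>))"
      unfolding set_lebesgue_integral_def
    proof (rule integral_dominated_convergence[where w="\<lambda>r. C * indicator {0..t} r"])
      show "AE r in lborel. (\<lambda>n. indicator {0..t} r *\<^sub>R g n (X r \<omega>)) \<longlonglongrightarrow> indicator {0..t} r *\<^sub>R G (X r \<omega>)"
        using local_time_zero_AE[OF pth.x_cont pth.lt[OF t], of \<omega>]
        by eventually_elim (auto simp: indicator_def intro: lim)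
      show "AE r in lborel. norm (indicator {0..t} r *\<^sub>R g n (X r \<omega>)) \<le> C * indicator {0..t} r" for n
        using b by (intro AE_I2) (auto simp: indicator_def)
    qed (auto simp: emeasure_lborel_Icc_eq)
  qed
qed simp

text \<open>Half the second derivative plus drift times the first derivative of
  \<open>exp_tent\<close>, valid off the level; the kink itself is accounted for by the local-time
  term.\<close>

definition kinked_generator :: "real \<Rightarrow> real \<Rightarrow> real \<Rightarrow> real" where
  "kinked_generator \<alpha> \<gamma> x = ((\<alpha> - \<gamma> * sgn x)\<^sup>2 / 2 + (\<alpha> - \<gamma> * sgn x) * mu x) * exp_tent \<alpha> \<gamma> x"

lemma kinked_generator_measurable [measurable]: "kinked_generator \<alpha> \<gamma> \<in> borel_measurable borel"
  unfolding kinked_generator_def[abs_def] exp_tent_def[abs_def] by measurable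

lemma slope_term_bound:
  assumes "\<bar>p\<bar> \<le> 2 * \<gamma>" "0 \<le> u" "u \<le> (1::real)"
  shows "\<bar>(p\<^sup>2 / 2 + p * mu x) * u\<bar> \<le> (2 * \<gamma>)\<^sup>2 / 2 + 2 * \<gamma> * (\<bar>\<mu>p\<bar> + \<bar>\<mu>m\<bar>)"
proof -
  have "p\<^sup>2 \<le> (2 * \<gamma>)\<^sup>2" using power_mono[OF assms(1), of 2] by simp
  moreover have "\<bar>p * mu x\<bar> \<le> 2 * \<gamma> * (\<bar>\<mu>p\<bar> + \<bar>\<mu>m\<bar>)"
    unfolding abs_mult using assms(1) drift_bound by (intro mult_mono) auto
  ultimately have 1: "\<bar>p\<^sup>2 / 2 + p * mu x\<bar> \<le> (2 * \<gamma>)\<^sup>2 / 2 + 2 * \<gamma> * (\<bar>\<mu>p\<bar> + \<bar>\<mu>m\<bar>)"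
    using zero_le_power2[of p] by linarith
  have 2: "\<bar>(p\<^sup>2 / 2 + p * mu x) * u\<bar> \<le> \<bar>p\<^sup>2 / 2 + p * mu x\<bar> * 1"
    unfolding abs_mult using assms by (intro mult_left_mono) auto
  show ?thesis by (rule order_trans[OF 2[unfolded mult_1_right] 1])
qed

lemma kinked_generator_bound:
  assumes "\<bar>\<alpha>\<bar> \<le> \<gamma>"
  shows "\<bar>kinked_generator \<alpha> \<gamma> x\<bar> \<le> (2 * \<gamma>)\<^sup>2 / 2 + 2 * \<gamma> * (\<bar>\<mu>p\<bar> + \<bar>\<mu>m\<bar>)"
  unfolding kinked_generator_def
proof (rule slope_term_bound)
  show "\<bar>\<alpha> - \<gamma> * sgn x\<bar> \<le> 2 * \<gamma>" using assms by (auto simp: sgn_real_def)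
qed (use exp_tent_bound[OF assms] in auto)

lemma beta_L_zero: "\<beta> * L 0 \<omega> = 0"
proof -
  have "\<bar>LBINT s:{0..0}. mu (X s \<omega>)\<bar> \<le> (\<bar>\<mu>p\<bar> + \<bar>\<mu>m\<bar>) * (0 - 0)"
    by (rule tail_integral_bound[OF _ drift_bound]) auto
  then show ?thesis using pth.eq[of 0 \<omega>] pth.x0 pth.b0 by simp
qed

text \<open>The Ito--Tanaka formula in expectation for a function with a kink at the skew level.\<close>

lemma forward_equation:
  assumes \<alpha>: "\<bar>\<alpha>\<bar> \<le> \<gamma>" and t: "0 \<le> t"
  shows "(\<integral>\<omega>. exp_tent \<alpha> \<gamma> (X t \<omega>) \<partial>M)
    = 1 + (LBINT r:{0..t}. (\<integral>\<omega>. kinked_generator \<alpha> \<gamma> (X r \<omega>) \<partial>M)) + (\<alpha> * \<beta> - \<gamma>) * (\<integral>\<omega>. L t \<omega> \<partial>M)"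
proof -
  define e where "e n = 1 / real (Suc n)" for n
  have e: "e \<longlonglongrightarrow> 0" "\<And>n. 0 < e n"
    unfolding e_def using LIMSEQ_inverse_real_of_nat by (auto simp: inverse_eq_divide)
  have \<gamma>: "0 \<le> \<gamma>" using \<alpha> by linarith
  define c where "c = \<bar>\<mu>p\<bar> + \<bar>\<mu>m\<bar>"
  define U where "U n = exp_hyp \<alpha> \<gamma> (e n)" for n
  define p where "p n = hyp_slope \<alpha> \<gamma> (e n)" for n
  define k where "k n = poisson_kernel (e n)" for n
  have [measurable]: "U n \<in> borel_measurable borel" "p n \<in> borel_measurable borel" "k n \<in> borel_measurable borel" for n
    unfolding U_def p_def k_def exp_hyp_def[abs_def] hyp_slope_def[abs_def] by measurable
  \<comment> \<open>The generator of the smoothed function is G - \<gamma> k - \<gamma> H: G stays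
    bounded, the occupation integral of k tends to the local time, and H disappears. Hence the
    coefficient -\<gamma>, half the jump of the derivative at the kink. The other part \<alpha>
    \<beta> is the derivative \<alpha> of the smoothed function at 0, up to a factor tending to 1,
    times \<beta>.\<close>
  define G where "G n z = ((p n z)\<^sup>2 / 2 + p n z * mu z) * U n z" for n z
  define H where "H n z = k n z * (U n z - 1)" for n z
  have Gm: "G n \<in> borel_measurable borel" and Hm: "H n \<in> borel_measurable borel" for n
    unfolding G_def[abs_def] H_def[abs_def] by measurable
  have Ub: "0 \<le> U n z" "U n z \<le> 1" for n z using exp_hyp_le_1[OF \<alpha>] by (auto simp: U_def exp_hyp_def)
  have Gb: "\<bar>G n z\<bar> \<le> (2 * \<gamma>)\<^sup>2 / 2 + 2 * \<gamma> * c" for n z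
    unfolding G_def p_def c_def using hyp_slope_bound[OF \<alpha>] Ub by (intro slope_term_bound)
  have Hb: "\<bar>H n z\<bar> \<le> \<gamma>" for n z unfolding H_def k_def U_def by (rule poisson_kernel_deficit[OF e(2) \<alpha>])
  have kb: "\<bar>k n z\<bar> \<le> 1 / (2 * e n)" for n z
    unfolding k_def using poisson_kernel_bound[OF e(2), of n z] poisson_kernel_nonneg[of "e n" z] by simp
  have LI: "(LBINT r:{0..t}. G n (X r \<omega>) - \<gamma> * k n (X r \<omega>) - \<gamma> * H n (X r \<omega>))
     = (LBINT r:{0..t}. G n (X r \<omega>)) - \<gamma> * (LBINT r:{0..t}. k n (X r \<omega>)) - \<gamma> * (LBINT r:{0..t}. H n (X r \<omega>))" for n \<omega>
  proof -
    note [measurable] = pth.x_meas[of \<omega>] Gm[of n] Hm[of n]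
    have i: "set_integrable lborel {0..t} (\<lambda>r. G n (X r \<omega>))" "set_integrable lborel {0..t} (\<lambda>r. k n (X r \<omega>))" "set_integrable lborel {0..t} (\<lambda>r. H n (X r \<omega>))"
      by (rule set_integrable_bounded[OF _ Gb] set_integrable_bounded[OF _ kb] set_integrable_bounded[OF _ Hb]; measurable)+
    then have i': "set_integrable lborel {0..t} (\<lambda>r. \<gamma> * k n (X r \<omega>))" "set_integrable lborel {0..t} (\<lambda>r. \<gamma>
      * H n (X r \<omega>))" by auto
    show ?thesis
      unfolding set_integral_diff(2)[OF set_integral_diff(1)[OF i(1) i'(1)] i'(2)] set_integral_diff(2)[OF i(1) i'(1)] set_integral_mult_right ..
  qed
  have ELI: "integrable M (\<lambda>\<omega>. LBINT r:{0..t}. G n (X r \<omega>))" "integrable M (\<lambda>\<omega>. LBINT r:{0..t}. k n (X r \<omega>))" "integrable M (\<lambda>\<omega>. LBINT r:{0..t}. H n (X r \<omega>))" for n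
    by (rule tail_integral_integrable[OF Gm Gb t] tail_integral_integrable[OF Hm Hb t] tail_integral_integrable[OF _ kb t]; measurable)+
  have eqn: "(\<integral>\<omega>. U n (X t \<omega>) \<partial>M) - exp (- \<gamma> * e n)
     = (\<integral>\<omega>. (LBINT r:{0..t}. G n (X r \<omega>)) \<partial>M) - \<gamma> * (\<integral>\<omega>. (LBINT r:{0..t}. k n (X r \<omega>)) \<partial>M) - \<gamma> * (\<integral>\<omega>. (LBINT r:{0..t}. H n (X r \<omega>)) \<partial>M)
       + \<alpha> * exp (- \<gamma> * e n) * (\<beta> * (\<integral>\<omega>. L t \<omega> \<partial>M))" for n
  proof -
    obtain K where K: "C3_bounded (U n) (\<lambda>x. p n x * U n x) (\<lambda>x. ((p n x)\<^sup>2 - 2 * \<gamma> * k n x) * U n x) K"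
      using C3_bounded_exp_hyp[OF e(2) \<alpha>, of n] unfolding U_def p_def k_def by blast
    have "(\<integral>\<omega>. 1 * (U n (X t \<omega>) - U n (X 0 \<omega>)) \<partial>M)
      = (\<integral>\<omega>. 1 * (LBINT r:{0..t}. ((p n (X r \<omega>))\<^sup>2 - 2 * \<gamma> * k n (X r \<omega>)) * U n (X r \<omega>) / 2 + p n (X r \<omega>) * U n (X r \<omega>) * mu (X r \<omega>)) \<partial>M)
        + p n 0 * U n 0 * (\<integral>\<omega>. 1 * (\<beta> * (L t \<omega> - L 0 \<omega>)) \<partial>M)"
      by (rule ito_expectation[OF K order_refl t, of "\<lambda>_. 1" 1]) auto
    moreover have "((p n z)\<^sup>2 - 2 * \<gamma> * k n z) * U n z / 2 + p n z * U n z * mu z = G n z - \<gamma> * k n z - \<gamma> * H n z" for z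
      by (simp add: G_def H_def algebra_simps diff_divide_distrib add_divide_distrib)
    moreover have U0: "U n 0 = exp (- \<gamma> * e n)" using e(2)[of n] by (simp add: U_def exp_hyp_def)
    moreover have "p n 0 = \<alpha>" by (simp add: p_def hyp_slope_def)
    moreover have "(\<integral>\<omega>. 1 * (U n (X t \<omega>) - U n (X 0 \<omega>)) \<partial>M) = (\<integral>\<omega>. U n (X t \<omega>) \<partial>M) - exp (- \<gamma> * e n)"
    proof -
      have [measurable]: "X t \<in> borel_measurable M" by (rule X_measurable)
      have "integrable M (\<lambda>\<omega>. U n (X t \<omega>))" by (rule integrable_const_bound[where B=1]) (use Ub in auto)
      then show ?thesis using pth.x0 U0 by (simp add: prob_space)
    qed
    moreover have "(\<integral>\<omega>. 1 * (\<beta> * (L t \<omega> - L 0 \<omega>)) \<partial>M) = \<beta> * (\<integral>\<omega>. L t \<omega> \<partial>M)"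
    proof -
      have "1 * (\<beta> * (L t \<omega> - L 0 \<omega>)) = \<beta> * L t \<omega>" for \<omega> using beta_L_zero[of \<omega>] by (simp add: right_diff_distrib)
      then show ?thesis by (simp only: integral_mult_right_zero)
    qed
    moreover have "(\<integral>\<omega>. (LBINT r:{0..t}. G n (X r \<omega>)) - \<gamma> * (LBINT r:{0..t}. k n (X r \<omega>)) - \<gamma>
      * (LBINT r:{0..t}. H n (X r \<omega>)) \<partial>M)
      = (\<integral>\<omega>. (LBINT r:{0..t}. G n (X r \<omega>)) \<partial>M) - \<gamma> * (\<integral>\<omega>. (LBINT r:{0..t}. k n (X r \<omega>)) \<partial>M) - \<gamma> * (\<integral>\<omega>. (LBINT r:{0..t}. H n (X r \<omega>)) \<partial>M)"
      using ELI[of n]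
        by (simp only: Bochner_Integration.integral_diff Bochner_Integration.integrable_diff integrable_mult_right integral_mult_right_zero)
    ultimately show ?thesis by (simp only: LI mult_1)
  qed
  have l1: "(\<lambda>n. \<integral>\<omega>. U n (X t \<omega>) \<partial>M) \<longlonglongrightarrow> (\<integral>\<omega>. exp_tent \<alpha> \<gamma> (X t \<omega>) \<partial>M)"
  proof (rule integral_dominated_convergence[where w="\<lambda>_. 1"])
    have [measurable]: "X t \<in> borel_measurable M" by (rule X_measurable)
    show "(\<lambda>\<omega>. exp_tent \<alpha> \<gamma> (X t \<omega>)) \<in> borel_measurable M" "(\<lambda>\<omega>. U n (X t \<omega>)) \<in> borel_measurable M" for n
      unfolding exp_tent_def by measurable
  qed (use Ub exp_hyp_limits(1)[OF e] in \<open>auto simp: U_def\<close>)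
  have l2: "(\<lambda>n. \<integral>\<omega>. (LBINT r:{0..t}. G n (X r \<omega>)) \<partial>M) \<longlonglongrightarrow> (\<integral>\<omega>. (LBINT r:{0..t}. kinked_generator \<alpha> \<gamma> (X r \<omega>)) \<partial>M)"
  proof (rule time_expectation_tendsto[OF Gm kinked_generator_measurable Gb _ _ t])
    show "\<bar>kinked_generator \<alpha> \<gamma> z\<bar> \<le> (2 * \<gamma>)\<^sup>2 / 2 + 2 * \<gamma> * c" for z unfolding c_def
      by (rule kinked_generator_bound[OF \<alpha>])
    show "(\<lambda>n. G n z) \<longlonglongrightarrow> kinked_generator \<alpha> \<gamma> z" if "z \<noteq> 0" for z
      unfolding G_def kinked_generator_def p_def U_def by (intro tendsto_intros exp_hyp_limits[OF e] that) simp
  qed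
  have l3: "(\<lambda>n. \<integral>\<omega>. (LBINT r:{0..t}. k n (X r \<omega>)) \<partial>M) \<longlonglongrightarrow> (\<integral>\<omega>. L t \<omega> \<partial>M)"
    using local_time_expectation(2)[OF t] unfolding k_def e_def .
  have l4: "(\<lambda>n. \<integral>\<omega>. (LBINT r:{0..t}. H n (X r \<omega>)) \<partial>M) \<longlonglongrightarrow> (\<integral>\<omega>. (LBINT r:{0..t}. (\<lambda>_. 0) (X r \<omega>)) \<partial>M)"
  proof (rule time_expectation_tendsto[OF Hm _ Hb _ _ t])
    show "(\<lambda>n. H n z) \<longlonglongrightarrow> 0" if "z \<noteq> 0" for z
      using tendsto_mult[OF exp_hyp_limits(3)[OF e that] tendsto_diff[OF exp_hyp_limits(1)[OF e, of \<alpha> \<gamma> z] tendsto_const[of 1]]]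
      by (simp add: H_def k_def U_def)
  qed (use \<gamma> in auto)
  have l5: "(\<lambda>n. exp (- \<gamma> * e n)) \<longlonglongrightarrow> exp (- \<gamma> * 0)" by (intro tendsto_intros e)
  have "(\<lambda>n. (\<integral>\<omega>. U n (X t \<omega>) \<partial>M) - exp (- \<gamma> * e n)) \<longlonglongrightarrow> (\<integral>\<omega>. exp_tent \<alpha> \<gamma> (X t \<omega>) \<partial>M) - exp (- \<gamma> * 0)"
    by (intro tendsto_diff l1 l5)
  moreover have "(\<lambda>n. (\<integral>\<omega>. U n (X t \<omega>) \<partial>M) - exp (- \<gamma> * e n)) \<longlonglongrightarrow>
    (\<integral>\<omega>. (LBINT r:{0..t}. kinked_generator \<alpha> \<gamma> (X r \<omega>)) \<partial>M) - \<gamma> * (\<integral>\<omega>. L t \<omega> \<partial>M) - \<gamma> * (\<integral>\<omega>. (LBINT r:{0..t}. (\<lambda>_. 0) (X r \<omega>)) \<partial>M)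
       + \<alpha> * exp (- \<gamma> * 0) * (\<beta> * (\<integral>\<omega>. L t \<omega> \<partial>M))"
    unfolding eqn by (intro tendsto_intros l2 l3 l4 e(1))
  ultimately have "(\<integral>\<omega>. exp_tent \<alpha> \<gamma> (X t \<omega>) \<partial>M) - exp (- \<gamma> * 0)
    = (\<integral>\<omega>. (LBINT r:{0..t}. kinked_generator \<alpha> \<gamma> (X r \<omega>)) \<partial>M) - \<gamma> * (\<integral>\<omega>. L t \<omega> \<partial>M) - \<gamma> * (\<integral>\<omega>. (LBINT r:{0..t}. (\<lambda>_. 0) (X r \<omega>)) \<partial>M)
       + \<alpha> * exp (- \<gamma> * 0) * (\<beta> * (\<integral>\<omega>. L t \<omega> \<partial>M))"
    by (rule LIMSEQ_unique)
  moreover have "(\<integral>\<omega>. (LBINT r:{0..t}. kinked_generator \<alpha> \<gamma> (X r \<omega>)) \<partial>M)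
    = (LBINT r:{0..t}. (\<integral>\<omega>. kinked_generator \<alpha> \<gamma> (X r \<omega>) \<partial>M))"
    by (rule expectation_time_integral(1)[where g="\<lambda>r \<omega>. kinked_generator \<alpha> \<gamma> (X r \<omega>)", OF X_joint_comp kinked_generator_bound[OF \<alpha>]]) measurable
  ultimately show ?thesis by (simp add: algebra_simps)
qed

section \<open>The resolvent and the law\<close>

text \<open>The zero set of every path is a Lebesgue null set; Fubini exchanges the roles of time
  and outcome, at the price of an exceptional set of times.\<close>

lemma time_at_zero_AE: "AE t in lborel. 0 < t \<longrightarrow> (AE \<omega> in M. X t \<omega> \<noteq> 0)"
proof -
  let ?I = "indicator {0} :: real \<Rightarrow> real"
  have Ij: "(\<lambda>(r, \<omega>). ?I (X r \<omega>)) \<in> borel_measurable (lborel \<Otimes>\<^sub>M M)" by (rule X_joint_comp) measurable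
  have Ib: "\<bar>?I z\<bar> \<le> 1" for z by (simp add: indicator_def)
  define f where "f r = (\<integral>\<omega>. ?I (X r \<omega>) \<partial>M)" for r
  have fm [measurable]: "f \<in> borel_measurable borel"
    unfolding f_def[abs_def] by (rule expectation_time_integral(2)[where g="\<lambda>r \<omega>. ?I (X r \<omega>)", OF Ij Ib])
  have fb: "\<bar>f r\<bar> \<le> 1" for r
    unfolding f_def by (rule expectation_time_integral(3)[where g="\<lambda>r \<omega>. ?I (X r \<omega>)", OF Ij Ib])
  have f0: "0 \<le> f r" for r unfolding f_def by (rule integral_nonneg_AE) simp
  have zero: "AE r in lborel. r \<in> {0..T} \<longrightarrow> f r = 0" if T: "0 \<le> T" for T
  proof -
    have "(LBINT r:{0..T}. ?I (X r \<omega>)) = 0" for \<omega>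
      unfolding set_lebesgue_integral_def
    proof (rule integral_eq_zero_AE)
      show "AE r in lborel. indicator {0..T} r *\<^sub>R ?I (X r \<omega>) = 0"
        using local_time_zero_AE[OF pth.x_cont pth.lt[OF T], of \<omega>] by eventually_elim (auto simp: indicator_def)
    qed
    then have "(LBINT r:{0..T}. f r) = 0"
      unfolding f_def expectation_time_integral(1)[where g="\<lambda>r \<omega>. ?I (X r \<omega>)", OF Ij Ib, symmetric] by simp
    moreover have "integrable lborel (\<lambda>r. indicator {0..T} r *\<^sub>R f r)"
      using set_integrable_bounded[OF fm fb] unfolding set_integrable_def .
    ultimately have "AE r in lborel. indicator {0..T} r *\<^sub>R f r = 0"
      unfolding set_lebesgue_integral_def using f0 by (subst (asm) integral_nonneg_eq_0_iff_AE) auto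
    then show ?thesis by eventually_elim (auto simp: indicator_def)
  qed
  have "AE r in lborel. \<forall>n::nat. r \<in> {0..real n} \<longrightarrow> f r = 0"
    unfolding AE_all_countable by (intro allI zero) simp
  then show ?thesis
  proof eventually_elim
    case (elim t)
    show ?case
    proof
      assume t: "0 < t"
      have [measurable]: "X t \<in> borel_measurable M" by (rule X_measurable)
      obtain n where "t \<le> real n" using real_arch_simple by blast
      then have "f t = 0" using elim t by auto
      moreover have "integrable M (\<lambda>\<omega>. ?I (X t \<omega>))" by (rule integrable_const_bound[where B=1]) (use Ib in auto)
      ultimately have "AE \<omega> in M. ?I (X t \<omega>) = 0"
        unfolding f_def by (subst (asm) integral_nonneg_eq_0_iff_AE) auto
      then show "AE \<omega> in M. X t \<omega> \<noteq> 0" by eventually_elim (auto simp: indicator_def split: if_splits)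
    qed
  qed
qed

definition positive_laplace :: "real \<Rightarrow> real \<Rightarrow> real" where
  "positive_laplace \<theta> t = (\<integral>\<omega>. (if 0 < X t \<omega> then exp (- (\<theta> * X t \<omega>)) else 0) \<partial>M)"

lemma positive_laplace_measurable:
  assumes "0 < \<theta>"
  shows "positive_laplace \<theta> \<in> borel_measurable borel" "0 \<le> positive_laplace \<theta> t" "positive_laplace \<theta> t \<le> 1"
proof -
  let ?g = "\<lambda>z. if 0 < z then exp (- (\<theta> * z)) else 0 :: real"
  have j: "(\<lambda>(r, \<omega>). ?g (X r \<omega>)) \<in> borel_measurable (lborel \<Otimes>\<^sub>M M)" by (rule X_joint_comp) measurable
  have b: "\<bar>?g z\<bar> \<le> 1" for z using assms by simp
  show "positive_laplace \<theta> \<in> borel_measurable borel"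
    unfolding positive_laplace_def[abs_def] by (rule expectation_time_integral(2)[where g="\<lambda>r \<omega>. ?g (X r \<omega>)", OF j b])
  have "\<bar>positive_laplace \<theta> t\<bar> \<le> 1"
    unfolding positive_laplace_def by (rule expectation_time_integral(3)[where g="\<lambda>r \<omega>. ?g (X r \<omega>)", OF j b])
  then show "positive_laplace \<theta> t \<le> 1" by simp
  show "0 \<le> positive_laplace \<theta> t" unfolding positive_laplace_def by (rule integral_nonneg_AE) auto
qed

text \<open>The exponent on the negative half-line is chosen so that the resolvent equation there is homogeneous;
  the choice \<open>\<theta> = \<mu>p + sqrt (\<mu>p\<^sup>2 + 2 * l)\<close> on the positive half-line makes it homogeneous there too,
  and thereby determines the expected local time, which is eliminated.\<close>

lemma resolvent_positive:
  fixes \<theta> l :: real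
  assumes \<theta>: "0 < \<theta>" and l: "0 < l"
  defines "rp \<equiv> sqrt (\<mu>p\<^sup>2 + 2 * l)" and "rm \<equiv> sqrt (\<mu>m\<^sup>2 + 2 * l)"
  assumes ne: "\<theta> \<noteq> \<mu>p + rp"
  shows "(LBINT t:{0<..}. exp (- (l * t)) * positive_laplace \<theta> t)
    = 2 * (1 + \<beta>) / ((1 + \<beta>) * (\<mu>p + rp) + (1 - \<beta>) * (rm - \<mu>m)) / (\<theta> + rp - \<mu>p)"
proof -
  have sq: "rp\<^sup>2 = \<mu>p\<^sup>2 + 2 * l" "rm\<^sup>2 = \<mu>m\<^sup>2 + 2 * l" using l by (auto simp: rp_def rm_def)
  have "\<bar>\<mu>p\<bar> < rp" "\<bar>\<mu>m\<bar> < rm"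
    unfolding rp_def rm_def using l by (auto intro!: real_less_rsqrt)
  then have r: "0 < \<mu>p + rp" "0 < rm - \<mu>m" "0 < rp - \<mu>p" by auto
  \<comment> \<open>\<open>k\<close> and \<open>a\<close> are the positive roots of the
    characteristic equations \<open>kk\<close> and \<open>aa\<close>; \<open>a\<close> is also the
    positive zero of \<open>D\<close>.\<close>
  define k where "k = rm - \<mu>m"
  define a where "a = \<mu>p + rp"
  have k0: "0 < k" and a0: "0 < a" using r by (auto simp: k_def a_def)
  have kk: "k\<^sup>2 / 2 + k * \<mu>m = l" 
  proof -
    have "k\<^sup>2 + 2 * (k * \<mu>m) = 2 * l" using sq(2) by (simp add: k_def power2_eq_square algebra_simps)
    then show ?thesis by linarith
  qed
  have aa: "l + \<mu>p * a - a\<^sup>2 / 2 = 0" 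
  proof -
    have "a\<^sup>2 - 2 * (\<mu>p * a) = 2 * l" using sq(1) by (simp add: a_def power2_eq_square algebra_simps)
    then show ?thesis by linarith
  qed
  define D where "D \<theta> = l + \<mu>p * \<theta> - \<theta>\<^sup>2 / 2" for \<theta>
  \<comment> \<open>\<open>al\<close> and \<open>ga\<close> solve al - ga = - \<theta> and al + ga =
    k, the prescribed logarithmic slopes on the right and on the left.\<close>
  define al where "al \<theta> = (k - \<theta>) / 2" for \<theta>
  define ga where "ga \<theta> = (k + \<theta>) / 2" for \<theta>
  \<comment> \<open>Minus the coefficient of the expected local time in
    \<open>forward_equation\<close>.\<close>
  define w where "w \<theta> = ga \<theta> - al \<theta> * \<beta>" for \<theta>
  define A where "A \<theta> t = (\<integral>\<omega>. exp_tent (al \<theta>) (ga \<theta>) (X t \<omega>) \<partial>M)" for \<theta> t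
  define N where "N \<theta> t = (\<integral>\<omega>. kinked_generator (al \<theta>) (ga \<theta>) (X t \<omega>) \<partial>M)" for \<theta> t
  have alga: "\<bar>al \<theta>\<bar> \<le> ga \<theta>" if "0 < \<theta>" for \<theta> using that k0 by (simp add: al_def ga_def abs_le_iff)
  have w2: "w \<theta> = ((1 + \<beta>) * \<theta> + (1 - \<beta>) * k) / 2" for \<theta>
    by (simp add: w_def al_def ga_def algebra_simps diff_divide_distrib add_divide_distrib)
  have w0: "0 < w \<theta>" if "0 < \<theta>" for \<theta>
    unfolding w2 using that k0 \<beta> by (intro divide_pos_pos add_pos_pos[OF mult_pos_pos mult_pos_pos]) auto
  have tm: "exp_tent x y \<in> borel_measurable borel" for x y unfolding exp_tent_def[abs_def] by measurable
  have tb: "\<bar>exp_tent (al \<theta>) (ga \<theta>) z\<bar> \<le> 1" if "0 < \<theta>" for \<theta> z using exp_tent_bound[OF alga[OF that], of z] by simp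
  note Aj = X_joint_comp[OF tm[of "al _" "ga _"]]
  note Nj = X_joint_comp[OF kinked_generator_measurable[of "al _" "ga _"]]
  have Am: "A \<theta> \<in> borel_measurable borel" and Ab: "\<bar>A \<theta> t\<bar> \<le> 1" if "0 < \<theta>" for \<theta> t
    unfolding A_def[abs_def]
    by (rule expectation_time_integral(2)[where g="\<lambda>r \<omega>. exp_tent (al \<theta>) (ga \<theta>) (X r \<omega>)", OF Aj tb[OF that]])
       (rule expectation_time_integral(3)[where g="\<lambda>r \<omega>. exp_tent (al \<theta>) (ga \<theta>) (X r \<omega>)", OF Aj tb[OF that]])
  define C where "C \<theta> = (2 * ga \<theta>)\<^sup>2 / 2 + 2 * ga \<theta> * (\<bar>\<mu>p\<bar> + \<bar>\<mu>m\<bar>)" for \<theta>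
  have Cb: "\<bar>kinked_generator (al \<theta>) (ga \<theta>) z\<bar> \<le> C \<theta>" if "0 < \<theta>" for \<theta> z
    unfolding C_def by (rule kinked_generator_bound[OF alga[OF that]])
  have Nm: "N \<theta> \<in> borel_measurable borel" and Nb: "\<bar>N \<theta> t\<bar> \<le> C \<theta>" if "0 < \<theta>" for \<theta> t
    unfolding N_def[abs_def]
    by (rule expectation_time_integral(2)[where g="\<lambda>r \<omega>. kinked_generator (al \<theta>) (ga \<theta>) (X r \<omega>)", OF Nj Cb[OF that]])
       (rule expectation_time_integral(3)[where g="\<lambda>r \<omega>. kinked_generator (al \<theta>) (ga \<theta>) (X r \<omega>)", OF Nj Cb[OF that]])
  have fwd: "A \<theta> t = 1 + (LBINT r:{0..t}. N \<theta> r) - w \<theta> * (\<integral>\<omega>. L t \<omega> \<partial>M)" if "0 < \<theta>" "0 < t" for \<theta> t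
    using forward_equation[OF alga[OF that(1)], of t] that(2) unfolding A_def N_def w_def by (simp add: algebra_simps)
  have pt: "l * exp_tent (al \<theta>) (ga \<theta>) z - kinked_generator (al \<theta>) (ga \<theta>) z
    = D \<theta> * (if 0 < z then exp (- (\<theta> * z)) else 0)" if "z \<noteq> 0" for \<theta> z
  proof (cases "0 < z")
    case True
    have s: "al \<theta> - ga \<theta> * sgn z = - \<theta>" "al \<theta> * z - ga \<theta> * \<bar>z\<bar> = - (\<theta> * z)"
      using True by (auto simp: al_def ga_def diff_divide_distrib add_divide_distrib algebra_simps)
    show ?thesis
      unfolding kinked_generator_def exp_tent_def s D_def using True by (simp add: drift_def algebra_simps)
  next
    case False
    then have z: "z < 0" using that by simp
    have s: "al \<theta> - ga \<theta> * sgn z = k"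
      using z by (auto simp: al_def ga_def diff_divide_distrib add_divide_distrib algebra_simps)
    have "kinked_generator (al \<theta>) (ga \<theta>) z = l * exp_tent (al \<theta>) (ga \<theta>) z"
      unfolding kinked_generator_def s using z kk by (simp add: drift_def)
    then show ?thesis using False by simp
  qed
  have AN: "AE t in lborel. 0 < t \<longrightarrow> (\<forall>\<theta>>0. l * A \<theta> t - N \<theta> t = D \<theta> * positive_laplace \<theta> t)"
    using time_at_zero_AE
  proof eventually_elim
    case (elim t)
    show ?case
    proof (intro impI allI)
      fix \<theta> :: real assume t: "0 < t" and \<theta>: "0 < \<theta>"
      have Xm [measurable]: "X t \<in> borel_measurable M" by (rule X_measurable)
      note [measurable] = tm
      have i1: "integrable M (\<lambda>\<omega>. exp_tent (al \<theta>) (ga \<theta>) (X t \<omega>))"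
        by (rule integrable_const_bound[where B=1]) (use tb[OF \<theta>] in auto)
      have i2: "integrable M (\<lambda>\<omega>. kinked_generator (al \<theta>) (ga \<theta>) (X t \<omega>))"
        by (rule integrable_const_bound[where B="C \<theta>"]) (use Cb[OF \<theta>] in auto)
      have "l * A \<theta> t - N \<theta> t = (\<integral>\<omega>. l * exp_tent (al \<theta>) (ga \<theta>) (X t \<omega>) - kinked_generator (al \<theta>) (ga \<theta>) (X t \<omega>) \<partial>M)"
        unfolding A_def N_def using i1 i2 by simp
      also have "\<dots> = (\<integral>\<omega>. D \<theta> * (if 0 < X t \<omega> then exp (- (\<theta> * X t \<omega>)) else 0) \<partial>M)"
      proof (rule integral_cong_AE)
        show "AE \<omega> in M. l * exp_tent (al \<theta>) (ga \<theta>) (X t \<omega>) - kinked_generator (al \<theta>) (ga \<theta>) (X t \<omega>)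
          = D \<theta> * (if 0 < X t \<omega> then exp (- (\<theta> * X t \<omega>)) else 0)"
          using mp[OF elim t] by eventually_elim (rule pt)
      qed measurable
      also have "\<dots> = D \<theta> * positive_laplace \<theta> t" unfolding positive_laplace_def by (rule integral_mult_right_zero)
      finally show "l * A \<theta> t - N \<theta> t = D \<theta> * positive_laplace \<theta> t" .
    qed
  qed
  \<comment> \<open>In this combination the local-time contributions cancel before the Laplace
    transform is taken, so growth of the expected local time in t never has to be controlled; the
    combination itself is bounded.\<close>
  define AA where "AA t = w a * A \<theta> t - w \<theta> * A a t" for t
  define NN where "NN t = w a * N \<theta> t - w \<theta> * N a t" for t
  have "(LBINT t:{0<..}. exp (- (l * t)) * (l * AA t - NN t)) = w a - w \<theta>"
  proof (rule laplace_of_primitive[OF _ _ l])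
    note [measurable] = Am[OF \<theta>] Am[OF a0] Nm[OF \<theta>] Nm[OF a0]
    show "NN \<in> borel_measurable borel" "AA \<in> borel_measurable borel"
      unfolding NN_def[abs_def] AA_def[abs_def] by measurable
    show "\<bar>NN r\<bar> \<le> w a * C \<theta> + w \<theta> * C a" for r
    proof -
      have "\<bar>w a * N \<theta> r\<bar> \<le> w a * C \<theta>" "\<bar>w \<theta> * N a r\<bar> \<le> w \<theta> * C a"
        using Nb[OF \<theta>, of r] Nb[OF a0, of r] w0[OF \<theta>] w0[OF a0] by (auto simp: abs_mult intro!: mult_left_mono)
      then show ?thesis unfolding NN_def by linarith
    qed
    show "\<bar>AA r\<bar> \<le> w a * 1 + w \<theta> * 1" for r
    proof -
      have "\<bar>w a * A \<theta> r\<bar> \<le> w a * 1" "\<bar>w \<theta> * A a r\<bar> \<le> w \<theta> * 1"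
        using Ab[OF \<theta>, of r] Ab[OF a0, of r] w0[OF \<theta>] w0[OF a0] by (auto simp: abs_mult intro!: mult_left_le)
      then show ?thesis unfolding AA_def by linarith
    qed
    show "AA t = w a - w \<theta> + (LBINT r:{0..t}. NN r)" if t: "0 < t" for t
    proof -
      have i: "set_integrable lborel {0..t} (\<lambda>r. w a * N \<theta> r)" "set_integrable lborel {0..t} (\<lambda>r. w \<theta> * N a r)"
        using set_integrable_bounded[OF Nm[OF \<theta>] Nb[OF \<theta>]] set_integrable_bounded[OF Nm[OF a0] Nb[OF a0]] by auto
      have "(LBINT r:{0..t}. NN r) = w a * (LBINT r:{0..t}. N \<theta> r) - w \<theta> * (LBINT r:{0..t}. N a r)"
        unfolding NN_def set_integral_diff(2)[OF i] set_integral_mult_right ..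
      then show ?thesis unfolding AA_def fwd[OF \<theta> t] fwd[OF a0 t] by (simp add: algebra_simps)
    qed
  qed
  moreover have "(LBINT t:{0<..}. exp (- (l * t)) * (l * AA t - NN t))
    = (LBINT t:{0<..}. (w a * D \<theta>) * (exp (- (l * t)) * positive_laplace \<theta> t))"
    unfolding set_lebesgue_integral_def
  proof (rule integral_cong_AE)
    note [measurable] = Am[OF \<theta>] Am[OF a0] Nm[OF \<theta>] Nm[OF a0] positive_laplace_measurable(1)[OF \<theta>]
    show "(\<lambda>t. indicator {0<..} t *\<^sub>R (exp (- (l * t)) * (l * AA t - NN t))) \<in> borel_measurable lborel"
      "(\<lambda>t. indicator {0<..} t *\<^sub>R ((w a * D \<theta>) * (exp (- (l * t)) * positive_laplace \<theta> t))) \<in> borel_measurable lborel"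
      unfolding AA_def NN_def by measurable
    show "AE t in lborel. indicator {0<..} t *\<^sub>R (exp (- (l * t)) * (l * AA t - NN t))
      = indicator {0<..} t *\<^sub>R ((w a * D \<theta>) * (exp (- (l * t)) * positive_laplace \<theta> t))"
      using AN
    proof eventually_elim
      case (elim t)
      show ?case
      proof (cases "0 < t")
        case True
        have "l * AA t - NN t = w a * (l * A \<theta> t - N \<theta> t) - w \<theta> * (l * A a t - N a t)"
          by (simp add: AA_def NN_def algebra_simps)
        also have "\<dots> = w a * (D \<theta> * positive_laplace \<theta> t)"
          using elim True \<theta> a0 aa by (simp add: D_def)
        finally show ?thesis by simp
      qed simp
    qed
  qed
  ultimately have eq: "w a * D \<theta> * (LBINT t:{0<..}. exp (- (l * t)) * positive_laplace \<theta> t) = w a - w \<theta>"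
    unfolding set_integral_mult_right by simp
  \<comment> \<open>The other zero of \<open>D\<close> is -b, which factorises
    \<open>D \<theta>\<close>. The common factor a - \<theta> can then be cancelled; at \<theta> = a
    the identity would read 0 = 0.\<close>
  define b where "b = rp - \<mu>p"
  have Dt: "D \<theta> = (a - \<theta>) * (\<theta> + b) / 2"
  proof -
    have l1: "l = a * b / 2" using sq(1) by (simp add: a_def b_def power2_eq_square algebra_simps)
    have m1: "\<mu>p = (a - b) / 2" by (simp add: a_def b_def)
    show ?thesis unfolding D_def by (subst l1, subst m1) (simp add: power2_eq_square field_simps)
  qed
  have ww: "w a - w \<theta> = (1 + \<beta>) * (a - \<theta>) / 2" by (simp add: w2 field_simps)
  have wa: "(1 + \<beta>) * (\<mu>p + rp) + (1 - \<beta>) * (rm - \<mu>m) = 2 * w a" by (simp add: w2 a_def k_def)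
  have nz: "a - \<theta> \<noteq> 0" "\<theta> + b > 0" "w a > 0" using ne r \<theta> w0[OF a0] by (auto simp: a_def b_def)
  define J where "J = (LBINT t:{0<..}. exp (- (l * t)) * positive_laplace \<theta> t)"
  have "(a - \<theta>) * (w a * (\<theta> + b) * J) = (a - \<theta>) * (1 + \<beta>)"
    using eq unfolding ww Dt J_def[symmetric] by (simp add: field_simps)
  then have "w a * (\<theta> + b) * J = 1 + \<beta>" using nz(1) by simp
  moreover have "w a * (\<theta> + b) \<noteq> 0" using nz by simp
  ultimately have "J = (1 + \<beta>) / (w a * (\<theta> + b))" by (metis nonzero_mult_div_cancel_left)
  then have "J = (1 + \<beta>) / (w a) / (\<theta> + b)" by simp
  then have "J = 2 * (1 + \<beta>) / (2 * w a) / (\<theta> + b)"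
    by (subst mult_divide_mult_cancel_left) simp_all
  then show ?thesis unfolding wa J_def b_def by (simp add: add_diff_eq)
qed

lemma resolvent_positive_nn:
  fixes \<theta> l :: real
  assumes \<theta>: "0 < \<theta>" and l: "0 < l" and ne: "\<theta> \<noteq> \<mu>p + sqrt (\<mu>p\<^sup>2 + 2 * l)"
  shows "(\<integral>\<^sup>+t\<in>{0<..}. ennreal (exp (- (l * t))) * ennreal (positive_laplace \<theta> t) \<partial>lborel)
    = (\<integral>\<^sup>+t\<in>{0<..}. ennreal (exp (- (l * t))) * (\<integral>\<^sup>+y\<in>{0<..}. ennreal (exp (- (\<theta> * y))) * half_density \<beta> \<mu>p \<mu>m t y \<partial>lborel) \<partial>lborel)"
    and "(\<integral>\<^sup>+t\<in>{0<..}. ennreal (exp (- (l * t))) * ennreal (positive_laplace \<theta> t) \<partial>lborel) < \<infinity>"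
proof -
  note pl = positive_laplace_measurable[OF \<theta>]
  have nn: "(\<integral>\<^sup>+t. ennreal (indicator {0<..} t *\<^sub>R (exp (- (l * t)) * positive_laplace \<theta> t)) \<partial>lborel)
      = (\<integral>\<^sup>+t\<in>{0<..}. ennreal (exp (- (l * t))) * ennreal (positive_laplace \<theta> t) \<partial>lborel)"
    using pl(2) by (intro nn_integral_cong) (auto simp: indicator_def ennreal_mult)
  have "(\<integral>\<^sup>+t\<in>{0<..}. ennreal (exp (- (l * t))) * ennreal (positive_laplace \<theta> t) \<partial>lborel)
    \<le> (\<integral>\<^sup>+t\<in>{0<..}. ennreal (exp (- (l * t))) \<partial>lborel)"
  proof (intro nn_integral_mono)
    fix t
    have "ennreal (exp (- (l * t))) * ennreal (positive_laplace \<theta> t) \<le> ennreal (exp (- (l * t))) * 1"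
      using pl(3)[of t] by (intro mult_left_mono) auto
    then show "ennreal (exp (- (l * t))) * ennreal (positive_laplace \<theta> t) * indicator {0<..} t
      \<le> ennreal (exp (- (l * t))) * indicator {0<..} t"
      by (auto simp: indicator_def)
  qed
  also have "\<dots> < \<infinity>" unfolding nn_integral_exp_Ioi[OF l] by simp
  finally show fin: "(\<integral>\<^sup>+t\<in>{0<..}. ennreal (exp (- (l * t))) * ennreal (positive_laplace \<theta> t) \<partial>lborel) < \<infinity>" .
  have int: "integrable lborel (\<lambda>t. indicator {0<..} t *\<^sub>R (exp (- (l * t)) * positive_laplace \<theta> t))"
    using fin pl unfolding nn[symmetric] by (intro integrableI_nonneg) auto
  have "\<mu>p < sqrt (\<mu>p\<^sup>2 + 2 * l)" using l by (intro real_less_rsqrt) simp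
  then have th: "0 < \<theta> + sqrt (\<mu>p\<^sup>2 + 2 * l) - \<mu>p" using \<theta> by simp
  have "(\<integral>\<^sup>+t\<in>{0<..}. ennreal (exp (- (l * t))) * ennreal (positive_laplace \<theta> t) \<partial>lborel)
    = ennreal (LBINT t:{0<..}. exp (- (l * t)) * positive_laplace \<theta> t)"
    unfolding nn[symmetric] set_lebesgue_integral_def using pl(2) by (intro nn_integral_eq_integral[OF int]) auto
  also have "\<dots>
    = (\<integral>\<^sup>+t\<in>{0<..}. ennreal (exp (- (l * t))) * (\<integral>\<^sup>+y\<in>{0<..}. ennreal (exp (- (\<theta> * y))) * half_density \<beta> \<mu>p \<mu>m t y \<partial>lborel) \<partial>lborel)"
    unfolding resolvent_positive[OF \<theta> l ne] laplace_half_density[OF \<beta> l th] ..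
  finally show "(\<integral>\<^sup>+t\<in>{0<..}. ennreal (exp (- (l * t))) * ennreal (positive_laplace \<theta> t) \<partial>lborel)
    = (\<integral>\<^sup>+t\<in>{0<..}. ennreal (exp (- (l * t))) * (\<integral>\<^sup>+y\<in>{0<..}. ennreal (exp (- (\<theta> * y))) * half_density \<beta> \<mu>p \<mu>m t y \<partial>lborel) \<partial>lborel)" .
qed

lemma positive_laplace_AE:
  assumes \<theta>: "0 < \<theta>"
  shows "AE t in lborel. 0 < t \<longrightarrow> ennreal (positive_laplace \<theta> t)
    = (\<integral>\<^sup>+y\<in>{0<..}. ennreal (exp (- (\<theta> * y))) * half_density \<beta> \<mu>p \<mu>m t y \<partial>lborel)"
proof -
  \<comment> \<open>Large enough that \<theta> stays strictly below the excluded value \<mu>p +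
    sqrt(\<mu>p^2 + 2 (l + n)) for every n.\<close>
  define l where "l = (\<theta> + \<bar>\<mu>p\<bar>)\<^sup>2 + 1"
  have l0: "0 < l + real n" for n by (simp add: l_def add_pos_nonneg add_nonneg_pos)
  have ne: "\<theta> \<noteq> \<mu>p + sqrt (\<mu>p\<^sup>2 + 2 * (l + real n))" for n
  proof -
    have "\<theta> + \<bar>\<mu>p\<bar> < sqrt (\<mu>p\<^sup>2 + 2 * (l + real n))"
    proof (rule real_less_rsqrt)
      have "(\<theta> + \<bar>\<mu>p\<bar>)\<^sup>2 < l + real n" by (simp add: l_def)
      also have "\<dots> \<le> 2 * (l + real n)" using l0[of n] by simp
      also have "\<dots> \<le> \<mu>p\<^sup>2 + 2 * (l + real n)" by simp
      finally show "(\<theta> + \<bar>\<mu>p\<bar>)\<^sup>2 < \<mu>p\<^sup>2 + 2 * (l + real n)" .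
    qed
    then show ?thesis by linarith
  qed
  note [measurable] = positive_laplace_measurable(1)[OF \<theta>]
  show ?thesis
    by (rule laplace_unique_AE[where l=l])
       (use resolvent_positive_nn[OF \<theta> l0 ne] resolvent_positive_nn(2)[OF \<theta> l0[of 0] ne[of 0]] in \<open>simp_all\<close>)
qed

text \<open>Integer exponents suffice, so the exceptional times form one null set. The exponents
  start at 1 because \<theta> has to be positive; the weight exp(-y) on both measures absorbs this
  shift and is divided out at the end.\<close>

lemma positive_part_law:
  "AE t in lborel. 0 < t \<longrightarrow> (\<forall>A\<in>sets borel. A \<subseteq> {0<..} \<longrightarrow>
     emeasure (distr M borel (X t)) A = (\<integral>\<^sup>+y. indicator A y * half_density \<beta> \<mu>p \<mu>m t y \<partial>lborel))"
proof -
  have "AE t in lborel. \<forall>n::nat. 0 < t \<longrightarrow> ennreal (positive_laplace (real n + 1) t)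
    = (\<integral>\<^sup>+y\<in>{0<..}. ennreal (exp (- ((real n + 1) * y))) * half_density \<beta> \<mu>p \<mu>m t y \<partial>lborel)"
    unfolding AE_all_countable by (intro allI positive_laplace_AE) simp
  then show ?thesis
  proof eventually_elim
    case (elim t)
    show ?case
    proof (intro impI ballI)
      fix A :: "real set" assume t: "0 < t" and A [measurable]: "A \<in> sets borel" and A0: "A \<subseteq> {0<..}"
      have [measurable]: "X t \<in> borel_measurable M" by (rule X_measurable)
      define P where "P = distr M borel (X t)"
      have [measurable_cong]: "sets P = sets borel" by (simp add: P_def)
      define q where "q = half_density \<beta> \<mu>p \<mu>m t"
      have [measurable]: "q \<in> borel_measurable borel" unfolding q_def by measurable
      define F where "F y = ennreal (exp (- y)) * indicator {0<..} y" for y :: real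
      have [measurable]: "F \<in> borel_measurable borel" unfolding F_def by measurable
      have e: "ennreal (exp (- (real n * y))) * (ennreal (exp (- y)) * z)
        = ennreal (exp (- ((real n + 1) * y))) * z" for n y z
        by (simp add: mult.assoc[symmetric] ennreal_mult[symmetric] exp_add[symmetric] algebra_simps)
      have LP: "(\<integral>\<^sup>+y. ennreal (exp (- (real n * y))) * F y \<partial>P) = ennreal (positive_laplace (real n + 1) t)" for n
      proof -
        have i: "integrable M (\<lambda>\<omega>. if 0 < X t \<omega> then exp (- ((real n + 1) * X t \<omega>)) else 0)"
          by (rule integrable_const_bound[where B=1]) auto
        have "(\<integral>\<^sup>+y. ennreal (exp (- (real n * y))) * F y \<partial>P)
          = (\<integral>\<^sup>+\<omega>. ennreal (if 0 < X t \<omega> then exp (- ((real n + 1) * X t \<omega>)) else 0) \<partial>M)"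
          unfolding P_def by (subst nn_integral_distr) (auto simp: F_def e intro!: nn_integral_cong)
        also have "\<dots> = ennreal (positive_laplace (real n + 1) t)"
          unfolding positive_laplace_def by (rule nn_integral_eq_integral[OF i]) simp
        finally show ?thesis .
      qed
      have LQ: "(\<integral>\<^sup>+y. ennreal (exp (- (real n * y))) * (F y * q y) \<partial>lborel)
        = ennreal (positive_laplace (real n + 1) t)" for n
      proof -
        have "(\<integral>\<^sup>+y. ennreal (exp (- (real n * y))) * (F y * q y) \<partial>lborel)
          = (\<integral>\<^sup>+y\<in>{0<..}. ennreal (exp (- ((real n + 1) * y))) * q y \<partial>lborel)"
          by (intro nn_integral_cong) (auto simp: F_def indicator_def e)
        then show ?thesis using elim t unfolding q_def by simp
      qed
      have "density P F = density lborel (\<lambda>y. F y * q y)"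
      proof (rule laplace_unique_measure)
        show "finite_borel_measure (density P F)" "finite_borel_measure (density lborel (\<lambda>y. F y * q y))"
          using LP[of 0] LQ[of 0]
          by (auto intro!: finite_borel_measure.intro finite_measureI simp: emeasure_density finite_borel_measure_axioms_def P_def)
        show "AE y in density P F. 0 \<le> y" "AE y in density lborel (\<lambda>y. F y * q y). 0 \<le> y"
          by (subst AE_density, simp, auto simp: F_def indicator_def)+
        show "(\<integral>y. exp (- (real n * y)) \<partial>density P F)
          = (\<integral>y. exp (- (real n * y)) \<partial>density lborel (\<lambda>y. F y * q y))" for n
        proof (subst (1 2) integral_eq_nn_integral)
          have "(\<integral>\<^sup>+y. ennreal (exp (- (real n * y))) \<partial>density P F)
            = (\<integral>\<^sup>+y. ennreal (exp (- (real n * y))) \<partial>density lborel (\<lambda>y. F y * q y))"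
            using LP[of n] LQ[of n] by (subst (1 2) nn_integral_density) (simp_all add: mult.commute)
          then show "enn2real (\<integral>\<^sup>+y. ennreal (exp (- (real n * y))) \<partial>density P F)
            = enn2real (\<integral>\<^sup>+y. ennreal (exp (- (real n * y))) \<partial>density lborel (\<lambda>y. F y * q y))"
            by simp
        qed auto
      qed
      then have "(\<integral>\<^sup>+y. ennreal (exp y) * indicator A y \<partial>density P F)
        = (\<integral>\<^sup>+y. ennreal (exp y) * indicator A y \<partial>density lborel (\<lambda>y. F y * q y))"
        by simp
      moreover have "(\<integral>\<^sup>+y. ennreal (exp y) * indicator A y \<partial>density P F) = emeasure P A"
      proof -
        have "F y * (ennreal (exp y) * indicator A y) = indicator A y" for y
          using A0 by (auto simp: F_def indicator_def ennreal_mult[symmetric] exp_minus)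
        then show ?thesis by (subst nn_integral_density) auto
      qed
      moreover have "(\<integral>\<^sup>+y. ennreal (exp y) * indicator A y \<partial>density lborel (\<lambda>y. F y * q y))
        = (\<integral>\<^sup>+y. indicator A y * q y \<partial>lborel)"
      proof -
        have "F y * q y * (ennreal (exp y) * indicator A y) = indicator A y * q y" for y
        proof -
          have "F y * (ennreal (exp y) * indicator A y) = indicator A y"
            using A0 by (auto simp: F_def indicator_def ennreal_mult[symmetric] exp_minus)
          then show ?thesis by (metis mult.assoc mult.commute)
        qed
        then show ?thesis by (subst nn_integral_density) auto
      qed
      ultimately show "emeasure (distr M borel (X t)) A = (\<integral>\<^sup>+y. indicator A y * half_density \<beta> \<mu>p \<mu>m t y \<partial>lborel)"
        by (simp add: P_def q_def)
    qed
  qed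
qed

end

section \<open>Reflection, and the law at every time\<close>

lemma skew_path_uminus:
  assumes "skew_path x b l \<beta> \<mu>p \<mu>m"
  shows "skew_path (\<lambda>t. - x t) (\<lambda>t. - b t) l (- \<beta>) (- \<mu>m) (- \<mu>p)"
proof -
  interpret skew_path x b l \<beta> \<mu>p \<mu>m by fact
  have d: "drift (- \<mu>m) (- \<mu>p) (- z) = - drift \<mu>p \<mu>m z" for z by (simp add: drift_def)
  show ?thesis
  proof
    \<comment> \<open>The occupation window is symmetric about the level, so reflection leaves the
      local time unchanged and only the sign of its coefficient flips; the two drifts trade
      sides.\<close>
    show "has_symmetric_local_time (\<lambda>t. - x t) t 0 (l t)" if "0 \<le> t" for t
      using lt[OF that] by (simp add: has_symmetric_local_time_def)
    show "- x t = - b t + - \<beta> * l t + (LBINT s:{0..t}. drift (- \<mu>m) (- \<mu>p) (- x s))" if "0 \<le> t" for t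
      using eq[OF that] unfolding d by (simp add: set_lebesgue_integral_def)
  qed (auto simp: x0 b0 intro!: continuous_intros x_cont b_cont)
qed

lemma (in refracted) refracted_uminus:
  "refracted M F (\<lambda>t \<omega>. - X t \<omega>) (\<lambda>t \<omega>. - B t \<omega>) L (- \<beta>) (- \<mu>m) (- \<mu>p)"
proof (intro refracted.intro refracted_axioms.intro)
  show "skew_path (\<lambda>t. - X t \<omega>) (\<lambda>t. - B t \<omega>) (\<lambda>t. L t \<omega>) (- \<beta>) (- \<mu>m) (- \<mu>p)" for \<omega>
    by (rule skew_path_uminus[OF path])
  fix s t :: real assume st: "0 \<le> s" "s < t"
  have sw: "- B t \<omega> - - B s \<omega> = - (B t \<omega> - B s \<omega>)" for \<omega> by simp
  show "integrable M (\<lambda>\<omega>. (- B t \<omega> - - B s \<omega>) ^ k)" for k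
  proof -
    have "(- B t \<omega> - - B s \<omega>) ^ k = (- 1) ^ k * (B t \<omega> - B s \<omega>) ^ k" for \<omega>
      unfolding sw by (metis power_minus)
    then show ?thesis using incr_integrable[OF st, of k] by simp
  qed
  show "(\<integral>\<omega>. Z \<omega> * (- B t \<omega> - - B s \<omega>) \<partial>M) = 0" if "Z \<in> borel_measurable (F s)" "\<And>\<omega>. \<bar>Z \<omega>\<bar> \<le> K" for Z K
    using incr_1[OF st that] unfolding sw mult_minus_right Bochner_Integration.integral_minus by (simp only: minus_zero)
  show "(\<integral>\<omega>. Z \<omega> * (- B t \<omega> - - B s \<omega>)\<^sup>2 \<partial>M)
    = (t - s) * (\<integral>\<omega>. Z \<omega> \<partial>M)" if "Z \<in> borel_measurable (F s)" "\<And>\<omega>. \<bar>Z \<omega>\<bar> \<le> K" for Z K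
  proof -
    have "(- B t \<omega> - - B s \<omega>)\<^sup>2 = (B t \<omega> - B s \<omega>)\<^sup>2" for \<omega> unfolding sw by (rule power2_minus)
    then show ?thesis using incr_2[OF st that] by (simp only:)
  qed
  show "(\<integral>\<omega>. (- B t \<omega> - - B s \<omega>) ^ 4 \<partial>M) = 3 * (t - s)\<^sup>2"
  proof -
    have "(- B t \<omega> - - B s \<omega>) ^ 4 = (B t \<omega> - B s \<omega>) ^ 4" for \<omega> unfolding sw by (rule power_minus_even) simp
    then show ?thesis using incr_4[OF st] by (simp only:)
  qed
qed (use prob_space_axioms \<beta> subalg F_mono X_adapted X_neg B_meas in auto)

text \<open>The negative branch is \<open>half_density\<close> of the reflected process. The value
  at the single point 0 does not affect the law and agrees with the theorem.\<close>

definition full_density :: "real \<Rightarrow> real \<Rightarrow> real \<Rightarrow> real \<Rightarrow> real \<Rightarrow> ennreal" where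
  "full_density \<beta> \<mu>p \<mu>m t y = (if 0 < y then half_density \<beta> \<mu>p \<mu>m t y
     else if y < 0 then half_density (- \<beta>) (- \<mu>m) (- \<mu>p) t (- y) else 0)"

lemma full_density_measurable [measurable]: "full_density \<beta> \<mu>p \<mu>m t \<in> borel_measurable borel"
  unfolding full_density_def[abs_def] by measurable

lemma nn_integral_full_density:
  assumes [measurable]: "g \<in> borel_measurable borel"
  shows "(\<integral>\<^sup>+y. g y * full_density \<beta> \<mu>p \<mu>m t y \<partial>lborel)
    = (\<integral>\<^sup>+y\<in>{0<..}. g y * half_density \<beta> \<mu>p \<mu>m t y \<partial>lborel) + (\<integral>\<^sup>+y\<in>{0<..}. g (- y) * half_density (- \<beta>) (- \<mu>m) (- \<mu>p) t y \<partial>lborel)"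
proof -
  have "(\<integral>\<^sup>+y. g y * full_density \<beta> \<mu>p \<mu>m t y \<partial>lborel)
     = (\<integral>\<^sup>+y. g y * half_density \<beta> \<mu>p \<mu>m t y * indicator {0<..} y + g y * half_density (- \<beta>) (- \<mu>m) (- \<mu>p) t (- y) * indicator {..<0} y \<partial>lborel)"
    by (intro nn_integral_cong) (auto simp: full_density_def indicator_def)
  also have "\<dots>
    = (\<integral>\<^sup>+y\<in>{0<..}. g y * half_density \<beta> \<mu>p \<mu>m t y \<partial>lborel) + (\<integral>\<^sup>+y\<in>{..<0}. g y * half_density (- \<beta>) (- \<mu>m) (- \<mu>p) t (- y) \<partial>lborel)"
    by (rule nn_integral_add) auto
  also have "(\<integral>\<^sup>+y\<in>{..<0}. g y * half_density (- \<beta>) (- \<mu>m) (- \<mu>p) t (- y) \<partial>lborel)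
    = (\<integral>\<^sup>+y\<in>{0<..}. g (- y) * half_density (- \<beta>) (- \<mu>m) (- \<mu>p) t y \<partial>lborel)"
    by (subst nn_integral_real_affine[where c="-1" and t=0]) (auto intro!: nn_integral_cong simp: indicator_def)
  finally show ?thesis .
qed

context refracted
begin

text \<open>A Borel set is cut into its positive part and its reflected negative part, each covered
  by \<open>positive_part_law\<close>; the point 0 carries no mass at almost every time.\<close>

lemma law_AE: "AE t in lborel. 0 < t \<longrightarrow> distr M borel (X t) = density lborel (full_density \<beta> \<mu>p \<mu>m t)"
proof -
  interpret N: refracted M F "\<lambda>t \<omega>. - X t \<omega>" "\<lambda>t \<omega>. - B t \<omega>" L "- \<beta>" "- \<mu>m" "- \<mu>p"
    by (rule refracted_uminus)
  show ?thesis
    using positive_part_law N.positive_part_law time_at_zero_AE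
  proof eventually_elim
    case (elim t)
    show ?case
    proof
      assume t: "0 < t"
      have Xm [measurable]: "X t \<in> borel_measurable M" by (rule X_measurable)
      show "distr M borel (X t) = density lborel (full_density \<beta> \<mu>p \<mu>m t)"
      proof (rule measure_eqI)
        fix A assume "A \<in> sets (distr M borel (X t))"
        then have A [measurable]: "A \<in> sets borel" by simp
        let ?P = "A \<inter> {0<..}" and ?N = "uminus -` A \<inter> {0<..}"
        have Nm [measurable]: "?N \<in> sets borel" using measurable_sets[of uminus borel borel A] by simp
        have "AE \<omega> in M. X t \<omega> \<noteq> 0" using elim(3) t by blast
        then have "emeasure (distr M borel (X t)) A = emeasure M (X t -` ?P \<inter> space M \<union> (\<lambda>\<omega>. - X t \<omega>) -` ?N \<inter> space M)"
          by (subst emeasure_distr) (auto intro!: emeasure_eq_AE elim!: eventually_mono)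
        also have "\<dots> = emeasure M (X t -` ?P \<inter> space M) + emeasure M ((\<lambda>\<omega>. - X t \<omega>) -` ?N \<inter> space M)"
          by (rule plus_emeasure[symmetric]) auto
        also have "\<dots> = emeasure (distr M borel (X t)) ?P + emeasure (distr M borel (\<lambda>\<omega>. - X t \<omega>)) ?N"
          by (simp add: emeasure_distr)
        also have "\<dots>
          = (\<integral>\<^sup>+y. indicator ?P y * half_density \<beta> \<mu>p \<mu>m t y \<partial>lborel) + (\<integral>\<^sup>+y. indicator ?N y * half_density (- \<beta>) (- \<mu>m) (- \<mu>p) t y \<partial>lborel)"
          using elim(1,2) t by simp
        also have "\<dots> = (\<integral>\<^sup>+y. indicator A y * full_density \<beta> \<mu>p \<mu>m t y \<partial>lborel)"
          by (subst nn_integral_full_density) (auto intro!: arg_cong2[where f="(+)"] nn_integral_cong simp: indicator_def)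
        also have "\<dots> = emeasure (density lborel (full_density \<beta> \<mu>p \<mu>m t)) A"
          by (simp add: emeasure_density mult.commute)
        finally show "emeasure (distr M borel (X t)) A = emeasure (density lborel (full_density \<beta> \<mu>p \<mu>m t)) A" .
      qed simp
    qed
  qed
qed

text \<open>The time is approached from the right through good times, as
  \<open>half_density_tendsto\<close> requires. Weak limits control only continuous test functions,
  so the two measures are then compared through ramps and distribution functions.\<close>

lemma law:
  assumes t: "0 < t"
  shows "distr M borel (X t) = density lborel (full_density \<beta> \<mu>p \<mu>m t)"
proof -
  have Xm [measurable]: "X s \<in> borel_measurable M" for s by (rule X_measurable)
  define q where "q s = full_density \<beta> \<mu>p \<mu>m s" for s
  have [measurable]: "q s \<in> borel_measurable borel" for s unfolding q_def by measurable
  have b': "- 1 < - \<beta>" "- \<beta> < 1" using \<beta> by auto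
  have "\<exists>s. t < s \<and> s < t + 1 / real (Suc n) \<and> distr M borel (X s) = density lborel (q s)" for n
  proof (rule AE_E3[OF law_AE])
    fix N assume N: "\<And>x. x \<in> space lborel - N \<Longrightarrow> 0 < x \<longrightarrow> distr M borel (X x)
      = density lborel (full_density \<beta> \<mu>p \<mu>m x)" "N \<in> null_sets lborel"
    have "\<not> {t <..< t + 1 / real (Suc n)} \<subseteq> N"
      using null_sets_subset[OF N(2), of "{t <..< t + 1 / real (Suc n)}"] by (auto simp: null_sets_def)
    then obtain s where "s \<in> {t <..< t + 1 / real (Suc n)}" "s \<notin> N" by blast
    then show ?thesis using N(1)[of s] t unfolding q_def by auto
  qed
  then obtain u where u: "\<And>n. t < u n" "\<And>n. u n < t + 1 / real (Suc n)" "\<And>n. distr M borel (X (u n))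
    = density lborel (q (u n))"
    by metis
  have ulim: "u \<longlonglongrightarrow> t"
  proof (rule tendsto_sandwich[where f="\<lambda>_. t" and h="\<lambda>n. t + inverse (real (Suc n))"])
    have "(\<lambda>n. t + inverse (real (Suc n))) \<longlonglongrightarrow> t + 0" by (intro tendsto_intros LIMSEQ_inverse_real_of_nat)
    then show "(\<lambda>n. t + inverse (real (Suc n))) \<longlonglongrightarrow> t" by simp
  qed (use u(1,2) in \<open>auto intro!: always_eventually less_imp_le simp: inverse_eq_divide\<close>)
  have cont: "(\<integral>\<^sup>+\<omega>. ennreal (g (X t \<omega>)) \<partial>M) = (\<integral>\<^sup>+y. ennreal (g y) * q t y \<partial>lborel)"
    if g: "continuous_on UNIV g" "\<And>z. 0 \<le> g z" "\<And>z. g z \<le> 1" for g :: "real \<Rightarrow> real"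
  proof -
    have [measurable]: "g \<in> borel_measurable borel" using g(1) by (rule borel_measurable_continuous_onI)
    have "(\<lambda>n. \<integral>\<^sup>+\<omega>. ennreal (g (X (u n) \<omega>)) \<partial>M) \<longlonglongrightarrow> (\<integral>\<^sup>+\<omega>. ennreal (g (X t \<omega>)) \<partial>M)"
    proof (rule nn_integral_dominated_convergence[where w="\<lambda>_. 1"])
      show "AE \<omega> in M. (\<lambda>n. ennreal (g (X (u n) \<omega>))) \<longlonglongrightarrow> ennreal (g (X t \<omega>))"
      proof (intro AE_I2 tendsto_ennrealI)
        fix \<omega>
        have "isCont (\<lambda>s. g (X s \<omega>)) t"
          using continuous_on_compose2[OF g(1) pth.x_cont[of \<omega>]] by (simp add: continuous_on_eq_continuous_at)
        then show "(\<lambda>n. g (X (u n) \<omega>)) \<longlonglongrightarrow> g (X t \<omega>)" using ulim by (rule isCont_tendsto_compose)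
      qed
    qed (use g(3) in \<open>auto simp: emeasure_space_1 ennreal_le_1\<close>)
    moreover have "(\<integral>\<^sup>+\<omega>. ennreal (g (X (u n) \<omega>)) \<partial>M) = (\<integral>\<^sup>+y. ennreal (g y) * q (u n) y \<partial>lborel)" for n
    proof -
      have "(\<integral>\<^sup>+\<omega>. ennreal (g (X (u n) \<omega>)) \<partial>M) = (\<integral>\<^sup>+y. ennreal (g y) \<partial>distr M borel (X (u n)))"
        by (subst nn_integral_distr) auto
      then show ?thesis unfolding u(3) by (simp add: nn_integral_density mult.commute)
    qed
    moreover have "(\<lambda>n. \<integral>\<^sup>+y. ennreal (g y) * q (u n) y \<partial>lborel) \<longlonglongrightarrow> (\<integral>\<^sup>+y. ennreal (g y) * q t y \<partial>lborel)"
      unfolding q_def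
    proof (subst (1 2) nn_integral_full_density, measurable, intro tendsto_add)
      show "(\<lambda>n. \<integral>\<^sup>+y\<in>{0<..}. ennreal (g y) * half_density \<beta> \<mu>p \<mu>m (u n) y \<partial>lborel)
        \<longlonglongrightarrow> (\<integral>\<^sup>+y\<in>{0<..}. ennreal (g y) * half_density \<beta> \<mu>p \<mu>m t y \<partial>lborel)"
        by (rule half_density_tendsto[OF \<beta> t ulim]) (use u(1) g(3) in \<open>auto simp: less_imp_le ennreal_le_1\<close>)
      show "(\<lambda>n. \<integral>\<^sup>+y\<in>{0<..}. ennreal (g (- y)) * half_density (- \<beta>) (- \<mu>m) (- \<mu>p) (u n) y \<partial>lborel)
        \<longlonglongrightarrow> (\<integral>\<^sup>+y\<in>{0<..}. ennreal (g (- y)) * half_density (- \<beta>) (- \<mu>m) (- \<mu>p) t y \<partial>lborel)"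
        by (rule half_density_tendsto[OF b' t ulim]) (use u(1) g(3) in \<open>auto simp: less_imp_le ennreal_le_1\<close>)
    qed
    ultimately show ?thesis using LIMSEQ_unique by simp
  qed
  have qfin: "(\<integral>\<^sup>+y. q t y \<partial>lborel) < \<infinity>"
    using nn_integral_full_density[of "\<lambda>_. 1" \<beta> \<mu>p \<mu>m t] half_density_finite[OF \<beta> t] half_density_finite[OF b' t]
    by (simp add: q_def)
  have em: "emeasure (distr M borel (X t)) {..a} = emeasure (density lborel (q t)) {..a}" for a
  proof -
    \<comment> \<open>Continuous ramps decreasing to the indicator of {..a}; passing to the limit
      against the density uses its finite total mass.\<close>
    define g where "g n y = max 0 (min 1 (1 + real n * (a - y)))" for n and y :: real
    have gb: "0 \<le> g n y" "g n y \<le> 1" for n y by (auto simp: g_def)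
    have gc: "continuous_on UNIV (g n)" for n unfolding g_def[abs_def] by (intro continuous_intros)
    have [measurable]: "g n \<in> borel_measurable borel" for n using gc by (rule borel_measurable_continuous_onI)
    have lim: "(\<lambda>n. ennreal (g n y)) \<longlonglongrightarrow> indicator {..a} y" for y
    proof (cases "y \<le> a")
      case True
      then have "g n y = 1" for n by (simp add: g_def)
      then show ?thesis using True by simp
    next
      case False
      then have "a - y < 0" by simp
      then have "LIM n sequentially. (a - y) * real n :> at_bot"
        by (intro filterlim_tendsto_neg_mult_at_bot[OF tendsto_const] filterlim_real_sequentially)
      then have "\<forall>\<^sub>F n in sequentially. (a - y) * real n \<le> -1"
        unfolding filterlim_at_bot by blast
      then have "\<forall>\<^sub>F n in sequentially. ennreal (g n y) = 0"
        by eventually_elim (auto simp: g_def mult.commute)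
      then show ?thesis using False by (simp add: tendsto_eventually)
    qed
    have "(\<lambda>n. \<integral>\<^sup>+\<omega>. ennreal (g n (X t \<omega>)) \<partial>M) \<longlonglongrightarrow> (\<integral>\<^sup>+\<omega>. indicator {..a} (X t \<omega>) \<partial>M)"
      by (rule nn_integral_dominated_convergence[where w="\<lambda>_. 1"]) (use lim gb in \<open>auto simp: emeasure_space_1 ennreal_le_1\<close>)
    moreover have "(\<lambda>n. \<integral>\<^sup>+y. ennreal (g n y) * q t y \<partial>lborel) \<longlonglongrightarrow> (\<integral>\<^sup>+y. indicator {..a} y * q t y \<partial>lborel)"
    proof (rule nn_integral_dominated_convergence[where w="q t"])
      show "AE y in lborel. ennreal (g n y) * q t y \<le> q t y" for n
        using gb mult_right_mono[of "ennreal (g n _)" 1] by (intro AE_I2) (auto simp: ennreal_le_1)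
      have "AE y in lborel. q t y \<noteq> \<infinity>" using qfin by (intro nn_integral_PInf_AE) auto
      then show "AE y in lborel. (\<lambda>n. ennreal (g n y) * q t y) \<longlonglongrightarrow> indicator {..a} y * q t y"
      proof eventually_elim
        case (elim y)
        have "(\<lambda>n. q t y * ennreal (g n y)) \<longlonglongrightarrow> q t y * indicator {..a} y"
          using elim lim[of y] by (intro ennreal_tendsto_cmult) (auto simp: less_top)
        then show ?case by (simp add: mult.commute)
      qed
    qed (use qfin in auto)
    moreover have "(\<integral>\<^sup>+\<omega>. ennreal (g n (X t \<omega>)) \<partial>M) = (\<integral>\<^sup>+y. ennreal (g n y) * q t y \<partial>lborel)" for n
      by (rule cont[OF gc gb])
    ultimately have "(\<integral>\<^sup>+\<omega>. indicator {..a} (X t \<omega>) \<partial>M) = (\<integral>\<^sup>+y. indicator {..a} y * q t y \<partial>lborel)"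
      using LIMSEQ_unique by simp
    moreover have "(\<integral>\<^sup>+\<omega>. indicator {..a} (X t \<omega>) \<partial>M) = emeasure (distr M borel (X t)) {..a}"
    proof -
      have "(\<integral>\<^sup>+\<omega>. indicator {..a} (X t \<omega>) \<partial>M) = (\<integral>\<^sup>+y. indicator {..a} y \<partial>distr M borel (X t))"
        by (rule nn_integral_distr[symmetric]) auto
      then show ?thesis by simp
    qed
    ultimately show ?thesis by (simp add: emeasure_density mult.commute)
  qed
  have "distr M borel (X t) = density lborel (q t)"
  proof (rule cdf_unique')
    show "finite_borel_measure (distr M borel (X t))"
      by (intro finite_borel_measure.intro finite_measure_distr) (auto simp: finite_borel_measure_axioms_def)
    show "finite_borel_measure (density lborel (q t))"
      using qfin
        by (auto intro!: finite_borel_measure.intro finite_measureI simp: emeasure_density finite_borel_measure_axioms_def)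
    show "cdf (distr M borel (X t)) = cdf (density lborel (q t))"
      using em by (simp add: cdf_def measure_def fun_eq_iff)
  qed
  then show ?thesis by (simp add: q_def)
qed

end

section \<open>Passage from almost sure to sure properties, and the theorem\<close>

text \<open>Paths outside the good event are replaced by one fixed good path, so that all pathwise
  properties hold for every outcome.\<close>

lemma refracted_modification:
  fixes M :: "'a measure" and B X :: "real \<Rightarrow> 'a \<Rightarrow> real"
  assumes \<beta>: "-1 < \<beta>" "\<beta> < 1" and r: "refracted_skew_brownian_motion M B \<beta> \<mu>p \<mu>m 0 0 X"
  obtains Y W L where "refracted M (augmented_filtration M B) Y W L \<beta> \<mu>p \<mu>m"
    "\<And>t. 0 \<le> t \<Longrightarrow> X t \<in> borel_measurable M" "\<And>t. 0 \<le> t \<Longrightarrow> AE \<omega> in M. X t \<omega> = Y t \<omega>"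
proof -
  have bm: "standard_brownian_motion M B" and Xad: "\<And>t. 0 \<le> t \<Longrightarrow> X t \<in> borel_measurable (augmented_filtration M B t)"
    using r by (auto simp: refracted_skew_brownian_motion_def)
  interpret prob_space M using bm by (simp add: standard_brownian_motion_def)
  let ?F = "augmented_filtration M B"
  have Bm: "B t \<in> borel_measurable M" if "0 \<le> t" for t using bm that by (simp add: standard_brownian_motion_def)
  have sub: "subalgebra M (?F t)" for t by (rule subalgebra_augmented_filtration[OF bm])
  have Xm: "X t \<in> borel_measurable M" if "0 \<le> t" for t
    by (rule measurable_from_subalg[OF sub Xad[OF that]])
  define good where "good \<omega> \<longleftrightarrow> B 0 \<omega> = 0 \<and> continuous_on {0..} (\<lambda>t. B t \<omega>) \<and> X 0 \<omega> = 0 \<and> continuous_on {0..} (\<lambda>t. X t \<omega>)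
    \<and> (\<forall>t\<ge>0. \<exists>l. has_symmetric_local_time (\<lambda>s. X s \<omega>) t 0 l \<and>
        X t \<omega> = X 0 \<omega> + B t \<omega> + \<beta> * l
          + \<mu>p * (LBINT s:{0..t}. indicator {0<..} (X s \<omega>))
          + \<mu>m * (LBINT s:{0..t}. indicator {..<0} (X s \<omega>)))" for \<omega>
  have "AE \<omega> in M. B 0 \<omega> = 0" "AE \<omega> in M. continuous_on {0..} (\<lambda>t. B t \<omega>)"
    using bm by (simp_all add: standard_brownian_motion_def)
  moreover have "AE \<omega> in M. continuous_on {0..} (\<lambda>t. X t \<omega>)" "AE \<omega> in M. X 0 \<omega> = 0"
    "AE \<omega> in M. \<forall>t\<ge>0. \<exists>l. has_symmetric_local_time (\<lambda>s. X s \<omega>) t 0 l \<and>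
        X t \<omega> = X 0 \<omega> + B t \<omega> + \<beta> * l
          + \<mu>p * (LBINT s:{0..t}. indicator {0<..} (X s \<omega>))
          + \<mu>m * (LBINT s:{0..t}. indicator {..<0} (X s \<omega>))"
    using r unfolding refracted_skew_brownian_motion_def by blast+
  ultimately have "AE \<omega> in M. good \<omega>" unfolding good_def by eventually_elim blast
  then obtain N where N: "\<And>\<omega>. \<omega> \<in> space M - N \<Longrightarrow> good \<omega>" "N \<in> null_sets M"
    by (rule AE_E3) blast
  define G where "G = space M - N"
  \<comment> \<open>The augmented filtration contains the null sets at every time, so redefining the
    process on one of them keeps it adapted.\<close>
  have GF: "G \<in> sets (?F t)" for t
  proof -
    have "N \<in> sets (?F t)" unfolding sets_augmented_filtration(1)[OF bm] using N(2) by (intro sigma_sets.Basic) auto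
    then have "space (?F t) - N \<in> sets (?F t)" by (rule sets.compl_sets)
    then show ?thesis by (simp add: G_def sets_augmented_filtration(2)[OF bm])
  qed
  have GM: "G \<in> sets M" using N(2) by (auto simp: G_def)
  have AEG: "AE \<omega> in M. \<omega> \<in> G"
    using AE_not_in[OF N(2)] AE_space by eventually_elim (simp add: G_def)
  have "G \<noteq> {}"
  proof
    assume "G = {}"
    then have "AE \<omega> in M. False" using AEG by simp
    then show False by simp
  qed
  then obtain \<omega>0 where \<omega>0: "\<omega>0 \<in> G" by blast
  define \<pi> where "\<pi> \<omega> = (if \<omega> \<in> G then \<omega> else \<omega>0)" for \<omega>
  have gpi: "good (\<pi> \<omega>)" for \<omega> using N(1) \<omega>0 by (auto simp: \<pi>_def G_def)
  \<comment> \<open>Times below 0 are clamped to 0, which extends the paths continuously to the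
    whole line.\<close>
  define Y where "Y t \<omega> = X (max 0 t) (\<pi> \<omega>)" for t \<omega>
  define W where "W t \<omega> = B (max 0 t) (\<pi> \<omega>)" for t \<omega>
  \<comment> \<open>A pointwise choice is enough: the local time is unique as a limit, and its
    measurability is derived afterwards.\<close>
  define L where "L t \<omega> = (SOME l. has_symmetric_local_time (\<lambda>s. X s (\<pi> \<omega>)) t 0 l \<and>
        X t (\<pi> \<omega>) = X 0 (\<pi> \<omega>) + B t (\<pi> \<omega>) + \<beta> * l
          + \<mu>p * (LBINT s:{0..t}. indicator {0<..} (X s (\<pi> \<omega>)))
          + \<mu>m * (LBINT s:{0..t}. indicator {..<0} (X s (\<pi> \<omega>))))" for t \<omega>
  have L: "has_symmetric_local_time (\<lambda>s. X s (\<pi> \<omega>)) t 0 (L t \<omega>)"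
    "X t (\<pi> \<omega>) = X 0 (\<pi> \<omega>) + B t (\<pi> \<omega>) + \<beta> * L t \<omega>
          + \<mu>p * (LBINT s:{0..t}. indicator {0<..} (X s (\<pi> \<omega>)))
          + \<mu>m * (LBINT s:{0..t}. indicator {..<0} (X s (\<pi> \<omega>)))" if "0 \<le> t" for t \<omega>
  proof -
    have "\<exists>l. has_symmetric_local_time (\<lambda>s. X s (\<pi> \<omega>)) t 0 l \<and>
        X t (\<pi> \<omega>) = X 0 (\<pi> \<omega>) + B t (\<pi> \<omega>) + \<beta> * l
          + \<mu>p * (LBINT s:{0..t}. indicator {0<..} (X s (\<pi> \<omega>)))
          + \<mu>m * (LBINT s:{0..t}. indicator {..<0} (X s (\<pi> \<omega>)))"
      using gpi[of \<omega>] that unfolding good_def by blast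
    from someI_ex[OF this] show "has_symmetric_local_time (\<lambda>s. X s (\<pi> \<omega>)) t 0 (L t \<omega>)"
      "X t (\<pi> \<omega>) = X 0 (\<pi> \<omega>) + B t (\<pi> \<omega>) + \<beta> * L t \<omega>
          + \<mu>p * (LBINT s:{0..t}. indicator {0<..} (X s (\<pi> \<omega>)))
          + \<mu>m * (LBINT s:{0..t}. indicator {..<0} (X s (\<pi> \<omega>)))"
      unfolding L_def by blast+
  qed
  have ext: "continuous_on UNIV (\<lambda>t. f (max 0 t))" if "continuous_on {0..} f" for f :: "real \<Rightarrow> real"
    by (rule continuous_on_compose2[OF that]) (auto intro!: continuous_intros)
  have Ycont: "continuous_on UNIV (\<lambda>t. Y t \<omega>)" and Wcont: "continuous_on UNIV (\<lambda>t. W t \<omega>)" for \<omega>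
    using gpi[of \<omega>] unfolding good_def Y_def W_def by (auto intro: ext)
  have path: "skew_path (\<lambda>t. Y t \<omega>) (\<lambda>t. W t \<omega>) (\<lambda>t. L t \<omega>) \<beta> \<mu>p \<mu>m" for \<omega>
  proof
    show "continuous_on UNIV (\<lambda>t. Y t \<omega>)" "continuous_on UNIV (\<lambda>t. W t \<omega>)" by (rule Ycont Wcont)+
    show "Y 0 \<omega> = 0" "W 0 \<omega> = 0" using gpi[of \<omega>] by (auto simp: good_def Y_def W_def)
    fix t :: real assume t: "0 \<le> t"
    have "{s \<in> {0..t}. \<bar>Y s \<omega> - 0\<bar> \<le> e} = {s \<in> {0..t}. \<bar>X s (\<pi> \<omega>) - 0\<bar> \<le> e}" for e by (auto simp: Y_def)
    then show "has_symmetric_local_time (\<lambda>t. Y t \<omega>) t 0 (L t \<omega>)"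
      using L(1)[OF t, of \<omega>] unfolding has_symmetric_local_time_def by simp
    have [measurable]: "(\<lambda>t. Y t \<omega>) \<in> borel_measurable borel" using Ycont by (rule borel_measurable_continuous_onI)
    have i: "set_integrable lborel {0..t} (\<lambda>s. \<mu>p * indicator {0<..} (Y s \<omega>))" "set_integrable lborel {0..t} (\<lambda>s. \<mu>m
      * indicator {..<0} (Y s \<omega>))"
      by (intro set_integrable_mult_right set_integrable_bounded[where C=1]; (measurable | simp add: indicator_def))+
    have "(LBINT s:{0..t}. drift \<mu>p \<mu>m (Y s \<omega>))
      = (LBINT s:{0..t}. \<mu>p * indicator {0<..} (Y s \<omega>) + \<mu>m * indicator {..<0} (Y s \<omega>))"
      by (rule set_lebesgue_integral_cong) (auto simp: drift_def indicator_def)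
    also have "\<dots> = \<mu>p * (LBINT s:{0..t}. indicator {0<..} (Y s \<omega>)) + \<mu>m * (LBINT s:{0..t}. indicator {..<0} (Y s \<omega>))"
      unfolding set_integral_add(2)[OF i] set_integral_mult_right ..
    also have "(LBINT s:{0..t}. indicator {0<..} (Y s \<omega>)) = (LBINT s:{0..t}. indicator {0<..} (X s (\<pi> \<omega>)) :: real)"
      by (rule set_lebesgue_integral_cong) (auto simp: Y_def)
    also have "(LBINT s:{0..t}. indicator {..<0} (Y s \<omega>)) = (LBINT s:{0..t}. indicator {..<0} (X s (\<pi> \<omega>)) :: real)"
      by (rule set_lebesgue_integral_cong) (auto simp: Y_def)
    finally show "Y t \<omega> = W t \<omega> + \<beta> * L t \<omega> + (LBINT s:{0..t}. drift \<mu>p \<mu>m (Y s \<omega>))"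
      using L(2)[OF t, of \<omega>] gpi[of \<omega>] t by (simp add: Y_def W_def good_def)
  qed
  have XY: "AE \<omega> in M. X t \<omega> = Y t \<omega>" if "0 \<le> t" for t
    using AEG by eventually_elim (use that in \<open>simp add: Y_def \<pi>_def\<close>)
  have BW: "AE \<omega> in M. B t \<omega> = W t \<omega>" if "0 \<le> t" for t
    using AEG by eventually_elim (use that in \<open>simp add: W_def \<pi>_def\<close>)
  have Wm: "W t \<in> borel_measurable M" if "0 \<le> t" for t
  proof -
    have "(\<lambda>\<omega>. if \<omega> \<in> G then B t \<omega> else B t \<omega>0) \<in> borel_measurable M"
      using GM Bm[OF that] by (intro measurable_If_set) auto
    also have "(\<lambda>\<omega>. if \<omega> \<in> G then B t \<omega> else B t \<omega>0) = W t" using that by (auto simp: W_def \<pi>_def)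
    finally show ?thesis .
  qed
  have Yad: "Y t \<in> borel_measurable (?F t)" if "0 \<le> t" for t
  proof -
    have "(\<lambda>\<omega>. if \<omega> \<in> G then X t \<omega> else X t \<omega>0) \<in> borel_measurable (?F t)"
      using GF[of t] Xad[OF that] by (intro measurable_If_set) auto
    also have "(\<lambda>\<omega>. if \<omega> \<in> G then X t \<omega> else X t \<omega>0) = Y t" using that by (auto simp: Y_def \<pi>_def)
    finally show ?thesis .
  qed
  have ref: "refracted M ?F Y W L \<beta> \<mu>p \<mu>m"
  proof (intro refracted.intro refracted_axioms.intro)
    show "Y t \<omega> = 0" if "t < 0" for t \<omega> using that gpi[of \<omega>] by (simp add: Y_def good_def)
    fix s t :: real assume st: "0 \<le> s" "s < t"
    have WB: "AE \<omega> in M. W t \<omega> - W s \<omega> = B t \<omega> - B s \<omega>"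
      using BW[of t] BW[of s] st by (auto elim!: eventually_elim2)
    have mW: "W t \<in> borel_measurable M" "W s \<in> borel_measurable M" using Wm st by auto
    have mB: "B t \<in> borel_measurable M" "B s \<in> borel_measurable M" using Bm st by auto
    note [measurable] = mW mB
    have c0: "(\<lambda>_. 0 :: real) \<in> borel_measurable (?F s)" by simp
    show "integrable M (\<lambda>\<omega>. (W t \<omega> - W s \<omega>) ^ k)" for k
    proof -
      have "integrable M (\<lambda>\<omega>. (B t \<omega> - B s \<omega>) ^ k)"
        by (rule brownian_increment_moments(1)[OF bm st c0, of 0]) simp
      then show ?thesis
        by (rule integrable_cong_AE_imp) (measurable, use WB in eventually_elim, simp)
    qed
    show "(\<integral>\<omega>. (W t \<omega> - W s \<omega>) ^ 4 \<partial>M) = 3 * (t - s)\<^sup>2"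
    proof -
      have "(\<integral>\<omega>. (W t \<omega> - W s \<omega>) ^ 4 \<partial>M) = (\<integral>\<omega>. (B t \<omega> - B s \<omega>) ^ 4 \<partial>M)"
        by (rule integral_cong_AE) (measurable, use WB in eventually_elim, simp)
      also have "\<dots> = 3 * (t - s)\<^sup>2" by (rule brownian_increment_moments(4)[OF bm st c0, of 0]) simp
      finally show ?thesis .
    qed
    fix Z K assume Z: "Z \<in> borel_measurable (?F s)" "\<And>\<omega>. \<bar>Z \<omega>\<bar> \<le> (K::real)"
    have [measurable]: "Z \<in> borel_measurable M" by (rule measurable_from_subalg[OF sub Z(1)])
    show "(\<integral>\<omega>. Z \<omega> * (W t \<omega> - W s \<omega>) \<partial>M) = 0"
    proof -
      have "(\<integral>\<omega>. Z \<omega> * (W t \<omega> - W s \<omega>) \<partial>M) = (\<integral>\<omega>. Z \<omega> * (B t \<omega> - B s \<omega>) \<partial>M)"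
        by (rule integral_cong_AE) (measurable, use WB in eventually_elim, simp)
      then show ?thesis using brownian_increment_moments(2)[OF bm st Z] by simp
    qed
    show "(\<integral>\<omega>. Z \<omega> * (W t \<omega> - W s \<omega>)\<^sup>2 \<partial>M) = (t - s) * (\<integral>\<omega>. Z \<omega> \<partial>M)"
    proof -
      have "(\<integral>\<omega>. Z \<omega> * (W t \<omega> - W s \<omega>)\<^sup>2 \<partial>M) = (\<integral>\<omega>. Z \<omega> * (B t \<omega> - B s \<omega>)\<^sup>2 \<partial>M)"
        by (rule integral_cong_AE) (measurable, use WB in eventually_elim, simp)
      then show ?thesis using brownian_increment_moments(3)[OF bm st Z] by simp
    qed
  qed (rule prob_space_axioms \<beta> path sub augmented_filtration_mono[OF bm] Yad Wm; assumption?)+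
  show thesis by (rule that[OF ref Xm XY])
qed

theorem theorem4:
  fixes M :: "'a measure" and B X :: "real \<Rightarrow> 'a \<Rightarrow> real" and \<mu>p \<mu>m \<beta> t :: real
  assumes "-1 < \<beta>" and "\<beta> < 1" and "0 < t"
    and "refracted_skew_brownian_motion M B \<beta> \<mu>p \<mu>m 0 0 X"
  shows "distributed M lborel (X t) (\<lambda>y. ennreal
    (if 0 < y then
       2 * (1 + \<beta>) * exp (2 * \<mu>p * y) *
         (LBINT b:{0<..}. LBINT \<tau>:{0<..<t}.
            h (t - \<tau>) ((1 + \<beta>) * b + y) \<mu>p * h \<tau> ((1 - \<beta>) * b) (- \<mu>m))
     else if y < 0 then
       2 * (1 - \<beta>) * exp (2 * \<mu>m * y) *
         (LBINT b:{0<..}. LBINT \<tau>:{0<..<t}.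
            h (t - \<tau>) ((1 + \<beta>) * b) \<mu>p * h \<tau> ((1 - \<beta>) * b - y) (- \<mu>m))
     else 0))"
proof -
  obtain Y W L where r: "refracted M (augmented_filtration M B) Y W L \<beta> \<mu>p \<mu>m"
    and Xm: "\<And>t. 0 \<le> t \<Longrightarrow> X t \<in> borel_measurable M" and XY: "\<And>t. 0 \<le> t \<Longrightarrow> AE \<omega> in M. X t \<omega> = Y t \<omega>"
    by (rule refracted_modification[OF assms(1,2,4)]) blast
  interpret R: refracted M "augmented_filtration M B" Y W L \<beta> \<mu>p \<mu>m by (rule r)
  have b': "- 1 < - \<beta>" "- \<beta> < 1" using assms by auto
  let ?f = "\<lambda>y. ennreal
    (if 0 < y then
       2 * (1 + \<beta>) * exp (2 * \<mu>p * y) *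
         (LBINT b:{0<..}. LBINT \<tau>:{0<..<t}.
            h (t - \<tau>) ((1 + \<beta>) * b + y) \<mu>p * h \<tau> ((1 - \<beta>) * b) (- \<mu>m))
     else if y < 0 then
       2 * (1 - \<beta>) * exp (2 * \<mu>m * y) *
         (LBINT b:{0<..}. LBINT \<tau>:{0<..<t}.
            h (t - \<tau>) ((1 + \<beta>) * b) \<mu>p * h \<tau> ((1 - \<beta>) * b - y) (- \<mu>m))
     else 0)"
  have fm: "?f \<in> borel_measurable lborel"
    unfolding set_lebesgue_integral_def by measurable
  have "(\<integral>\<^sup>+y. full_density \<beta> \<mu>p \<mu>m t y \<partial>lborel) < \<infinity>"
    using nn_integral_full_density[of "\<lambda>_. 1" \<beta> \<mu>p \<mu>m t] half_density_finite[OF assms(1-3)] half_density_finite[OF b' assms(3)]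
    by simp
  \<comment> \<open>Where the extended density is finite, the iterated Bochner integrals of the
    theorem have the same value; finite total mass makes this almost everywhere.\<close>
  then have "AE y in lborel. full_density \<beta> \<mu>p \<mu>m t y \<noteq> \<infinity>" by (intro nn_integral_PInf_AE) auto
  then have "AE y in lborel. full_density \<beta> \<mu>p \<mu>m t y = ?f y"
  proof eventually_elim
    case (elim y)
    consider "0 < y" | "y < 0" | "y = 0" by linarith
    then show ?case
    proof cases
      case 1
      then show ?thesis
        using elim half_density_eq_lebesgue_integral[OF assms(1,2), of \<mu>p \<mu>m t y] by (simp add: full_density_def less_top)
    next
      case 2
      \<comment> \<open>For negative y the claimed branch is brought into the form of the positive
        branch for the reflected parameters, evaluated at -y.\<close>
      have e: "2 * (1 + - \<beta>) * exp (2 * (- \<mu>m) * (- y)) = 2 * (1 - \<beta>) * exp (2 * \<mu>m * y)" by simp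
      have "?f y = ennreal (2 * (1 + - \<beta>) * exp (2 * (- \<mu>m) * (- y)) *
          (LBINT b:{0<..}. LBINT \<tau>:{0<..<t}. h (t - \<tau>) ((1 + - \<beta>) * b + - y) (- \<mu>m) * h \<tau> ((1 - - \<beta>) * b) (- (- \<mu>p))))"
        unfolding e half_density_reflect using 2 by simp
      then show ?thesis
        using 2 elim half_density_eq_lebesgue_integral[OF b', of "- \<mu>m" "- \<mu>p" t "- y"] by (simp add: full_density_def less_top)
    qed (simp add: full_density_def)
  qed
  then have "density lborel (full_density \<beta> \<mu>p \<mu>m t) = density lborel ?f"
    using fm by (intro density_cong) auto
  moreover have "distr M borel (X t) = distr M borel (Y t)"
    using XY[of t] Xm[of t] R.X_measurable[of t] assms(3) by (intro distr_cong_AE) auto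
  moreover have "distr M lborel (X t) = distr M borel (X t)" by (rule distr_cong) auto
  ultimately have "distr M lborel (X t) = density lborel ?f" using R.law[OF assms(3)] by simp
  then show ?thesis
    unfolding distributed_def using fm Xm[of t] assms(3) by simp
qed

end
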